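(* Under the standing assumptions on $M$, $I$, $g$ and $f$ stated in the context, let $\nu$ and $\sigma$ be measure-valued entropy solutions of $$\partial_t u+\lambda u+\operatorname{div} f(u)=0\ \text{ in } M\times I$$ (each for some initial value in $L^\infty(M)$). Then for almost all $0<s\le t<T$ $$\int_M\langle\nu_t\otimes\sigma_t,\eta\rangle\,dV_{g(t)}\le\int_M\langle\nu_s\otimes\sigma_s,\eta\rangle\,dV_{g(s)},$$ where $\eta(u,v):=[u-v]^+$. The same inequality holds for $\eta(u,v):=|u-v|$.
   Context: Standing assumptions: $M$ is a smooth, oriented, closed (compact, without boundary) $d$-dimensional manifold; $I=(0,T)$ is a bounded time interval; $g=g(t)$, $t\in\bar I$, is a time-dependent Riemannian metric on $M$ of class $C^{1,1}$ (in $(x,t)\in M\times\bar I$); $f=f(x,t,u)$ is a family of vector fields on $M$ depending on $t\in\bar I$ and a real parameter $u\in\mathbb{R}$, with $f,\partial_u f\in C^1$ (on $M\times\bar I\times\mathbb{R}$); and $\partial_u\operatorname{div} f$ is uniformly bounded from below in $M\times I\times\mathbb{R}$. Notation: $[w]^+:=\max(w,0)$. $dV=dV_{g(t)}$ is the Riemannian volume measure, $\operatorname{div}=\operatorname{div}_{g(t)}$ the Riemannian divergence, and $\lambda:M\times I\to\mathbb{R}$ is defined by $\partial_t dV_{g(t)}=\lambda\,dV_{g(t)}$; $\operatorname{div}^x$ denotes divergence with respect to the explicit dependence on $x$, keeping the value of $u$ fixed. For measures, $\nu_t:=\nu_{\cdot,t}$ and $\langle\nu_t\otimes\sigma_t,\eta\rangle$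 is the function $x\mapsto\int_{\mathbb{R}}\int_{\mathbb{R}}\eta(k_1,k_2)\,d\nu_{x,t}(k_1)\,d\sigma_{x,t}(k_2)$. For a convex function $\eta:\mathbb{R}\to\mathbb{R}$ with derivative $\eta'$ (at points of non-differentiability take the left derivative) set $q(x,t,u):=\int_k^u\eta'(v)\,\partial_v f(x,t,v)\,dv$ for some fixed $k\in\mathbb{R}$. Let $\operatorname{Prob}(\mathbb{R})\subset (C_0(\mathbb{R}))'$ be the set of probability measures on $\mathbb{R}$, and $\langle\nu,\eta\rangle:=\int_{\mathbb{R}}\eta\,d\nu$. For $u_0\in L^\infty(M)$, a weak-$^*$ measurable mapping $\nu:M\times I\to\operatorname{Prob}(\mathbb{R})$ (i.e. for each $h\in L^1(M\times I,C_0(\mathbb{R}))$ the map $(x,t)\mapsto\langle\nu_{x,t},h(x,t)\rangle$ is measurable), whose supports $\operatorname{supp}\nu_{x,t}$ are contained in a fixed bounded interval, is called a measure-valued entropy solution with initial value $u_0$ if $$\int_I\int_M\partial_t\varphi\,\langle\nu,\eta\rangle+\varphi\,\langle\nu,\lambda(\eta-\eta'(\cdot)\,\cdot)+\operatorname{div}^x q-\eta'\operatorname{div}^x f\rangle+\langle\nu,d\varphi(q)\rangle\,dV\,dt+\int_M\varphi(0)\,\eta(u_0)\,dV_{g(0)}\ge0$$ for every convex $\eta:\mathbb{R}\to\mathbb{R}$ and every nonnegative $\varphi\in C^{0,1}_c(M\times[0,T))$. Here $\eta'(\cdot)\,\cdot$ denotes the function $v\mapsto\eta'(v)v$. *)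

theory Defs
  imports "HOL-Probability.Probability"
begin

section \<open>Regularity classes on subsets of Euclidean space\<close>

text \<open>\<open>ck_on k S f\<close> is meant for open \<open>S\<close>.\<close>

primrec ck_on :: "nat \<Rightarrow> 'a::euclidean_space set \<Rightarrow> ('a \<Rightarrow> 'b::real_normed_vector) \<Rightarrow> bool" where
  "ck_on 0 S f \<longleftrightarrow> continuous_on S f"
| "ck_on (Suc k) S f \<longleftrightarrow>
     (\<forall>x\<in>S. f differentiable (at x)) \<and> (\<forall>v. ck_on k S (\<lambda>x. frechet_derivative f (at x) v))"

definition smooth_on :: "'a::euclidean_space set \<Rightarrow> ('a \<Rightarrow> 'b::real_normed_vector) \<Rightarrow> bool" where
  "smooth_on S f \<longleftrightarrow> (\<forall>k. ck_on k S f)"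

definition loc_lipschitz_on ::
    "'a::metric_space set \<Rightarrow> ('a \<Rightarrow> 'b::metric_space) \<Rightarrow> bool" where
  "loc_lipschitz_on S f \<longleftrightarrow> (\<forall>z\<in>S. \<exists>r>0. \<exists>L. L-lipschitz_on (S \<inter> ball z r) f)"

text \<open>
  The next two are used on products of an open set with \<open>{0..T}\<close>, where the derivative
  within the set is unique; at \<open>t = 0\<close> and \<open>t = T\<close> it is one-sided in time.
\<close>

definition c1_on :: "'a::euclidean_space set \<Rightarrow> ('a \<Rightarrow> 'b::real_normed_vector) \<Rightarrow> bool" where
  "c1_on S f \<longleftrightarrow>
     (\<exists>f'. (\<forall>z\<in>S. (f has_derivative blinfun_apply (f' z)) (at z within S)) \<and> continuous_on S f')"

definition c11_on :: "'a::euclidean_space set \<Rightarrow> ('a \<Rightarrow> 'b::real_normed_vector) \<Rightarrow> bool" where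
  "c11_on S f \<longleftrightarrow>
     (\<exists>f'. (\<forall>z\<in>S. (f has_derivative blinfun_apply (f' z)) (at z within S)) \<and>
           continuous_on S f' \<and> loc_lipschitz_on S f')"


section \<open>Closed oriented manifolds\<close>

text \<open>
  The manifold is the whole type \<open>'m\<close>; a chart is a pair of its domain and its coordinate map,
  and the dimension is \<open>CARD('d)\<close>.
\<close>

type_synonym ('m, 'd) chart = "'m set \<times> ('m \<Rightarrow> real^'d)"

definition chart_inv :: "('m, 'd::finite) chart \<Rightarrow> real^'d \<Rightarrow> 'm" where
  "chart_inv c = inv_into (fst c) (snd c)"

definition chart_image :: "('m, 'd::finite) chart \<Rightarrow> (real^'d) set" where
  "chart_image c = snd c ` fst c"

definition is_chart :: "('m::topological_space, 'd::finite) chart \<Rightarrow> bool" where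
  "is_chart c \<longleftrightarrow> open (fst c) \<and> open (chart_image c) \<and>
     homeomorphism (fst c) (chart_image c) (snd c) (chart_inv c)"

definition transition ::
    "('m, 'd::finite) chart \<Rightarrow> ('m, 'd) chart \<Rightarrow> real^'d \<Rightarrow> real^'d" where
  "transition c1 c2 = snd c2 \<circ> chart_inv c1"

definition jac :: "('m, 'd::finite) chart \<Rightarrow> ('m, 'd) chart \<Rightarrow> 'm \<Rightarrow> real^'d^'d" where
  "jac c1 c2 p = matrix (frechet_derivative (transition c1 c2) (at (snd c1 p)))"

definition oriented_smooth_atlas ::
    "('m::{t2_space,second_countable_topology}, 'd::finite) chart set \<Rightarrow> bool" where
  "oriented_smooth_atlas A \<longleftrightarrow>
     (\<forall>c\<in>A. is_chart c) \<and> (\<Union>c\<in>A. fst c) = UNIV \<and>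
     (\<forall>c1\<in>A. \<forall>c2\<in>A. smooth_on (snd c1 ` (fst c1 \<inter> fst c2)) (transition c1 c2) \<and>
        (\<forall>p\<in>fst c1 \<inter> fst c2. det (jac c1 c2 p) > 0))"

definition closed_oriented_manifold ::
    "('m::{t2_space,second_countable_topology}, 'd::finite) chart set \<Rightarrow> bool" where
  "closed_oriented_manifold A \<longleftrightarrow> compact (UNIV :: 'm set) \<and> oriented_smooth_atlas A"

text \<open>
  Scalars built from tensor components below do not depend on the chart, so any chart of the
  atlas around the point can be used to compute them.
\<close>

definition chart_at :: "('m, 'd::finite) chart set \<Rightarrow> 'm \<Rightarrow> ('m, 'd) chart" where
  "chart_at A p = (SOME c. c \<in> A \<and> p \<in> fst c)"


section \<open>Vector fields and metrics\<close>

text \<open>Tensor fields are given by their components in every chart, with the transformation law.\<close>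

type_synonym ('m, 'd) vfield = "('m, 'd) chart \<Rightarrow> 'm \<Rightarrow> real^'d"
type_synonym ('m, 'd) mfield = "('m, 'd) chart \<Rightarrow> 'm \<Rightarrow> real^'d^'d"

definition is_vector_field ::
    "('m, 'd::finite) chart set \<Rightarrow> ('m, 'd) vfield \<Rightarrow> bool" where
  "is_vector_field A X \<longleftrightarrow>
     (\<forall>c1\<in>A. \<forall>c2\<in>A. \<forall>p\<in>fst c1 \<inter> fst c2. X c2 p = jac c1 c2 p *v X c1 p)"

definition is_riemannian_metric ::
    "('m, 'd::finite) chart set \<Rightarrow> ('m, 'd) mfield \<Rightarrow> bool" where
  "is_riemannian_metric A G \<longleftrightarrow>
     (\<forall>c\<in>A. \<forall>p\<in>fst c. transpose (G c p) = G c p \<and> (\<forall>v. v \<noteq> 0 \<longrightarrow> v \<bullet> (G c p *v v) > 0)) \<and>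
     (\<forall>c1\<in>A. \<forall>c2\<in>A. \<forall>p\<in>fst c1 \<inter> fst c2.
        G c1 p = transpose (jac c1 c2 p) ** G c2 p ** jac c1 c2 p)"

definition c11_metric_family ::
    "('m, 'd::finite) chart set \<Rightarrow> real \<Rightarrow> (real \<Rightarrow> ('m, 'd) mfield) \<Rightarrow> bool" where
  "c11_metric_family A T g \<longleftrightarrow>
     (\<forall>t\<in>{0..T}. is_riemannian_metric A (g t)) \<and>
     (\<forall>c\<in>A. c11_on (chart_image c \<times> {0..T}) (\<lambda>(y, t). g t c (chart_inv c y)))"

text \<open>The Riemannian density \<open>sqrt (det G)\<close> of a metric in the coordinates of \<open>c\<close>.\<close>

definition vol_density :: "('m, 'd::finite) mfield \<Rightarrow> ('m, 'd) chart \<Rightarrow> 'm \<Rightarrow> real" where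
  "vol_density G c p = sqrt (det (G c p))"

text \<open>
  The Riemannian volume measure: the unique Borel measure that has density \<open>sqrt (det G)\<close> in
  every chart. It is completed, since the integrands below are in general only measurable
  up to null sets.
\<close>

definition riem_volume ::
    "('m::topological_space, 'd::finite) chart set \<Rightarrow> ('m, 'd) mfield \<Rightarrow> 'm measure" where
  "riem_volume A G = completion (THE \<mu>. sets \<mu> = sets borel \<and>
     (\<forall>c\<in>A. \<forall>B\<in>sets borel. B \<subseteq> fst c \<longrightarrow>
        emeasure \<mu> B =
          (\<integral>\<^sup>+y\<in>snd c ` B. ennreal (vol_density G c (chart_inv c y)) \<partial>lborel)))"

definition riem_div ::
    "('m, 'd::finite) chart set \<Rightarrow> ('m, 'd) mfield \<Rightarrow> ('m, 'd) vfield \<Rightarrow> 'm \<Rightarrow> real" where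
  "riem_div A G X p =
     (let c = chart_at A p in
        (\<Sum>i\<in>UNIV. frechet_derivative
           (\<lambda>y. vol_density G c (chart_inv c y) * X c (chart_inv c y) $ i)
           (at (snd c p)) (axis i 1)) / vol_density G c p)"

text \<open>\<open>\<partial>\<^sub>t dV = \<lambda> dV\<close>, read off from the coordinate densities.\<close>

definition vol_rate ::
    "('m, 'd::finite) chart set \<Rightarrow> (real \<Rightarrow> ('m, 'd) mfield) \<Rightarrow> 'm \<Rightarrow> real \<Rightarrow> real" where
  "vol_rate A g p t =
     (let c = chart_at A p in deriv (\<lambda>s. vol_density (g s) c p) t / vol_density (g t) c p)"

text \<open>\<open>d\<psi>(X)\<close> for a scalar function \<open>\<psi>\<close> and a vector field \<open>X\<close>.\<close>

definition diff_along ::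
    "('m, 'd::finite) chart set \<Rightarrow> ('m \<Rightarrow> real) \<Rightarrow> ('m, 'd) vfield \<Rightarrow> 'm \<Rightarrow> real" where
  "diff_along A \<psi> X p =
     (let c = chart_at A p in
        frechet_derivative (\<lambda>y. \<psi> (chart_inv c y)) (at (snd c p)) (X c p))"


section \<open>Flux and entropy flux\<close>

text \<open>A flux is written \<open>f t u\<close>: for fixed \<open>t\<close> and \<open>u\<close> it is a vector field.\<close>

type_synonym ('m, 'd) flux = "real \<Rightarrow> real \<Rightarrow> ('m, 'd) vfield"

definition flux_du :: "('m, 'd::finite) flux \<Rightarrow> ('m, 'd) flux" where
  "flux_du f t u = (\<lambda>c p. vector_derivative (\<lambda>v. f t v c p) (at u))"

definition c1_flux ::
    "('m, 'd::finite) chart set \<Rightarrow> real \<Rightarrow> ('m, 'd) flux \<Rightarrow> bool" where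
  "c1_flux A T f \<longleftrightarrow>
     (\<forall>c\<in>A. c1_on (chart_image c \<times> {0..T} \<times> UNIV) (\<lambda>(y, t, u). f t u c (chart_inv c y)))"

definition admissible_flux ::
    "('m, 'd::finite) chart set \<Rightarrow> real \<Rightarrow> (real \<Rightarrow> ('m, 'd) mfield) \<Rightarrow> ('m, 'd) flux \<Rightarrow> bool" where
  "admissible_flux A T g f \<longleftrightarrow>
     (\<forall>t\<in>{0..T}. \<forall>u. is_vector_field A (f t u)) \<and>
     c1_flux A T f \<and> c1_flux A T (flux_du f) \<and>
     (\<exists>b. \<forall>p. \<forall>t\<in>{0<..<T}. \<forall>u. b \<le> deriv (\<lambda>v. riem_div A (g t) (f t v) p) u)"

definition left_deriv :: "(real \<Rightarrow> real) \<Rightarrow> real \<Rightarrow> real" where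
  "left_deriv \<eta> v = (THE D. (\<eta> has_real_derivative D) (at_left v))"

definition entropy_flux ::
    "('m, 'd::finite) flux \<Rightarrow> real \<Rightarrow> (real \<Rightarrow> real) \<Rightarrow> ('m, 'd) flux" where
  "entropy_flux f k \<eta> t u =
     (\<lambda>c p. LBINT v=ereal k..ereal u. left_deriv \<eta> v *\<^sub>R flux_du f t v c p)"


section \<open>Measure-valued entropy solutions\<close>

text \<open>
  The metrics \<open>g t\<close>, \<open>t \<in> [0,T]\<close>, have volume densities that are uniformly comparable,
  so the measures \<open>dV\<^sub>g\<^sub>(\<^sub>t\<^sub>) dt\<close> and \<open>dV\<^sub>g\<^sub>(\<^sub>0\<^sub>) dt\<close>
  define the same measurable functions, null sets and \<open>L\<^sup>1\<close> space on \<open>M \<times> I\<close>.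
\<close>

definition spacetime ::
    "('m::topological_space, 'd::finite) chart set \<Rightarrow> real \<Rightarrow> (real \<Rightarrow> ('m, 'd) mfield)
      \<Rightarrow> ('m \<times> real) measure" where
  "spacetime A T g =
     completion (riem_volume A (g 0) \<Otimes>\<^sub>M lebesgue_on {0<..<T})"

text \<open>
  \<open>L\<^sup>1(M \<times> I, C\<^sub>0(\<real>))\<close>. As \<open>C\<^sub>0(\<real>)\<close> is separable, Borel measurability
  for the norm topology is the same as strong (Bochner) measurability.
\<close>

definition L1_C0 :: "'z measure \<Rightarrow> ('z \<Rightarrow> (real \<Rightarrow>\<^sub>C real)) set" where
  "L1_C0 M = {h. h \<in> borel_measurable M \<and>
     (\<forall>z. (apply_bcontfun (h z) \<longlongrightarrow> 0) at_infinity) \<and>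
     (\<integral>\<^sup>+z. ennreal (norm (h z)) \<partial>M) < \<infinity>}"

definition measure_support :: "real measure \<Rightarrow> real set" where
  "measure_support \<mu> = {v. \<forall>U. open U \<longrightarrow> v \<in> U \<longrightarrow> emeasure \<mu> U > 0}"

definition weak_star_measurable_prob ::
    "('m::topological_space, 'd::finite) chart set \<Rightarrow> real \<Rightarrow> (real \<Rightarrow> ('m, 'd) mfield)
      \<Rightarrow> ('m \<Rightarrow> real \<Rightarrow> real measure) \<Rightarrow> bool" where
  "weak_star_measurable_prob A T g \<nu> \<longleftrightarrow>
     (\<forall>p. \<forall>t\<in>{0<..<T}. real_distribution (\<nu> p t)) \<and>
     (\<forall>h\<in>L1_C0 (spacetime A T g).
        (\<lambda>(p, t). LINT v|\<nu> p t. apply_bcontfun (h (p, t)) v)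
          \<in> borel_measurable (spacetime A T g))"

text \<open>
  Nonnegative functions of class \<open>C\<^sup>0\<^sup>,\<^sup>1\<^sub>c(M \<times> [0,T))\<close>; given the compact support,
  being Lipschitz amounts to being locally Lipschitz in charts. Their derivatives exist only
  almost everywhere, and the values of \<open>deriv\<close> and \<open>frechet_derivative\<close> on the
  remaining null set are irrelevant under the integral.
\<close>

definition test_function ::
    "('m::topological_space, 'd::finite) chart set \<Rightarrow> real \<Rightarrow> ('m \<Rightarrow> real \<Rightarrow> real) \<Rightarrow> bool" where
  "test_function A T \<phi> \<longleftrightarrow>
     (\<forall>p. \<forall>t\<in>{0..<T}. \<phi> p t \<ge> 0) \<and>
     (\<forall>c\<in>A. loc_lipschitz_on (chart_image c \<times> {0..<T}) (\<lambda>(y, t). \<phi> (chart_inv c y) t)) \<and>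
     (\<exists>K. compact K \<and> K \<subseteq> UNIV \<times> {0..<T} \<and>
        (\<forall>p. \<forall>t\<in>{0..<T}. (p, t) \<notin> K \<longrightarrow> \<phi> p t = 0))"

definition L_infty :: "'z measure \<Rightarrow> ('z \<Rightarrow> real) set" where
  "L_infty M = {u. u \<in> borel_measurable M \<and> (\<exists>b. AE x in M. \<bar>u x\<bar> \<le> b)}"

definition mv_entropy_solution ::
    "('m::{t2_space,second_countable_topology}, 'd::finite) chart set \<Rightarrow> real
      \<Rightarrow> (real \<Rightarrow> ('m, 'd) mfield) \<Rightarrow> ('m, 'd) flux \<Rightarrow> real
      \<Rightarrow> ('m \<Rightarrow> real) \<Rightarrow> ('m \<Rightarrow> real \<Rightarrow> real measure) \<Rightarrow> bool" where
  "mv_entropy_solution A T g f k u0 \<nu> \<longleftrightarrow>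
     weak_star_measurable_prob A T g \<nu> \<and>
     (\<exists>a b. \<forall>p. \<forall>t\<in>{0<..<T}. measure_support (\<nu> p t) \<subseteq> {a..b}) \<and>
     (\<forall>\<eta> \<phi>. convex_on UNIV \<eta> \<longrightarrow> test_function A T \<phi> \<longrightarrow>
        (LINT t:{0<..<T}|lebesgue. LINT p|riem_volume A (g t).
            deriv (\<lambda>s. \<phi> p s) t * (LINT v|\<nu> p t. \<eta> v)
          + \<phi> p t * (LINT v|\<nu> p t.
                vol_rate A g p t * (\<eta> v - left_deriv \<eta> v * v)
              + riem_div A (g t) (entropy_flux f k \<eta> t v) p
              - left_deriv \<eta> v * riem_div A (g t) (f t v) p)
          + (LINT v|\<nu> p t. diff_along A (\<lambda>x. \<phi> x t) (entropy_flux f k \<eta> t v) p))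
        + (LINT p|riem_volume A (g 0). \<phi> p 0 * \<eta> (u0 p)) \<ge> 0)"

text \<open>The function \<open>x \<mapsto> \<langle>\<nu>\<^sub>t \<otimes> \<sigma>\<^sub>t, \<eta>\<rangle>\<close>.\<close>

definition tensor_pairing ::
    "('m \<Rightarrow> real \<Rightarrow> real measure) \<Rightarrow> ('m \<Rightarrow> real \<Rightarrow> real measure) \<Rightarrow> real
      \<Rightarrow> (real \<Rightarrow> real \<Rightarrow> real) \<Rightarrow> 'm \<Rightarrow> real" where
  "tensor_pairing \<nu> \<sigma> t \<eta> p = (LINT k2|\<sigma> p t. LINT k1|\<nu> p t. \<eta> k1 k2)"

end

theory Submission imports Defs begin

text \<open>
  Kruzhkov's doubling of variables is carried out in charts for the distribution functions
  \<open>\<nu>{r<..}\<close> and \<open>\<sigma>{..r}\<close>, which satisfy linear kinetic inequalities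
  with the level \<open>r\<close> as a parameter. Integrating \<open>\<nu>{r<..} * \<sigma>{..r}\<close> over \<open>r\<close> gives
  the pairing of \<open>\<nu>\<close> and \<open>\<sigma>\<close> with the positive part of the difference, and summing the local
  inequalities against a partition of unity cancels the flux terms. Hence the spatial integral
  of the pairing has a nonpositive distributional derivative in time.
\<close>


text \<open>The obstacle is the commutator created by mollifying:
  \<open>(a z r - a z' r) .* drh (z - z') + rh (z - z') * be z r\<close>. It has size
  \<open>ep^-n\<close> on a ball of radius \<open>ep\<close>, because \<open>a\<close> is Lipschitz,
  and integral zero, because \<open>be\<close> is the divergence of \<open>a\<close>; so L1
  continuity of translations removes it, and measurable, bounded Young measures are enough.
  Multiplying the equation by the coordinate density \<open>W = sqrt (det g)\<close> and treating
  time as a coordinate turns \<open>u_t + lambda u + div f(u)\<close> into the divergence of one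
  spacetime field \<open>(W *. f, W * u)\<close>, which absorbs lambda and the change of the metric.
  The entropies are (v - c)^+ for one solution and (c - v)^+ for the other. With left derivatives
  their thresholds are \<open>c < v\<close> and \<open>v <= c\<close>; the mismatch on the diagonal
  u = v has to be repaired before the two inequalities can be added. Test functions are supported
  inside the open time interval, which removes the initial terms. Weak-star measurability holds only
  up to null sets, so each Young measure is replaced by a Borel kernel; the volume measures of all
  times share their null sets, so the replacement is valid at almost every time.\<close>

abbreviation "borel2 \<equiv> borel \<Otimes>\<^sub>M borel"
abbreviation "bmeas M \<equiv> measurable M borel"
abbreviation "ind \<equiv> indicator"
abbreviation "cimg \<equiv> chart_image"
notation pair_measure (infixr "<x>" 80)
notation measurable (infixr "-M>" 60)
notation inner (infixl ".*" 70)
notation scaleR (infixr "*." 75)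
notation Product_Type.Times (infixr "<*>" 80)
lemmas lint_i_add = Bochner_Integration.integrable_add
 and lint_i_bound = Bochner_Integration.integrable_bound
 and lint_i_cong = Bochner_Integration.integrable_cong
 and lint_i_diff = Bochner_Integration.integrable_diff
 and lint_i_sum = Bochner_Integration.integrable_sum
 and lint_add = Bochner_Integration.integral_add
 and lint_cong = Bochner_Integration.integral_cong
 and lint_diff = Bochner_Integration.integral_diff
 and lint_indicator = Bochner_Integration.integral_indicator
 and lint_sum = Bochner_Integration.integral_sum
 and bmeas_contI = borel_measurable_continuous_onI
 and cont_comp2 = continuous_on_compose2
 and bmeas_cont_if = borel_measurable_continuous_on_if
 and meas_cong_sets = measurable_cong_sets

section \<open>Gradients and test functions\<close>

text \<open>The C^1 class of the whole proof: the derivative is stored as a vector field, so that it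
  can be integrated and paired with a flux. \<open>S\<close> is meant to be open; the derivative at
  \<open>z\<close> is not taken within \<open>S\<close>.\<close>

definition has_grad ::
  "('a::euclidean_space => real) => ('a => 'a) => 'a set => bool" where
 "has_grad f df S \<longleftrightarrow>
  (ALL z:S. (f has_derivative (%h. df z .* h)) (at z)) & continuous_on S df"

lemma has_gradD: "has_grad f df S ==> z : S ==> (f has_derivative (%h. df z .* h)) (at z)"
 by (auto simp: has_grad_def)

lemma has_grad_continuous: "has_grad f df S ==> continuous_on S f"
 by (auto simp: has_grad_def intro!: continuous_at_imp_continuous_on has_derivative_continuous)

lemma has_grad_continuous_grad: "has_grad f df S ==> continuous_on S df"
 by (auto simp: has_grad_def)

lemma has_grad_subset: "has_grad f df S ==> T \<subseteq> S ==> has_grad f df T"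
 by (auto simp: has_grad_def intro: continuous_on_subset)

lemma has_grad_const: "has_grad (%_. c) (%_. 0) S"
 by (auto simp: has_grad_def)

lemma has_grad_add:
 assumes "has_grad f df S" "has_grad g dg S"
 shows "has_grad (%z. f z + g z) (%z. df z + dg z) S"
 using assms by (auto simp: has_grad_def inner_add_left intro!: continuous_intros has_derivative_add)

lemma has_grad_mult:
 assumes "has_grad f df S" "has_grad g dg S"
 shows "has_grad (%z. f z * g z) (%z. g z *. df z + f z *. dg z) S"
 using assms has_grad_continuous[OF assms(1)] has_grad_continuous[OF assms(2)]
 by (auto simp: has_grad_def inner_add_left algebra_simps intro!: continuous_intros derivative_eq_intros)

lemma has_grad_cmult:
 assumes "has_grad f df S"
 shows "has_grad (%z. c * f z) (%z. c *. df z) S"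
 using has_grad_mult[OF has_grad_const assms, of c] by simp

lemma has_grad_diff:
 assumes "has_grad f df S" "has_grad g dg S"
 shows "has_grad (%z. f z - g z) (%z. df z - dg z) S"
 using has_grad_add[OF assms(1) has_grad_cmult[OF assms(2), of "-1"]] by simp

lemma has_grad_sum:
 assumes "finite I" "!!i. i : I ==> has_grad (f i) (df i) S"
 shows "has_grad (%z. SUM i:I. f i z) (%z. SUM i:I. df i z) S"
 using assms by (induction I rule: finite_induct)
  (auto intro!: has_grad_const has_grad_add)

lemma has_grad_prod:
 assumes "finite I" "!!i. i : I ==> EX d. has_grad (f i) d S"
 shows "EX d. has_grad (%z. PROD i:I. f i z) d S"
 using assms
proof (induction I rule: finite_induct)
 case empty
 show ?case by (simp add: exI[of _ "%_. 0"] has_grad_const)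
next
 case (insert i I)
 from insert.IH insert.prems obtain d' where d': "has_grad (%z. PROD i:I. f i z) d' S" by auto
 from insert.prems obtain d where "has_grad (f i) d S" by blast
 from has_grad_mult[OF this d'] insert.hyps show ?case by auto
qed

lemma has_grad_real_comp:
 assumes "has_grad f df S" "!!z. z : S ==> (h has_real_derivative h' (f z)) (at (f z))"
  "continuous_on (f ` S) h'"
 shows "has_grad (%z. h (f z)) (%z. h' (f z) *. df z) S"
 unfolding has_grad_def
proof (intro conjI ballI)
 fix z assume z: "z : S"
 have "(h has_derivative (%x. x * h' (f z))) (at (f z))"
  using assms(2)[OF z] by (simp add: has_field_derivative_def mult_commute_abs)
 from diff_chain_at[OF has_gradD[OF assms(1) z] this]
 show "((%z. h (f z)) has_derivative (%x. h' (f z) *. df z .* x)) (at z)"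
  by (simp add: o_def mult.commute)
next
 show "continuous_on S (%z. h' (f z) *. df z)"
  using cont_comp2[OF assms(3) has_grad_continuous[OF assms(1)]]
   has_grad_continuous_grad[OF assms(1)]
  by (auto intro!: continuous_intros)
qed

text \<open>The new gradient is the adjoint of \<open>ta' x\<close> applied to
  \<open>df (ta x)\<close>, written out over \<open>Basis\<close>. Continuity of \<open>ta'\<close>
  is asked for on each fixed vector only, which is the form in which smoothness of a transition map
  supplies it.\<close>

lemma has_grad_compose:
 fixes ta :: "'a::euclidean_space => 'b::euclidean_space"
 assumes "has_grad f df S'" "!!x. x : S ==> (ta has_derivative ta' x) (at x)"
  "!!v. continuous_on S (%x. ta' x v)" "ta ` S \<subseteq> S'"
 shows "has_grad (%x. f (ta x)) (%x. SUM b:Basis. (df (ta x) .* ta' x b) *. b) S"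
 unfolding has_grad_def
proof (intro conjI ballI)
 fix x assume x: "x : S"
 have lin: "linear (ta' x)" using assms(2)[OF x] has_derivative_linear by blast
 have eq: "(SUM b:Basis. (df (ta x) .* ta' x b) *. b) .* h = df (ta x) .* ta' x h" for h
 proof -
  have "ta' x h = (SUM b:Basis. (h .* b) *. ta' x b)"
   by (subst (1) euclidean_representation[of h, symmetric])
    (simp only: linear_sum[OF lin] linear_scale[OF lin])
  thus ?thesis
   by (simp only: inner_sum_left inner_sum_right inner_scaleR_left inner_scaleR_right mult.commute
     inner_commute[of h])
 qed
 have "(f has_derivative (%h. df (ta x) .* h)) (at (ta x))"
  using assms x by (auto intro: has_gradD)
 from diff_chain_at[OF assms(2)[OF x] this]
 have "((%x. f (ta x)) has_derivative (%h. df (ta x) .* ta' x h)) (at x)" by (simp add: o_def)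
 thus "((%x. f (ta x)) has_derivative (%h. (SUM b:Basis. (df (ta x) .* ta' x b) *. b) .* h)) (at x)"
  unfolding eq .
next
 have "continuous_on S ta"
  using has_derivative_continuous[OF assms(2)] continuous_at_imp_continuous_on by blast
 from cont_comp2[OF has_grad_continuous_grad[OF assms(1)] this assms(4)]
 show "continuous_on S (%x. SUM b:Basis. (df (ta x) .* ta' x b) *. b)"
  by (intro continuous_on_sum continuous_on_scaleR continuous_on_inner continuous_on_const assms(3))
qed

lemma has_grad_transform:
 assumes "has_grad f df S" "open S" "!!z. z : S ==> f z = g z"
 shows "has_grad g df S"
 unfolding has_grad_def
 using assms has_derivative_transform_within_open[of f _ _ UNIV S g]
 by (auto simp: has_grad_def)

lemma has_grad_cong_gradient:
 assumes "has_grad f df S" "!!z. z : S ==> df z = dg z"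
 shows "has_grad f dg S"
 unfolding has_grad_def
proof (intro conjI ballI)
 show "continuous_on S dg"
  using continuous_on_eq[OF has_grad_continuous_grad[OF assms(1)] assms(2)] .
 show "(f has_derivative (.*) (dg z)) (at z)" if "z : S" for z
  using has_gradD[OF assms(1) that] assms(2)[OF that] by simp
qed

lemma has_grad_Un:
 assumes "has_grad f df S" "has_grad f df T" "open S" "open T"
 shows "has_grad f df (S Un T)"
 using assms unfolding has_grad_def by (auto intro: continuous_on_open_Un)

lemma gradient_eq_0:
 assumes "(f has_derivative (%h. g .* h)) (at z)" "open T" "z : T" "!!x. x : T ==> f x = 0"
 shows "g = 0"
proof -
 have "((%_. 0) has_derivative (%h. g .* h)) (at z)"
  by (rule has_derivative_transform_within_open[OF assms(1-3)]) (use assms(4) in auto)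
 hence "(%h. g .* h) = (%_. 0)"
  using has_derivative_unique has_derivative_const by blast
 thus ?thesis by (metis inner_eq_zero_iff)
qed

text \<open>Near each point outside \<open>K\<close> the extended function is zero, so its gradient
  vanishes there; the open sets \<open>S\<close> and \<open>- K\<close> cover the space, and the two
  C^1 pieces agree on the overlap.\<close>

lemma has_grad_extend_zero:
 assumes "has_grad f df S" "open S" "closed K" "K \<subseteq> S" "!!z. z : S ==> z ~: K ==> f z = 0"
 shows "has_grad (%z. if z : S then f z else 0) (%z. if z : K then df z else 0) UNIV"
  (is "has_grad ?f ?df UNIV")
proof -
 have zero: "df z = 0" if "z : S" "z ~: K" for z
  by (rule gradient_eq_0[OF has_gradD[OF assms(1)], of z "S - K"])
   (use that assms in auto)
 have "has_grad ?f df S"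
  by (rule has_grad_transform[OF assms(1,2)]) auto
 hence 1: "has_grad ?f ?df S"
  by (rule has_grad_cong_gradient) (use zero in auto)
 have "has_grad (%_. 0) (%_. 0) (- K)" by (rule has_grad_const)
 hence "has_grad ?f (%_. 0) (- K)"
  by (rule has_grad_transform) (use assms in auto)
 hence 2: "has_grad ?f ?df (- K)"
  by (rule has_grad_cong_gradient) auto
 have "S Un - K = UNIV" using assms by auto
 with has_grad_Un[OF 1 2] assms show ?thesis by (auto simp: open_Compl)
qed

lemma has_grad_zero_outside:
 assumes "has_grad f df UNIV" "closed K" "!!z. z ~: K ==> f z = 0" "z ~: K"
 shows "df z = 0"
 by (rule gradient_eq_0[OF has_gradD[OF assms(1)], of z "- K"]) (use assms in auto)

lemma has_grad_lipschitz:
 assumes "has_grad f df S" "convex S" "!!z. z : S ==> norm (df z) <= L" "x : S" "y : S"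
 shows "abs (f x - f y) <= L * norm (x - y)"
proof -
 have "norm (f x - f y) <= L * norm (x - y)"
 proof (rule differentiable_bound[OF assms(2), where f' = "%z h. df z .* h"])
  fix z assume z: "z : S"
  show "(f has_derivative (.*) (df z)) (at z within S)"
   using has_gradD[OF assms(1) z] by (rule has_derivative_at_withinI)
  have "onorm ((.*) (df z)) <= norm (df z)"
   by (rule onorm_le) (simp add: Cauchy_Schwarz_ineq2)
  thus "onorm ((.*) (df z)) <= L" using assms(3)[OF z] by simp
 qed (use assms in auto)
 thus ?thesis by simp
qed

text \<open>The total derivative of a compactly supported function integrates to zero: difference
 quotients do, by translation invariance.\<close>

lemma lborel_integral_shift:
 fixes f :: "'a::euclidean_space => 'b::{banach, second_countable_topology}"
 assumes [measurable]: "f : bmeas borel"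
 shows "(LINT z|lborel. f (z + a)) = (LINT z|lborel. f z)"
proof -
 have "(LINT z|lborel. f z) = (LINT z|distr lborel borel ((+) a). f z)"
  by (simp add: lborel_distr_plus)
 also have "... = (LINT z|lborel. f (a + z))"
  by (rule integral_distr) auto
 finally show ?thesis by (simp add: add.commute)
qed

lemma lborel_integrable_shift:
 fixes f :: "'a::euclidean_space => 'b::{banach, second_countable_topology}"
 assumes "integrable lborel f"
 shows "integrable lborel (%z. f (z + a))"
proof -
 have "integrable (distr lborel borel ((+) a)) f"
  using assms by (simp add: lborel_distr_plus)
 thus ?thesis
  by (subst (asm) integrable_distr_eq) (use assms in \<open>auto simp: add.commute\<close>)
qed

lemma i_bsupp:
 fixes f :: "'a::euclidean_space => 'b::{banach, second_countable_topology}"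
 assumes [measurable]: "f : bmeas borel"
  and "!!z. norm (f z) <= C" "bounded K" "!!z. z ~: K ==> f z = 0"
 shows "integrable lborel f"
proof -
 obtain r where r: "K \<subseteq> cball 0 r"
  using bounded_subset_ballD[OF assms(3), of 0] ball_subset_cball by blast
 have C: "0 <= C" by (rule order_trans[OF norm_ge_zero assms(2)])
 show ?thesis
 proof (rule lint_i_bound)
  show "integrable lborel (%z::'a. C * ind (cball 0 r) z)"
   by (intro integrable_mult_right integrable_real_indicator)
    (auto intro: emeasure_lborel_cball_finite simp del: infinity_ennreal_def)
  show "AE z in lborel. norm (f z) <= norm (C * ind (cball 0 r) z)"
  proof (rule AE_I2)
   fix z show "norm (f z) <= norm (C * ind (cball 0 r) z)"
    using assms(2)[of z] assms(4)[of z] subsetD[OF r, of z] C by (cases "z : cball 0 r") auto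
  qed
 qed simp
qed

lemma bounded_of_compact_support:
 fixes f :: "'a::euclidean_space => 'b::real_normed_vector"
 assumes "continuous_on UNIV f" "compact K" "!!z. z ~: K ==> f z = 0"
 obtains C where "C >= 0" "!!z. norm (f z) <= C"
proof -
 have "bounded (f ` K)"
  using assms by (intro compact_imp_bounded compact_continuous_image) (auto intro: continuous_on_subset)
 then obtain C where C: "ALL z:K. norm (f z) <= C" by (auto simp: bounded_iff)
 show ?thesis
 proof (rule that[of "max C 0"])
  show "norm (f z) <= max C 0" for z
   using C assms(3)[of z] by (cases "z : K") auto
 qed simp
qed

lemma integral_gradient_zero:
 fixes f :: "'a::euclidean_space => real"
 assumes f: "has_grad f df UNIV" and K: "compact K" "!!z. z ~: K ==> f z = 0"
 shows "integrable lborel (%z. df z .* e)" "(LINT z|lborel. df z .* e) = 0"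
proof -
 have cf: "continuous_on UNIV f" and cdf: "continuous_on UNIV df"
  using f by (auto simp: has_grad_def intro: has_grad_continuous[OF f])
 have [measurable]: "f : bmeas borel" "df : bmeas borel"
  using cf cdf by (auto intro: bmeas_contI)
 have df0: "df z = 0" if "z ~: K" for z
  using has_grad_zero_outside[OF f _ K(2) that] K(1) compact_imp_closed by blast
 obtain L where L: "L >= 0" "!!z. norm (df z) <= L"
  using bounded_of_compact_support[OF cdf K(1) df0] by blast
 obtain C where C: "C >= 0" "!!z. norm (f z) <= C"
  using bounded_of_compact_support[OF cf K(1) K(2)] by blast
 have bK: "bounded K" using K(1) compact_imp_bounded by blast
 have intf: "integrable lborel f"
  by (rule i_bsupp[OF _ C(2) bK K(2)]) auto
 show "integrable lborel (%z. df z .* e)"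
 proof (rule i_bsupp[where C = "L * norm e"])
  show "norm (df z .* e) <= L * norm e" for z
   using Cauchy_Schwarz_ineq2[of "df z" e] mult_right_mono[OF L(2)[of z], of "norm e"] by simp
 qed (use df0 bK in auto)
 define q where "q n z = (f (z + inverse (real (Suc n)) *. e) - f z) * real (Suc n)" for n z
 obtain r where r: "r > 0" "K \<subseteq> cball 0 r"
  using bounded_subset_ballD[OF bK, of 0] ball_subset_cball by blast
 \<comment> \<open>The mean value bound \<open>L * norm e\<close> dominates all difference
   quotients. They are supported in the ball enlarged by \<open>norm e\<close>, because the step
   lengths \<open>inverse (Suc n)\<close> are at most 1.\<close>
 have "(%n. LINT z|lborel. q n z) \<longlonglongrightarrow> (LINT z|lborel. df z .* e)"
 proof (rule integral_dominated_convergence[where w = "%z. L * norm e * ind (cball 0 (r + norm e)) z"])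
  show "integrable lborel (%z::'a. L * norm e * ind (cball 0 (r + norm e)) z)"
   by (intro integrable_mult_right integrable_real_indicator)
    (auto intro: emeasure_lborel_cball_finite simp del: infinity_ennreal_def)
  show "AE z in lborel. norm (q n z) <= L * norm e * ind (cball 0 (r + norm e)) z" for n
  proof (rule AE_I2)
   fix z :: 'a
   show "norm (q n z) <= L * norm e * ind (cball 0 (r + norm e)) z"
   proof (cases "z : cball 0 (r + norm e)")
    case True
    have "abs (f (z + inverse (real (Suc n)) *. e) - f z) <= L * norm (z + inverse (real (Suc n)) *. e - z)"
     by (rule has_grad_lipschitz[OF f]) (use L in auto)
    hence "abs (f (z + inverse (real (Suc n)) *. e) - f z) * real (Suc n)
      <= L * norm (inverse (real (Suc n)) *. e) * real (Suc n)"
     by (intro mult_right_mono) auto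
    also have "... = L * norm e" by (simp add: field_simps)
    finally show ?thesis using True by (simp add: q_def abs_mult)
   next
    case False
    have "norm (inverse (real (Suc n)) *. e) <= norm e"
     by (simp add: field_simps mult_le_cancel_left1)
    hence "z ~: cball 0 r" "z + inverse (real (Suc n)) *. e ~: cball 0 r"
     using False norm_ge_zero[of e]
      norm_triangle_ineq4[of "z + inverse (real (Suc n)) *. e" "inverse (real (Suc n)) *. e"]
     by (simp_all del: norm_ge_zero of_nat_Suc)
    hence "f z = 0" "f (z + inverse (real (Suc n)) *. e) = 0" using r K(2) by blast+
    thus ?thesis using False by (simp add: q_def)
   qed
  qed
  show "AE z in lborel. (%n. q n z) \<longlonglongrightarrow> df z .* e"
  proof (rule AE_I2)
   fix z :: 'a
   have "(f has_derivative (%h. df z .* h)) (at (z + 0 *. e))"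
    using f by (simp add: has_grad_def)
   moreover have "((%s. z + s *. e) has_derivative (%s. s *. e)) (at 0)"
    by (auto intro!: derivative_eq_intros)
   ultimately have "((%s. f (z + s *. e)) has_derivative (%s. df z .* (s *. e))) (at 0)"
    using diff_chain_at[of "%s. z + s *. e" "%s. s *. e" 0 f "%h. df z .* h"]
    by (simp only: o_def)
   hence "((%s. f (z + s *. e)) has_real_derivative (df z .* e)) (at 0)"
    by (simp add: has_field_derivative_def mult_commute_abs)
   hence *: "((%s. (f (z + s *. e) - f z) / s) \<longlongrightarrow> df z .* e) (at 0)"
    by (simp add: DERIV_def)
   have "filterlim (%n. inverse (real (Suc n))) (at 0) sequentially"
    using LIMSEQ_inverse_real_of_nat by (auto simp: filterlim_at)
   from filterlim_compose[OF * this] show "(%n. q n z) \<longlonglongrightarrow> df z .* e"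
    by (simp add: q_def divide_inverse)
  qed
 qed (auto simp: q_def)
 moreover have "(LINT z|lborel. q n z) = 0" for n
  unfolding q_def using intf lborel_integrable_shift[OF intf]
  by (simp add: lborel_integral_shift)
 ultimately show "(LINT z|lborel. df z .* e) = 0"
  by (simp add: LIMSEQ_const_iff)
qed

lemma DERIV_pos_part_square: "((%s. (max 0 s)\<^sup>2) has_real_derivative 2 * max 0 s) (at (s::real))"
proof -
 consider "s > 0" | "s < 0" | "s = 0" by linarith
 thus ?thesis
 proof cases
  case 1
  have "((%s. s\<^sup>2) has_real_derivative 2 * max 0 s) (at s)"
   using 1 by (auto intro!: derivative_eq_intros)
  thus ?thesis
   by (rule DERIV_cong_ev[THEN iffD1, rotated 3]) (use 1 eventually_nhds_in_open[of "{0<..}" s] in \<open>auto elim!: eventually_mono\<close>)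
 next
  case 2
  have "((%s. 0) has_real_derivative 2 * max 0 s) (at s)"
   using 2 by (auto intro!: derivative_eq_intros)
  thus ?thesis
   by (rule DERIV_cong_ev[THEN iffD1, rotated 3]) (use 2 eventually_nhds_in_open[of "{..<0}" s] in \<open>auto elim!: eventually_mono\<close>)
 next
  case 3
  have "((%t::real. max 0 t) \<longlongrightarrow> max 0 0) (at 0)"
   by (intro tendsto_intros)
  moreover have "(%t::real. (max 0 t)\<^sup>2 / t) = (%t. max 0 t)"
   by (auto simp: fun_eq_iff max_def power2_eq_square)
  ultimately have "((%t::real. (max 0 t)\<^sup>2 / t) \<longlongrightarrow> 0) (at 0)" by simp
  thus ?thesis using 3 by (simp add: DERIV_def)
 qed
qed

text \<open>The witness is the square of the positive part of \<open>r^2 - |z - x|^2\<close>: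
  squaring makes it C^1 across the sphere, which is all the regularity that test functions have
  here.\<close>

lemma bump_exists:
 fixes x :: "'a::euclidean_space"
 assumes "r > 0"
 shows "EX f df. has_grad f df UNIV & (ALL z. 0 <= f z) & (ALL z:ball x r. 0 < f z) & (ALL z. z ~: ball x r --> f z = 0)"
proof -
 define p where "p z = r\<^sup>2 - (z - x) .* (z - x)" for z
 have p: "has_grad p (%z. - 2 *. (z - x)) UNIV"
  unfolding has_grad_def p_def
  by (auto intro!: continuous_intros derivative_eq_intros simp: inner_commute algebra_simps)
 have "has_grad (%z. (max 0 (p z))\<^sup>2) (%z. (2 * max 0 (p z)) *. (- 2 *. (z - x))) UNIV"
  by (rule has_grad_real_comp[OF p DERIV_pos_part_square]) (auto intro!: continuous_intros)
 moreover have p_pos: "p z > 0 \<longleftrightarrow> z : ball x r" for z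
 proof -
  have "p z > 0 \<longleftrightarrow> (norm (z - x))\<^sup>2 < r\<^sup>2"
   by (simp add: p_def power2_norm_eq_inner)
  also have "... \<longleftrightarrow> norm (z - x) < r"
   using assms power_strict_mono[of "norm (z - x)" r 2] power_less_imp_less_base[of "norm (z - x)" 2 r]
   by auto
  finally show ?thesis by (simp add: dist_norm norm_minus_commute)
 qed
 moreover have "max 0 (p z) = 0" if "z ~: ball x r" for z
  using p_pos[of z] that by (simp add: max_def)
 moreover have "(max 0 (p z))\<^sup>2 > 0" if "z : ball x r" for z
  using p_pos[of z] that by simp
 ultimately show ?thesis
  by (intro exI[of _ "%z. (max 0 (p z))\<^sup>2"] exI conjI) (assumption, simp_all)
qed

lemma ball_not_AE:
 assumes "r > 0"
 shows "\<not> (AE z in lborel. z ~: ball (x::'a::euclidean_space) r)"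
proof
 assume "AE z in lborel. z ~: ball x r"
 hence "ball x r : null_sets lborel"
  by (subst (asm) AE_iff_null_sets[symmetric]) auto
 hence "emeasure lborel (ball x r) = 0" by auto
 hence "ennreal (unit_ball_vol (real DIM('a)) * r ^ DIM('a)) = 0"
  using assms by (simp add: emeasure_ball)
 moreover have "unit_ball_vol (real DIM('a)) * r ^ DIM('a) > 0"
  using assms by (intro mult_pos_pos unit_ball_vol_pos) auto
 ultimately show False by (simp add: ennreal_eq_0_iff)
qed

text \<open>Scaling one normalised bump keeps \<open>C\<close> independent of \<open>ep\<close>. The
  exact powers of \<open>ep\<close> matter: in the commutator estimate a factor \<open>ep\<close>
  from the Lipschitz bound brings the gradient down to the size \<open>ep^-n\<close> of the kernel
  itself.\<close>

lemma mollifier_exists: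
 obtains C where "C >= 0" "!!ep. ep > 0 ==> EX rh drh. has_grad rh drh (UNIV::'a::euclidean_space set)
   & (ALL z. 0 <= rh z) & (ALL z. rh z <= C / ep ^ DIM('a)) & (ALL z. norm (drh z) <= C / ep ^ Suc DIM('a))
   & (ALL z. z ~: ball 0 ep --> rh z = 0) & (LINT z|lborel. rh z) = 1"
proof -
 obtain f df where f: "has_grad f df (UNIV::'a set)" "!!z. 0 <= f z" "!!z. z : ball 0 1 ==> 0 < f z"
   "!!z. z ~: ball 0 1 ==> f z = 0"
  using bump_exists[of 1 "0::'a"] by auto
 have f0: "f z = 0" if "z ~: cball 0 1" for z using that f(4) by auto
 have cf: "continuous_on UNIV f" and cdf: "continuous_on UNIV df"
  using f by (auto simp: has_grad_def intro: has_grad_continuous[OF f(1)])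
 have [measurable]: "f : bmeas borel"
  using cf by (auto intro: bmeas_contI)
 have df0: "df z = 0" if "z ~: cball 0 1" for z
  using has_grad_zero_outside[OF f(1) closed_cball f0 that] .
 obtain C1 where C1: "C1 >= 0" "!!z. norm (f z) <= C1"
  using bounded_of_compact_support[OF cf compact_cball f0] by blast
 obtain C2 where C2: "C2 >= 0" "!!z. norm (df z) <= C2"
  using bounded_of_compact_support[OF cdf compact_cball df0] by blast
 have intf: "integrable lborel f"
  by (rule i_bsupp[where C = C1 and K = "cball 0 1"]) (use C1 f0 in auto)
 define m where "m = (LINT z|lborel. f z)"
 have "m ~= 0"
 proof
  assume "m = 0"
  hence "AE z in lborel. f z = 0"
   unfolding m_def using integral_nonneg_eq_0_iff_AE[OF intf] f(2) by auto
  hence "AE z in lborel. z ~: ball (0::'a) 1"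
   using f(3) by (auto elim!: eventually_mono) (metis less_irrefl mem_ball_0)
  thus False using ball_not_AE[of 1 "0::'a"] by simp
 qed
 moreover have "m >= 0" unfolding m_def using f(2) by (intro integral_nonneg_AE) auto
 ultimately have m: "m > 0" by simp
 define C where "C = max C1 C2 / m"
 show ?thesis
 proof (rule that[of C])
  show "C >= 0" using m C1 by (auto simp: C_def)
  fix ep :: real assume e: "ep > 0"
  define n where "n = DIM('a)"
  define rh where "rh z = (1 / (m * ep ^ n)) * f (z /\<^sub>R ep)" for z
  define drh where "drh z = (1 / (m * ep ^ n)) *. ((1 / ep) *. df (z /\<^sub>R ep))" for z
  have "has_grad (%z. f (z /\<^sub>R ep)) (%z. (1 / ep) *. df (z /\<^sub>R ep)) UNIV"
   unfolding has_grad_def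
  proof (intro conjI ballI)
   fix z :: 'a
   have "((%z. z /\<^sub>R ep) has_derivative (%z. z /\<^sub>R ep)) (at z)"
    by (auto intro!: derivative_eq_intros)
   have eq: "(.*) ((1 / ep) *. df (z /\<^sub>R ep)) = (%x. df (z /\<^sub>R ep) .* (x /\<^sub>R ep))"
    by (auto simp: fun_eq_iff divide_inverse)
   from diff_chain_at[OF \<open>(_ has_derivative _) _\<close> has_gradD[OF f(1) UNIV_I]]
   show "((%z. f (z /\<^sub>R ep)) has_derivative (.*) ((1 / ep) *. df (z /\<^sub>R ep))) (at z)"
    unfolding eq by (simp only: o_def)
  qed (auto intro!: continuous_intros cont_comp2[OF cdf])
  hence "has_grad rh drh UNIV"
   unfolding rh_def drh_def by (rule has_grad_cmult)
  moreover have "0 <= rh z" for z using f(2) m e by (simp add: rh_def)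
  moreover have "rh z <= C / ep ^ n" for z
  proof -
   have "f (z /\<^sub>R ep) <= max C1 C2" using C1(2)[of "z /\<^sub>R ep"] by auto
   thus ?thesis using m e by (simp add: rh_def C_def field_simps)
  qed
  moreover have "norm (drh z) <= C / ep ^ Suc n" for z
  proof -
   have "norm (df (z /\<^sub>R ep)) <= max C1 C2" using C2(2)[of "z /\<^sub>R ep"] by auto
   thus ?thesis using m e by (simp add: drh_def C_def field_simps abs_mult)
  qed
  moreover have "rh z = 0" if "z ~: ball 0 ep" for z
  proof -
   have "z /\<^sub>R ep ~: ball 0 1" using that e by (simp add: field_simps)
   thus ?thesis using f(4) by (simp add: rh_def)
  qed
  moreover have "(LINT z|lborel. rh z) = 1"
  proof -
   have "(LINT z|lborel. f (z /\<^sub>R ep)) = (LINT z|density (distr lborel borel (%x. 0 + ep *. x)) (%_. abs ep^DIM('a)). f (z /\<^sub>R ep))"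
    using lborel_affine[of ep "0::'a"] e by simp
   also have "... = (LINT z|distr lborel borel (%x. 0 + ep *. x). ep ^ n * f (z /\<^sub>R ep))"
    using e by (subst integral_density) (auto simp: n_def)
   also have "... = (LINT z|lborel. ep ^ n * f z)"
    using e by (subst integral_distr) auto
   also have "... = ep ^ n * m" by (simp add: m_def)
   finally show ?thesis using e m by (simp add: rh_def)
  qed
  ultimately show "EX rh drh. has_grad rh drh (UNIV::'a::euclidean_space set)
   & (ALL z. 0 <= rh z) & (ALL z. rh z <= C / ep ^ DIM('a)) & (ALL z. norm (drh z) <= C / ep ^ Suc DIM('a))
   & (ALL z. z ~: ball 0 ep --> rh z = 0) & (LINT z|lborel. rh z) = 1"
   unfolding n_def by blast
 qed
qed

text \<open>A finite sum of bumps is at least some \<open>m > 0\<close> on \<open>K\<close>;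
  composing it with a C^1 function that is constantly 1 above \<open>m / 2\<close> gives the
  plateau. The open set \<open>V\<close> is part of the result because the cutoff must be invisible
  to derivatives near \<open>K\<close>, not only to values on it.\<close>

lemma cutoff_exists:
 fixes K :: "'a::euclidean_space set"
 assumes K: "compact K" "K \<subseteq> OM" "open OM"
 obtains th dth V K' where "has_grad th dth UNIV" "!!z. 0 <= th z" "!!z. th z <= 1"
  "open V" "K \<subseteq> V" "!!z. z : V ==> th z = 1" "compact K'" "K' \<subseteq> OM" "!!z. z ~: K' ==> th z = 0"
proof (cases "K = {}")
 case True
 show ?thesis
  by (rule that[of "%_. 0" "%_. 0" "{}" "{}"]) (auto simp: True has_grad_const)
next
 case False
 have "ALL x:K. EX r>0. cball x r \<subseteq> OM"
  using K open_contains_cball by blast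
 then obtain r where r: "!!x. x : K ==> r x > 0 & cball x (r x) \<subseteq> OM" by metis
 have "EX f df. has_grad f df UNIV & (ALL z. 0 <= f z) & (ALL z:ball x (r x). 0 < f z) & (ALL z. z ~: ball x (r x) --> f z = 0)"
  if "x : K" for x using bump_exists r[OF that] by blast
 then obtain f df where f: "!!x. x : K ==> has_grad (f x) (df x) UNIV"
  "!!x z. x : K ==> 0 <= f x z" "!!x z. x : K ==> z : ball x (r x) ==> 0 < f x z"
  "!!x z. x : K ==> z ~: ball x (r x) ==> f x z = 0" by metis
 obtain I where I: "I \<subseteq> K" "finite I" "K \<subseteq> (UN x:I. ball x (r x))"
  by (rule compactE_image[OF K(1), of K "%x. ball x (r x)"]) (use r in force)+
 define s where "s z = (SUM x:I. f x z)" for z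
 define K' where "K' = (UN x:I. cball x (r x))"
 have s: "has_grad s (%z. SUM x:I. df x z) UNIV"
  unfolding s_def using I f by (intro has_grad_sum) auto
 have s_pos: "s z > 0" if zK: "z : K" for z
 proof -
  obtain x where x: "x : I" "z : ball x (r x)" using subsetD[OF I(3) zK] by auto
  thus ?thesis
   unfolding s_def using I f(2,3) by (intro sum_pos2[of _ x]) auto
 qed
 have s0: "s z = 0" if "z ~: K'" for z
  unfolding s_def by (rule sum.neutral) (use that f(4) I in \<open>force simp: K'_def\<close>)
 have s_nn: "s z >= 0" for z unfolding s_def using I f(2) by (auto intro!: sum_nonneg)
 have cs: "continuous_on UNIV s" by (rule has_grad_continuous[OF s])
 obtain z0 where z0: "z0 : K" "!!z. z : K ==> s z0 <= s z"
  using continuous_attains_inf[OF K(1) False continuous_on_subset[OF cs]] by auto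
 define m where "m = s z0"
 have m: "m > 0" using s_pos z0 by (simp add: m_def)
 define th where "th z = 1 - (max 0 (1 - (2 / m) * s z))\<^sup>2" for z
 define dth where "dth z = 0 - (2 * max 0 (1 - (2 / m) * s z)) *. (0 - (2 / m) *. (SUM x:I. df x z))" for z
 have "has_grad (%z. 1 - (2 / m) * s z) (%z. 0 - (2 / m) *. (SUM x:I. df x z)) UNIV"
  by (intro has_grad_diff has_grad_const has_grad_cmult s)
 hence "has_grad (%z. (max 0 (1 - (2 / m) * s z))\<^sup>2)
   (%z. (2 * max 0 (1 - (2 / m) * s z)) *. (0 - (2 / m) *. (SUM x:I. df x z))) UNIV"
  by (rule has_grad_real_comp[where h = "%s. (max 0 s)\<^sup>2" and h' = "%s. 2 * max 0 s"])
   (auto intro!: DERIV_pos_part_square continuous_intros)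
 from has_grad_diff[OF has_grad_const this]
 have th: "has_grad th dth UNIV"
  unfolding th_def dth_def .
 show ?thesis
 proof (rule that[OF th, of "{z. s z > m / 2}" K'])
  show "th z >= 0" for z
  proof -
   have "(max 0 (1 - (2 / m) * s z))\<^sup>2 <= 1\<^sup>2"
    using s_nn[of z] m by (intro power_mono) auto
   thus ?thesis by (simp add: th_def)
  qed
  show "th z <= 1" for z by (simp add: th_def)
  show "open {z. m / 2 < s z}"
   by (rule open_Collect_less[OF continuous_on_const cs])
  show "K \<subseteq> {z. s z > m / 2}" using z0(2) m by (force simp: m_def)
  show "th z = 1" if "z : {z. s z > m / 2}" for z
   using that m by (simp add: th_def max_def field_simps)
  show "compact K'" unfolding K'_def using I by (intro compact_UN) auto
  show "K' \<subseteq> OM" unfolding K'_def using r I by blast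
  show "th z = 0" if "z ~: K'" for z using s0[OF that] by (simp add: th_def)
 qed
qed

section \<open>Weak identities and L1 continuity of translations\<close>

lemma continuous_nonpos_of_weak_zero:
 fixes u :: "'a::euclidean_space => real"
 assumes "open S" "continuous_on S u" "z : S"
  and weak: "!!ph dph K. has_grad ph dph UNIV ==> (!!z. 0 <= ph z) ==> compact K ==> K \<subseteq> S ==>
   (!!z. z ~: K ==> ph z = 0) ==> (LINT z|lborel. ph z * u z) = 0"
 shows "u z <= 0"
proof (rule ccontr)
 assume "\<not> u z <= 0"
 \<comment> \<open>If \<open>u z > 0\<close>, a bump supported in the open set \<open>S'\<close> of
   positivity has a strictly positive integral against \<open>u\<close>.\<close>
 define S' where "S' = S Int u -` {0<..}"
 have "open S'" unfolding S'_def
  using assms(1,2) by (auto simp: continuous_on_open_vimage Int_commute)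
 moreover have "z : S'" using assms(3) \<open>\<not> u z <= 0\<close> by (auto simp: S'_def)
 ultimately obtain r where r: "r > 0" "cball z r \<subseteq> S'"
  using open_contains_cball by blast
 obtain ph dph where ph: "has_grad ph dph UNIV" "!!x. 0 <= ph x" "!!x. x : ball z r ==> 0 < ph x"
   "!!x. x ~: ball z r ==> ph x = 0"
  using bump_exists[OF r(1), of z] by auto
 have sub: "cball z r \<subseteq> S" using r by (auto simp: S'_def)
 have "(LINT x|lborel. ph x * u x) = 0"
  by (rule weak[OF ph(1,2) compact_cball sub]) (use ph(4) in auto)
 moreover have eq: "(%x. ph x * u x) = (%x. ind (cball z r) x *. (ph x * u x))"
  using ph(4) by (auto simp: indicator_def fun_eq_iff)
 moreover have "integrable lborel (%x. ind (cball z r) x *. (ph x * u x))"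
  by (rule borel_integrable_compact)
   (auto intro!: continuous_intros continuous_on_subset[OF has_grad_continuous[OF ph(1)]]
    continuous_on_subset[OF assms(2) sub])
 moreover have "0 <= ph x * u x" for x
 proof (cases "x : ball z r")
  case True
  hence "u x > 0" using r(2) ball_subset_cball unfolding S'_def by blast
  thus ?thesis using ph(2) by (simp add: less_imp_le)
 qed (simp add: ph(4))
 ultimately have "AE x in lborel. ph x * u x = 0"
  using integral_nonneg_eq_0_iff_AE[of lborel "%x. ph x * u x"] by auto
 moreover have "ph x * u x ~= 0" if "x : ball z r" for x
 proof -
  have "u x > 0" using r(2) that ball_subset_cball unfolding S'_def by blast
  thus ?thesis using ph(3)[OF that] by simp
 qed
 ultimately have "AE x in lborel. x ~: ball z r"
  by (auto elim!: eventually_mono)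
 thus False using ball_not_AE[OF r(1)] by blast
qed

lemma continuous_zero_of_weak_zero:
 fixes u :: "'a::euclidean_space => real"
 assumes "open S" "continuous_on S u" "z : S"
  and weak: "!!ph dph K. has_grad ph dph UNIV ==> (!!z. 0 <= ph z) ==> compact K ==> K \<subseteq> S ==>
   (!!z. z ~: K ==> ph z = 0) ==> (LINT z|lborel. ph z * u z) = 0"
 shows "u z = 0"
proof -
 have "u z <= 0" by (rule continuous_nonpos_of_weak_zero[OF assms])
 moreover have "- u z <= 0"
  by (rule continuous_nonpos_of_weak_zero[OF assms(1) continuous_on_minus[OF assms(2)] assms(3)])
   (use weak in auto)
 ultimately show ?thesis by simp
qed

text \<open>Inner regularity of finite measures, applied to Lebesgue measure restricted to
  \<open>A\<close>; the restriction is what makes the measure finite.\<close>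

lemma lmeasurable_inner_compact:
 fixes A :: "'a::euclidean_space set"
 assumes A[measurable]: "A : sets borel" and fin: "emeasure lborel A < \<infinity>" and de: "de > 0"
 shows "EX K. compact K & K \<subseteq> A & emeasure lborel (A - K) < ennreal de"
proof -
 define M where "M = density lborel (ind A)"
 have em: "emeasure M B = emeasure lborel (A Int B)" if "B : sets borel" for B
  using that by (simp add: M_def emeasure_density indicator_inter_arith[symmetric])
 have eq: "emeasure M A = (SUP K\<in>{K. K \<subseteq> A & compact K}. emeasure M K)"
 proof (rule inner_regular)
  show "emeasure M (space M) ~= \<infinity>"
   using em[of UNIV] fin by (auto simp: M_def)
 qed (auto simp: M_def)
 show ?thesis
 proof (cases "emeasure lborel A = 0")
  case True
  thus ?thesis using de by (intro exI[of _ "{}"]) auto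
 next
  case False
  have MA: "emeasure M A = emeasure lborel A" using em[of A] by simp
  obtain a where a: "emeasure lborel A = ennreal a" "a >= 0" using fin by (cases "emeasure lborel A") auto
  define de' where "de' = ennreal de"
  have "a > 0" using False a by (cases "a = 0") auto
  hence "emeasure lborel A - de' < emeasure M A"
   using de a by (simp add: MA de'_def ennreal_minus ennreal_lessI)
  then obtain K where K: "K \<subseteq> A" "compact K" "emeasure lborel A - de' < emeasure M K"
   unfolding eq less_SUP_iff by auto
  have [measurable]: "K : sets borel" using K by (auto intro: borel_compact)
  have MK: "emeasure M K = emeasure lborel K" using em[of K] K by (simp add: Int_absorb1)
  have finK: "emeasure lborel K < \<infinity>" using emeasure_mono[OF K(1), of lborel] fin by (auto intro: le_less_trans)
  have "emeasure lborel (A - K) = emeasure lborel A - emeasure lborel K"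
   using K finK by (intro emeasure_Diff) auto
  also have "... < de'"
  proof -
   obtain b where b: "emeasure lborel K = ennreal b" "b >= 0" using finK by (cases "emeasure lborel K") auto
   have "ennreal (a - de) < ennreal b"
    using K(3) de a b by (simp add: MK de'_def ennreal_minus)
   hence "a - de < b" using b by (metis ennreal_leI not_le)
   thus ?thesis using a b de by (simp add: de'_def ennreal_minus ennreal_lessI)
  qed
  finally show ?thesis using K by (auto simp: de'_def)
 qed
qed

text \<open>Induction along the construction of integrable functions. For the indicator of
  \<open>A\<close> take \<open>K\<close> compact inside \<open>A\<close> and \<open>U\<close> open
  around it: shifts shorter than the distance from \<open>K\<close> to the complement of
  \<open>U\<close> change the indicator only on \<open>U - K\<close> and its translate. Sums and
  dominated limits then follow from the triangle inequality.\<close>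

lemma translation_continuous_L1:
 fixes f :: "'a::euclidean_space => real"
 assumes "integrable lborel f"
 shows "ALL e>0. EX d>0. ALL xi. norm xi < d --> (LINT z|lborel. abs (f (z + xi) - f z)) < e"
 using assms
proof (induction rule: integrable_induct)
 case (base A c)
 show ?case
 proof (intro allI impI)
  fix e :: real assume e: "e > 0"
  have A[measurable]: "A : sets borel" using base by simp
  \<comment> \<open>The estimate below costs \<open>4 * abs c * de\<close>: two copies of
    \<open>D\<close>, each of measure below \<open>2 * de\<close>. The 1 added to
    \<open>abs c\<close> covers \<open>c = 0\<close>.\<close>
  define de where "de = e / (8 * (abs c + 1))"
  have de: "de > 0" using e by (auto simp: de_def intro!: divide_pos_pos add_nonneg_pos)
  obtain U where U: "open U" "A \<subseteq> U" "U - A : lmeasurable" "emeasure lebesgue (U - A) < ennreal de"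
   using sets_lebesgue_outer_open[of A de] de A by auto
  obtain K where K: "compact K" "K \<subseteq> A" "emeasure lborel (A - K) < ennreal de"
   using lmeasurable_inner_compact[OF A _ de] base by auto
  define D where "D = U - K"
  have D[measurable]: "D : sets borel" using U K by (auto simp: D_def intro: borel_open borel_compact)
  have UK: "U : sets borel" "K : sets borel" using U K by (auto intro: borel_open borel_compact)
  have "emeasure lborel D = emeasure lebesgue ((U - A) Un (A - K))"
  proof -
   have "D = (U - A) Un (A - K)" using U(2) K(2) by (auto simp: D_def)
   thus ?thesis using D by simp
  qed
  also have "... <= emeasure lebesgue (U - A) + emeasure lebesgue (A - K)"
   using UK A by (intro emeasure_subadditive) auto
  also have "emeasure lebesgue (A - K) = emeasure lborel (A - K)"
   using A UK by auto
  also have "emeasure lebesgue (U - A) + emeasure lborel (A - K) < ennreal de + ennreal de" using U K by (intro add_strict_mono) auto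
  also have "... = ennreal (2 * de)" using de by (simp flip: ennreal_plus)
  finally have emD: "emeasure lborel D < ennreal (2 * de)" .
  have intD: "integrable lborel (ind D :: 'a => real)"
   using emD by (intro integrable_real_indicator) (auto intro: less_trans)
  have LD: "(LINT z|lborel. ind D z) < 2 * de"
   using emD de D by (cases "emeasure lborel D") (auto simp: measure_def ennreal_less_iff)
  obtain d where d: "d > 0" "!!x y. x : K ==> dist x y < d ==> y : U"
  proof (cases "U = UNIV")
   case True
   thus ?thesis using that[of 1] by auto
  next
   case False
   have "K Int (- U) = {}" using K U by auto
   from separate_compact_closed[OF K(1) _ this] U(1)
   obtain d where "d > 0" "ALL x:K. ALL y:- U. d <= dist x y" by auto
   thus ?thesis using that[of d] by force
  qed
  show "EX d>0. ALL xi. norm xi < d --> (LINT z|lborel. abs (ind A (z + xi) *. c - ind A z *. c)) < e"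
  proof (intro exI[of _ d] conjI allI impI d(1))
   fix xi :: 'a assume xi: "norm xi < d"
   have le: "abs (ind A (z + xi) *. c - ind A z *. c) <= abs c * (ind D z + ind D (z + xi))" for z
   proof -
    have 1: "z + xi : U" if "z : K" using d(2)[OF that, of "z + xi"] xi by (simp add: dist_norm)
    have 2: "z : U" if "z + xi : K" using d(2)[OF that, of z] xi by (simp add: dist_norm)
    show ?thesis
     using 1 2 K(2) U(2) by (auto simp: D_def indicator_def)
   qed
   have "(LINT z|lborel. abs (ind A (z + xi) *. c - ind A z *. c))
     <= (LINT z|lborel. abs c * (ind D z + ind D (z + xi)))"
   proof (rule integral_mono')
    show "integrable lborel (%z. abs c * (ind D z + ind D (z + xi)))"
     using intD lborel_integrable_shift[OF intD, of xi] by (intro integrable_mult_right lint_i_add)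
   qed (use le in auto)
   also have "... = abs c * (2 * (LINT z|lborel. ind D z))"
    using intD lborel_integrable_shift[OF intD, of xi] lborel_integral_shift[of "ind D :: 'a => real" xi]
    by (simp del: lint_indicator)
   also have "... <= abs c * (2 * (2 * de))"
    using LD by (intro mult_left_mono) auto
   also have "... < e"
   proof -
    have "(abs c + 1) * de = e / 8"
     using abs_ge_zero[of c] unfolding de_def by (simp add: field_simps)
    hence "abs c * (2 * (2 * de)) = e / 2 - 4 * de" by (simp add: algebra_simps)
    thus ?thesis using e de by simp
   qed
   finally show "(LINT z|lborel. abs (ind A (z + xi) *. c - ind A z *. c)) < e" .
  qed
 qed
next
 case (add f g)
 show ?case
 proof (intro allI impI)
  fix e :: real assume "e > 0"
  hence e2: "e / 2 > 0" by simp
  obtain d1 where d1: "d1 > 0" "!!xi. norm xi < d1 ==> (LINT z|lborel. abs (f (z + xi) - f z)) < e / 2"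
   using add.IH(1) e2 by blast
  obtain d2 where d2: "d2 > 0" "!!xi. norm xi < d2 ==> (LINT z|lborel. abs (g (z + xi) - g z)) < e / 2"
   using add.IH(2) e2 by blast
  show "EX d>0. ALL xi. norm xi < d --> (LINT z|lborel. abs (f (z + xi) + g (z + xi) - (f z + g z))) < e"
  proof (intro exI[of _ "min d1 d2"] conjI allI impI)
   fix xi :: 'a assume xi: "norm xi < min d1 d2"
   have i: "integrable lborel (%z. abs (f (z + xi) - f z))" "integrable lborel (%z. abs (g (z + xi) - g z))"
    using add.hyps lborel_integrable_shift by (auto intro!: integrable_abs lint_i_diff)
   have "(LINT z|lborel. abs (f (z + xi) + g (z + xi) - (f z + g z)))
     <= (LINT z|lborel. abs (f (z + xi) - f z) + abs (g (z + xi) - g z))"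
    using i by (intro integral_mono') auto
   also have "... < e / 2 + e / 2" using i d1(2)[of xi] d2(2)[of xi] xi by simp
   finally show "(LINT z|lborel. abs (f (z + xi) + g (z + xi) - (f z + g z))) < e" by simp
  qed (use d1 d2 in auto)
 qed
next
 case (lim f s)
 have "(%i. LINT z|lborel. abs (s i z - f z)) \<longlonglongrightarrow> integral\<^sup>L lborel (%_::'a. 0::real)"
 proof (rule integral_dominated_convergence[where w = "%z. 3 * norm (f z)" and f = "%_. 0" and s = "%i z. abs (s i z - f z)"])
  show "AE z in lborel. (%i. abs (s i z - f z)) \<longlonglongrightarrow> 0"
   using tendsto_rabs_zero[OF LIM_zero[OF lim.hyps(2)]] by simp
  show "AE z in lborel. norm \<bar>s i z - f z\<bar> <= 3 * norm (f z)" for i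
  proof (rule AE_I2)
   fix z :: 'a
   show "norm \<bar>s i z - f z\<bar> <= 3 * norm (f z)"
    using lim.hyps(3)[of z i] by auto
  qed
 qed (use lim.hyps in auto)
 hence L: "(%i. LINT z|lborel. abs (s i z - f z)) \<longlonglongrightarrow> 0" by simp
 show ?case
 proof (intro allI impI)
  fix e :: real assume "e > 0"
  hence e3: "e / 3 > 0" by simp
  obtain i where i: "(LINT z|lborel. abs (s i z - f z)) < e / 3"
   using order_tendstoD(2)[OF L e3] by (auto simp: eventually_sequentially)
  obtain d where d: "d > 0" "!!xi. norm xi < d ==> (LINT z|lborel. abs (s i (z + xi) - s i z)) < e / 3"
   using lim.IH e3 by blast
  show "EX d>0. ALL xi. norm xi < d --> (LINT z|lborel. abs (f (z + xi) - f z)) < e"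
  proof (intro exI[of _ d] conjI allI impI d(1))
   fix xi :: 'a assume xi: "norm xi < d"
   have i1: "integrable lborel (%z. abs (s i z - f z))"
    using lim.hyps by (auto intro!: integrable_abs lint_i_diff)
   have i2: "integrable lborel (%z. abs (s i (z + xi) - f (z + xi)))"
    using lborel_integrable_shift[OF i1] .
   have i3: "integrable lborel (%z. abs (s i (z + xi) - s i z))"
    using lim.hyps(1) lborel_integrable_shift[OF lim.hyps(1)]
    by (intro integrable_abs lint_i_diff)
   have "(LINT z|lborel. abs (f (z + xi) - f z))
    <= (LINT z|lborel. (abs (s i (z + xi) - f (z + xi)) + abs (s i (z + xi) - s i z)) + abs (s i z - f z))"
    using i1 i2 i3 by (intro integral_mono') auto
   also have "... = (LINT z|lborel. abs (s i (z + xi) - f (z + xi))) + (LINT z|lborel. abs (s i (z + xi) - s i z))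
     + (LINT z|lborel. abs (s i z - f z))"
    using i1 i2 i3 by simp
   also have "(LINT z|lborel. abs (s i (z + xi) - f (z + xi))) = (LINT z|lborel. abs (s i z - f z))"
    using lborel_integral_shift[of "%z. abs (s i z - f z)" xi] i1 by (auto dest: borel_measurable_integrable)
   also have "(LINT z|lborel. abs (s i z - f z)) + (LINT z|lborel. abs (s i (z + xi) - s i z)) + (LINT z|lborel. abs (s i z - f z)) < e"
    using i d(2)[OF xi] by simp
   finally show "(LINT z|lborel. abs (f (z + xi) - f z)) < e" .
  qed
 qed
qed

section \<open>Doubling of variables\<close>

lemma kernel_integral_measurable:
 fixes f :: "'a => 'b => real"
 assumes f[measurable]: "(%(x, y). f x y) : bmeas (M <x> N)"
  and K[measurable]: "K : M -M> prob_algebra N"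
 shows "(%x. LINT y|K x. f x y) : bmeas M"
proof -
 \<comment> \<open>Carrying the point \<open>x\<close> along turns the parameter-dependent integrand
   into one fixed function on \<open>M <x> N\<close>.\<close>
 have "(%x. distr (K x) (M <x> N) (%y. (x, y))) : M -M> prob_algebra (M <x> N)"
  by measurable
 from measurable_compose[OF measurable_prob_algebraD[OF this] integral_measurable_subprob_algebra[OF f]]
 show ?thesis
 proof (rule measurable_cong[THEN iffD1, rotated])
  fix x assume x: "x : space M"
  have [measurable_cong]: "sets (K x) = sets N"
   using measurable_space[OF K x] by (simp add: space_prob_algebra)
  show "(LINT y|distr (K x) (M <x> N) (%y. (x, y)). (case y of (x, y) => f x y)) = (LINT y|K x. f x y)"
   using x by (subst integral_distr) auto
 qed
qed

lemma integral_abs_le: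
 fixes f g :: "'a => real"
 assumes "integrable M g" "!!x. x : space M ==> abs (f x) <= g x"
 shows "abs (LINT x|M. f x) <= (LINT x|M. g x)"
proof -
 have "abs (LINT x|M. f x) <= (LINT x|M. abs (f x))" by (rule integral_abs_bound)
 also have "... <= (LINT x|M. g x)"
  by (rule integral_mono'[OF assms(1)]) (use assms(2) abs_ge_zero order_trans in blast)+
 finally show ?thesis .
qed

lemma kernel_prob_space:
 assumes "K : M -M> prob_algebra N" "x : space M"
 shows "prob_space (K x)" "sets (K x) = sets N"
 using measurable_space[OF assms] by (auto simp: space_prob_algebra)

lemma kernel_prob_space_borel:
 assumes "K : borel -M> prob_algebra borel"
 shows "prob_space (K x)" "sets (K x) = sets borel"
 using kernel_prob_space[OF assms, of x] by auto

text \<open>The Young measure over \<open>B\<close> as one probability measure on pairs (z, u). The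
  normalisation makes products of two such measures, and Fubini for them, available; the integrands
  used with it vanish off \<open>B\<close>, so the price is a division by
  \<open>measure lborel B\<close>.\<close>

definition skew_product :: "'e::euclidean_space set => ('e => real measure) => ('e * real) measure" where
 "skew_product B nv = uniform_measure lborel B \<bind> (%z. distr (nv z) borel2 (Pair z))"

context
 fixes B :: "'e::euclidean_space set" and nv :: "'e => real measure"
 assumes B[measurable]: "B : sets borel" and B0: "emeasure lborel B ~= 0" and Bf: "emeasure lborel B ~= \<infinity>"
  and nu[measurable]: "nv : borel -M> prob_algebra borel"
begin

lemma skew_kernel: "(%z. distr (nv z) borel2 (Pair z)) : borel -M> prob_algebra borel2"
 by (rule measurable_distr_prob_space2[where M = borel]) (auto intro: nu)

lemma skew_product_sets: "sets (skew_product B nv) = sets borel2"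
 unfolding skew_product_def
 by (rule sets_bind[OF kernel_prob_space(2)[OF skew_kernel]]) auto

lemma prob_space_skew_product: "prob_space (skew_product B nv)"
proof -
 interpret prob_space "uniform_measure lborel B"
  by (rule prob_space_uniform_measure[OF B0 Bf])
 show ?thesis
  unfolding skew_product_def
  by (rule prob_space_bind[where S = "borel <x> borel"])
   (use kernel_prob_space[OF skew_kernel] measurable_prob_algebraD[OF skew_kernel]
    in \<open>auto simp: meas_cong_sets[of "uniform_measure lborel B" borel]\<close>)
qed

lemma uniform_integral:
 fixes f :: "'e => real"
 assumes [measurable]: "f : bmeas borel" and "!!z. z ~: B ==> f z = 0"
 shows "(LINT z|uniform_measure lborel B. f z) = (LINT z|lborel. f z) / measure lborel B"
proof -
 have m: "emeasure lborel B = ennreal (measure lborel B)" "measure lborel B > 0"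
  using B0 Bf by (auto simp: emeasure_eq_ennreal_measure zero_less_measure_iff)
 have "uniform_measure lborel B = density lborel (%z. ennreal (ind B z / measure lborel B))"
  unfolding uniform_measure_def
  by (rule density_cong) (use m in \<open>auto simp: indicator_def divide_ennreal[symmetric] ennreal_1[symmetric] simp del: ennreal_1\<close>)
 hence "(LINT z|uniform_measure lborel B. f z) = (LINT z|lborel. (ind B z / measure lborel B) *. f z)"
  using m by (simp add: integral_density)
 also have "... = (LINT z|lborel. f z / measure lborel B)"
  using assms(2) by (intro lint_cong) (auto simp: indicator_def)
 finally show ?thesis by simp
qed

lemma skew_integral:
 fixes f :: "'e * real => real"
 assumes f[measurable]: "f : bmeas borel2" and b: "!!x. abs (f x) <= C"
  and out: "!!z u. z ~: B ==> f (z, u) = 0"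
 shows "(LINT x|skew_product B nv. f x) = (LINT z|lborel. LINT u|nv z. f (z, u)) / measure lborel B"
proof -
 have sc: "measurable (uniform_measure lborel B) N = measurable borel N" for N :: "'x measure"
  by (rule meas_cong_sets) auto
 have "(LINT x|skew_product B nv. f x)
  = (LINT z|uniform_measure lborel B. LINT x|distr (nv z) borel2 (Pair z). f x)"
  unfolding skew_product_def
 proof (rule integral_bind[where K = "borel <x> borel" and B = C and B' = 1])
  show "(%z. distr (nv z) borel2 (Pair z)) : uniform_measure lborel B -M> subprob_algebra borel2"
   using measurable_prob_algebraD[OF skew_kernel] by (simp add: meas_cong_sets[of "uniform_measure lborel B" borel])
  show "finite_measure (uniform_measure lborel B)"
   using prob_space_uniform_measure[OF B0 Bf] by (simp add: prob_space_def)
  show "AE x in uniform_measure lborel B. emeasure (distr (nv x) borel2 (Pair x))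
    (space (distr (nv x) borel2 (Pair x))) <= ennreal 1"
   using prob_space.emeasure_space_1[OF kernel_prob_space(1)[OF skew_kernel]] by simp
 qed (use b in auto)
 also have "(%z. LINT x|distr (nv z) borel2 (Pair z). f x) = (%z. LINT u|nv z. f (z, u))"
 proof
  fix z
  have [measurable_cong]: "sets (nv z) = sets borel" by (rule kernel_prob_space_borel(2)[OF nu])
  show "(LINT x|distr (nv z) borel2 (Pair z). f x) = (LINT u|nv z. f (z, u))"
   by (subst integral_distr) auto
 qed
 also have "(LINT z|uniform_measure lborel B. LINT u|nv z. f (z, u))
   = (LINT z|lborel. LINT u|nv z. f (z, u)) / measure lborel B"
  by (rule uniform_integral) (use out in \<open>auto intro!: kernel_integral_measurable[OF _ nu]\<close>)
 finally show ?thesis .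
qed

lemma skew_AE:
 assumes [measurable]: "Measurable.pred borel P" and "!!z. AE u in nv z. P u"
 shows "AE x in skew_product B nv. P (snd x)"
 unfolding skew_product_def
proof (subst AE_bind[where B = "borel <x> borel"])
 show "(%z. distr (nv z) borel2 (Pair z)) : uniform_measure lborel B -M> subprob_algebra borel2"
  using measurable_prob_algebraD[OF skew_kernel] by (simp add: meas_cong_sets[of "uniform_measure lborel B" borel])
 have "AE y in distr (nv x) borel2 (Pair x). P (snd y)" for x
 proof -
  have [measurable_cong]: "sets (nv x) = sets borel" by (rule kernel_prob_space_borel(2)[OF nu])
  show ?thesis using assms(2) by (subst AE_distr_iff) auto
 qed
 thus "AE x in uniform_measure lborel B. AE y in distr (nv x) borel2 (Pair x). P (snd y)"
  by simp
qed measurable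

end

lemma lborel_Fubini_bounded:
 fixes F :: "'a::euclidean_space * 'b::euclidean_space => real"
 assumes F[measurable]: "F : bmeas borel2"
  and b: "!!p. abs (F p) <= C" and K: "bounded K" "!!p. p ~: K ==> F p = 0"
 shows "integrable lborel F"
  and "(LINT x|lborel. LINT y|lborel. F (x, y)) = (LINT p|lborel. F p)"
  and "(LINT y|lborel. LINT x|lborel. F (x, y)) = (LINT p|lborel. F p)"
  and "integrable lborel (%x. LINT y|lborel. F (x, y))"
proof -
 show i: "integrable lborel F"
  by (rule i_bsupp[where C = C and K = K]) (use F b K in \<open>auto simp: borel_prod\<close>)
 hence i': "integrable (lborel <x> lborel) F" by (simp add: lborel_prod)
 show 1: "(LINT x|lborel. LINT y|lborel. F (x, y)) = (LINT p|lborel. F p)"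
  using lborel_pair.integral_fst'[OF i'] by (simp add: lborel_prod)
 show "(LINT y|lborel. LINT x|lborel. F (x, y)) = (LINT p|lborel. F p)"
  using lborel_pair.Fubini_integral[of "%x y. F (x, y)"] i' 1 by simp
 show "integrable lborel (%x. LINT y|lborel. F (x, y))"
  using lborel_pair.integrable_fst'[OF i'] .
qed

lemma average_integrand:
 fixes G :: "'e::euclidean_space * real => real"
 assumes G[measurable]: "G : bmeas borel2"
  and b: "!!p. abs (G p) <= C" and out: "!!p. p ~: cball 0 s \<times> cball 0 R ==> G p = 0" and ep: "0 < ep"
 shows "integrable lborel (%w. LINT z|lborel. ind (cball (fst w) ep) z * abs (G (z, snd w) - G w))"
  and "integrable lborel (%z. ind (cball (fst w) ep) z * abs (G (z, snd w) - G w))"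
proof -
 have C: "C >= 0" using b[of undefined] by simp
 define F where "F p = (if norm (snd p - fst (fst p)) <= ep then abs (G (snd p, snd (fst p)) - G (fst p)) else 0)" for p
 have Fm: "F : bmeas borel2"
  unfolding F_def borel_prod[symmetric] by measurable
 have F_eq: "F (w, z) = ind (cball (fst w) ep) z * abs (G (z, snd w) - G w)" for w z
  by (simp add: F_def indicator_def dist_norm norm_minus_commute)
 have Fb: "abs (F p) <= 2 * C" for p
  using b[of "(snd p, snd (fst p))"] b[of "fst p"] C unfolding F_def by auto
 have Fout: "F p = 0" if "p ~: (cball 0 (s + ep) \<times> cball 0 R) \<times> cball 0 (s + ep)" for p
 proof (rule ccontr)
  assume F0: "F p ~= 0"
  obtain z' r z where p: "p = ((z', r), z)" by (metis surj_pair)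
  have n: "norm (z - z') <= ep" using F0 by (auto simp: F_def p split: if_splits)
  have "G (z, r) ~= 0 \<or> G (z', r) ~= 0" using F0 by (auto simp: F_def p split: if_splits)
  hence "(z, r) : cball 0 s \<times> cball 0 R \<or> (z', r) : cball 0 s \<times> cball 0 R" using out by blast
  moreover have "norm z <= norm z' + ep" "norm z' <= norm z + ep"
   using n norm_triangle_sub[of z z'] norm_triangle_sub[of z' z] by (auto simp: norm_minus_commute)
  ultimately show False using that ep by (auto simp: p)
 qed
 have bd: "bounded ((cball (0::'e) (s + ep) \<times> cball (0::real) R) \<times> cball (0::'e) (s + ep))"
  by (intro bounded_Times bounded_cball)
 show "integrable lborel (%w. LINT z|lborel. ind (cball (fst w) ep) z * abs (G (z, snd w) - G w))"
  using lborel_Fubini_bounded(4)[OF Fm Fb bd Fout] by (simp add: F_eq)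
 have "integrable lborel (%z. F (w, z))"
 proof (rule i_bsupp[where C = "2 * C" and K = "cball (fst w) ep"])
  show "(%z. F (w, z)) : bmeas borel" using measurable_compose[OF _ Fm, of "%z. (w, z)" borel] by simp
  show "norm (F (w, z)) <= 2 * C" for z using Fb[of "(w, z)"] by simp
  show "z ~: cball (fst w) ep ==> F (w, z) = 0" for z by (simp add: F_eq)
 qed simp
 thus "integrable lborel (%z. ind (cball (fst w) ep) z * abs (G (z, snd w) - G w))" by (simp add: F_eq)
qed

text \<open>Only the first coordinate is shifted. With \<open>z = fst w + xi\<close> and the
  integrals exchanged, L1 continuity of translations is integrated over the shifts
  \<open>(xi, 0)\<close> of a ball, whose volume is the unit ball volume \<open>ka\<close> times
  \<open>ep ^ DIM('e)\<close>. A kernel of size \<open>ep^-n\<close> then leaves an error of order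
  \<open>e\<close>.\<close>

lemma average_translation_L1:
 fixes G :: "'e::euclidean_space * real => real"
 assumes G[measurable]: "G : bmeas borel2"
  and b: "!!p. abs (G p) <= C" and K: "bounded K" "!!p. p ~: K ==> G p = 0" and e: "e > 0"
 shows "EX d>0. ALL ep. 0 < ep --> ep < d -->
  (LINT w|lborel. LINT z|lborel. ind (cball (fst w) ep) z * abs (G (z, snd w) - G w)) <= e * ep ^ DIM('e)"
proof -
 have G'[measurable]: "G : bmeas borel" using G by (simp add: borel_prod)
 have intG: "integrable lborel G" by (rule i_bsupp[OF G' _ K, where C = C]) (use b in auto)
 define ka where "ka = unit_ball_vol (real DIM('e))"
 have ka: "ka > 0" by (simp add: ka_def)
 obtain d where d: "d > 0" "!!xi. norm xi < d ==> (LINT w|lborel. abs (G (w + xi) - G w)) < e / ka"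
  using translation_continuous_L1[OF intG] e ka by (meson divide_pos_pos)
 have C: "C >= 0" using b[of undefined] by simp
 show ?thesis
 proof (intro exI[of _ d] conjI allI impI d(1))
  fix ep :: real assume ep: "0 < ep" "ep < d"
  define F where "F = (%(w, xi). ind (cball 0 ep) xi * abs (G (w + (xi, 0)) - G w))"
  have Fm: "F : bmeas borel2"
  proof -
   have "(%p::('e * real) * 'e. ind (cball 0 ep) (snd p) * abs (G (fst p + (snd p, 0)) - G (fst p))) : bmeas borel"
    by (intro borel_measurable_times borel_measurable_abs borel_measurable_diff measurable_compose[OF _ G']
      measurable_compose[OF _ borel_measurable_indicator[of "cball 0 ep" borel]]
      bmeas_contI continuous_intros) auto
   thus ?thesis by (simp add: F_def borel_prod case_prod_beta')
  qed
  obtain s where s: "K \<subseteq> cball 0 s" using bounded_subset_ballD[OF K(1), of 0] ball_subset_cball by blast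
  have Fout: "F p = 0" if "p ~: cball 0 (s + ep) \<times> cball 0 ep" for p
  proof (cases p)
   case (Pair w xi)
   show ?thesis
   proof (cases "xi : cball 0 ep")
    case True
    hence "norm w > s + ep" using that Pair by auto
    moreover have "norm (xi, 0::real) <= ep" using True by (simp add: norm_Pair)
    ultimately have "w ~: cball 0 s" "w + (xi, 0) ~: cball 0 s"
     using ep norm_triangle_ineq4[of "w + (xi, 0)" "(xi, 0)"] by auto
    hence "G w = 0" "G (w + (xi, 0)) = 0" using s K(2) by blast+
    thus ?thesis by (simp add: F_def Pair)
   qed (simp add: F_def Pair)
  qed
  have Fb: "abs (F p) <= 2 * C" for p
  proof (cases p)
   case (Pair w xi)
   show ?thesis using b[of w] b[of "w + (xi, 0)"] C by (auto simp: F_def Pair indicator_def)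
  qed
  have bd: "bounded (cball (0::'e * real) (s + ep) \<times> cball (0::'e) ep)"
   by (intro bounded_Times bounded_cball)
  note Fub = lborel_Fubini_bounded[OF Fm Fb bd Fout]
  have "(LINT z|lborel. ind (cball (fst w) ep) z * abs (G (z, snd w) - G w)) = (LINT xi|lborel. F (w, xi))" for w
  proof -
   have "(LINT xi|lborel. F (w, xi))
    = (LINT xi|lborel. ind (cball (fst w) ep) (xi + fst w) * abs (G (xi + fst w, snd w) - G w))"
   proof (intro lint_cong refl)
    fix xi :: 'e
    have "w + (xi, 0) = (xi + fst w, snd w)" by (simp add: prod_eq_iff add.commute)
    thus "F (w, xi) = ind (cball (fst w) ep) (xi + fst w) * abs (G (xi + fst w, snd w) - G w)"
     by (simp add: F_def indicator_def dist_norm)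
   qed
   also have "... = (LINT z|lborel. ind (cball (fst w) ep) z * abs (G (z, snd w) - G w))"
    by (rule lborel_integral_shift)
     (intro borel_measurable_times borel_measurable_abs borel_measurable_diff measurable_compose[OF _ G']
      borel_measurable_indicator borel_measurable_const bmeas_contI continuous_intros; simp)
   finally show ?thesis by simp
  qed
  hence "(LINT w|lborel. LINT z|lborel. ind (cball (fst w) ep) z * abs (G (z, snd w) - G w))
   = (LINT xi|lborel. LINT w|lborel. F (w, xi))"
   using Fub by simp
  also have "... <= (LINT xi|lborel. (e / ka) * ind (cball (0::'e) ep) xi)"
  proof (rule integral_mono')
   show "integrable lborel (%xi. (e / ka) * ind (cball (0::'e) ep) xi)"
    by (intro integrable_mult_right integrable_real_indicator)
     (auto intro: emeasure_lborel_cball_finite simp del: infinity_ennreal_def)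
   fix xi :: 'e
   show "(LINT w|lborel. F (w, xi)) <= (e / ka) * ind (cball (0::'e) ep) xi"
   proof (cases "xi : cball 0 ep")
    case True
    hence "(LINT w|lborel. F (w, xi)) = (LINT w|lborel. abs (G (w + (xi, 0)) - G w))"
     by (simp add: F_def)
    also have "... < e / ka" using True ep by (intro d(2)) (simp add: norm_Pair)
    finally show ?thesis using True by simp
   qed (simp add: F_def)
   show "0 <= (e / ka) * ind (cball (0::'e) ep) xi" using e ka by simp
  qed
  also have "... = (e / ka) * (ka * ep ^ DIM('e))"
   using ep by (simp add: content_cball ka_def)
  also have "... = e * ep ^ DIM('e)" using ka by simp
  finally show "(LINT w|lborel. LINT z|lborel. ind (cball (fst w) ep) z * abs (G (z, snd w) - G w))
   <= e * ep ^ DIM('e)" .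
 qed
qed


lemma lborel_integral_reflect:
 fixes f :: "'a::euclidean_space => real"
 assumes [measurable]: "f : bmeas borel"
 shows "(LINT z|lborel. f (c - z)) = (LINT z|lborel. f z)"
proof -
 have "lborel = distr lborel borel ((-) c)"
  using lborel_affine[of "-1" c] by (simp add: density_1)
 hence "(LINT z|lborel. f z) = (LINT z|distr lborel borel ((-) c). f z)" by simp
 also have "... = (LINT z|lborel. f (c - z))" by (rule integral_distr) auto
 finally show ?thesis by simp
qed

lemma has_grad_shift:
 assumes "has_grad f df UNIV"
 shows "has_grad (%z. f (z - c)) (%z. df (z - c)) UNIV"
 unfolding has_grad_def
proof (intro conjI ballI)
 fix z
 have "((%z. z - c) has_derivative (%h. h)) (at z)" by (auto intro!: derivative_eq_intros)
 from diff_chain_at[OF this has_gradD[OF assms UNIV_I]]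
 show "((%z. f (z - c)) has_derivative (.*) (df (z - c))) (at z)" by (simp add: o_def)
qed (intro continuous_intros cont_comp2[OF has_grad_continuous_grad[OF assms]] subset_UNIV)

lemma has_grad_reflect:
 assumes "has_grad f df UNIV"
 shows "has_grad (%z. f (c - z)) (%z. - df (c - z)) UNIV"
 unfolding has_grad_def
proof (intro conjI ballI)
 fix z
 have "((%z. c - z) has_derivative (%h. - h)) (at z)" by (auto intro!: derivative_eq_intros)
 from diff_chain_at[OF this has_gradD[OF assms UNIV_I]]
 have "((%z. f (c - z)) has_derivative (%h. df (c - z) .* (- h))) (at z)" by (simp only: o_def)
 moreover have "(.*) (- df (c - z)) = (%h. df (c - z) .* (- h))" by auto
 ultimately show "((%z. f (c - z)) has_derivative (.*) (- df (c - z))) (at z)" by (simp only:)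
qed (intro continuous_intros cont_comp2[OF has_grad_continuous_grad[OF assms]] subset_UNIV)

text \<open>
 Kruzhkov's inequalities for two Young measures \<open>nv\<close> and \<open>sig\<close>, written with the kinetic speed
 \<open>a(z, r) = \<partial>\<^sub>r A(z, r)\<close> of a flux \<open>A\<close> whose divergence at fixed \<open>r\<close> is \<open>b\<close>; so \<open>be\<close> is the
 divergence of \<open>a\<close>. Time is one of the coordinates of \<open>z\<close>.
\<close>

locale kinetic_pair =
 fixes nv sig :: "'e::euclidean_space => real measure" and a :: "'e => real => 'e"
  and be b :: "'e => real => real" and OM :: "'e set" and R L :: real
 assumes nu[measurable]: "nv : borel -M> prob_algebra borel"
  and sg[measurable]: "sig : borel -M> prob_algebra borel"
  and nu_supp: "!!z. AE u in nv z. abs u < R" and sg_supp: "!!z. AE u in sig z. abs u < R"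
  and L: "0 <= L"
  and a_meas[measurable]: "(%(z, r). a z r) : bmeas borel2"
  and a_bound: "!!z r. norm (a z r) <= L"
  and a_lip: "!!z z' r. norm (a z r - a z' r) <= L * norm (z - z')"
  and a_out: "!!z r. abs r > R ==> a z r = 0"
  and be_meas[measurable]: "(%(z, r). be z r) : bmeas borel2"
  and be_bound: "!!z r. abs (be z r) <= L"
  and be_out: "!!z r. abs r > R ==> be z r = 0"
  and b_meas[measurable]: "(%(z, r). b z r) : bmeas borel2"
  and b_bound: "!!z r. abs (b z r) <= L"
  and b_unif: "!!e. e > 0 ==> EX d>0. ALL z z' u. norm (z - z') < d --> abs (b z u - b z' u) < e"
  and b_diff: "!!z u v. v <= u ==> b z u - b z v = (LINT r|lborel. (if v <= r & r < u then be z r else 0))"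
  and div: "!!ph dph K r. has_grad ph dph UNIV ==> compact K ==> (!!z. z ~: K ==> ph z = 0) ==>
    (LINT z|lborel. ph z * be z r + a z r .* dph z) = 0"
  and open_Omega: "open OM"
  and nu_ineq: "!!c ph dph K. abs c <= R ==> has_grad ph dph UNIV ==> (!!z. 0 <= ph z) ==>
    compact K ==> K \<subseteq> OM ==> (!!z. z ~: K ==> ph z = 0) ==>
    0 <= (LINT z|lborel. LINT u|nv z.
     (LINT r|lborel. (if c <= r & r < u then a z r .* dph z else 0)) - (if c < u then ph z * b z c else 0))"
  and sg_ineq: "!!c ph dph K. abs c <= R ==> has_grad ph dph UNIV ==> (!!z. 0 <= ph z) ==>
    compact K ==> K \<subseteq> OM ==> (!!z. z ~: K ==> ph z = 0) ==>
    0 <= (LINT z|lborel. LINT v|sig z.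
     (LINT r|lborel. (if v <= r & r < c then a z r .* dph z else 0)) + (if v <= c then ph z * b z c else 0))"
begin

text \<open>For \<open>v <= u\<close> this is the flux difference
  \<open>(A z u - A z v) .* e\<close>, where \<open>a\<close> is the derivative of \<open>A\<close>
  in the state; for \<open>u < v\<close> it is 0. It is Kruzhkov's entropy flux in kinetic
  form.\<close>

definition I :: "'e => 'e => real => real => real" where
 "I z e v u = (LINT r|lborel. (if v <= r & r < u then a z r .* e else 0))"

lemma R_nonneg: "0 <= R"
proof (rule ccontr)
 assume "\<not> 0 <= R"
 hence "AE u in nv 0. False" using nu_supp[of 0] by (auto elim!: eventually_mono)
 thus False
  using prob_space.AE_False[OF kernel_prob_space_borel(1)[OF nu, of 0]] by simp
qed

lemma a_section[measurable]: "a z : bmeas borel"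
 using measurable_compose[OF _ a_meas, of "%r. (z, r)" borel] by simp

lemma be_section[measurable]: "be z : bmeas borel"
 using measurable_compose[OF _ be_meas, of "%r. (z, r)" borel] by simp

lemma integrable_clip:
 fixes f :: "real => real"
 assumes [measurable]: "f : bmeas borel"
  and "!!r. abs (f r) <= C" "!!r. abs r > R ==> f r = 0"
 shows "integrable lborel (%r. if v <= r & r < u then f r else 0)"
proof (rule i_bsupp[where C = C and K = "cball 0 R"])
 have "0 <= C" using assms(2)[of 0] by linarith
 thus "norm (if v <= r & r < u then f r else 0) <= C" for r using assms(2)[of r] by auto
 show "r ~: cball 0 R ==> (if v <= r & r < u then f r else 0) = 0" for r using assms(3)[of r] by auto
qed auto

lemma a_inner_bound: "abs (a z r .* e) <= L * norm e"
 using Cauchy_Schwarz_ineq2[of "a z r" e] mult_right_mono[OF a_bound[of z r], of "norm e"] by simp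

lemma I_integrable: "integrable lborel (%r. if v <= r & r < u then a z r .* e else 0)"
 by (rule integrable_clip[where C = "L * norm e"]) (auto simp: a_out a_inner_bound)

text \<open>The second bound makes the flux difference and \<open>b\<close> Lipschitz in the level,
  which is what lets levels converge in \<open>nu_ineq_closed\<close>.\<close>

lemma clip_bound:
 fixes f :: "real => real"
 assumes [measurable]: "f : bmeas borel"
  and f: "!!r. abs (f r) <= C" "!!r. abs r > R ==> f r = 0"
 shows "abs (LINT r|lborel. (if v <= r & r < u then f r else 0)) <= 2 * R * C"
  and "v <= u ==> abs (LINT r|lborel. (if v <= r & r < u then f r else 0)) <= (u - v) * C"
proof -
 have C: "0 <= C" using f(1)[of 0] by linarith
 have "abs (LINT r|lborel. (if v <= r & r < u then f r else 0)) <= (LINT r|lborel. C * ind {-R..R} r)"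
 proof (rule integral_abs_le)
  show "integrable lborel (%r. C * ind {-R..R} r)"
   by (intro integrable_mult_right integrable_real_indicator) (auto simp: emeasure_lborel_Icc_eq)
  show "abs (if v <= r & r < u then f r else 0) <= C * ind {-R..R} r" for r
   using f(1)[of r] f(2)[of r] C by (cases "abs r > R") (auto simp: indicator_def)
 qed
 also have "... = 2 * R * C" using R_nonneg by simp
 finally show "abs (LINT r|lborel. (if v <= r & r < u then f r else 0)) <= 2 * R * C" .
 assume vu: "v <= u"
 have "abs (LINT r|lborel. (if v <= r & r < u then f r else 0)) <= (LINT r|lborel. C * ind {v..u} r)"
 proof (rule integral_abs_le)
  show "integrable lborel (%r. C * ind {v..u} r)"
   by (intro integrable_mult_right integrable_real_indicator) (auto simp: emeasure_lborel_Icc_eq)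
  show "abs (if v <= r & r < u then f r else 0) <= C * ind {v..u} r" for r
   using f(1)[of r] C by (auto simp: indicator_def)
 qed
 also have "... = (u - v) * C" using vu by simp
 finally show "abs (LINT r|lborel. (if v <= r & r < u then f r else 0)) <= (u - v) * C" .
qed

lemma I_bound: "abs (I z e v u) <= 2 * R * L * norm e"
 unfolding I_def using clip_bound(1)[of "%r. a z r .* e" "L * norm e" v u] a_inner_bound a_out
 by (simp add: mult.assoc)

lemma I_zero[simp]: "I z 0 v u = 0"
 by (simp add: I_def cong: if_cong)

lemma I_empty: "u <= v ==> I z e v u = 0"
 unfolding I_def by (subst lint_cong[of lborel lborel _ "%_. 0"]) auto

lemma I_measurable[measurable (raw)]:
 assumes [measurable]: "f : M -M> borel" "g : M -M> borel" "h : bmeas M" "k : bmeas M"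
 shows "(%x. I (f x) (g x) (h x) (k x)) : bmeas M"
proof -
 have [measurable]: "(%p. a (f (fst p)) (snd p)) : bmeas (M <x> lborel)"
  using measurable_compose[OF _ a_meas, of "%p. (f (fst p), snd p)" "M <x> lborel"] by simp
 show ?thesis
  unfolding I_def by measurable
qed

lemma I_left_diff:
 assumes "v' <= v"
 shows "abs (I z e v' u - I z e v u) <= (v - v') * (L * norm e)"
proof -
 have "I z e v' u - I z e v u = (LINT r|lborel. (if v' <= r & r < min v u then a z r .* e else 0))"
  unfolding I_def
  by (subst lint_diff[symmetric, OF I_integrable I_integrable])
   (use assms in \<open>auto intro!: lint_cong\<close>)
 also have "abs ... <= (v - v') * (L * norm e)"
 proof (cases "v' <= min v u")
  case True
  have "abs (LINT r|lborel. (if v' <= r & r < min v u then a z r .* e else 0)) <= (min v u - v') * (L * norm e)"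
   by (rule clip_bound(2)[OF _ _ _ True]) (auto simp: a_inner_bound a_out)
  also have "... <= (v - v') * (L * norm e)" using L by (intro mult_right_mono) auto
  finally show ?thesis .
 next
  case False
  hence "(%r. if v' <= r & r < min v u then a z r .* e else 0) = (%_. 0)" by (auto simp: fun_eq_iff)
  thus ?thesis using assms L by simp
 qed
 finally show ?thesis .
qed

lemma b_left_diff:
 assumes "v' <= v"
 shows "abs (b z v - b z v') <= (v - v') * L"
 unfolding b_diff[OF assms] by (rule clip_bound(2)[OF _ _ _ assms]) (auto simp: be_bound be_out)

text \<open>Letting \<open>c\<close> increase to its limit turns the strict inequality \<open>c < u\<close> into \<open>c <= u\<close>, so that the
 contributions of the diagonal match in the doubling of variables.\<close>

lemma nu_ineq_closed:
 assumes c: "abs c < R" and ph: "has_grad ph dph UNIV" "!!z. 0 <= ph z"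
  and K: "compact K" "K \<subseteq> OM" "!!z. z ~: K ==> ph z = 0"
 shows "0 <= (LINT z|lborel. LINT u|nv z. I z (dph z) c u - (if c <= u then ph z * b z c else 0))"
proof -
 \<comment> \<open>A convex combination of \<open>c\<close> and \<open>- R\<close>, so it never
   leaves the range in which the inequality is available; it stays strictly below \<open>c\<close>
   because \<open>R + c > 0\<close>.\<close>
 define cn where "cn n = c - (R + c) * inverse (real (Suc n))" for n
 have pos: "R + c > 0" using c by auto
 have cn_lt: "cn n < c" for n using pos by (auto simp: cn_def)
 have cn_R: "abs (cn n) <= R" for n
 proof -
  define x where "x = (R + c) * inverse (real (Suc n))"
  have "x <= (R + c) * 1"
   unfolding x_def using pos by (intro mult_left_mono) (auto simp: field_simps)
  moreover have "cn n = c - x" by (simp add: cn_def x_def)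
  ultimately show ?thesis using cn_lt[of n] c by (auto simp: abs_le_iff)
 qed
 have cn_lim: "cn \<longlonglongrightarrow> c"
  using tendsto_diff[OF tendsto_const tendsto_mult[OF tendsto_const LIMSEQ_inverse_real_of_nat], of c "R + c"]
  by (simp add: cn_def[abs_def])
 have cph: "continuous_on UNIV ph" and cdph: "continuous_on UNIV dph"
  using ph by (auto simp: has_grad_def intro: has_grad_continuous[OF ph(1)])
 have [measurable]: "ph : bmeas borel" "dph : bmeas borel"
  using cph cdph by (auto intro: bmeas_contI)
 have dph0: "dph z = 0" if "z ~: K" for z
  using has_grad_zero_outside[OF ph(1) compact_imp_closed[OF K(1)] K(3) that] .
 obtain C0 where C0: "C0 >= 0" "!!z. norm (ph z) <= C0"
  using bounded_of_compact_support[OF cph K(1) K(3)] by blast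
 obtain C1 where C1: "C1 >= 0" "!!z. norm (dph z) <= C1"
  using bounded_of_compact_support[OF cdph K(1) dph0] by blast
 define C where "C = 2 * R * L * C1 + C0 * L"
 have Cb: "abs (I z (dph z) v u - (if Q then ph z * b z v else 0)) <= C" for z v u Q
 proof -
  have "abs (I z (dph z) v u) <= 2 * R * L * norm (dph z)" by (rule I_bound)
  also have "... <= 2 * R * L * C1" using R_nonneg L C1 by (intro mult_left_mono) auto
  finally have 1: "abs (I z (dph z) v u) <= 2 * R * L * C1" .
  have "abs (ph z * b z v) <= C0 * L"
   unfolding abs_mult using C0 b_bound[of z v] by (intro mult_mono) auto
  hence "abs (if Q then ph z * b z v else 0) <= C0 * L" using C0 L by auto
  with 1 show ?thesis unfolding C_def by linarith
 qed
 define F where "F n z u = I z (dph z) (cn n) u - (if cn n < u then ph z * b z (cn n) else 0)" for n z u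
 define F' where "F' z u = I z (dph z) c u - (if c <= u then ph z * b z c else 0)" for z u
 have Fm[measurable]: "(%(z, u). F n z u) : bmeas borel2" for n
  unfolding F_def by measurable
 have F'm[measurable]: "(%(z, u). F' z u) : bmeas borel2"
  unfolding F'_def by measurable
 have lim: "(%n. F n z u) \<longlonglongrightarrow> F' z u" for z u
 proof -
  have bl: "(%n. b z (cn n)) \<longlonglongrightarrow> b z c"
  proof (rule Lim_null_comparison[where g = "%n. (c - cn n) * L", THEN LIM_zero_cancel])
   show "\<forall>\<^sub>F n in sequentially. norm (b z (cn n) - b z c) <= (c - cn n) * L"
    using b_left_diff[OF less_imp_le[OF cn_lt]] by (auto simp: abs_minus_commute)
   show "(%n. (c - cn n) * L) \<longlonglongrightarrow> 0"
    using tendsto_mult[OF tendsto_diff[OF tendsto_const cn_lim] tendsto_const, of c L] by simp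
  qed
  have Il: "(%n. I z (dph z) (cn n) u) \<longlonglongrightarrow> I z (dph z) c u"
  proof (rule Lim_null_comparison[where g = "%n. (c - cn n) * (L * norm (dph z))", THEN LIM_zero_cancel])
   show "\<forall>\<^sub>F n in sequentially. norm (I z (dph z) (cn n) u - I z (dph z) c u) <= (c - cn n) * (L * norm (dph z))"
    using I_left_diff[OF less_imp_le[OF cn_lt]] by auto
   show "(%n. (c - cn n) * (L * norm (dph z))) \<longlonglongrightarrow> 0"
    using tendsto_mult[OF tendsto_diff[OF tendsto_const cn_lim] tendsto_const, of c] by simp
  qed
  \<comment> \<open>Here the strict condition at levels below \<open>c\<close> becomes the closed
    condition at \<open>c\<close>.\<close>
  have ifl: "(%n. if cn n < u then ph z * b z (cn n) else 0) \<longlonglongrightarrow> (if c <= u then ph z * b z c else 0)"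
  proof (cases "c <= u")
   case True
   hence "cn n < u" for n using cn_lt[of n] by linarith
   thus ?thesis using True tendsto_mult[OF tendsto_const bl] by simp
  next
   case False
   hence "\<forall>\<^sub>F n in sequentially. u < cn n" using order_tendstoD(1)[OF cn_lim] by auto
   hence "\<forall>\<^sub>F n in sequentially. 0 = (if cn n < u then ph z * b z (cn n) else 0)"
    by eventually_elim auto
   thus ?thesis using False by (simp add: Lim_transform_eventually[OF tendsto_const])
  qed
  show ?thesis unfolding F_def F'_def by (intro tendsto_diff Il ifl)
 qed
 have lim1: "(%n. LINT u|nv z. F n z u) \<longlonglongrightarrow> (LINT u|nv z. F' z u)" for z
 proof -
  interpret prob_space "nv z" by (rule kernel_prob_space_borel(1)[OF nu])
  have [measurable_cong]: "sets (nv z) = sets borel" by (rule kernel_prob_space_borel(2)[OF nu])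
  show ?thesis
  proof (rule integral_dominated_convergence[where w = "%_. C"])
   show "AE u in nv z. norm (F n z u) <= C" for n
    using Cb by (auto simp: F_def)
  qed (use lim in auto)
 qed
 obtain s where s: "K \<subseteq> cball 0 s"
  using bounded_subset_ballD[OF compact_imp_bounded[OF K(1)], of 0] ball_subset_cball by blast
 have meas: "(%z. LINT u|nv z. F n z u) : bmeas borel" for n
  by (rule kernel_integral_measurable[OF Fm nu])
 have meas': "(%z. LINT u|nv z. F' z u) : bmeas borel"
  by (rule kernel_integral_measurable[OF F'm nu])
 have "(%n. LINT z|lborel. LINT u|nv z. F n z u) \<longlonglongrightarrow> (LINT z|lborel. LINT u|nv z. F' z u)"
 proof (rule integral_dominated_convergence[where w = "%z. C * ind (cball 0 s) z"])
  show "integrable lborel (%z::'e. C * ind (cball 0 s) z)"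
   by (intro integrable_mult_right integrable_real_indicator)
    (auto intro: emeasure_lborel_cball_finite simp del: infinity_ennreal_def)
  show "AE z in lborel. norm (LINT u|nv z. F n z u) <= C * ind (cball 0 s) z" for n
  proof (rule AE_I2)
   fix z
   interpret prob_space "nv z" by (rule kernel_prob_space_borel(1)[OF nu])
   have [measurable_cong]: "sets (nv z) = sets borel" by (rule kernel_prob_space_borel(2)[OF nu])
   show "norm (LINT u|nv z. F n z u) <= C * ind (cball 0 s) z"
   proof (cases "z : K")
    case True
    have "norm (LINT u|nv z. F n z u) <= (LINT u|nv z. C)"
     unfolding real_norm_def by (rule integral_abs_le) (use Cb in \<open>auto simp: F_def\<close>)
    thus ?thesis using True s by (auto simp: prob_space)
   next
    case False
    hence "F n z u = 0" for u using K(3) dph0 by (simp add: F_def)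
    moreover have "0 <= C" using C0 C1 R_nonneg L by (simp add: C_def)
    ultimately show ?thesis by simp
   qed
  qed
 qed (use lim1 meas meas' in auto)
 moreover have "0 <= (LINT z|lborel. LINT u|nv z. F n z u)" for n
  unfolding F_def I_def by (rule nu_ineq[OF cn_R ph K])
 ultimately have "0 <= (LINT z|lborel. LINT u|nv z. F' z u)"
  by (intro LIMSEQ_le_const) auto
 thus ?thesis by (simp add: F'_def)
qed

definition g :: "'e * real => real" where "g w = measure (nv (fst w)) {snd w<..}"

definition h :: "'e * real => real" where "h w = measure (sig (fst w)) {..snd w}"

lemma g_measurable[measurable]: "g : bmeas borel2"
proof -
 have eq: "Sigma (space borel2) (%w. {snd w<..}) = {x : space (borel2 <x> borel). snd (fst x) < (snd x::real)}"
  by (auto simp: space_pair_measure)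
 have "Sigma (space borel2) (%w::'e * real. {snd w<..}) : sets (borel2 <x> borel)"
  unfolding eq by measurable
 moreover have "(%w. nv (fst w)) : borel <x> borel -M> prob_algebra borel" by measurable
 ultimately show ?thesis unfolding g_def by (rule measure_measurable_prob_algebra2)
qed

lemma h_measurable[measurable]: "h : bmeas borel2"
proof -
 have eq: "Sigma (space borel2) (%w. {..snd w}) = {x : space (borel2 <x> borel). snd x <= (snd (fst x)::real)}"
  by (auto simp: space_pair_measure)
 have "Sigma (space borel2) (%w::'e * real. {..snd w}) : sets (borel2 <x> borel)"
  unfolding eq by measurable
 moreover have "(%w. sig (fst w)) : borel <x> borel -M> prob_algebra borel" by measurable
 ultimately show ?thesis unfolding h_def by (rule measure_measurable_prob_algebra2)
qed

lemma g_bounds: "0 <= g w" "g w <= 1"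
 using prob_space.prob_le_1[OF kernel_prob_space_borel(1)[OF nu]] by (auto simp: g_def)

lemma h_bounds: "0 <= h w" "h w <= 1"
 using prob_space.prob_le_1[OF kernel_prob_space_borel(1)[OF sg]] by (auto simp: h_def)

text \<open>The inequality for \<open>nv\<close> in (z, u) is used at the level \<open>v\<close>
  with test function \<open>ps z * rh (z - z')\<close> and averaged over (z', v) with
  \<open>sig\<close>; the one for \<open>sig\<close> is used at the level \<open>u\<close> and
  averaged over (z, u) with \<open>nv\<close>. In the sum, Fubini turns the restriction
  \<open>v <= r < u\<close> into the product \<open>g * h\<close>. The three terms of
  \<open>Y\<close> come from the derivative of \<open>ps\<close>, the commutator and the divergence;
  \<open>de\<close> pays for comparing \<open>b\<close> at \<open>z\<close> and at
  \<open>z'\<close>.\<close>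

lemma doubling:
 assumes ps: "has_grad ps dps UNIV" "!!z. 0 <= ps z"
  and K: "compact K" "K \<subseteq> OM" "!!z. z ~: K ==> ps z = 0"
  and rh: "has_grad rh drh UNIV" "!!z. 0 <= rh z" "!!z. z ~: ball 0 ep ==> rh z = 0"
   "(LINT z|lborel. rh z) = 1" and ep: "0 < ep" "!!z. z : K ==> cball z ep \<subseteq> OM"
  and de: "!!z z' u. norm (z - z') < ep ==> abs (b z u - b z' u) <= de"
 defines "Y \<equiv> %z z' r. rh (z - z') * (a z r .* dps z) + ps z * ((a z r - a z' r) .* drh (z - z')) + ps z * rh (z - z') * be z r"
 shows "- de * (LINT z|lborel. ps z) <= (LINT w|lborel. LINT z|lborel. g (z, snd w) * h w * Y z (fst w) (snd w))"
proof -
 have cps: "continuous_on UNIV ps" and cdps: "continuous_on UNIV dps"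
  and crh: "continuous_on UNIV rh" and cdrh: "continuous_on UNIV drh"
  using ps(1) rh(1) by (auto intro: has_grad_continuous has_grad_continuous_grad)
 have [measurable]: "ps : bmeas borel" "dps : bmeas borel"
  "rh : bmeas borel" "drh : bmeas borel"
  using cps cdps crh cdrh by (auto intro: bmeas_contI)
 have dps0: "dps z = 0" if "z ~: K" for z
  using has_grad_zero_outside[OF ps(1) compact_imp_closed[OF K(1)] K(3) that] .
 have rh0: "rh z = 0" if "z ~: cball 0 ep" for z using rh(3)[of z] that by auto
 have drh0: "drh z = 0" if "z ~: cball 0 ep" for z
  using has_grad_zero_outside[OF rh(1) closed_cball rh0 that] .
 obtain c0 where c0: "c0 >= 0" "!!z. norm (ps z) <= c0"
  using bounded_of_compact_support[OF cps K(1) K(3)] by blast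
 obtain c1 where c1: "c1 >= 0" "!!z. norm (dps z) <= c1"
  using bounded_of_compact_support[OF cdps K(1) dps0] by blast
 obtain c2 where c2: "c2 >= 0" "!!z. norm (rh z) <= c2"
  using bounded_of_compact_support[OF crh compact_cball rh0] by blast
 obtain c3 where c3: "c3 >= 0" "!!z. norm (drh z) <= c3"
  using bounded_of_compact_support[OF cdrh compact_cball drh0] by blast
 obtain s0 where s0: "K \<subseteq> ball 0 s0" "s0 > 0"
  using bounded_subset_ballD[OF compact_imp_bounded[OF K(1)], of 0] by auto
 \<comment> \<open>\<open>B\<close> has to contain the support of \<open>ps\<close> in the variable
   \<open>z\<close> and also every \<open>z'\<close> within \<open>ep\<close> of it.\<close>
 define s where "s = s0 + ep"
 define B where "B = cball (0::'e) s"
 have KB: "z : B" if "z : K" for z using that s0 ep by (auto simp: B_def s_def)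
 have KB': "z' : B" if "z : K" "z - z' : cball 0 ep" for z z'
 proof -
  have "norm z < s0" using that s0 by auto
  moreover have "norm z' <= norm z + norm (z - z')" by (rule norm_triangle_sub[of z' z, unfolded norm_minus_commute[of z' z]])
  ultimately show ?thesis using that by (auto simp: B_def s_def)
 qed
 have B[measurable]: "B : sets borel" by (simp add: B_def)
 have B0: "emeasure lborel B ~= 0" "emeasure lborel B ~= \<infinity>"
 proof -
  show "emeasure lborel B ~= 0"
  proof
   assume "emeasure lborel B = 0"
   hence "AE z in lborel. z ~: B" by (subst AE_iff_null_sets[symmetric]) auto
   hence "AE z in lborel. z ~: ball (0::'e) s" by (rule eventually_mono) (auto simp: B_def)
   thus False using ball_not_AE[of s "0::'e"] s0 ep by (auto simp: s_def)
  qed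
  show "emeasure lborel B ~= \<infinity>"
   using emeasure_lborel_cball_finite[of "0::'e" s] by (auto simp: B_def)
 qed
 define m where "m = measure lborel B"
 have m: "m > 0" using B0 by (auto simp: m_def zero_less_measure_iff emeasure_eq_ennreal_measure)
 define P where "P = skew_product B nv"
 define Q where "Q = skew_product B sig"
 have sP[measurable_cong]: "sets P = sets borel2" and sQ[measurable_cong]: "sets Q = sets borel2"
  unfolding P_def Q_def by (rule skew_product_sets[OF B B0 nu] skew_product_sets[OF B B0 sg])+
 interpret P: prob_space P unfolding P_def by (rule prob_space_skew_product[OF B B0 nu])
 interpret Q: prob_space Q unfolding Q_def by (rule prob_space_skew_product[OF B B0 sg])
 interpret PQ: pair_prob_space P Q ..
 note intP = skew_integral[OF B B0 nu, folded P_def m_def]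
 note intQ = skew_integral[OF B B0 sg, folded Q_def m_def]
 \<comment> \<open>\<open>X1\<close> is the inequality for \<open>nv\<close> at level
   \<open>v = snd y\<close>, \<open>X2\<close> the one for \<open>sig\<close> at level
   \<open>u = snd x\<close>. Both carry the closed condition \<open>v <= u\<close>, so that their
   diagonal terms can be added.\<close>
 define X1 :: "('e * real) => ('e * real) => real" where
  "X1 x y = I (fst x) (rh (fst x - fst y) *. dps (fst x) + ps (fst x) *. drh (fst x - fst y)) (snd y) (snd x)
   - (if snd y <= snd x then (ps (fst x) * rh (fst x - fst y)) * b (fst x) (snd y) else 0)" for x y
 define X2 :: "('e * real) => ('e * real) => real" where
  "X2 x y = I (fst y) (ps (fst x) *. - drh (fst x - fst y)) (snd y) (snd x)
   + (if snd y <= snd x then (ps (fst x) * rh (fst x - fst y)) * b (fst y) (snd x) else 0)" for x y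
 have [measurable]: "(%p. X1 (fst p) (snd p)) : bmeas (borel2 <x> borel2)"
  "(%p. X2 (fst p) (snd p)) : bmeas (borel2 <x> borel2)"
  unfolding X1_def X2_def by measurable
 have X1m[measurable]: "(%x. X1 x y) : bmeas borel2" for y
  unfolding X1_def by measurable
 have X2m[measurable]: "(%y. X2 x y) : bmeas borel2" for x
  unfolding X2_def by measurable
 define C where "C = 2 * R * L * (c2 * c1 + c0 * c3) + c0 * c2 * L"
 have nb: "norm (rh z *. dps z' + ps z' *. drh z) <= c2 * c1 + c0 * c3" for z z'
 proof -
  have "norm (rh z *. dps z') <= c2 * c1" "norm (ps z' *. drh z) <= c0 * c3"
   unfolding norm_scaleR using c0 c1 c2 c3 by (auto intro!: mult_mono)
  thus ?thesis by (intro norm_triangle_le) linarith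
 qed
 have nb2: "norm (ps z' *. - drh z) <= c2 * c1 + c0 * c3" for z z'
 proof -
  have "norm (ps z' *. - drh z) <= c0 * c3"
   unfolding norm_scaleR norm_minus_cancel using c0 c3 by (auto intro!: mult_mono)
  moreover have "0 <= c2 * c1" using c1 c2 by simp
  ultimately show ?thesis by linarith
 qed
 have Ib: "abs (I z e v u) <= 2 * R * L * (c2 * c1 + c0 * c3)" if "norm e <= c2 * c1 + c0 * c3" for z e u v
  using I_bound[of z e v u] mult_left_mono[OF that, of "2 * R * L"] R_nonneg L by simp
 have bb: "abs (if q then (ps z' * rh z) * b y u else 0) <= c0 * c2 * L" for q z z' y u
 proof -
  have "abs (ps z' * rh z * b y u) <= c0 * c2 * L"
   unfolding abs_mult using c0 c2 b_bound[of y u] by (auto intro!: mult_mono)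
  thus ?thesis using c0 c2 L by auto
 qed
 have X1b: "abs (X1 x y) <= C" for x y
  unfolding X1_def C_def
  by (rule order_trans[OF abs_triangle_ineq4]) (intro add_mono Ib nb bb)
 have X2b: "abs (X2 x y) <= C" for x y
  unfolding X2_def C_def
  by (rule order_trans[OF abs_triangle_ineq]) (intro add_mono Ib nb2 bb)
 have X1_out: "X1 (z, u) y = 0" if "z ~: B" for z u y
  using KB that K(3)[of z] dps0[of z] by (cases "z : K") (auto simp: X1_def)
 have X2_out: "X2 x (z', v) = 0" if "z' ~: B" for z' v x
 proof (cases "fst x : K & fst x - z' : cball 0 ep")
  case True
  thus ?thesis using KB'[of "fst x" z'] that by blast
 next
  case False
  thus ?thesis using K(3)[of "fst x"] rh0[of "fst x - z'"] drh0[of "fst x - z'"]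
   by (cases "fst x : K") (auto simp: X2_def)
 qed
 \<comment> \<open>The level has to lie strictly inside the range to be approached from below; by
   the support bound almost every \<open>v\<close> does.\<close>
 have T1: "0 <= (LINT x|P. X1 x y)" if v: "abs (snd y) < R" for y
 proof -
  have "(LINT x|P. X1 x y) = (LINT z|lborel. LINT u|nv z. X1 (z, u) y) / m"
   by (rule intP[of _ C]) (use X1b X1_out in auto)
  moreover have "0 <= (LINT z|lborel. LINT u|nv z. X1 (z, u) y)"
   unfolding X1_def fst_conv snd_conv
   by (rule nu_ineq_closed[OF v has_grad_mult[OF ps(1) has_grad_shift[OF rh(1), of "fst y"]] _ K(1,2)])
    (use ps(2) rh(2) K(3) in auto)
  ultimately show ?thesis using m by simp
 qed
 have T2: "0 <= (LINT y|Q. X2 x y)" if u: "abs (snd x) < R" for x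
 proof -
  have "(LINT y|Q. X2 x y) = (LINT z|lborel. LINT v|sig z. X2 x (z, v)) / m"
   by (rule intQ[of _ C]) (use X2b X2_out in auto)
  moreover have "0 <= (LINT z|lborel. LINT v|sig z. X2 x (z, v))"
  proof (cases "fst x : K")
   case True
   show ?thesis
    unfolding X2_def fst_conv snd_conv I_def
   proof (rule sg_ineq[OF _ has_grad_cmult[OF has_grad_reflect[OF rh(1)]] _ compact_cball ep(2)[OF True]])
    show "abs (snd x) <= R" using u by simp
    show "0 <= ps (fst x) * rh (fst x - z)" for z using ps(2) rh(2) by simp
    show "ps (fst x) * rh (fst x - z) = 0" if "z ~: cball (fst x) ep" for z
     using rh0[of "fst x - z"] that by (simp add: dist_norm norm_minus_commute)
   qed
  next
   case False
   thus ?thesis using K(3) by (simp add: X2_def)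
  qed
  ultimately show ?thesis using m by simp
 qed
 have iX1: "integrable (P <x> Q) (%p. X1 (fst p) (snd p))" and iX2: "integrable (P <x> Q) (%p. X2 (fst p) (snd p))"
  using X1b X2b by (auto intro!: PQ.P.integrable_const_bound[where B = C])
 have "0 <= (LINT y|Q. LINT x|P. X1 x y)"
 proof (rule integral_nonneg_AE)
  have "AE y in Q. abs (snd y) < R"
   unfolding Q_def by (rule skew_AE[OF B B0 sg _ sg_supp]) measurable
  thus "AE y in Q. 0 <= (LINT x|P. X1 x y)" by eventually_elim (rule T1)
 qed
 also have "(LINT y|Q. LINT x|P. X1 x y) = (LINT p|(P <x> Q). X1 (fst p) (snd p))"
  using PQ.integral_snd[of X1] iX1 by (simp add: case_prod_beta')
 finally have S1: "0 <= (LINT p|(P <x> Q). X1 (fst p) (snd p))" .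
 have "0 <= (LINT x|P. LINT y|Q. X2 x y)"
 proof (rule integral_nonneg_AE)
  have "AE x in P. abs (snd x) < R"
   unfolding P_def by (rule skew_AE[OF B B0 nu _ nu_supp]) measurable
  thus "AE x in P. 0 <= (LINT y|Q. X2 x y)" by eventually_elim (rule T2)
 qed
 also have "(LINT x|P. LINT y|Q. X2 x y) = (LINT p|(P <x> Q). X2 (fst p) (snd p))"
  using PQ.integral_fst'[OF iX2] by simp
 finally have S2: "0 <= (LINT p|(P <x> Q). X2 (fst p) (snd p))" .
 define Zr :: "(('e * real) \<times> ('e * real)) => real => real" where
  "Zr p r = (if snd (snd p) <= r & r < snd (fst p) then Y (fst (fst p)) (fst (snd p)) r else 0)" for p r
 \<comment> \<open>\<open>b z' u - b z v\<close> is split as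
   \<open>(b z u - b z v) + (b z' u - b z u)\<close>: the first part is the integral of
   \<open>be\<close> and goes into \<open>Y\<close>, the second is the error \<open>W\<close>, small
   because \<open>rh\<close> keeps \<open>z'\<close> within \<open>ep\<close> of
   \<open>z\<close>.\<close>
 define W :: "(('e * real) \<times> ('e * real)) => real" where
  "W p = (if snd (snd p) <= snd (fst p) then ps (fst (fst p)) * rh (fst (fst p) - fst (snd p))
    * (b (fst (snd p)) (snd (fst p)) - b (fst (fst p)) (snd (fst p))) else 0)" for p
 have Y_int: "integrable lborel (%r. if v <= r & r < u then Y z z' r else 0)" for v u z z'
 proof -
  have "integrable lborel (%r. rh (z - z') * (if v <= r & r < u then a z r .* dps z else 0)
   + ps z * ((if v <= r & r < u then a z r .* drh (z - z') else 0) - (if v <= r & r < u then a z' r .* drh (z - z') else 0))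
   + ps z * rh (z - z') * (if v <= r & r < u then be z r else 0))"
   by (intro lint_i_add lint_i_diff integrable_mult_right I_integrable
     integrable_clip[where C = L]) (auto simp: be_bound be_out)
  thus ?thesis
   by (rule lint_i_cong[THEN iffD1, rotated 2])
    (auto simp: Y_def inner_diff_left)
 qed
 have X12: "X1 (fst p) (snd p) + X2 (fst p) (snd p) = (LINT r|lborel. Zr p r) + W p" for p
 proof -
  obtain z u z' v where p: "p = ((z, u), (z', v))" by (metis surj_pair)
  show ?thesis
  proof (cases "v <= u")
   case True
   have "(LINT r|lborel. Zr p r) = (LINT r|lborel.
    rh (z - z') * (if v <= r & r < u then a z r .* dps z else 0)
    + ps z * ((if v <= r & r < u then a z r .* drh (z - z') else 0) - (if v <= r & r < u then a z' r .* drh (z - z') else 0))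
    + ps z * rh (z - z') * (if v <= r & r < u then be z r else 0))"
    by (intro lint_cong) (auto simp: p Zr_def Y_def inner_diff_left)
   also have "... = rh (z - z') * I z (dps z) v u + ps z * (I z (drh (z - z')) v u - I z' (drh (z - z')) v u)
    + ps z * rh (z - z') * (b z u - b z v)"
    unfolding I_def b_diff[OF True]
    by (subst lint_add lint_diff integral_mult_right_zero;
      (intro lint_i_add lint_i_diff integrable_mult_right I_integrable
       integrable_clip[where C = L] refl)?; (simp add: be_bound be_out)?)+
   finally have 1: "(LINT r|lborel. Zr p r) = ..." .
   have Iadd: "I z (x *. e + y *. e') v u = x * I z e v u + y * I z e' v u" for x y z e e'
   proof -
    have "I z (x *. e + y *. e') v u = (LINT r|lborel. x * (if v <= r & r < u then a z r .* e else 0) + y * (if v <= r & r < u then a z r .* e' else 0))"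
     unfolding I_def by (intro lint_cong) (auto simp: inner_add_right)
    also have "... = x * I z e v u + y * I z e' v u"
     unfolding I_def using I_integrable by simp
    finally show ?thesis .
   qed
   have Im: "I z' (ps z *. - e) v u = - (ps z * I z' e v u)" for e
    using Iadd[of z' "- ps z" e 0 0] by simp
   show ?thesis
    unfolding 1 using True by (simp add: p X1_def X2_def W_def Iadd Im algebra_simps del: scaleR_minus_right)
  next
   case False
   hence "Zr p = (%r. 0)" by (auto simp: Zr_def p fun_eq_iff)
   thus ?thesis using False by (simp add: p X1_def X2_def W_def I_empty)
  qed
 qed
 define CY where "CY = c2 * (L * c1) + c0 * (2 * L * c3) + c0 * c2 * L"
 have CY: "abs (Y z z' r) <= CY" for z z' r
 proof -
  have "abs (rh (z - z') * (a z r .* dps z)) <= c2 * (L * c1)"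
   unfolding abs_mult
   by (intro mult_mono order_trans[OF a_inner_bound] mult_left_mono) (use c1 c2 L in auto)
  moreover have "abs (ps z * ((a z r - a z' r) .* drh (z - z'))) <= c0 * (2 * L * c3)"
  proof -
   have "norm (a z r - a z' r) <= 2 * L"
    using norm_triangle_ineq4[of "a z r" "a z' r"] a_bound[of z r] a_bound[of z' r] by linarith
   hence "abs ((a z r - a z' r) .* drh (z - z')) <= 2 * L * c3"
    using c3 L by (intro order_trans[OF Cauchy_Schwarz_ineq2] mult_mono) auto
   thus ?thesis unfolding abs_mult using c0 by (intro mult_mono) auto
  qed
  moreover have "abs (ps z * rh (z - z') * be z r) <= c0 * c2 * L"
   unfolding abs_mult using c0 c2 be_bound[of z r] by (auto intro!: mult_mono)
  ultimately show ?thesis unfolding Y_def CY_def by linarith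
 qed
 have CY0: "0 <= CY" using order_trans[OF abs_ge_zero CY] .
 have Y_out_r: "Y z z' r = 0" if "abs r > R" for z z' r
  using that by (simp add: Y_def a_out be_out)
 have Y_out: "Y z z' r = 0" if "z ~: B \<or> z' ~: B" for z z' r
 proof (cases "z : K & z - z' : cball 0 ep")
  case True
  thus ?thesis using KB[of z] KB'[of z z'] that by blast
 next
  case False
  thus ?thesis using K(3)[of z] dps0[of z] rh0[of "z - z'"] drh0[of "z - z'"]
   by (cases "z : K") (auto simp: Y_def)
 qed
 have Y_meas[measurable (raw)]: "(%x. Y (f x) (f' x) (k x)) : bmeas N"
  if [measurable]: "f : N -M> borel" "f' : N -M> borel" "k : N -M> borel" for f f' k and N :: "'x measure"
  unfolding Y_def by measurable
 have [measurable]: "W : bmeas (P <x> Q)"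
  unfolding W_def by measurable
 have [measurable]: "(%(p, r). Zr p r) : bmeas ((P <x> Q) <x> lborel)"
  unfolding Zr_def case_prod_beta' by measurable
 have Zr_b: "abs (Zr p r) <= CY" for p r using CY CY0 by (simp add: Zr_def)
 have Z_b: "abs (LINT r|lborel. Zr p r) <= 2 * R * CY" for p
  unfolding Zr_def by (rule clip_bound(1)) (auto simp: CY Y_out_r)
 have W_b: "abs (W p) <= de * (ps (fst (fst p)) * rh (fst (fst p) - fst (snd p)))" for p
 proof (cases "norm (fst (fst p) - fst (snd p)) < ep")
  case True
  have "abs (b (fst (snd p)) (snd (fst p)) - b (fst (fst p)) (snd (fst p))) <= de"
   using de[OF True] by (simp add: abs_minus_commute)
  hence "ps (fst (fst p)) * rh (fst (fst p) - fst (snd p)) * abs (b (fst (snd p)) (snd (fst p)) - b (fst (fst p)) (snd (fst p)))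
   <= ps (fst (fst p)) * rh (fst (fst p) - fst (snd p)) * de"
   using ps(2) rh(2) by (intro mult_left_mono) auto
  moreover have "0 <= de" using order_trans[OF abs_ge_zero de[OF True]] .
  ultimately show ?thesis using ps(2) rh(2) by (auto simp: W_def abs_mult mult.commute)
 next
  case False
  hence "rh (fst (fst p) - fst (snd p)) = 0" by (intro rh(3)) auto
  thus ?thesis by (simp add: W_def)
 qed
 have de0: "0 <= de" using order_trans[OF abs_ge_zero de[of 0 0]] ep by simp
 have psirho: "abs (ps z * rh z') <= c0 * c2" for z z'
  unfolding abs_mult using c0 c2 by (auto intro!: mult_mono)
 \<comment> \<open>The majorant of \<open>W\<close> up to the factor \<open>de\<close>. Since
   \<open>rh\<close> has integral 1, its total mass is that of \<open>ps\<close>, divided by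
   \<open>m\<close> once for each normalised measure.\<close>
 define V where "V p = ps (fst (fst p)) * rh (fst (fst p) - fst (snd p))" for p :: "(('e * real) \<times> ('e * real))"
 have [measurable]: "V : bmeas (P <x> Q)" unfolding V_def by measurable
 have iV: "integrable (P <x> Q) V"
  using psirho by (auto intro!: PQ.P.integrable_const_bound[where B = "c0 * c2"] simp: V_def)
 have iW: "integrable (P <x> Q) W"
 proof (rule PQ.P.integrable_const_bound[where B = "de * (c0 * c2)"])
  show "AE p in P <x> Q. norm (W p) <= de * (c0 * c2)"
   using order_trans[OF W_b mult_left_mono[OF order_trans[OF abs_ge_self psirho] de0]] by auto
 qed measurable
 have iZ: "integrable (P <x> Q) (%p. LINT r|lborel. Zr p r)"
  using Z_b by (auto intro!: PQ.P.integrable_const_bound[where B = "2 * R * CY"])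
 have "(LINT p|(P <x> Q). V p) = (LINT x|P. LINT y|Q. V (x, y))"
  using PQ.integral_fst'[OF iV] by simp
 also have "(%x. LINT y|Q. V (x, y)) = (%x. ps (fst x) / m)"
 proof
  fix x :: "'e * real"
  have "(LINT y|Q. V (x, y)) = (LINT z'|lborel. LINT v|sig z'. V (x, (z', v))) / m"
  proof (rule intQ[of _ "c0 * c2"])
   show "V (x, (z', v)) = 0" if "z' ~: B" for z' v
   proof (cases "fst x : K & fst x - z' : cball 0 ep")
    case True
    thus ?thesis using KB'[of "fst x" z'] that by blast
   next
    case False
    thus ?thesis using K(3)[of "fst x"] rh0[of "fst x - z'"] by (auto simp: V_def)
   qed
  qed (auto simp: V_def psirho)
  also have "(LINT z'|lborel. LINT v|sig z'. V (x, (z', v))) = (LINT z'|lborel. ps (fst x) * rh (fst x - z'))"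
   using prob_space.prob_space[OF kernel_prob_space_borel(1)[OF sg]] by (simp add: V_def)
  also have "... = ps (fst x)"
   using lborel_integral_reflect[of rh "fst x"] rh(4) by simp
  finally show "(LINT y|Q. V (x, y)) = ps (fst x) / m" .
 qed
 also have "(LINT x|P. ps (fst x) / m) = (LINT z|lborel. LINT u|nv z. ps (fst (z, u)) / m) / m"
 proof (rule intP[of _ "c0 / m"])
  show "abs (ps (fst x) / m) <= c0 / m" for x :: "'e * real" using c0(2)[of "fst x"] m by (simp add: divide_right_mono)
  show "ps (fst (z, u)) / m = 0" if "z ~: B" for z and u :: real using that KB K(3)[of z] by auto
 qed measurable
 also have "... = (LINT z|lborel. ps z) / m / m"
  using prob_space.prob_space[OF kernel_prob_space_borel(1)[OF nu]] by simp
 finally have LV: "(LINT p|(P <x> Q). V p) = (LINT z|lborel. ps z) / m / m" .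
 have LW: "(LINT p|(P <x> Q). W p) <= de * ((LINT z|lborel. ps z) / m / m)"
 proof -
  have "(LINT p|(P <x> Q). W p) <= (LINT p|(P <x> Q). de * V p)"
   using order_trans[OF abs_ge_self W_b]
   by (intro integral_mono[OF iW integrable_mult_right[OF iV]]) (simp add: V_def)
  thus ?thesis using LV by simp
 qed
 have Zsum: "0 <= (LINT p|(P <x> Q). LINT r|lborel. Zr p r) + (LINT p|(P <x> Q). W p)"
 proof -
  have "0 <= (LINT p|(P <x> Q). X1 (fst p) (snd p) + X2 (fst p) (snd p))"
   using S1 S2 iX1 iX2 by simp
  also have "... = (LINT p|(P <x> Q). (LINT r|lborel. Zr p r) + W p)" by (simp only: X12)
  finally show ?thesis using iZ iW by simp
 qed
 interpret PQL: pair_sigma_finite "P <x> Q" lborel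
  by (intro pair_sigma_finite.intro PQ.P.sigma_finite_measure_axioms sigma_finite_lborel)
 have iZr: "integrable ((P <x> Q) <x> lborel) (%(p, r). Zr p r)"
 proof (rule lint_i_bound)
  have "emeasure ((P <x> Q) <x> lborel) (space (P <x> Q) <*> {-R..R}) = emeasure (P <x> Q) (space (P <x> Q)) * emeasure lborel {-R..R}"
   by (rule sigma_finite_measure.emeasure_pair_measure_Times) (auto intro: sigma_finite_lborel)
  hence "emeasure ((P <x> Q) <x> lborel) (space (P <x> Q) <*> {-R..R}) < \<infinity>"
   using PQ.P.emeasure_space_1 R_nonneg by simp
  thus "integrable ((P <x> Q) <x> lborel) (%x. CY * ind (space (P <x> Q) <*> {-R..R}) x)"
   by (intro integrable_mult_right integrable_real_indicator) auto
  show "AE x in (P <x> Q) <x> (lborel :: real measure). norm (case x of (p, r) => Zr p r) <= norm (CY * ind (space (P <x> Q) <*> {-R..R}) x)"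
  proof (rule AE_I2)
   fix x :: "(('e * real) \<times> ('e * real)) * real" assume x: "x : space ((P <x> Q) <x> lborel)"
   obtain p r where pr: "x = (p, r)" by (cases x)
   hence "p : space (P <x> Q)" using x by (simp add: space_pair_measure)
   thus "norm (case x of (p, r) => Zr p r) <= norm (CY * ind (space (P <x> Q) <*> {-R..R}) x)"
    using Zr_b[of p r] CY0 Y_out_r[of r] by (cases "abs r > R") (auto simp: pr Zr_def indicator_def abs_le_iff)
  qed
 qed measurable
 define Kf where "Kf z z' r = g (z, r) * h (z', r) * Y z z' r" for z z' r
 have Kf_m[measurable (raw)]: "(%x. Kf (f x) (f' x) (k x)) : bmeas N"
  if [measurable]: "f : N -M> borel" "f' : N -M> borel" "k : N -M> borel" for f f' k and N :: "'x measure"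
  unfolding Kf_def by measurable
 have Kf_b: "abs (Kf z z' r) <= CY" for z z' r
 proof -
  have "g (z, r) * h (z', r) <= 1 * 1" using g_bounds h_bounds by (intro mult_mono) auto
  hence "abs (g (z, r) * h (z', r)) <= 1" using g_bounds(1)[of "(z, r)"] h_bounds(1)[of "(z', r)"] by simp
  hence "abs (Kf z z' r) <= 1 * CY" unfolding Kf_def abs_mult[of "g (z, r) * h (z', r)"] using CY by (intro mult_mono) auto
  thus ?thesis by simp
 qed
 have Kf_out: "Kf z z' r = 0" if "z ~: B \<or> z' ~: B \<or> r ~: cball 0 R" for z z' r
  using that Y_out[of z z' r] Y_out_r[of r z z'] by (auto simp: Kf_def)
 have Kf_in: "Kf z z' r = 0 \<or> z : B & z' : B & r : cball 0 R" for z z' r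
  using Kf_out by blast
 \<comment> \<open>For fixed \<open>r\<close> the indicator of \<open>v <= r < u\<close> is a
   product of a function of \<open>v\<close> and one of \<open>u\<close>, so the two Young measures
   integrate separately to \<open>h (z', r)\<close> and \<open>g (z, r)\<close>.\<close>
 have slice: "(LINT p|(P <x> Q). Zr p r) = (LINT z|lborel. LINT z'|lborel. Kf z z' r) / m / m" for r
 proof -
  have [measurable]: "(%p. Zr p r) : bmeas (P <x> Q)" unfolding Zr_def by measurable
  have "integrable (P <x> Q) (%p. Zr p r)"
   using Zr_b by (auto intro!: PQ.P.integrable_const_bound[where B = CY])
  hence "(LINT p|(P <x> Q). Zr p r) = (LINT x|P. LINT y|Q. Zr (x, y) r)"
   using PQ.integral_fst'[of "%p. Zr p r"] by simp
  also have "... = (LINT z|lborel. LINT u|nv z. LINT y|Q. Zr ((z, u), y) r) / m"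
  proof (rule intP[of "%x. LINT y|Q. Zr (x, y) r" CY])
   show "(%x. LINT y|Q. Zr (x, y) r) : bmeas borel2"
    unfolding Zr_def fst_conv snd_conv
    by (rule Q.borel_measurable_lebesgue_integral) measurable
   show "abs (LINT y|Q. Zr (x, y) r) <= CY" for x
    using integral_abs_le[of Q "%_. CY" "%y. Zr (x, y) r"] Zr_b by (simp add: Q.prob_space)
   show "(LINT y|Q. Zr ((z, u), y) r) = 0" if "z ~: B" for z u
    using that by (simp add: Zr_def Y_out cong: if_cong)
  qed
  also have "(%z. LINT u|nv z. LINT y|Q. Zr ((z, u), y) r) = (%z. (LINT z'|lborel. Kf z z' r) / m)"
  proof
   fix z
   have inner: "(LINT y|Q. Zr ((z, u), y) r) = ind {r<..} u * ((LINT z'|lborel. h (z', r) * Y z z' r) / m)" for u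
   proof -
    have "(LINT y|Q. Zr ((z, u), y) r) = (LINT z'|lborel. LINT v|sig z'. Zr ((z, u), (z', v)) r) / m"
    proof (rule intQ[of _ CY])
     show "(%y. Zr ((z, u), y) r) : bmeas borel2"
      unfolding Zr_def fst_conv snd_conv by measurable
     show "abs (Zr ((z, u), y) r) <= CY" for y by (rule Zr_b)
     show "Zr ((z, u), (z', v)) r = 0" if "z' ~: B" for z' v
      using that by (simp add: Zr_def Y_out cong: if_cong)
    qed
    also have "(%z'. LINT v|sig z'. Zr ((z, u), (z', v)) r) = (%z'. ind {r<..} u * (h (z', r) * Y z z' r))"
    proof
     fix z'
     interpret prob_space "sig z'" by (rule kernel_prob_space_borel(1)[OF sg])
     have ss[measurable_cong]: "sets (sig z') = sets borel" by (rule kernel_prob_space_borel(2)[OF sg])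
     have "(LINT v|sig z'. Zr ((z, u), (z', v)) r) = (LINT v|sig z'. (ind {r<..} u * Y z z' r) * ind {..r} v)"
      by (intro lint_cong) (auto simp: Zr_def indicator_def)
     also have "... = (ind {r<..} u * Y z z' r) * measure (sig z') {..r}"
      using ss sets_eq_imp_space_eq[OF ss] by simp
     finally show "(LINT v|sig z'. Zr ((z, u), (z', v)) r) = ind {r<..} u * (h (z', r) * Y z z' r)"
      by (simp add: h_def)
    qed
    finally show ?thesis by simp
   qed
   interpret prob_space "nv z" by (rule kernel_prob_space_borel(1)[OF nu])
   have ss[measurable_cong]: "sets (nv z) = sets borel" by (rule kernel_prob_space_borel(2)[OF nu])
   show "(LINT u|nv z. LINT y|Q. Zr ((z, u), y) r) = (LINT z'|lborel. Kf z z' r) / m"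
    unfolding inner using ss sets_eq_imp_space_eq[OF ss] by (simp add: Kf_def g_def mult.assoc)
  qed
  finally show ?thesis by simp
 qed
 have "(LINT p|(P <x> Q). LINT r|lborel. Zr p r) = (LINT r|lborel. LINT p|(P <x> Q). Zr p r)"
  using PQL.Fubini_integral[OF iZr] by simp
 also have "... = (LINT r|lborel. LINT z|lborel. LINT z'|lborel. Kf z z' r) / m / m"
  unfolding slice by simp
 \<comment> \<open>Only the order of integration changes: the integral over \<open>z\<close> goes
   innermost, around a fixed point \<open>w = (z', r)\<close>, as the translation estimate wants
   it.\<close>
 also have "(LINT r|lborel. LINT z|lborel. LINT z'|lborel. Kf z z' r) = (LINT w|lborel. LINT z|lborel. Kf z (fst w) (snd w))"
 proof -
  have bB: "bounded B" by (simp add: B_def)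
  have "(LINT z|lborel. LINT z'|lborel. Kf z z' r) = (LINT q|lborel. Kf (fst q) (snd q) r)" for r
  proof -
   have m3: "(%q. Kf (fst q) (snd q) r) : bmeas borel2" by measurable
   have o3: "Kf (fst q) (snd q) r = 0" if "q ~: B \<times> B" for q
    using that Kf_in[of "fst q" "snd q" r] by (cases q) auto
   from lborel_Fubini_bounded(2)[OF m3 Kf_b bounded_Times[OF bB bB] o3] show ?thesis by simp
  qed
  hence "(LINT r|lborel. LINT z|lborel. LINT z'|lborel. Kf z z' r) = (LINT r|lborel. LINT q|lborel. Kf (fst q) (snd q) r)"
   by simp
  also have "... = (LINT q|lborel. LINT r|lborel. Kf (fst q) (snd q) r)"
  proof -
   have m3: "(%p. Kf (fst (fst p)) (snd (fst p)) (snd p)) : bmeas borel2"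
    unfolding borel_prod[symmetric] by measurable
   have bd3: "bounded ((B \<times> B) \<times> cball 0 R)" by (intro bounded_Times bB bounded_cball)
   have o3: "Kf (fst (fst p)) (snd (fst p)) (snd p) = 0" if "p ~: (B \<times> B) \<times> cball 0 R" for p
    using that Kf_in[of "fst (fst p)" "snd (fst p)" "snd p"] by (cases p) auto
   from lborel_Fubini_bounded(2,3)[OF m3 Kf_b bd3 o3] show ?thesis by simp
  qed
  also have "... = (LINT z|lborel. LINT z'|lborel. LINT r|lborel. Kf z z' r)"
  proof -
   have m3: "(%q. LINT r|lborel. Kf (fst q) (snd q) r) : bmeas borel2"
    by measurable
   have b3: "abs (LINT r|lborel. Kf (fst q) (snd q) r) <= CY * (2 * R)" for q
   proof -
    have "abs (LINT r|lborel. Kf (fst q) (snd q) r) <= (LINT r|lborel. CY * ind {-R..R} r)"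
    proof (rule integral_abs_le)
     show "integrable lborel (%r. CY * ind {-R..R} r)"
      by (intro integrable_mult_right integrable_real_indicator) (auto simp: emeasure_lborel_Icc_eq)
     show "abs (Kf (fst q) (snd q) r) <= CY * ind {-R..R} r" for r
      using Kf_b[of "fst q" "snd q" r] Kf_out[of "fst q" "snd q" r] CY0
      by (cases "r : cball 0 R") (auto simp: indicator_def)
    qed
    thus ?thesis using R_nonneg by simp
   qed
   have bd3: "bounded (B \<times> B)" by (intro bounded_Times bB)
   have o3: "(LINT r|lborel. Kf (fst q) (snd q) r) = 0" if "q ~: B \<times> B" for q
   proof -
    have "Kf (fst q) (snd q) r = 0" for r
     using that Kf_in[of "fst q" "snd q" r] by (cases q) auto
    thus ?thesis by simp
   qed
   from lborel_Fubini_bounded(2)[OF m3 b3 bd3 o3] show ?thesis by simp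
  qed
  also have "(%z. LINT z'|lborel. LINT r|lborel. Kf z z' r) = (%z. LINT w|lborel. Kf z (fst w) (snd w))"
  proof
   fix z
   show "(LINT z'|lborel. LINT r|lborel. Kf z z' r) = (LINT w|lborel. Kf z (fst w) (snd w))"
   proof -
    have m3: "(%w. Kf z (fst w) (snd w)) : bmeas borel2" by measurable
    have o3: "Kf z (fst w) (snd w) = 0" if "w ~: B \<times> cball 0 R" for w
     using that Kf_in[of z "fst w" "snd w"] by (cases w) auto
    from lborel_Fubini_bounded(2)[OF m3 Kf_b bounded_Times[OF bB bounded_cball] o3] show ?thesis by simp
   qed
  qed
  also have "(LINT z|lborel. LINT w|lborel. Kf z (fst w) (snd w)) = (LINT w|lborel. LINT z|lborel. Kf z (fst w) (snd w))"
  proof -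
   have m3: "(%p. Kf (fst p) (fst (snd p)) (snd (snd p))) : bmeas borel2"
    unfolding borel_prod[symmetric] by measurable
   have bd3: "bounded (B \<times> (B \<times> cball 0 R))" by (intro bounded_Times bB bounded_cball)
   have o3: "Kf (fst p) (fst (snd p)) (snd (snd p)) = 0" if "p ~: B \<times> (B \<times> cball 0 R)" for p
    using that Kf_in[of "fst p" "fst (snd p)" "snd (snd p)"] by (cases p) auto
   from lborel_Fubini_bounded(2,3)[OF m3 Kf_b bd3 o3] show ?thesis by simp
  qed
  finally show ?thesis .
 qed
 finally have "(LINT p|(P <x> Q). LINT r|lborel. Zr p r) = (LINT w|lborel. LINT z|lborel. Kf z (fst w) (snd w)) / m / m" .
 with Zsum LW have "0 <= (LINT w|lborel. LINT z|lborel. Kf z (fst w) (snd w)) / m / m + de * ((LINT z|lborel. ps z) / m / m)"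
  by linarith
 also have "... = ((LINT w|lborel. LINT z|lborel. Kf z (fst w) (snd w)) + de * (LINT z|lborel. ps z)) / (m * m)"
  by (simp add: add_divide_distrib)
 finally have "0 <= (LINT w|lborel. LINT z|lborel. Kf z (fst w) (snd w)) + de * (LINT z|lborel. ps z)"
  using mult_pos_pos[OF m m] by (simp only: zero_le_divide_iff) linarith
 thus ?thesis by (simp add: Kf_def)
qed

text \<open>Friedrichs' commutator argument: as \<open>ep\<close> tends to 0, the functions
  containing \<open>g\<close> may be frozen at \<open>z'\<close> at a small L1 cost, since all
  kernels have size \<open>ep^-n\<close> on a ball of radius \<open>ep\<close>. After freezing,
  \<open>rh\<close> integrates to 1 and the commutator \<open>k\<close> to 0, and only the term with
  \<open>dps\<close> survives. \<open>h\<close> is never shifted, so its bound by 1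
  suffices.\<close>

theorem kinetic_product_inequality:
 assumes ps: "has_grad ps dps UNIV" "!!z. 0 <= ps z"
  and K: "compact K" "K \<subseteq> OM" "!!z. z ~: K ==> ps z = 0"
 shows "0 <= (LINT w|lborel. g w * h w * (a (fst w) (snd w) .* dps (fst w)))"
proof -
 define n where "n = DIM('e)"
 obtain C where C: "C >= 0" "!!ep. ep > 0 ==> EX rh drh. has_grad rh drh (UNIV::'e set)
   & (ALL z. 0 <= rh z) & (ALL z. rh z <= C / ep ^ n) & (ALL z. norm (drh z) <= C / ep ^ Suc n)
   & (ALL z. z ~: ball 0 ep --> rh z = 0) & (LINT z|lborel. rh z) = 1"
  unfolding n_def using mollifier_exists by blast
 have cps: "continuous_on UNIV ps" and cdps: "continuous_on UNIV dps"
  using ps(1) by (auto intro: has_grad_continuous has_grad_continuous_grad)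
 have [measurable]: "ps : bmeas borel" "dps : bmeas borel"
  using cps cdps by (auto intro: bmeas_contI)
 have dps0: "dps z = 0" if "z ~: K" for z
  using has_grad_zero_outside[OF ps(1) compact_imp_closed[OF K(1)] K(3) that] .
 obtain c0 where c0: "c0 >= 0" "!!z. norm (ps z) <= c0"
  using bounded_of_compact_support[OF cps K(1) K(3)] by blast
 obtain c1 where c1: "c1 >= 0" "!!z. norm (dps z) <= c1"
  using bounded_of_compact_support[OF cdps K(1) dps0] by blast
 obtain s where s: "K \<subseteq> cball 0 s"
  using bounded_subset_ballD[OF compact_imp_bounded[OF K(1)], of 0] ball_subset_cball by blast
 obtain e0 where e0: "e0 > 0" "!!z. z : K ==> cball z e0 \<subseteq> OM"
 proof -
  have "K Int (- OM) = {}" using K by auto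
  from separate_compact_closed[OF K(1) _ this] open_Omega
  obtain d where d: "d > 0" "ALL x:K. ALL y:- OM. d <= dist x y" by auto
  show ?thesis by (rule that[of "d / 2"]) (use d in force)+
 qed
 \<comment> \<open>The two functions to be frozen: \<open>G1\<close> stands next to
   \<open>rh\<close>, \<open>G\<close> next to \<open>k\<close>. The condition on
   \<open>snd w\<close> gives \<open>G\<close> a bounded support; \<open>G1\<close> has one because
   \<open>a\<close> vanishes beyond \<open>R\<close>.\<close>
 define G1 where "G1 w = g w * (a (fst w) (snd w) .* dps (fst w))" for w
 define G where "G w = (if abs (snd w) <= R then g w * ps (fst w) else 0)" for w
 have G1m[measurable]: "G1 : bmeas borel2" unfolding G1_def by measurable
 have Gm[measurable]: "G : bmeas borel2" unfolding G_def by measurable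
 have G1b: "abs (G1 w) <= L * c1" for w
 proof -
  have "abs (G1 w) <= 1 * (L * c1)" unfolding G1_def abs_mult
   by (intro mult_mono order_trans[OF a_inner_bound] mult_left_mono) (use g_bounds c1 L in auto)
  thus ?thesis by simp
 qed
 have Gb: "abs (G w) <= c0" for w
 proof -
  have "abs (g w * ps (fst w)) <= 1 * c0" unfolding abs_mult
   by (intro mult_mono) (use g_bounds c0 in auto)
  thus ?thesis using c0 by (simp add: G_def)
 qed
 have G1out: "G1 w = 0" if "w ~: cball 0 s \<times> cball 0 R" for w
 proof (cases "fst w : K")
  case True
  hence "abs (snd w) > R" using that s by (cases w) auto
  thus ?thesis by (simp add: G1_def a_out)
 qed (simp add: G1_def dps0)
 have Gout: "G w = 0" if "w ~: cball 0 s \<times> cball 0 R" for w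
 proof (cases "fst w : K")
  case True
  hence "abs (snd w) > R" using that s by (cases w) auto
  thus ?thesis by (simp add: G_def)
 qed (simp add: G_def K(3))
 have bds: "bounded (cball (0::'e) s \<times> cball (0::real) R)" by (intro bounded_Times bounded_cball)
 define J0 where "J0 = (LINT w|lborel. h w * G1 w)"
 define M where "M = (LINT z|lborel. ps z)"
 have M: "M >= 0" unfolding M_def using ps(2) by (intro integral_nonneg_AE) auto
 \<comment> \<open>\<open>de\<close> controls the modulus of continuity of \<open>b\<close>,
   \<open>e\<close> the translation errors. Both are sent to 0 afterwards, so it matters that their
   coefficients do not depend on \<open>ep\<close>.\<close>
 have key: "0 <= J0 + de * M + 2 * e * ((2 * L + 1) * C)" if e: "e > 0" and d: "de > 0" for e de
 proof -
  obtain d1 where d1: "d1 > 0" "!!ep. 0 < ep ==> ep < d1 ==>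
   (LINT w|lborel. LINT z|lborel. ind (cball (fst w) ep) z * abs (G1 (z, snd w) - G1 w)) <= e * ep ^ n"
   using average_translation_L1[OF G1m G1b bds G1out e] unfolding n_def by blast
  obtain d2 where d2: "d2 > 0" "!!ep. 0 < ep ==> ep < d2 ==>
   (LINT w|lborel. LINT z|lborel. ind (cball (fst w) ep) z * abs (G (z, snd w) - G w)) <= e * ep ^ n"
   using average_translation_L1[OF Gm Gb bds Gout e] unfolding n_def by blast
  obtain d3 where d3: "d3 > 0" "!!z z' u. norm (z - z') < d3 ==> abs (b z u - b z' u) < de"
   using b_unif[OF d] by blast
  define ep where "ep = min (min d1 d2) (min d3 e0) / 2"
  have ep: "0 < ep" "ep < d1" "ep < d2" "ep < d3" "ep <= e0"
   using d1(1) d2(1) d3(1) e0(1) by (auto simp: ep_def min_def)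
  obtain rh drh where rh: "has_grad rh drh (UNIV::'e set)" "!!z. 0 <= rh z" "!!z. rh z <= C / ep ^ n"
   "!!z. norm (drh z) <= C / ep ^ Suc n" "!!z. z ~: ball 0 ep ==> rh z = 0" "(LINT z|lborel. rh z) = 1"
   using C(2)[OF ep(1)] by blast
  have crh: "continuous_on UNIV rh" and cdrh: "continuous_on UNIV drh"
   using rh(1) by (auto intro: has_grad_continuous has_grad_continuous_grad)
  have [measurable]: "rh : bmeas borel" "drh : bmeas borel"
   using crh cdrh by (auto intro: bmeas_contI)
  have rh0: "rh z = 0" if "z ~: cball 0 ep" for z using rh(5)[of z] that by auto
  have drh0: "drh z = 0" if "z ~: cball 0 ep" for z
   using has_grad_zero_outside[OF rh(1) closed_cball rh0 that] .
  define k where "k z w = (a z (snd w) - a (fst w) (snd w)) .* drh (z - fst w) + rh (z - fst w) * be z (snd w)" for z w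
  define Y where "Y z z' r = rh (z - z') * (a z r .* dps z) + ps z * ((a z r - a z' r) .* drh (z - z')) + ps z * rh (z - z') * be z r" for z z' r
  \<comment> \<open>One bound for both kernels: \<open>rh\<close> is at most
    \<open>C / ep ^ n\<close>, and \<open>k\<close> at most \<open>2 * L * (C / ep ^ n)\<close>,
    since the difference of \<open>a\<close> gains a factor \<open>L * ep\<close> against the
    gradient.\<close>
  define D where "D = (2 * L + 1) * (C / ep ^ n)"
  have CE: "C / ep ^ n >= 0" using C(1) ep by simp
  have D: "D >= 0" "C / ep ^ n <= D" "2 * L * (C / ep ^ n) <= D"
   using CE mult_nonneg_nonneg[OF mult_nonneg_nonneg[of 2 L] CE] L
   unfolding D_def distrib_right mult_1 by linarith+
  have kb: "abs (k z w) <= D" for z w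
  proof (cases "z - fst w : cball 0 ep")
   case True
   have "abs ((a z (snd w) - a (fst w) (snd w)) .* drh (z - fst w)) <= (L * ep) * (C / ep ^ Suc n)"
    by (intro order_trans[OF Cauchy_Schwarz_ineq2] mult_mono rh(4) order_trans[OF a_lip] mult_left_mono)
     (use True L ep in auto)
   also have "... = L * (C / ep ^ n)" using ep by simp
   finally have 1: "abs ((a z (snd w) - a (fst w) (snd w)) .* drh (z - fst w)) <= L * (C / ep ^ n)" .
   have 2: "abs (rh (z - fst w) * be z (snd w)) <= (C / ep ^ n) * L"
    unfolding abs_mult by (intro mult_mono be_bound) (use rh(2,3) CE in auto)
   have "abs (k z w) <= L * (C / ep ^ n) + (C / ep ^ n) * L"
    unfolding k_def by (rule order_trans[OF abs_triangle_ineq add_mono[OF 1 2]])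
   also have "... = 2 * L * (C / ep ^ n)" by simp
   finally have "abs (k z w) <= 2 * L * (C / ep ^ n)" .
   thus ?thesis using D by linarith
  next
   case False
   thus ?thesis using D by (simp add: k_def rh0 drh0)
  qed
  have kout: "k z w = 0" if "z ~: cball (fst w) ep" for z w
   using that rh0[of "z - fst w"] drh0[of "z - fst w"] by (simp add: k_def dist_norm norm_minus_commute)
  have k_meas[measurable]: "(%z. k z w) : bmeas borel" for w
   unfolding k_def by measurable
  have ik: "integrable lborel (%z. k z w)" for w
   by (rule i_bsupp[where C = D and K = "cball (fst w) ep"]) (use kb kout in auto)
  have k0: "(LINT z|lborel. k z w) = 0" for w
  proof -
   have sh: "has_grad (%z. rh (z - fst w)) (%z. drh (z - fst w)) UNIV"
    by (rule has_grad_shift[OF rh(1)])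
   have sh0: "rh (z - fst w) = 0" if "z ~: cball (fst w) ep" for z
    using that rh0[of "z - fst w"] by (simp add: dist_norm norm_minus_commute)
   have i1: "integrable lborel (%z. drh (z - fst w) .* a (fst w) (snd w))"
    and z1: "(LINT z|lborel. drh (z - fst w) .* a (fst w) (snd w)) = 0"
    using integral_gradient_zero[OF sh compact_cball sh0] by auto
   have eq: "rh (z - fst w) * be z (snd w) + a z (snd w) .* drh (z - fst w) = k z w + drh (z - fst w) .* a (fst w) (snd w)" for z
    by (simp add: k_def inner_diff_left inner_commute[of "drh (z - fst w)"])
   have "(LINT z|lborel. rh (z - fst w) * be z (snd w) + a z (snd w) .* drh (z - fst w)) = 0"
    by (rule div[OF sh compact_cball sh0])
   thus ?thesis unfolding eq using ik i1 z1 by simp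
  qed
  have r1: "(LINT z|lborel. rh (z - fst w)) = 1" for w :: "'e * real"
   using lborel_integral_shift[of rh "- fst w"] rh(6) by simp
  \<comment> \<open>A nonzero integral proves integrability, because the integral of a
    non-integrable function is 0 by convention.\<close>
  have ir: "integrable lborel (%z. rh (z - fst w))" for w :: "'e * real"
   using r1[of w] not_integrable_integral_eq by fastforce
  define Bd where "Bd w = (LINT z|lborel. D * (ind (cball (fst w) ep) z * abs (G1 (z, snd w) - G1 w))
    + D * (ind (cball (fst w) ep) z * abs (G (z, snd w) - G w)))" for w
  note av1 = average_integrand[OF G1m G1b G1out ep(1)]
  note av2 = average_integrand[OF Gm Gb Gout ep(1)]
  have Bd_eq: "Bd w = D * (LINT z|lborel. ind (cball (fst w) ep) z * abs (G1 (z, snd w) - G1 w))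
    + D * (LINT z|lborel. ind (cball (fst w) ep) z * abs (G (z, snd w) - G w))" for w
   unfolding Bd_def
   by (subst lint_add) (intro integrable_mult_right av1(2) av2(2) | simp)+
  have iBd: "integrable lborel Bd"
   unfolding Bd_eq[abs_def] by (intro lint_i_add integrable_mult_right av1(1) av2(1))
  have LBd: "(LINT w|lborel. Bd w) <= 2 * e * ((2 * L + 1) * C)"
  proof -
   have "(LINT w|lborel. Bd w) = D * (LINT w|lborel. LINT z|lborel. ind (cball (fst w) ep) z * abs (G1 (z, snd w) - G1 w))
    + D * (LINT w|lborel. LINT z|lborel. ind (cball (fst w) ep) z * abs (G (z, snd w) - G w))"
    unfolding Bd_eq
    by (subst lint_add) (intro integrable_mult_right av1(1) av2(1) | simp)+
   also have "... <= D * (e * ep ^ n) + D * (e * ep ^ n)"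
    by (intro add_mono mult_left_mono d1(2) d2(2) ep D)
   also have "... = 2 * e * ((2 * L + 1) * C)" using ep by (simp add: D_def)
   finally show ?thesis .
  qed
  define Jin where "Jin w = (LINT z|lborel. g (z, snd w) * h w * Y z (fst w) (snd w))" for w
  \<comment> \<open>Add and subtract the values at \<open>w\<close>: the first summand is the
    translation error, and of the two frozen terms one integrates to \<open>h w * G1 w\<close> and
    the other to 0.\<close>
  have split: "g (z, snd w) * h w * Y z (fst w) (snd w)
   = h w * (rh (z - fst w) * (G1 (z, snd w) - G1 w) + k z w * (G (z, snd w) - G w)) + h w * G1 w * rh (z - fst w) + h w * G w * k z w" for z w
  proof (cases "abs (snd w) <= R")
   case True
   thus ?thesis by (simp add: Y_def G1_def G_def k_def algebra_simps)
  next
   case False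
   hence "a x (snd w) = 0" "be x (snd w) = 0" for x using a_out[of "snd w"] be_out[of "snd w"] by auto
   thus ?thesis by (simp add: Y_def G1_def k_def)
  qed
  have rem_le: "abs (h w * (rh (z - fst w) * (G1 (z, snd w) - G1 w) + k z w * (G (z, snd w) - G w)))
   <= D * (ind (cball (fst w) ep) z * abs (G1 (z, snd w) - G1 w))
    + D * (ind (cball (fst w) ep) z * abs (G (z, snd w) - G w))" for z w
  proof (cases "z : cball (fst w) ep")
   case True
   have "abs (rh (z - fst w) * (G1 (z, snd w) - G1 w)) <= D * abs (G1 (z, snd w) - G1 w)"
    unfolding abs_mult using rh(2,3)[of "z - fst w"] D by (intro mult_right_mono) auto
   moreover have "abs (k z w * (G (z, snd w) - G w)) <= D * abs (G (z, snd w) - G w)"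
    unfolding abs_mult using kb by (intro mult_right_mono) auto
   ultimately have "abs (rh (z - fst w) * (G1 (z, snd w) - G1 w) + k z w * (G (z, snd w) - G w))
    <= D * abs (G1 (z, snd w) - G1 w) + D * abs (G (z, snd w) - G w)" by linarith
   hence "abs (h w) * abs (rh (z - fst w) * (G1 (z, snd w) - G1 w) + k z w * (G (z, snd w) - G w))
    <= 1 * (D * abs (G1 (z, snd w) - G1 w) + D * abs (G (z, snd w) - G w))"
    using h_bounds[of w] by (intro mult_mono) auto
   thus ?thesis using True by (simp add: abs_mult)
  next
   case False
   hence "rh (z - fst w) = 0" "k z w = 0"
    using kout rh0[of "z - fst w"] by (auto simp: dist_norm norm_minus_commute)
   thus ?thesis using D by simp
  qed
  have irem: "integrable lborel (%z. h w * (rh (z - fst w) * (G1 (z, snd w) - G1 w) + k z w * (G (z, snd w) - G w)))" for w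
  proof (rule lint_i_bound)
   show "integrable lborel (%z. D * (ind (cball (fst w) ep) z * abs (G1 (z, snd w) - G1 w))
    + D * (ind (cball (fst w) ep) z * abs (G (z, snd w) - G w)))"
    by (intro lint_i_add integrable_mult_right av1(2) av2(2))
   show "AE z in lborel. norm (h w * (rh (z - fst w) * (G1 (z, snd w) - G1 w) + k z w * (G (z, snd w) - G w)))
    <= norm (D * (ind (cball (fst w) ep) z * abs (G1 (z, snd w) - G1 w))
    + D * (ind (cball (fst w) ep) z * abs (G (z, snd w) - G w)))"
    using order_trans[OF rem_le abs_ge_self] by auto
   have "(%z. (z, snd w)) : borel -M> borel <x> borel" by measurable
   from measurable_compose[OF this G1m] measurable_compose[OF this Gm]
   show "(%z. h w * (rh (z - fst w) * (G1 (z, snd w) - G1 w) + k z w * (G (z, snd w) - G w))) : bmeas lborel"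
    by simp
  qed
  have lin: "(LINT z|lborel. F1 z + A * F2 z + A' * F3 z) = (LINT z|lborel. F1 z) + A * (LINT z|lborel. F2 z) + A' * (LINT z|lborel. F3 z)"
   if "integrable lborel F1" "integrable lborel F2" "integrable lborel F3" for F1 F2 F3 :: "'e => real" and A A'
   using that by simp
  have Jin_eq: "Jin w - h w * G1 w = (LINT z|lborel. h w * (rh (z - fst w) * (G1 (z, snd w) - G1 w) + k z w * (G (z, snd w) - G w)))" for w
  proof -
   have "Jin w = (LINT z|lborel. h w * (rh (z - fst w) * (G1 (z, snd w) - G1 w) + k z w * (G (z, snd w) - G w)))
    + h w * G1 w * (LINT z|lborel. rh (z - fst w)) + h w * G w * (LINT z|lborel. k z w)"
    unfolding Jin_def split by (rule lin[OF irem ir ik])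
   thus ?thesis using k0 r1 by simp
  qed
  have le: "abs (Jin w - h w * G1 w) <= Bd w" for w
   unfolding Jin_eq Bd_def
   by (rule integral_abs_le[OF _ rem_le]) (intro lint_i_add integrable_mult_right av1(2) av2(2))
  have ihG: "integrable lborel (%w. h w * G1 w)"
  proof (rule i_bsupp[where C = "L * c1", OF _ _ bds])
   show "(%w. h w * G1 w) : bmeas borel" unfolding borel_prod[symmetric] by measurable
   show "norm (h w * G1 w) <= L * c1" for w
   proof -
    have "abs (h w * G1 w) <= 1 * (L * c1)" unfolding abs_mult by (intro mult_mono G1b) (use h_bounds[of w] in auto)
    thus ?thesis by simp
   qed
  qed (use G1out in auto)
  have "- de * M <= (LINT w|lborel. Jin w)"
   unfolding M_def Jin_def Y_def
  proof (rule doubling[OF ps K rh(1,2,5,6) ep(1)])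
   show "cball z ep \<subseteq> OM" if "z : K" for z
    using subset_cball[OF ep(5)] e0(2)[OF that] by (rule subset_trans)
   show "abs (b z u - b z' u) <= de" if "norm (z - z') < ep" for z z' u
    using d3(2)[of z z' u] that ep(4) by simp
  qed
  \<comment> \<open>\<open>Jin\<close> differs from the integrable \<open>h w * G1 w\<close> by at
    most \<open>Bd\<close>, so the case of a non-integrable \<open>Jin\<close> is
    contradictory.\<close>
  also have "(LINT w|lborel. Jin w) <= J0 + (LINT w|lborel. Bd w)"
  proof (cases "integrable lborel Jin")
   case True
   have "(LINT w|lborel. Jin w) - J0 = (LINT w|lborel. Jin w - h w * G1 w)"
    unfolding J0_def using True ihG by simp
   also have "... <= (LINT w|lborel. Bd w)"
    using integral_abs_le[OF iBd le] by (meson abs_ge_self order_trans)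
   finally show ?thesis by simp
  next
   case False
   have "integrable lborel (%w. Jin w - h w * G1 w)"
   proof (rule lint_i_bound[OF iBd])
    have [measurable]: "(%p. k (snd p) (fst p)) : bmeas (borel2 <x> borel)"
     unfolding k_def by measurable
    have "(%w. LINT z|lborel. h w * (rh (z - fst w) * (G1 (z, snd w) - G1 w) + k z w * (G (z, snd w) - G w))) : bmeas borel2"
     by measurable
    thus "(%w. Jin w - h w * G1 w) : bmeas lborel"
     unfolding Jin_eq by (simp add: borel_prod)
    show "AE w in lborel. norm (Jin w - h w * G1 w) <= norm (Bd w)"
     using order_trans[OF le abs_ge_self] by auto
   qed
   from lint_i_add[OF this ihG] False show ?thesis by simp
  qed
  finally show ?thesis using LBd by simp
 qed
 have "0 <= J0 + et" if "et > 0" for et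
 proof -
  define Q where "Q = (2 * L + 1) * C"
  have Q: "Q >= 0" using L C by (simp add: Q_def)
  \<comment> \<open>Each of the two errors gets half of \<open>et\<close>; adding 1 to
    \<open>M\<close> and \<open>Q\<close> avoids a division by 0.\<close>
  have 1: "et / (2 * (M + 1)) > 0" "et / (2 * (Q + 1)) / 2 > 0" using that M Q by (auto intro!: divide_pos_pos)
  from key[OF 1(2,1)] have 2: "0 <= J0 + et / (2 * (M + 1)) * M + 2 * (et / (2 * (Q + 1)) / 2) * Q"
   by (simp only: Q_def)
  have frac: "et / (2 * (x + 1)) * x <= et / 2" if "x >= 0" for x
  proof -
   have "et / (2 * (x + 1)) * x <= et / (2 * (x + 1)) * (x + 1)"
    using that \<open>et > 0\<close> by (intro mult_left_mono divide_nonneg_nonneg) auto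
   also have "... = et / 2" using that by (simp add: divide_eq_eq algebra_simps)
   finally show ?thesis .
  qed
  have half: "2 * (x / 2) * y = x * y" for x y :: real by simp
  from 2 have "0 <= J0 + et / (2 * (M + 1)) * M + et / (2 * (Q + 1)) * Q" by (simp only: half)
  with frac[OF M] frac[OF Q] show ?thesis by linarith
 qed
 hence "0 <= J0" by (rule field_le_epsilon)
 also have "J0 = (LINT w|lborel. g w * h w * (a (fst w) (snd w) .* dps (fst w)))"
  unfolding J0_def G1_def by (intro lint_cong) (auto simp: mult_ac)
 finally show ?thesis .
qed

end

section \<open>Riemannian volume in charts\<close>

text \<open>The segment from the identity to \<open>G\<close> stays positive definite, hence
  invertible, so the determinant cannot change sign along it.\<close>

lemma det_pos_of_posdef:
 fixes G :: "real^'n^'n"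
 assumes pd: "!!v. v ~= 0 ==> v .* (G *v v) > 0"
 shows "det G > 0"
proof (rule ccontr)
 assume neg: "\<not> det G > 0"
 define M where "M s = (1 - s) *. (mat 1 :: real^'n^'n) + s *. G" for s :: real
 have nz: "det (M s) ~= 0" if s: "0 <= s" "s <= 1" for s
 proof -
  have "x = 0" if "M s *v x = 0" for x
  proof (rule ccontr)
   assume x: "x ~= 0"
   have "x .* (M s *v x) = (1 - s) * (x .* x) + s * (x .* (G *v x))"
    unfolding M_def matrix_vector_mult_add_rdistrib scaleR_matrix_vector_assoc[symmetric]
    by (simp add: inner_add_right)
   moreover have "x .* x > 0" using x by simp
   moreover note pd[OF x]
   ultimately have "x .* (M s *v x) > 0"
    using s by (cases "s = 0") (auto intro: add_nonneg_pos)
   thus False using that by simp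
  qed
  hence "invertible (M s)"
   using matrix_left_invertible_ker[of "M s"] invertible_left_inverse by blast
  thus ?thesis by (simp add: invertible_det_nz)
 qed
 have "continuous_on {0..1} (%s. det (M s))"
  unfolding M_def det_def by (intro continuous_intros)
 moreover have "det (M 1) <= 0" "0 <= det (M 0)" using neg by (auto simp: M_def)
 ultimately obtain s where "0 <= s" "s <= 1" "det (M s) = 0"
  using IVT2'[of "%s. det (M s)" 1 0 0] by auto
 thus False using nz by blast
qed

text \<open>The change of variables theorems of the library need a well-ordered index type.\<close>

typedef 'a well_ordered = "UNIV :: 'a set" morphisms unwo wo by simp

lemma unwo_wo[simp]: "unwo (wo x) = x" and wo_unwo[simp]: "wo (unwo y) = y"
 by (auto simp: wo_inverse unwo_inverse)

lemma bij_wo: "bij wo" "bij unwo"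
 by (rule bij_betw_byWitness[of _ unwo], auto) (rule bij_betw_byWitness[of _ wo], auto)

instance well_ordered :: (finite) finite
proof
 have "(UNIV :: 'a well_ordered set) = wo ` UNIV" by (rule bij_is_surj[OF bij_wo(1), symmetric])
 thus "finite (UNIV :: 'a well_ordered set)" by (metis finite finite_imageI)
qed

instantiation well_ordered :: (finite) wellorder
begin

definition less_eq_well_ordered :: "'a well_ordered => 'a well_ordered => bool" where
 "x <= y \<longleftrightarrow> to_nat (unwo x) <= to_nat (unwo y)"

definition less_well_ordered :: "'a well_ordered => 'a well_ordered => bool" where
 "x < y \<longleftrightarrow> to_nat (unwo x) < to_nat (unwo y)"

instance
proof
 fix P :: "'a well_ordered => bool" and a
 assume *: "!!x. (!!y. y < x ==> P y) ==> P x"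
 show "P a"
  by (induction a rule: measure_induct[of "%x. to_nat (unwo x)"])
   (use * in \<open>auto simp: less_well_ordered_def\<close>)
qed (auto simp: less_eq_well_ordered_def less_well_ordered_def unwo_inject)

end

definition to_wo :: "real^'d::finite => real^('d well_ordered)" where "to_wo x = (\<chi> i. x $ unwo i)"
definition of_wo :: "real^('d well_ordered) => real^'d::finite" where "of_wo x = (\<chi> i. x $ wo i)"

lemma to_of_wo[simp]: "to_wo (of_wo x) = x" "of_wo (to_wo y) = y"
 by (auto simp: to_wo_def of_wo_def vec_eq_iff)

lemma linear_to_wo: "linear to_wo" "linear of_wo"
 by (auto simp: to_wo_def of_wo_def vec_eq_iff intro!: linearI)

lemma continuous_to_wo: "continuous_on S to_wo" "continuous_on S' of_wo"
 using linear_to_wo linear_continuous_on linear_conv_bounded_linear by blast+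

lemma borel_to_wo[measurable]: "to_wo : borel -M> borel" "of_wo : borel -M> borel"
 by (intro bmeas_contI continuous_to_wo)+

lemma to_wo_image: "to_wo ` B = of_wo -` B"
 by (force simp: image_iff intro: to_of_wo(1)[symmetric])

lemma prod_Basis_cart: "(PROD b:(Basis::(real^'n::finite) set). x .* b) = (PROD i:UNIV. x $ i)"
proof -
 have B: "(Basis::(real^'n) set) = (%i. axis i 1) ` UNIV" by (auto simp: Basis_vec_def)
 have inj: "inj (%i::'n. axis i (1::real))" by (auto simp: inj_def axis_eq_axis)
 have "(PROD b:(Basis::(real^'n) set). x .* b) = (PROD b:(%i. axis i 1) ` UNIV. x .* b)"
  by (rule prod.cong[OF B refl])
 also have "... = (PROD i:UNIV. x .* axis i 1)"
  by (subst prod.reindex[OF inj]) (simp add: o_def)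
 finally show ?thesis by (simp add: inner_axis)
qed

text \<open>Relabelling coordinates maps boxes to boxes of the same volume, and boxes determine
  Lebesgue measure.\<close>

lemma distr_of_wo: "distr lborel borel of_wo = (lborel :: (real^'d::finite) measure)"
proof (rule lborel_eqI[symmetric])
 fix l u :: "real^'d" assume lu: "!!b. b : Basis ==> l .* b <= u .* b"
 have le: "l $ i <= u $ i" for i using lu[of "axis i 1"] by (simp add: inner_axis axis_in_Basis_iff)
 have "of_wo -` box l u = box (to_wo l) (to_wo u)"
 proof (intro set_eqI iffI)
  fix x assume "x : of_wo -` box l u"
  hence "!!i. l $ i < x $ wo i & x $ wo i < u $ i" by (auto simp: mem_box_cart of_wo_def)
  hence "l $ unwo i < x $ wo (unwo i) & x $ wo (unwo i) < u $ unwo i" for i by blast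
  thus "x : box (to_wo l) (to_wo u)" by (simp add: mem_box_cart to_wo_def)
 next
  fix x assume "x : box (to_wo l) (to_wo u)"
  hence "!!i. l $ unwo i < x $ i & x $ i < u $ unwo i" by (auto simp: mem_box_cart to_wo_def)
  from this[of "wo _"] show "x : of_wo -` box l u" by (auto simp: mem_box_cart of_wo_def)
 qed
 hence "emeasure (distr lborel borel of_wo) (box l u) = emeasure lborel (box (to_wo l) (to_wo u))"
  by (simp add: emeasure_distr)
 also have "... = (PROD b:Basis. (to_wo u - to_wo l) .* b)"
 proof (rule emeasure_lborel_box)
  fix b :: "real^('d well_ordered)" assume "b : Basis"
  then obtain i where "b = axis i 1" by (auto simp: Basis_vec_def)
  thus "to_wo l .* b <= to_wo u .* b" using le by (simp add: inner_axis to_wo_def)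
 qed
 also have "... = (PROD b:Basis. (u - l) .* b)"
  unfolding prod_Basis_cart using prod.reindex_bij_betw[OF bij_wo(2), of "%i. u $ i - l $ i"] by (simp add: to_wo_def)
 finally show "emeasure (distr lborel borel of_wo) (box l u) = (PROD b:Basis. (u - l) .* b)" .
qed simp

lemma emeasure_to_wo: "B : sets borel ==> emeasure lborel (to_wo ` B) = emeasure lborel B"
 unfolding to_wo_image using emeasure_distr[of of_wo lborel borel B] by (simp add: distr_of_wo)

text \<open>Rows and columns are relabelled by the same bijection, so permutations correspond by
  conjugation, which keeps their sign.\<close>

lemma det_reindex:
 fixes A :: "real^'d::finite^'d"
 shows "det (\<chi> i j. A $ unwo i $ unwo j) = det A"
proof -
 let ?f = "map_permutation (UNIV::'d set) wo"
 have inj: "inj wo" using bij_wo(1) by (rule bij_is_inj)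
 have f: "?f p = wo \<circ> p \<circ> unwo" for p
 proof -
  have "inv (wo :: 'd => 'd well_ordered) = unwo" using inj by (metis inv_equality unwo_wo wo_unwo)
  thus ?thesis by (simp add: map_permutation_def restrict_id_def bij_is_surj[OF bij_wo(1)] fun_eq_iff)
 qed
 have bij: "bij_betw ?f {p. p permutes UNIV} {p. p permutes UNIV}"
 proof (rule bij_betw_byWitness[of _ "%p. unwo \<circ> p \<circ> wo"])
  show "?f ` {p. p permutes UNIV} \<subseteq> {p. p permutes UNIV}"
   using map_permutation_permutes[OF bij_wo(1)] by auto
  have "unwo \<circ> p \<circ> wo permutes UNIV" if "p permutes UNIV" for p
   using bij_comp[OF bij_wo(1) bij_comp[OF permutes_bij[OF that] bij_wo(2)]]
   by (intro bij_imp_permutes) (auto simp: o_assoc)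
  thus "(%p. unwo \<circ> p \<circ> wo) ` {p. p permutes UNIV} \<subseteq> {p. p permutes UNIV}" by auto
 qed (auto simp: f fun_eq_iff)
 have "det (\<chi> i j. A $ unwo i $ unwo j) = (\<Sum>p | p permutes UNIV. of_int (sign (?f p)) * (PROD i:UNIV. A $ unwo i $ unwo (?f p i)))"
  unfolding det_def using sum.reindex_bij_betw[OF bij, symmetric] by simp
 also have "... = (\<Sum>p | p permutes UNIV. of_int (sign p) * (PROD i:UNIV. A $ i $ p i))"
 proof (rule sum.cong[OF refl])
  fix p :: "'d => 'd" assume "p : {p. p permutes UNIV}"
  hence "sign (?f p) = sign p" by (intro sign_map_permutation) (auto simp: inj)
  moreover have "(PROD i:UNIV. A $ unwo i $ unwo (?f p i)) = (PROD i:UNIV. A $ i $ p i)"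
   unfolding f using prod.reindex_bij_betw[OF bij_wo(2), of "%i. A $ i $ p i"] by simp
  ultimately show "of_int (sign (?f p)) * (PROD i:UNIV. A $ unwo i $ unwo (?f p i)) = of_int (sign p) * (PROD i:UNIV. A $ i $ p i)"
   by simp
 qed
 finally show ?thesis by (simp add: det_def)
qed

text \<open>If either side is finite, the change of variables theorem for finite integrals applies
  in one of its two directions; otherwise both sides are infinite.\<close>

lemma emeasure_differentiable_image_wo:
 fixes ta :: "real^'n::{finite,wellorder} => real^'n::_"
 assumes B: "B : sets borel" and im: "ta ` B : sets borel" and inj: "inj_on ta B"
  and der: "!!x. x : B ==> (ta has_derivative ta' x) (at x)"
  and meas: "(%x. ind B x * abs (det (matrix (ta' x)))) : bmeas borel"
 shows "emeasure lborel (ta ` B) = (\<integral>\<^sup>+x. ennreal \<bar>det (matrix (ta' x))\<bar> * ind B x \<partial>lborel)"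
proof -
 let ?D = "%x. abs (det (matrix (ta' x)))"
 note cov = has_measure_differentiable_image[of B ta ta', OF _ _ inj]
 have B': "B : sets lebesgue" using B by simp
 have der': "(ta has_derivative ta' x) (at x within B)" if "x : B" for x
  using der[OF that] by (rule has_derivative_at_withinI)
 have eqm: "emeasure lborel (ta ` B) = ennreal m" "(\<integral>\<^sup>+x. ennreal (?D x) * ind B x \<partial>lborel) = ennreal m"
  if "(?D has_integral m) B" for m
 proof -
  have "ta ` B : lmeasurable & measure lebesgue (ta ` B) = m" using cov[OF B' der'] that by blast
  thus "emeasure lborel (ta ` B) = ennreal m"
   using emeasure_eq_measure2[of "ta ` B" lebesgue] im by simp
  show "(\<integral>\<^sup>+x. ennreal (?D x) * ind B x \<partial>lborel) = ennreal m"
   by (rule nn_integral_has_integral_lebesgue'[OF _ that]) simp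
 qed
 consider "emeasure lborel (ta ` B) < \<infinity>" | "(\<integral>\<^sup>+x. ennreal (?D x) * ind B x \<partial>lborel) < \<infinity>"
  | "emeasure lborel (ta ` B) = \<infinity>" "(\<integral>\<^sup>+x. ennreal (?D x) * ind B x \<partial>lborel) = \<infinity>"
  by (auto simp: less_top[symmetric])
 thus ?thesis
 proof cases
  case 1
  hence "ta ` B : lmeasurable" using im by (auto simp: fmeasurable_def)
  hence "(?D has_integral measure lebesgue (ta ` B)) B" using cov[OF B' der'] by blast
  from eqm[OF this] show ?thesis by simp
 next
  case 2
  have "integrable lborel (%x. ind B x * ?D x)"
   by (rule integrableI_nonneg[OF _ _ le_less_trans[OF _ 2]])
    (use meas in \<open>auto intro!: nn_integral_mono simp: indicator_def\<close>)
  hence "((%x. ind B x * ?D x) has_integral (LINT x|lborel. ind B x * ?D x)) UNIV"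
   by (rule has_integral_integral_lborel)
  moreover have "(%x. ind B x * ?D x) = (%x. if x : B then ?D x else 0)"
   by (auto simp: fun_eq_iff indicator_def)
  ultimately have "(?D has_integral (LINT x|lborel. ind B x * ?D x)) B"
   by (simp only: has_integral_restrict_UNIV)
  from eqm[OF this] show ?thesis by simp
 next
  case 3
  thus ?thesis by simp
 qed
qed

text \<open>Conjugating with \<open>to_wo\<close> preserves both Lebesgue measure and the Jacobian
  determinant.\<close>

lemma emeasure_differentiable_image:
 fixes ta :: "real^'d::finite => real^'d"
 assumes B: "B : sets borel" and im: "ta ` B : sets borel" and inj: "inj_on ta B"
  and der: "!!x. x : B ==> (ta has_derivative ta' x) (at x)"
  and meas: "(%x. ind B x * abs (det (matrix (ta' x)))) : bmeas borel"
 shows "emeasure lborel (ta ` B) = (\<integral>\<^sup>+x. ennreal \<bar>det (matrix (ta' x))\<bar> * ind B x \<partial>lborel)"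
proof -
 define ta2 where "ta2 x = to_wo (ta (of_wo x))" for x
 define ta2' where "ta2' x h = to_wo (ta' (of_wo x) (of_wo h))" for x h
 have det_eq: "det (matrix (ta2' x)) = det (matrix (ta' (of_wo x)))" for x
 proof -
  have ax: "of_wo (axis j 1) = axis (unwo j) 1" for j :: "'d well_ordered"
   by (auto simp: of_wo_def axis_def vec_eq_iff)
  hence "matrix (ta2' x) = (\<chi> i j. matrix (ta' (of_wo x)) $ unwo i $ unwo j)"
   unfolding vec_eq_iff[of "matrix (ta2' x)"] by (simp add: matrix_def ta2'_def to_wo_def ax vec_eq_iff)
  thus ?thesis by (simp add: det_reindex)
 qed
 have ind: "ind (to_wo ` B) x = ind B (of_wo x)" for x
  by (auto simp: to_wo_image indicator_def)
 have im2: "ta2 ` to_wo ` B = to_wo ` ta ` B" by (auto simp: ta2_def image_image)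
 have bor: "to_wo ` C : sets borel" if "C : sets borel" for C
  unfolding to_wo_image using measurable_sets[OF borel_to_wo(2) that] by simp
 have "emeasure lborel (ta ` B) = emeasure lborel (ta2 ` to_wo ` B)"
  unfolding im2 by (rule emeasure_to_wo[OF im, symmetric])
 also have "... = (\<integral>\<^sup>+x. ennreal \<bar>det (matrix (ta2' x))\<bar> * ind (to_wo ` B) x \<partial>lborel)"
 proof (rule emeasure_differentiable_image_wo)
  show "to_wo ` B : sets borel" by (rule bor[OF B])
  show "ta2 ` to_wo ` B : sets borel" unfolding im2 by (rule bor[OF im])
  show "inj_on ta2 (to_wo ` B)"
   using inj by (auto simp: inj_on_def ta2_def) (metis to_of_wo(2))
  show "(ta2 has_derivative ta2' x) (at x)" if "x : to_wo ` B" for x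
  proof -
   have "of_wo x : B" using that by (auto simp: to_wo_image)
   note d = der[OF this]
   have "(of_wo has_derivative of_wo) (at x)"
    using linear_to_wo(2) by (rule linear_imp_has_derivative)
   from diff_chain_at[OF this d]
   have "(ta \<circ> of_wo has_derivative ta' (of_wo x) \<circ> of_wo) (at x)" .
   moreover have "(to_wo has_derivative to_wo) (at ((ta \<circ> of_wo) x))"
    using linear_to_wo(1) by (rule linear_imp_has_derivative)
   ultimately have "(to_wo \<circ> (ta \<circ> of_wo) has_derivative to_wo \<circ> (ta' (of_wo x) \<circ> of_wo)) (at x)"
    by (rule diff_chain_at)
   thus ?thesis by (simp add: o_def ta2_def[abs_def] ta2'_def[abs_def])
  qed
  show "(%x. ind (to_wo ` B) x * abs (det (matrix (ta2' x)))) : bmeas borel"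
   unfolding ind det_eq by (rule measurable_compose[OF borel_to_wo(2) meas])
 qed
 also have "... = (\<integral>\<^sup>+x. ennreal (ind B (of_wo x) * abs (det (matrix (ta' (of_wo x))))) \<partial>lborel)"
  unfolding ind det_eq by (intro nn_integral_cong) (auto simp: indicator_def)
 also have "... = (\<integral>\<^sup>+x. ennreal (ind B x * abs (det (matrix (ta' x)))) \<partial>distr lborel borel of_wo)"
  by (rule nn_integral_distr[symmetric]) (use meas in auto)
 also have "... = (\<integral>\<^sup>+x. ennreal \<bar>det (matrix (ta' x))\<bar> * ind B x \<partial>lborel)"
  unfolding distr_of_wo by (intro nn_integral_cong) (auto simp: indicator_def)
 finally show ?thesis .
qed

text \<open>The set version says that two measures coincide: Lebesgue measure on the image of
  \<open>S\<close>, and the image under \<open>ta\<close> of the measure with the Jacobian as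
  density. Integrating \<open>f\<close> against both gives the claim.\<close>

lemma nn_integral_differentiable_image:
 fixes ta :: "real^'d::finite => real^'d" and f :: "real^'d => ennreal"
 assumes S[measurable]: "S : sets borel" and im: "!!B. B : sets borel ==> B \<subseteq> S ==> ta ` B : sets borel" and inj: "inj_on ta S"
  and der: "!!x. x : S ==> (ta has_derivative ta' x) (at x)"
  and meas: "(%x. ind S x * abs (det (matrix (ta' x)))) : bmeas borel"
  and tam: "(%x. if x : S then ta x else 0) : borel -M> borel"
  and f[measurable]: "f : bmeas borel"
 shows "(\<integral>\<^sup>+y. f y * ind (ta ` S) y \<partial>lborel) = (\<integral>\<^sup>+x. f (ta x) * ennreal \<bar>det (matrix (ta' x))\<bar> * ind S x \<partial>lborel)"
proof -
 let ?D = "%x. ennreal (ind S x * abs (det (matrix (ta' x))))"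
 let ?t = "%x. if x : S then ta x else 0"
 have Dm[measurable]: "?D : bmeas borel" using meas by measurable
 note tam[measurable]
 have tS[measurable]: "ta ` S : sets borel" by (rule im) auto
 have eq: "density lborel (ind (ta ` S)) = distr (density lborel ?D) borel ?t"
 proof (rule measure_eqI)
  fix C assume "C : sets (density lborel (ind (ta ` S)))"
  hence C[measurable]: "C : sets borel" by simp
  define B where "B = {x : S. ta x : C}"
  have "B = S Int (?t -` C Int space borel)" by (auto simp: B_def)
  hence B[measurable]: "B : sets borel" using measurable_sets[OF tam C] S by simp
  have BS: "B \<subseteq> S" by (auto simp: B_def)
  have mB: "(%x. ind B x * abs (det (matrix (ta' x)))) : bmeas borel"
  proof -
   have "(%x. ind B x * abs (det (matrix (ta' x)))) = (%x. ind B x * (ind S x * abs (det (matrix (ta' x)))))"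
    using BS by (auto simp: indicator_def fun_eq_iff)
   thus ?thesis using meas by simp
  qed
  have "emeasure (density lborel (ind (ta ` S))) C = emeasure lborel (ta ` S Int C)"
   by (simp add: emeasure_density indicator_inter_arith[symmetric])
  also have "ta ` S Int C = ta ` B" by (auto simp: B_def)
  also have "emeasure lborel (ta ` B) = (\<integral>\<^sup>+x. ennreal \<bar>det (matrix (ta' x))\<bar> * ind B x \<partial>lborel)"
   by (rule emeasure_differentiable_image[OF B im[OF B BS] inj_on_subset[OF inj BS] _ mB]) (use der BS in auto)
  also have "... = (\<integral>\<^sup>+x. ?D x * ind (?t -` C) x \<partial>lborel)"
   by (intro nn_integral_cong) (auto simp: B_def indicator_def)
  also have "... = emeasure (density lborel ?D) (?t -` C)"
   by (rule emeasure_density[symmetric]) (use Dm measurable_sets[OF tam C] in auto)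
  also have "... = emeasure (distr (density lborel ?D) borel ?t) C"
   by (subst emeasure_distr) auto
  finally show "emeasure (density lborel (ind (ta ` S))) C = emeasure (distr (density lborel ?D) borel ?t) C" .
 qed simp
 have "(\<integral>\<^sup>+y. f y * ind (ta ` S) y \<partial>lborel) = (\<integral>\<^sup>+y. f y \<partial>density lborel (ind (ta ` S)))"
  by (simp add: nn_integral_density mult.commute)
 also have "... = (\<integral>\<^sup>+x. ?D x * f (?t x) \<partial>lborel)"
 proof -
  have m: "(%x. f (?t x)) : bmeas lborel" using measurable_compose[OF tam f] by simp
  have "(\<integral>\<^sup>+y. f y \<partial>distr (density lborel ?D) borel ?t) = (\<integral>\<^sup>+x. f (?t x) \<partial>density lborel ?D)"
   by (rule nn_integral_distr) auto
  also have "... = (\<integral>\<^sup>+x. ?D x * f (?t x) \<partial>lborel)"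
   by (rule nn_integral_density[OF _ m]) (use Dm in simp)
  finally show ?thesis unfolding eq .
 qed
 also have "... = (\<integral>\<^sup>+x. f (ta x) * ennreal \<bar>det (matrix (ta' x))\<bar> * ind S x \<partial>lborel)"
  by (intro nn_integral_cong) (auto simp: indicator_def mult.commute)
 finally show ?thesis .
qed

section \<open>Charts of a closed manifold and its Riemannian measure\<close>

locale closed_manifold =
 fixes A :: "('m::{t2_space,second_countable_topology}, 'd::finite) chart set"
 assumes mfd: "closed_oriented_manifold A"
begin

lemma compact_UNIV: "compact (UNIV :: 'm set)"
 using mfd by (simp add: closed_oriented_manifold_def)

lemma is_chart: "c : A ==> is_chart c"
 using mfd by (simp add: closed_oriented_manifold_def oriented_smooth_atlas_def)

lemma cover: "EX c:A. p : fst c"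
 using mfd by (auto simp: closed_oriented_manifold_def oriented_smooth_atlas_def)

lemma open_dom: "c : A ==> open (fst c)" and open_image: "c : A ==> open (cimg c)"
 using is_chart[of c] by (auto simp: is_chart_def)

lemma homeo: "c : A ==> homeomorphism (fst c) (cimg c) (snd c) (chart_inv c)"
 using is_chart[of c] by (auto simp: is_chart_def)

lemma inv_coord[simp]: "c : A ==> p : fst c ==> chart_inv c (snd c p) = p"
 and coord_in[simp]: "c : A ==> p : fst c ==> snd c p : cimg c"
 and coord_inv[simp]: "c : A ==> y : cimg c ==> snd c (chart_inv c y) = y"
 and inv_in[simp]: "c : A ==> y : cimg c ==> chart_inv c y : fst c"
 using homeo[of c] by (auto simp: homeomorphism_def)

lemma cont_coord: "c : A ==> continuous_on (fst c) (snd c)"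
 and cont_inv: "c : A ==> continuous_on (cimg c) (chart_inv c)"
 using homeo[of c] by (auto simp: homeomorphism_def)

lemma coord_image: "c : A ==> B \<subseteq> fst c ==> snd c ` B = {y : cimg c. chart_inv c y : B}"
proof (intro set_eqI iffI)
 fix y assume "c : A" "B \<subseteq> fst c" "y : {y : cimg c. chart_inv c y : B}"
 thus "y : snd c ` B" by (intro image_eqI[of _ _ "chart_inv c y"]) auto
qed auto

lemma open_coord_image:
 assumes "c : A" "open B" "B \<subseteq> fst c"
 shows "open (snd c ` B)"
proof -
 have "snd c ` B = cimg c Int chart_inv c -` B"
  using coord_image[OF assms(1,3)] by auto
 moreover have "open (cimg c Int chart_inv c -` B)"
  using cont_inv[OF assms(1)] open_image[OF assms(1)] assms(2)
  by (auto simp: continuous_on_open_vimage Int_commute)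
 ultimately show ?thesis by simp
qed

lemma open_inv_image:
 assumes "c : A" "open V" "V \<subseteq> cimg c"
 shows "open (chart_inv c ` V)"
proof -
 have "chart_inv c ` V = fst c Int snd c -` V"
  using assms by (auto simp: image_iff) (metis inv_coord)
 moreover have "open (fst c Int snd c -` V)"
  using cont_coord[OF assms(1)] open_dom[OF assms(1)] assms(2)
  by (auto simp: continuous_on_open_vimage Int_commute)
 ultimately show ?thesis by simp
qed

lemma transition_coord: "c1 : A ==> p : fst c1 ==> transition c1 c2 (snd c1 p) = snd c2 p"
 by (simp add: transition_def)

lemma open_overlap: "c1 : A ==> c2 : A ==> open (snd c1 ` (fst c1 Int fst c2))"
 by (rule open_coord_image) (auto intro: open_dom)

lemma transition_derivative:
 assumes "c1 : A" "c2 : A" "y : snd c1 ` (fst c1 Int fst c2)"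
 shows "(transition c1 c2 has_derivative frechet_derivative (transition c1 c2) (at y)) (at y)"
proof -
 have "smooth_on (snd c1 ` (fst c1 Int fst c2)) (transition c1 c2)"
  using mfd assms by (auto simp: closed_oriented_manifold_def oriented_smooth_atlas_def)
 hence "ck_on (Suc 0) (snd c1 ` (fst c1 Int fst c2)) (transition c1 c2)"
  unfolding smooth_on_def by blast
 thus ?thesis using assms(3) by (auto simp: frechet_derivative_works)
qed

lemma transition_derivative_continuous:
 assumes "c1 : A" "c2 : A"
 shows "continuous_on (snd c1 ` (fst c1 Int fst c2)) (%y. frechet_derivative (transition c1 c2) (at y) v)"
proof -
 have "smooth_on (snd c1 ` (fst c1 Int fst c2)) (transition c1 c2)"
  using mfd assms by (auto simp: closed_oriented_manifold_def oriented_smooth_atlas_def)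
 hence "ck_on (Suc 0) (snd c1 ` (fst c1 Int fst c2)) (transition c1 c2)"
  unfolding smooth_on_def by blast
 thus ?thesis by simp
qed

lemma jac_mult:
 assumes "c1 : A" "c2 : A" "p : fst c1 Int fst c2"
 shows "jac c1 c2 p *v v = frechet_derivative (transition c1 c2) (at (snd c1 p)) v"
proof -
 have "linear (frechet_derivative (transition c1 c2) (at (snd c1 p)))"
  using assms(3) by (intro has_derivative_linear[OF transition_derivative[OF assms(1,2)]]) auto
 hence "Vector_Spaces.linear (*s) (*s) (frechet_derivative (transition c1 c2) (at (snd c1 p)))"
  by (simp add: linear_def scalar_mult_eq_scaleR[abs_def])
 from matrix_works[OF this] show ?thesis by (simp add: jac_def)
qed

lemma det_jac_pos: "c1 : A ==> c2 : A ==> p : fst c1 Int fst c2 ==> det (jac c1 c2 p) > 0"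
 using mfd by (auto simp: closed_oriented_manifold_def oriented_smooth_atlas_def)

lemma finite_cover:
 obtains C where "C \<subseteq> A" "finite C" "(UN c:C. fst c) = UNIV"
proof -
 have "UNIV \<subseteq> (UN c:A. fst c)" using cover by auto
 from compactE_image[OF compact_UNIV open_dom this] obtain C where "C \<subseteq> A" "finite C" "UNIV \<subseteq> (UN c:C. fst c)" by metis
 thus ?thesis using that[of C] by auto
qed

text \<open>\<open>chart_inv\<close> made constant outside the chart image, so that it is Borel on
  the whole space. The constant does no harm because the densities paired with it vanish
  there.\<close>

definition inv0 :: "('m, 'd) chart => real^'d => 'm" where
 "inv0 c y = (if y : cimg c then chart_inv c y else undefined)"

lemma inv0_measurable[measurable]: "c : A ==> inv0 c : borel -M> borel"
 unfolding inv0_def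
 by (intro bmeas_cont_if borel_open open_image cont_inv continuous_on_const)

lemma coord_image_borel: "c : A ==> B : sets borel ==> B \<subseteq> fst c ==> snd c ` B : sets borel"
proof -
 assume *: "c : A" "B : sets borel" "B \<subseteq> fst c"
 have "snd c ` B = cimg c Int (inv0 c -` B Int space borel)"
  using coord_image[OF *(1,3)] by (auto simp: inv0_def)
 thus ?thesis using * measurable_sets[OF inv0_measurable *(2)] open_image by auto
qed

lemma dom_borel[measurable]: "c : A ==> fst c : sets borel"
 by (rule borel_open) (rule open_dom)

lemma image_borel[measurable]: "c : A ==> cimg c : sets borel"
 by (rule borel_open) (rule open_image)

end

locale riemannian_manifold = closed_manifold A for A :: "('m::{t2_space,second_countable_topology}, 'd::finite) chart set" +
 fixes G :: "('m, 'd) mfield"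
 assumes metric: "is_riemannian_metric A G"
  and metric_cont: "!!c. c : A ==> continuous_on (cimg c) (%y. G c (chart_inv c y))"
begin

lemma det_metric_pos: "c : A ==> p : fst c ==> det (G c p) > 0"
 using metric unfolding is_riemannian_metric_def by (intro det_pos_of_posdef) blast

lemma vol_density_pos: "c : A ==> p : fst c ==> vol_density G c p > 0"
 using det_metric_pos by (simp add: vol_density_def)

text \<open>No absolute value appears around the Jacobian determinant: it is positive because the
  atlas is oriented.\<close>

lemma vol_density_transform:
 assumes "c1 : A" "c2 : A" "p : fst c1 Int fst c2"
 shows "vol_density G c1 p = det (jac c1 c2 p) * vol_density G c2 p"
proof -
 have "G c1 p = transpose (jac c1 c2 p) ** G c2 p ** jac c1 c2 p"
  using metric assms unfolding is_riemannian_metric_def by blast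
 hence "det (G c1 p) = (det (jac c1 c2 p))\<^sup>2 * det (G c2 p)"
  by (simp add: det_mul power2_eq_square)
 thus ?thesis
  using det_jac_pos[OF assms] by (simp add: vol_density_def real_sqrt_mult)
qed

definition w :: "('m, 'd) chart => real^'d => real" where
 "w c y = (if y : cimg c then vol_density G c (chart_inv c y) else 0)"

lemma w_continuous: "c : A ==> continuous_on (cimg c) (w c)"
proof -
 assume c: "c : A"
 have "continuous_on (cimg c) (%y. sqrt (det (G c (chart_inv c y))))"
  unfolding det_def using metric_cont[OF c] by (intro continuous_intros) auto
 thus ?thesis by (rule continuous_on_eq) (simp add: w_def vol_density_def)
qed

lemma w_nonneg: "c : A ==> w c y >= 0"
 using vol_density_pos[of c] by (auto simp: w_def intro: less_imp_le)

lemma w_measurable[measurable]: "c : A ==> w c : bmeas borel"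
proof -
 assume c: "c : A"
 have "(%y. if y : cimg c then w c y else 0) : bmeas borel"
  using c by (intro bmeas_cont_if borel_open open_image w_continuous continuous_on_const)
 moreover have "(%y. if y : cimg c then w c y else 0) = w c" by (auto simp: w_def fun_eq_iff)
 ultimately show ?thesis by simp
qed

definition vol :: "('m, 'd) chart => 'm measure" where
 "vol c = distr (density lborel (%y. ennreal (w c y))) borel (inv0 c)"

lemma vol_sets[simp, measurable_cong]: "sets (vol c) = sets borel" by (simp add: vol_def)

lemma emeasure_vol:
 assumes c: "c : A" and B: "B : sets borel"
 shows "emeasure (vol c) B = (\<integral>\<^sup>+y\<in>snd c ` (B Int fst c). ennreal (vol_density G c (chart_inv c y)) \<partial>lborel)"
proof -
 note [measurable] = inv0_measurable[OF c] w_measurable[OF c] B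
 have "emeasure (vol c) B = emeasure (density lborel (%y. ennreal (w c y))) (inv0 c -` B Int space lborel)"
  unfolding vol_def by (subst emeasure_distr) auto
 also have "... = (\<integral>\<^sup>+y. ennreal (w c y) * ind (inv0 c -` B Int space lborel) y \<partial>lborel)"
  by (rule emeasure_density) measurable
 also have "... = (\<integral>\<^sup>+y\<in>snd c ` (B Int fst c). ennreal (vol_density G c (chart_inv c y)) \<partial>lborel)"
  using coord_image[OF c, of "B Int fst c"] inv_in[OF c]
  by (intro nn_integral_cong) (auto simp: w_def inv0_def indicator_def)
 finally show ?thesis .
qed

text \<open>Change of variables by the transition map: the Jacobian it produces is exactly the
  factor by which the two densities differ.\<close>

lemma vol_compatible:
 assumes c: "c1 : A" "c2 : A" and B: "B : sets borel" "B \<subseteq> fst c1 Int fst c2"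
 shows "emeasure (vol c1) B = emeasure (vol c2) B"
proof -
 define ta where "ta = transition c1 c2"
 define S where "S = snd c1 ` B"
 have S: "S : sets borel" unfolding S_def using c B by (intro coord_image_borel) auto
 have inv_S: "chart_inv c1 y : B" if "y : S" for y using that c B by (auto simp: S_def)
 have ta_eq: "ta y = snd c2 (chart_inv c1 y)" for y by (simp add: ta_def transition_def)
 have ta_im: "ta ` C = snd c2 ` (chart_inv c1 ` C)" for C by (simp add: ta_eq[abs_def] image_image)
 have taS: "ta ` S = snd c2 ` B"
  unfolding S_def image_image using c B by (intro image_cong) (auto simp: ta_eq)
 have sub: "S \<subseteq> snd c1 ` (fst c1 Int fst c2)" using B by (auto simp: S_def)
 have ta_cont: "continuous_on S ta"
  using transition_derivative[OF c] sub has_derivative_continuous unfolding ta_def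
  by (intro continuous_at_imp_continuous_on) blast
 have jac_eq: "det (matrix (frechet_derivative ta (at y))) = det (jac c1 c2 (chart_inv c1 y))" if "y : S" for y
  using that c B inv_S[OF that] by (auto simp: jac_def ta_def S_def)
 have w_eq: "w c1 y = det (jac c1 c2 (chart_inv c1 y)) * w c2 (ta y)" if "y : S" for y
 proof -
  have p: "chart_inv c1 y : fst c1 Int fst c2" using inv_S[OF that] B by auto
  have "y : cimg c1" using that B c by (auto simp: S_def)
  thus ?thesis using vol_density_transform[OF c p] p c by (simp add: w_def ta_eq)
 qed
 have cont_det: "continuous_on S (%y. det (matrix (frechet_derivative ta (at y))))"
 proof -
  have "continuous_on S (%y. frechet_derivative ta (at y) v)" for v
   unfolding ta_def by (rule continuous_on_subset[OF transition_derivative_continuous[OF c] sub])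
  thus ?thesis unfolding det_def matrix_def by (intro continuous_intros) auto
 qed
 have "emeasure (vol c2) B = (\<integral>\<^sup>+y. ennreal (w c2 y) * ind (ta ` S) y \<partial>lborel)"
  unfolding emeasure_vol[OF c(2) B(1)] taS using B c
  by (intro nn_integral_cong) (auto simp: w_def indicator_def Int_absorb2)
 also have "... = (\<integral>\<^sup>+y. ennreal (w c2 (ta y)) * ennreal \<bar>det (matrix (frechet_derivative ta (at y)))\<bar> * ind S y \<partial>lborel)"
 proof (rule nn_integral_differentiable_image[OF S])
  show "ta ` C : sets borel" if C: "C : sets borel" "C \<subseteq> S" for C
  proof -
   have "S \<subseteq> cimg c1" using B c by (auto simp: S_def)
   with C(2) have "C \<subseteq> cimg c1" by (rule subset_trans)
   hence "chart_inv c1 ` C = {p : fst c1. snd c1 p : C}"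
    using c by (auto simp: image_iff) (metis inv_coord)
   also have "... = fst c1 Int ((%p. if p : fst c1 then snd c1 p else 0) -` C Int space borel)" by auto
   also have "... : sets borel"
    using measurable_sets[OF bmeas_cont_if[OF borel_open[OF open_dom[OF c(1)]] cont_coord[OF c(1)] continuous_on_const, of 0] C(1)]
     dom_borel[OF c(1)] by auto
   finally have 1: "chart_inv c1 ` C : sets borel" .
   have 2: "chart_inv c1 ` C \<subseteq> fst c2" using C(2) inv_S B(2) by blast
   show ?thesis unfolding ta_im by (rule coord_image_borel[OF c(2) 1 2])
  qed
  show "inj_on ta S"
  proof (rule inj_onI)
   fix x y assume xy: "x : S" "y : S" "ta x = ta y"
   then obtain p q where pq: "p : B" "q : B" "x = snd c1 p" "y = snd c1 q" by (auto simp: S_def)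
   have mem: "p : fst c1" "q : fst c1" "p : fst c2" "q : fst c2" using pq(1,2) B(2) by auto
   have "snd c2 p = snd c2 q" using xy(3) c mem by (simp add: ta_eq pq(3,4))
   hence "p = q" using inv_coord[OF c(2)] mem by metis
   thus "x = y" using pq by simp
  qed
  show "(ta has_derivative frechet_derivative ta (at x)) (at x)" if "x : S" for x
   using transition_derivative[OF c, of x] that sub by (auto simp: ta_def)
  show "(%x. if x : S then ta x else 0) : borel -M> borel"
   by (rule bmeas_cont_if[OF S ta_cont]) simp
  have "(%x. if x : S then abs (det (matrix (frechet_derivative ta (at x)))) else 0) : borel -M> borel"
   by (rule bmeas_cont_if[OF S]) (use cont_det in \<open>auto intro!: continuous_intros\<close>)
  moreover have "(%x. if x : S then abs (det (matrix (frechet_derivative ta (at x)))) else 0) = (%x. ind S x * abs (det (matrix (frechet_derivative ta (at x)))))"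
   by (auto simp: indicator_def fun_eq_iff)
  ultimately show "(%x. ind S x * abs (det (matrix (frechet_derivative ta (at x))))) : bmeas borel" by simp
  show "(%y. ennreal (w c2 y)) : bmeas borel" using w_measurable[OF c(2)] by measurable
 qed
 also have "... = (\<integral>\<^sup>+y. ennreal (w c1 y) * ind S y \<partial>lborel)"
 proof (intro nn_integral_cong)
  fix y :: "real^'d"
  show "ennreal (w c2 (ta y)) * ennreal \<bar>det (matrix (frechet_derivative ta (at y)))\<bar> * ind S y = ennreal (w c1 y) * ind S y"
  proof (cases "y : S")
   case True
   have "det (jac c1 c2 (chart_inv c1 y)) > 0" using inv_S[OF True] B c by (intro det_jac_pos) auto
   thus ?thesis using True w_eq[OF True] w_nonneg[OF c(2)] by (simp add: jac_eq ennreal_mult[symmetric] mult.commute)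
  qed simp
 qed
 also have "... = emeasure (vol c1) B"
  unfolding emeasure_vol[OF c(1) B(1)] S_def using B c
  by (intro nn_integral_cong) (auto simp: w_def indicator_def Int_absorb2)
 finally show ?thesis by simp
qed

definition is_vol :: "'m measure => bool" where
 "is_vol mu \<longleftrightarrow> sets mu = sets borel & (ALL c:A. ALL B:sets borel. B \<subseteq> fst c --> emeasure mu B = emeasure (vol c) B)"

text \<open>A finite subcover is made disjoint, and the measure adds up the chart measures on the
  pieces \<open>D i\<close>. Compatibility on overlaps shows that it restricts correctly to every
  chart of the atlas; any other candidate has the same values on the pieces, hence
  everywhere.\<close>

lemma ex1_vol: "EX! mu. is_vol mu"
proof -
 obtain C where C: "C \<subseteq> A" "finite C" "(UN c:C. fst c) = UNIV" by (rule finite_cover)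
 obtain cs where cs: "set cs = C" "distinct cs" using finite_distinct_list[OF C(2)] by auto
 define n where "n = length cs"
 define D where "D i = fst (cs ! i) - (\<Union>j<i. fst (cs ! j))" for i
 have csA: "cs ! i : A" if "i < n" for i using that cs C(1) nth_mem by (auto simp: n_def)
 have DB[measurable]: "D i : sets borel" if "i < n" for i
  unfolding D_def using that csA by (intro sets.Diff sets.finite_UN dom_borel) auto
 have Dsub: "D i \<subseteq> fst (cs ! i)" for i by (auto simp: D_def)
 have Ddisj: "disjoint_family_on D {..<n}"
  unfolding disjoint_family_on_def D_def by (auto dest: nat_neq_iff[THEN iffD1])
 have Dun: "(\<Union>i<n. D i) = UNIV"
 proof -
  have "EX i<n. p : D i" for p
  proof -
   obtain c where "c : C" "p : fst c" using C(3) by blast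
   then obtain i0 where "i0 < n" "p : fst (cs ! i0)" using cs by (auto simp: n_def in_set_conv_nth)
   hence ex: "EX i. i < n & p : fst (cs ! i)" by blast
   define i where "i = (LEAST i. i < n & p : fst (cs ! i))"
   have i: "i < n" "p : fst (cs ! i)" using LeastI_ex[OF ex] by (auto simp: i_def)
   have "p ~: fst (cs ! j)" if "j < i" for j using not_less_Least[OF that[unfolded i_def]] that i(1) by auto
   thus ?thesis using i by (auto simp: D_def)
  qed
  thus ?thesis by auto
 qed
 have decomp: "emeasure mu B = (\<Sum>i<n. emeasure mu (B Int D i))" if "sets mu = sets borel" "B : sets borel" for mu B
 proof -
  have "emeasure mu (UN i:{..<n}. B Int D i) = (\<Sum>i<n. emeasure mu (B Int D i))"
   by (rule sum_emeasure[symmetric])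
    (use that DB Ddisj in \<open>auto simp: disjoint_family_on_def\<close>)
  moreover have "(UN i:{..<n}. B Int D i) = B" using Dun by auto
  ultimately show ?thesis by simp
 qed
 define f where "f B = (\<Sum>i<n. emeasure (vol (cs ! i)) (B Int D i))" for B
 define mu where "mu = measure_of UNIV (sets borel) f"
 have smu: "sets mu = sets borel" unfolding mu_def by (simp add: sets_measure_of_conv) (metis sets.sigma_sets_eq space_borel)
 have emu: "emeasure mu B = f B" if "B : sets borel" for B
 proof (rule emeasure_measure_of[OF mu_def])
  show "positive (sets mu) f" by (simp add: positive_def f_def)
  show "countably_additive (sets mu) f"
  proof (rule countably_additiveI)
   fix X :: "nat => 'm set" assume X: "range X \<subseteq> sets mu" "disjoint_family X" "(\<Union>i. X i) : sets mu"
   have "(\<Sum>k. f (X k)) = (\<Sum>i<n. \<Sum>k. emeasure (vol (cs ! i)) (X k Int D i))"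
    unfolding f_def by (rule suminf_sum) simp
   also have "... = (\<Sum>i<n. emeasure (vol (cs ! i)) (\<Union>k. X k Int D i))"
   proof (intro sum.cong refl suminf_emeasure)
    fix i assume "i : {..<n}"
    thus "range (%k. X k Int D i) \<subseteq> sets (vol (cs ! i))" using X DB by (auto simp: smu)
    show "disjoint_family (%k. X k Int D i)" using X(2) by (auto simp: disjoint_family_on_def)
   qed
   finally show "(\<Sum>k. f (X k)) = f (\<Union>k. X k)" by (simp add: f_def)
  qed
 qed (use that smu in auto)
 show ?thesis
 proof (rule ex1I[of _ mu])
  show "is_vol mu"
   unfolding is_vol_def
  proof (intro conjI ballI impI smu)
   fix c B assume c: "c : A" and B: "B : sets borel" "B \<subseteq> fst c"
   have "emeasure mu B = (\<Sum>i<n. emeasure (vol c) (B Int D i))"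
    unfolding emu[OF B(1)] f_def
    by (intro sum.cong refl vol_compatible csA) (use c B DB Dsub in auto)
   also have "... = emeasure (vol c) B" by (rule decomp[symmetric]) (use B in auto)
   finally show "emeasure mu B = emeasure (vol c) B" .
  qed
  fix mu' assume v: "is_vol mu'"
  show "mu' = mu"
  proof (rule measure_eqI)
   show "sets mu' = sets mu" using v smu by (simp add: is_vol_def)
   fix B assume "B : sets mu'"
   hence B: "B : sets borel" using v by (simp add: is_vol_def)
   have "emeasure mu' B = (\<Sum>i<n. emeasure mu' (B Int D i))" using v B by (intro decomp) (auto simp: is_vol_def)
   also have "... = f B" unfolding f_def
    using v csA B DB Dsub unfolding is_vol_def by (intro sum.cong refl) (metis (no_types, lifting) inf.coboundedI2 lessThan_iff sets.Int)
   finally show "emeasure mu' B = emeasure mu B" using emu[OF B] by simp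
  qed
 qed
qed

definition mu :: "'m measure" where "mu = (THE mu. is_vol mu)"

lemma is_vol_mu: "is_vol mu"
 unfolding mu_def by (rule theI'[OF ex1_vol])

lemma mu_sets[simp, measurable_cong]: "sets mu = sets borel" and mu_space[simp]: "space mu = UNIV"
 using is_vol_mu sets_eq_imp_space_eq[of mu borel] by (auto simp: is_vol_def)

lemma riem_volume_eq: "riem_volume A G = completion mu"
proof -
 have "is_vol M \<longleftrightarrow> sets M = sets borel & (ALL c:A. ALL B:sets borel. B \<subseteq> fst c -->
    emeasure M B = (\<integral>\<^sup>+y\<in>snd c ` B. ennreal (vol_density G c (chart_inv c y)) \<partial>lborel))" for M
  unfolding is_vol_def by (auto simp: emeasure_vol Int_absorb2)
 hence "is_vol = (%M. sets M = sets borel & (ALL c:A. ALL B:sets borel. B \<subseteq> fst c -->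
    emeasure M B = (\<integral>\<^sup>+y\<in>snd c ` B. ennreal (vol_density G c (chart_inv c y)) \<partial>lborel)))"
  by (intro ext)
 thus ?thesis by (simp only: riem_volume_def mu_def)
qed

lemma mu_chart:
 assumes c: "c : A"
 shows "density mu (ind (fst c)) = vol c"
proof (rule measure_eqI)
 fix B assume "B : sets (density mu (ind (fst c)))"
 hence B[measurable]: "B : sets borel" by simp
 note [measurable] = dom_borel[OF c]
 have "emeasure (density mu (ind (fst c))) B = emeasure mu (fst c Int B)"
  by (simp add: emeasure_density indicator_inter_arith[symmetric])
 also have "... = emeasure (vol c) (fst c Int B)"
  using is_vol_mu c by (auto simp: is_vol_def)
 also have "... = emeasure (vol c) B"
  using c by (simp add: emeasure_vol Int_ac)
 finally show "emeasure (density mu (ind (fst c))) B = emeasure (vol c) B" .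
qed simp

lemma mu_integral_chart:
 fixes f :: "'m => real"
 assumes c: "c : A" and f[measurable]: "f : bmeas borel" and out: "!!p. p ~: fst c ==> f p = 0"
 shows "(LINT p|mu. f p) = (LINT y|lborel. w c y * f (inv0 c y))"
  and "integrable mu f \<longleftrightarrow> integrable lborel (%y. w c y * f (inv0 c y))"
proof -
 note [measurable] = dom_borel[OF c] w_measurable[OF c] inv0_measurable[OF c]
 have ind: "ind (fst c) = (%p. ennreal (ind (fst c) p))" by (auto simp: fun_eq_iff indicator_def)
 have eq: "ind (fst c) p * f p = f p" for p using out by (auto simp: indicator_def)
 have "(LINT p|density mu (ind (fst c)). f p) = (LINT p|mu. f p)"
  unfolding ind by (subst integral_density) (auto simp: eq)
 moreover have "(LINT p|vol c. f p) = (LINT y|lborel. w c y * f (inv0 c y))"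
  unfolding vol_def using w_nonneg[OF c] by (subst integral_distr) (auto simp: integral_density)
 ultimately show "(LINT p|mu. f p) = (LINT y|lborel. w c y * f (inv0 c y))" unfolding mu_chart[OF c] by simp
 have "integrable (density mu (ind (fst c))) f \<longleftrightarrow> integrable mu f"
  unfolding ind by (subst integrable_density) (auto simp: eq)
 moreover have "integrable (vol c) f \<longleftrightarrow> integrable lborel (%y. w c y * f (inv0 c y))"
  unfolding vol_def using w_nonneg[OF c] by (subst integrable_distr_eq) (auto simp: integrable_density)
 ultimately show "integrable mu f \<longleftrightarrow> integrable lborel (%y. w c y * f (inv0 c y))" unfolding mu_chart[OF c] by simp
qed

text \<open>The density is bounded on a compact ball in each chart, and finitely many such balls
  cover the compact manifold.\<close>

lemma finite_mu: "finite_measure mu"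
proof
 have "EX N. open N & p : N & emeasure mu N < \<infinity>" for p
 proof -
  obtain c where c: "c : A" "p : fst c" using cover[of p] by blast
  then obtain r where r: "r > 0" "cball (snd c p) r \<subseteq> cimg c"
   using open_image[OF c(1)] coord_in[OF c] open_contains_cball by blast
  have "bounded (w c ` cball (snd c p) r)"
   using w_continuous[OF c(1)] r by (intro compact_imp_bounded compact_continuous_image) (auto intro: continuous_on_subset)
  then obtain C where C: "!!y. y : cball (snd c p) r ==> abs (w c y) <= C"
   unfolding bounded_iff real_norm_def by blast
  define O' where "O' = chart_inv c ` ball (snd c p) r"
  have sub: "ball (snd c p) r \<subseteq> cimg c" using r ball_subset_cball by blast
  have op: "open O'" unfolding O'_def by (rule open_inv_image[OF c(1) _ sub]) simp
  have pO: "p : O'" unfolding O'_def using c r(1) by (intro image_eqI[of _ _ "snd c p"]) auto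
  have O'c: "O' \<subseteq> fst c" using sub c by (auto simp: O'_def)
  have im: "snd c ` O' = ball (snd c p) r" unfolding O'_def image_image using sub c by (force simp: image_iff)
  have "emeasure mu O' = emeasure (vol c) O'" using is_vol_mu c op O'c by (auto simp: is_vol_def intro: borel_open)
  also have "... = (\<integral>\<^sup>+y\<in>ball (snd c p) r. ennreal (vol_density G c (chart_inv c y)) \<partial>lborel)"
   using op O'c c by (simp add: emeasure_vol borel_open Int_absorb2 im)
  also have "... <= (\<integral>\<^sup>+y. ennreal C * ind (ball (snd c p) r) y \<partial>lborel)"
  proof (rule nn_integral_mono)
   fix y :: "real^'d"
   show "ennreal (vol_density G c (chart_inv c y)) * ind (ball (snd c p) r) y <= ennreal C * ind (ball (snd c p) r) y"
   proof (cases "y : ball (snd c p) r")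
    case True
    hence "w c y <= C" using C[of y] ball_subset_cball by fastforce
    thus ?thesis using True sub by (auto simp: w_def intro!: ennreal_leI)
   qed simp
  qed
  also have "... = ennreal C * emeasure lborel (ball (snd c p) r)" by (rule nn_integral_cmult_indicator) simp
  also have "... < \<infinity>" using emeasure_lborel_ball_finite[of "snd c p" r] by (simp add: ennreal_mult_less_top)
  finally show ?thesis using op pO by blast
 qed
 then obtain N where N: "!!p. open (N p)" "!!p. p : N p" "!!p. emeasure mu (N p) < \<infinity>" by metis
 obtain I where I: "finite I" "UNIV \<subseteq> (UN p:I. N p)"
  using compactE_image[OF compact_UNIV, of UNIV N] N by (metis UNIV_I UN_iff subsetI)
 have "emeasure mu (space mu) <= emeasure mu (UN p:I. N p)" using I N by (intro emeasure_mono) (auto intro: borel_open)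
 also have "... <= (SUM p:I. emeasure mu (N p))" using I N by (intro emeasure_subadditive_finite) (auto intro: borel_open)
 also have "... < \<infinity>" using I N by (simp add: ennreal_sum_less_top)
 finally show "emeasure mu (space mu) ~= \<infinity>" by simp
qed

end

section \<open>Divergence in charts\<close>

lemma sum_Basis_cart: "(SUM b:(Basis::(real^'n::finite) set). h b) = (SUM i:UNIV. h (axis i 1))"
 for h :: "real^'n => 'b::comm_monoid_add"
proof -
 have B: "(Basis::(real^'n) set) = (%i. axis i 1) ` UNIV" by (auto simp: Basis_vec_def)
 have inj: "inj (%i::'n. axis i (1::real))" by (auto simp: inj_def axis_eq_axis)
 show ?thesis unfolding B by (subst sum.reindex[OF inj]) (simp add: o_def)
qed

text \<open>A canonical representative: gradients found on two overlapping open sets become the same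
  function, so that \<open>has_grad_Un\<close> can glue them.\<close>

definition gradient :: "('a::euclidean_space => real) => 'a => 'a" where
 "gradient f z = (SUM b:Basis. frechet_derivative f (at z) b *. b)"

lemma gradient_eqI:
 assumes "(f has_derivative (%h. d .* h)) (at z)"
 shows "gradient f z = d"
proof -
 have "frechet_derivative f (at z) = (%h. d .* h)" using frechet_derivative_at[OF assms] by simp
 thus ?thesis by (simp add: gradient_def euclidean_representation)
qed

lemma has_grad_gradient: "has_grad f df S ==> has_grad f (gradient f) S"
 by (rule has_grad_cong_gradient, assumption) (auto dest: has_gradD intro: gradient_eqI[symmetric])

text \<open>\<open>V\<close> lives on \<open>S\<close> only, but each product
  \<open>ph z * (V z .* b)\<close> extends by zero to the whole space, where its derivative in the
  direction \<open>b\<close> integrates to 0.\<close>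

lemma integration_by_parts:
 fixes V :: "'e::euclidean_space => 'e"
 assumes S: "open S" and V: "!!b. b : Basis ==> has_grad (%z. V z .* b) (dV b) S"
  and ph: "has_grad ph dph S" and K: "compact K" "K \<subseteq> S" "!!z. z : S ==> z ~: K ==> ph z = 0"
 shows "integrable lborel (%z. ind S z * (ph z * (SUM b:Basis. dV b z .* b) + dph z .* V z))"
  and "(LINT z|lborel. ind S z * (ph z * (SUM b:Basis. dV b z .* b) + dph z .* V z)) = 0"
proof -
 define dH where "dH b z = (if z : K then (V z .* b) *. dph z + ph z *. dV b z else 0)" for b z
 have H: "integrable lborel (%z. dH b z .* b)" "(LINT z|lborel. dH b z .* b) = 0" if b: "b : Basis" for b
 proof -
  have "has_grad (%z. if z : S then ph z * (V z .* b) else 0) (dH b) UNIV"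
   unfolding dH_def
   by (rule has_grad_extend_zero[OF has_grad_mult[OF ph V[OF b]] S compact_imp_closed[OF K(1)] K(2)])
    (use K(3) in auto)
  from integral_gradient_zero[OF this K(1)] K(2,3)
  show "integrable lborel (%z. dH b z .* b)" "(LINT z|lborel. dH b z .* b) = 0" by auto
 qed
 have dph0: "dph z = 0" if "z : S" "z ~: K" for z
  by (rule gradient_eq_0[OF has_gradD[OF ph that(1)], of "S - K"])
   (use that S K compact_imp_closed in auto)
 have eq: "ind S z * (ph z * (SUM b:Basis. dV b z .* b) + dph z .* V z) = (SUM b:Basis. dH b z .* b)" for z
 proof (cases "z : K")
  case True
  have "(SUM b:Basis. (V z .* b) * (dph z .* b)) = dph z .* V z"
   by (subst euclidean_inner) (simp add: mult.commute)
  thus ?thesis using True K(2)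
   by (auto simp: dH_def inner_add_left sum.distrib sum_distrib_left)
 next
  case False
  thus ?thesis using K(3)[of z] dph0[of z] by (auto simp: dH_def indicator_def)
 qed
 show "integrable lborel (%z. ind S z * (ph z * (SUM b:Basis. dV b z .* b) + dph z .* V z))"
  unfolding eq by (intro lint_i_sum H)
 show "(LINT z|lborel. ind S z * (ph z * (SUM b:Basis. dV b z .* b) + dph z .* V z)) = 0"
  unfolding eq using H by (simp add: lint_sum)
qed

lemma has_grad_loc_lipschitz:
 assumes f: "has_grad f df S" and S: "open S"
 shows "loc_lipschitz_on S f"
 unfolding loc_lipschitz_on_def
proof
 fix z assume z: "z : S"
 obtain r where r: "r > 0" "cball z r \<subseteq> S" using S z open_contains_cball by blast
 have "bounded (df ` cball z r)"
  using has_grad_continuous_grad[OF f] r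
  by (intro compact_imp_bounded compact_continuous_image) (auto intro: continuous_on_subset)
 then obtain L where L: "!!x. x : cball z r ==> norm (df x) <= L" unfolding bounded_iff by blast
 have L0: "0 <= L" using order_trans[OF norm_ge_zero L[of z]] r(1) by simp
 have "L-lipschitz_on (S Int ball z r) f"
 proof (rule lipschitz_onI)
  fix x y assume xy: "x : S Int ball z r" "y : S Int ball z r"
  have "abs (f x - f y) <= L * norm (x - y)"
   by (rule has_grad_lipschitz[OF has_grad_subset[OF f r(2)] convex_cball L]) (use xy in auto)
  thus "dist (f x) (f y) <= L * dist x y" by (simp add: dist_real_def dist_norm)
 qed (rule L0)
 thus "EX r>0. EX L. L-lipschitz_on (S Int ball z r) f" using r(1) by blast
qed

lemma loc_lipschitz_on_subset: "loc_lipschitz_on S f ==> T \<subseteq> S ==> loc_lipschitz_on T f"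
 unfolding loc_lipschitz_on_def by (meson Int_mono lipschitz_on_subset order_refl subsetD)

section \<open>Chart functions extended to the manifold\<close>

context closed_manifold
begin

lemma chart_at: "chart_at A p : A" "p : fst (chart_at A p)"
proof -
 have "EX c. c : A & p : fst c" using cover by blast
 from someI_ex[OF this] show "chart_at A p : A" "p : fst (chart_at A p)" by (auto simp: chart_at_def)
qed

definition lift :: "('m, 'd) chart => ((real^'d)*real => real) => 'm => real => real" where
 "lift c ps p t = (if p : fst c then ps (snd c p, t) else 0)"

context
 fixes c :: "('m, 'd) chart" and ps :: "(real^'d)*real => real" and dps K
 assumes c: "c : A" and ps: "has_grad ps dps UNIV" and K: "compact K" "K \<subseteq> cimg c"
  and out: "!!y t. y ~: K ==> ps (y, t) = 0"
begin

lemma closed_support: "closed (chart_inv c ` K)"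
proof -
 have "compact (chart_inv c ` K)"
  using cont_inv[OF c] K by (intro compact_continuous_image) (auto intro: continuous_on_subset)
 thus ?thesis by (rule compact_imp_closed)
qed

lemma lift_outside: "p ~: chart_inv c ` K ==> lift c ps p t = 0"
 using out[of "snd c p"] c by (force simp: lift_def image_iff)

lemma transition_derivative_time:
 assumes c': "c' : A" and z: "z : (snd c' ` (fst c' Int fst c)) <*> UNIV"
 shows "((%z. (transition c' c (fst z), snd z)) has_derivative
   (%h. (frechet_derivative (transition c' c) (at (fst z)) (fst h), snd h))) (at z)"
proof -
 have "((%z. fst z) has_derivative fst) (at z)" by (auto intro!: derivative_eq_intros)
 moreover have "(transition c' c has_derivative frechet_derivative (transition c' c) (at (fst z))) (at (fst z))"
  using z by (intro transition_derivative[OF c' c]) auto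
 ultimately have "((%z. transition c' c (fst z)) has_derivative (%h. frechet_derivative (transition c' c) (at (fst z)) (fst h))) (at z)"
  using diff_chain_at[of fst fst z "transition c' c"] by (simp add: o_def)
 thus ?thesis by (intro has_derivative_Pair) (auto intro!: derivative_eq_intros)
qed

lemma lift_overlap:
 assumes c': "c' : A" and y: "y : snd c' ` (fst c' Int fst c)"
 shows "lift c ps (chart_inv c' y) t = ps (transition c' c y, t)"
 using y c' c by (auto simp: lift_def transition_def)

text \<open>Seen from another chart, the lifted function is \<open>ps\<close> composed with the
  transition map on the overlap, and 0 off the image of \<open>K\<close>, which is closed because it
  is compact in a Hausdorff space; these two open sets cover the chart.\<close>

lemma lift_chart:
 assumes c': "c' : A"
 shows "EX d. has_grad (%z. lift c ps (chart_inv c' (fst z)) (snd z)) d (cimg c' <*> UNIV)"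
proof -
 let ?f = "%z. lift c ps (chart_inv c' (fst z)) (snd z)"
 define S1 where "S1 = (snd c' ` (fst c' Int fst c)) \<times> (UNIV::real set)"
 define S2 where "S2 = (snd c' ` (fst c' - chart_inv c ` K)) \<times> (UNIV::real set)"
 have o1: "open S1" unfolding S1_def by (intro open_Times open_overlap c c' open_UNIV)
 have o2: "open S2" unfolding S2_def
  by (intro open_Times open_coord_image[OF c'] open_UNIV open_Diff closed_support open_dom c') auto
 have "has_grad (%z. ps (transition c' c (fst z), snd z))
  (%z. SUM b:Basis. (dps (transition c' c (fst z), snd z) .* (frechet_derivative (transition c' c) (at (fst z)) (fst b), snd b)) *. b) S1"
 proof (rule has_grad_compose[OF ps, where ta = "%z. (transition c' c (fst z), snd z)"])
  show "((%z. (transition c' c (fst z), snd z)) has_derivative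
   (%h. (frechet_derivative (transition c' c) (at (fst z)) (fst h), snd h))) (at z)" if "z : S1" for z
   by (rule transition_derivative_time[OF c']) (use that in \<open>simp add: S1_def\<close>)
  show "continuous_on S1 (%z. (frechet_derivative (transition c' c) (at (fst z)) (fst v), snd v))" for v
   unfolding S1_def
   by (intro continuous_on_Pair continuous_on_const
     cont_comp2[OF transition_derivative_continuous[OF c' c] continuous_on_fst[OF continuous_on_id]]) auto
 qed auto
 hence "has_grad ?f
  (%z. SUM b:Basis. (dps (transition c' c (fst z), snd z) .* (frechet_derivative (transition c' c) (at (fst z)) (fst b), snd b)) *. b) S1"
  by (rule has_grad_transform[OF _ o1]) (auto simp: S1_def lift_overlap[OF c'])
 hence g1: "has_grad ?f (gradient ?f) S1" by (rule has_grad_gradient)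
 have "has_grad (%_. 0) (%_. 0) S2" by (rule has_grad_const)
 hence "has_grad ?f (%_. 0) S2"
  by (rule has_grad_transform[OF _ o2]) (use c' in \<open>auto simp: S2_def lift_outside\<close>)
 hence g2: "has_grad ?f (gradient ?f) S2" by (rule has_grad_gradient)
 have "cimg c' <*> UNIV \<subseteq> S1 Un S2"
 proof
  fix z assume z: "z : cimg c' \<times> (UNIV::real set)"
  hence y: "fst z : cimg c'" by auto
  have im: "fst z : snd c' ` B" if "chart_inv c' (fst z) : B" for B
   using that coord_inv[OF c' y] by (metis image_eqI)
  have "chart_inv c ` K \<subseteq> fst c" using K(2) c by auto
  thus "z : S1 Un S2"
   using im[of "fst c' Int fst c"] im[of "fst c' - chart_inv c ` K"] inv_in[OF c' y]
   by (cases z) (auto simp: S1_def S2_def)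
 qed
 from has_grad_subset[OF has_grad_Un[OF g1 g2 o1 o2] this] show ?thesis by blast
qed

text \<open>\<open>diff_along\<close> computes in the arbitrary chart \<open>chart_at A p\<close>;
  the chain rule and the transformation law of \<open>X\<close> bring the value back to
  \<open>c\<close>.\<close>

lemma diff_along_lift:
 assumes X: "is_vector_field A X"
 shows "diff_along A (%x. lift c ps x t) X p = (if p : fst c then fst (dps (snd c p, t)) .* X c p else 0)"
proof -
 define c' where "c' = chart_at A p"
 have c': "c' : A" "p : fst c'" using chart_at by (auto simp: c'_def)
 let ?f = "%y. lift c ps (chart_inv c' y) t"
 have da: "diff_along A (%x. lift c ps x t) X p = frechet_derivative ?f (at (snd c' p)) (X c' p)"
  by (simp add: diff_along_def c'_def Let_def)
 show ?thesis
 proof (cases "p : fst c")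
  case True
  let ?S = "snd c' ` (fst c' Int fst c)"
  let ?D = "frechet_derivative (transition c' c) (at (snd c' p))"
  have pS: "snd c' p : ?S" using c' True by blast
  have "((%y. (transition c' c y, t)) has_derivative (%h. (?D h, 0))) (at (snd c' p))"
   by (rule has_derivative_Pair[OF transition_derivative[OF c'(1) c pS] has_derivative_const])
  moreover have tr: "transition c' c (snd c' p) = snd c p" by (rule transition_coord[OF c'])
  ultimately have "((%y. ps (transition c' c y, t)) has_derivative (%h. dps (snd c p, t) .* (?D h, 0))) (at (snd c' p))"
   using diff_chain_at[of "%y. (transition c' c y, t)" "%h. (?D h, 0)" "snd c' p" ps "%h. dps (snd c p, t) .* h"]
    has_gradD[OF ps UNIV_I, of "(snd c p, t)"] by (simp add: o_def)
  hence "(?f has_derivative (%h. dps (snd c p, t) .* (?D h, 0))) (at (snd c' p))"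
   by (rule has_derivative_transform_within_open[OF _ open_overlap[OF c'(1) c] pS])
    (use lift_overlap[OF c'(1)] in auto)
  from frechet_derivative_at[OF this, symmetric]
  have "diff_along A (%x. lift c ps x t) X p = fst (dps (snd c p, t)) .* ?D (X c' p)"
   by (simp add: da inner_prod_def)
  also have "?D (X c' p) = X c p"
  proof -
   have "X c p = jac c' c p *v X c' p"
    using X c' c True unfolding is_vector_field_def by blast
   thus ?thesis using jac_mult[OF c'(1) c, of p "X c' p"] c' True by simp
  qed
  finally show ?thesis using True by simp
 next
  case False
  have "p ~: chart_inv c ` K" using K(2) c False by auto
  hence pS: "snd c' p : snd c' ` (fst c' - chart_inv c ` K)" using c' by blast
  have op: "open (snd c' ` (fst c' - chart_inv c ` K))"
   by (intro open_coord_image[OF c'(1)] open_Diff closed_support open_dom c'(1)) auto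
  have "((%_. 0) has_derivative (%_. 0)) (at (snd c' p))" by simp
  hence "(?f has_derivative (%_. 0)) (at (snd c' p))"
   by (rule has_derivative_transform_within_open[OF _ op pS]) (use c' in \<open>auto simp: lift_outside\<close>)
  from frechet_derivative_at[OF this, symmetric] show ?thesis using False by (simp add: da)
 qed
qed

lemma deriv_lift: "deriv (%s. lift c ps p s) t = (if p : fst c then snd (dps (snd c p, t)) else 0)"
proof (cases "p : fst c")
 case True
 have "((%s. (snd c p, s)) has_derivative (%h. (0, h))) (at t)" by (auto intro!: derivative_eq_intros)
 from diff_chain_at[OF this has_gradD[OF ps UNIV_I]]
 have "((%s. ps (snd c p, s)) has_derivative (%h. dps (snd c p, t) .* (0, h))) (at t)" by (simp add: o_def)
 hence "((%s. ps (snd c p, s)) has_real_derivative snd (dps (snd c p, t))) (at t)"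
  by (simp add: has_field_derivative_def inner_prod_def mult_commute_abs)
 thus ?thesis using True by (simp add: lift_def DERIV_imp_deriv)
qed (simp add: lift_def)

text \<open>A function that is C^1 in every chart is locally Lipschitz there, and the product of the
  image of \<open>K\<close> with \<open>{al..be}\<close> is a compact support away from both ends of
  the time interval.\<close>

lemma lift_test_function:
 assumes nn: "!!z. 0 <= ps z" and J: "0 < al" "be < T" and outt: "!!y t. t ~: {al..be} ==> ps (y, t) = 0"
 shows "test_function A T (lift c ps)"
 unfolding test_function_def
proof (intro conjI allI ballI)
 show "0 <= lift c ps p t" for p t using nn by (simp add: lift_def)
 fix c' assume c': "c' : A"
 obtain d where d: "has_grad (%z. lift c ps (chart_inv c' (fst z)) (snd z)) d (cimg c' <*> UNIV)"
  using lift_chart[OF c'] by blast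
 have "open (cimg c' \<times> (UNIV::real set))" by (intro open_Times open_image c' open_UNIV)
 from loc_lipschitz_on_subset[OF has_grad_loc_lipschitz[OF d this], of "cimg c' <*> {0..<T}"]
 show "loc_lipschitz_on (cimg c' <*> {0..<T}) (%(y, t). lift c ps (chart_inv c' y) t)"
  by (auto simp: case_prod_beta')
next
 have "compact (chart_inv c ` K)"
  using cont_inv[OF c] K by (intro compact_continuous_image) (auto intro: continuous_on_subset)
 hence "compact (chart_inv c ` K <*> {al..be})" by (intro compact_Times) auto
 moreover have "chart_inv c ` K <*> {al..be} \<subseteq> UNIV <*> {0..<T}" using J by auto
 moreover have "lift c ps p t = 0" if "(p, t) ~: chart_inv c ` K <*> {al..be}" for p t
  using that lift_outside[of p t] outt[of t "snd c p"] by (auto simp: lift_def)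
 ultimately show "EX K. compact K & K \<subseteq> UNIV <*> {0..<T} & (ALL p. ALL t:{0..<T}. (p, t) ~: K --> lift c ps p t = 0)" by blast
qed

end

end

context riemannian_manifold
begin

definition flux_density :: "('m, 'd) vfield => ('m, 'd) chart => 'd => real^'d => real" where
 "flux_density X c i y = vol_density G c (chart_inv c y) * X c (chart_inv c y) $ i"

definition chart_div :: "('m, 'd) vfield => ('m, 'd) chart => real^'d => real" where
 "chart_div X c y = (SUM i:UNIV. gradient (flux_density X c i) y .* axis i 1)"

text \<open>
 The coordinate expression of the divergence does not depend on the chart: tested against a
 function, it is minus the integral of \<open>dph(X)\<close>, which is invariant.
\<close>

lemma chart_div_weak:
 assumes X: "is_vector_field A X"
  and C1: "!!c i. c : A ==> EX d. has_grad (flux_density X c i) d (cimg c)"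
  and c1: "c1 : A" and c: "c : A"
  and ps: "has_grad ps dps UNIV" and K: "compact K" "K \<subseteq> snd c1 ` (fst c1 Int fst c)"
  and out: "!!y. y ~: K ==> ps y = 0"
 defines "ph \<equiv> %p. if p : fst c1 then ps (snd c1 p) else 0"
 shows "(LINT y|lborel. ind (cimg c) y * (ph (chart_inv c y) * chart_div X c y))
  = - (LINT p|mu. (if p : fst c1 then dps (snd c1 p) .* X c1 p else 0))"
  and "integrable lborel (%y. ind (cimg c) y * (ph (chart_inv c y) * chart_div X c y))"
proof -
 \<comment> \<open>\<open>lift\<close> expects a time variable; the function is made constant in
   it.\<close>
 define ps2 :: "(real^'d)*real => real" where "ps2 z = ps (fst z)" for z
 define dps2 :: "(real^'d)*real => (real^'d)*real" where "dps2 z = (dps (fst z), 0)" for z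
 have ps2: "has_grad ps2 dps2 UNIV"
  unfolding has_grad_def
 proof (intro conjI ballI)
  fix z :: "(real^'d)*real"
  have "(fst has_derivative fst) (at z)" by (auto intro!: derivative_eq_intros)
  from diff_chain_at[OF this has_gradD[OF ps UNIV_I]]
  show "(ps2 has_derivative (.*) (dps2 z)) (at z)"
   by (simp add: o_def ps2_def[abs_def] dps2_def inner_prod_def[abs_def])
 qed (auto simp: dps2_def[abs_def] intro!: continuous_intros cont_comp2[OF has_grad_continuous_grad[OF ps]])
 have K1: "K \<subseteq> cimg c1" using K(2) c1 by auto
 have out2: "ps2 (y, t) = 0" if "y ~: K" for y t using out[OF that] by (simp add: ps2_def)
 have ph_lift: "ph p = lift c1 ps2 p 0" for p by (simp add: ph_def lift_def ps2_def)
 obtain d where "has_grad (%z. lift c1 ps2 (chart_inv c (fst z)) (snd z)) d (cimg c <*> UNIV)"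
  using lift_chart[OF c1 ps2 K(1) K1 out2 c] by blast
 note comp = has_grad_compose[OF this, where ta = "%y. (y, 0)" and ta' = "%_ h. (h, 0)" and S = "cimg c"]
 have "has_grad (%y. lift c1 ps2 (chart_inv c y) 0)
   (%y. SUM b:Basis. (d (y, 0) .* (b, 0)) *. b) (cimg c)"
  by (rule comp[simplified]) (auto intro!: derivative_eq_intros continuous_intros)
 then obtain dph where dph: "has_grad (%y. ph (chart_inv c y)) dph (cimg c)" unfolding ph_lift by auto
 define K' where "K' = snd c ` chart_inv c1 ` K"
 have inK: "chart_inv c1 y : fst c" if "y : K" for y using that K(2) c1 by auto
 have K'c: "compact K'"
  unfolding K'_def using cont_inv[OF c1] cont_coord[OF c] K(1) K1 inK
  by (intro compact_continuous_image) (auto intro: continuous_on_subset)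
 have K's: "K' \<subseteq> cimg c" unfolding K'_def using inK c by auto
 have out': "ph (chart_inv c y) = 0" if "y : cimg c" "y ~: K'" for y
 proof (rule ccontr)
  assume "ph (chart_inv c y) ~= 0"
  hence "chart_inv c y : chart_inv c1 ` K"
   using lift_outside[OF c1 ps2 K(1) K1 out2] unfolding ph_lift by blast
  hence "snd c (chart_inv c y) : K'" unfolding K'_def by (rule imageI)
  thus False using that c by simp
 qed
 define V where "V y = (\<chi> i. flux_density X c i y)" for y
 have V: "has_grad (%y. V y .* b) (gradient (%y. V y .* b)) (cimg c)" if bB: "b : Basis" for b
 proof -
  obtain i where "b = axis i 1" using bB by (auto simp: Basis_vec_def)
  hence "(%y. V y .* b) = flux_density X c i" by (auto simp: V_def inner_axis)
  thus ?thesis using C1[OF c, of i] has_grad_gradient by metis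
 qed
 have div_eq: "(SUM b:Basis. gradient (%y. V y .* b) y .* b) = chart_div X c y" for y
  unfolding sum_Basis_cart chart_div_def by (simp add: V_def inner_axis)
 note ibp = integration_by_parts[OF open_image[OF c] V dph K'c K's out', unfolded div_eq]
 define D where "D p = (if p : fst c1 then dps (snd c1 p) .* X c1 p else 0)" for p
 have D_lift: "D p = diff_along A (%x. lift c1 ps2 x 0) X p" for p
  using diff_along_lift[OF c1 ps2 K(1) K1 out2 X, of 0 p] by (simp add: D_def dps2_def)
 have D_chart: "D (chart_inv c y) = dph y .* X c (chart_inv c y)" if y: "y : cimg c" for y
 proof (cases "y : snd c ` (fst c Int fst c1)")
  case True
  let ?p = "chart_inv c y"
  have p: "?p : fst c" "?p : fst c1" using True c by auto
  have "((%y. ph (chart_inv c y)) has_derivative (%h. dph y .* h)) (at y)" by (rule has_gradD[OF dph y])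
  moreover have "((%y. ps (transition c c1 y)) has_derivative (%h. dps (transition c c1 y) .* frechet_derivative (transition c c1) (at y) h)) (at y)"
   using diff_chain_at[OF transition_derivative[OF c c1 True] has_gradD[OF ps UNIV_I]] by (simp add: o_def)
  hence "((%y. ph (chart_inv c y)) has_derivative (%h. dps (transition c c1 y) .* frechet_derivative (transition c c1) (at y) h)) (at y)"
   by (rule has_derivative_transform_within_open[OF _ open_overlap[OF c c1] True])
    (use c c1 in \<open>auto simp: ph_def transition_def\<close>)
  ultimately have "(%h. dph y .* h) = (%h. dps (transition c c1 y) .* frechet_derivative (transition c c1) (at y) h)"
   by (rule has_derivative_unique)
  from fun_cong[OF this, of "X c ?p"]
  have "dph y .* X c ?p = dps (transition c c1 y) .* (jac c c1 ?p *v X c ?p)"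
   using jac_mult[OF c c1, of ?p] p y c by simp
  also have "jac c c1 ?p *v X c ?p = X c1 ?p" using X c c1 p unfolding is_vector_field_def by (metis IntI)
  finally show ?thesis using p by (simp add: D_def transition_def)
 next
  case False
  hence "chart_inv c y ~: fst c1" using y c coord_inv[OF c y] by (metis IntI image_eqI inv_in)
  hence D0: "D (chart_inv c y) = 0" by (simp add: D_def)
  have "chart_inv c1 ` K \<subseteq> fst c1" using K1 c1 by auto
  hence "y ~: K'" using \<open>chart_inv c y ~: fst c1\<close> inK c y by (auto simp: K'_def)
  hence "dph y = 0"
   by (intro gradient_eq_0[OF has_gradD[OF dph y], of "cimg c - K'"])
    (use y out' open_image[OF c] K'c compact_imp_closed in auto)
  thus ?thesis using D0 by simp
 qed
 have wV: "ind (cimg c) y * (dph y .* V y) = w c y * D (inv0 c y)" for y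
 proof (cases "y : cimg c")
  case True
  have "V y = w c y *. X c (chart_inv c y)" using True by (simp add: V_def vec_eq_iff flux_density_def w_def)
  thus ?thesis using True D_chart[OF True] by (simp add: inv0_def)
 qed (simp add: w_def)
 have Xcont: "continuous_on (cimg c1) (%y. X c1 (chart_inv c1 y))"
 proof -
  have "continuous_on (cimg c1) (%y. \<chi> i. flux_density X c1 i y / w c1 y)"
  proof (intro continuous_on_vec_lambda continuous_on_divide w_continuous c1)
   fix i show "continuous_on (cimg c1) (flux_density X c1 i)"
    using C1[OF c1, of i] has_grad_continuous by blast
   show "ALL y:cimg c1. w c1 y ~= 0"
    using vol_density_pos[OF c1] inv_in[OF c1] by (force simp: w_def)
  qed
  thus ?thesis
   by (rule continuous_on_eq) (use vol_density_pos[OF c1] inv_in[OF c1] in \<open>force simp: vec_eq_iff flux_density_def w_def\<close>)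
 qed
 have Dm: "D : bmeas borel"
 proof -
  have "continuous_on (fst c1) (%p. dps (snd c1 p) .* X c1 (chart_inv c1 (snd c1 p)))"
   using c1 by (intro continuous_intros cont_comp2[OF has_grad_continuous_grad[OF ps]]
     cont_comp2[OF Xcont] cont_coord) auto
  hence "continuous_on (fst c1) (%p. dps (snd c1 p) .* X c1 p)"
   by (rule continuous_on_eq) (use c1 in simp)
  thus ?thesis
   unfolding D_def by (intro bmeas_cont_if dom_borel c1) auto
 qed
 have D_out: "D p = 0" if "p ~: fst c" for p
 proof (cases "p : fst c1")
  case True
  have "snd c1 p ~: K" using inK that True c1 by force
  hence "dps (snd c1 p) = 0"
   using has_grad_zero_outside[OF ps compact_imp_closed[OF K(1)] out] by blast
  thus ?thesis by (simp add: D_def)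
 qed (simp add: D_def)
 have split: "ind (cimg c) y * (ph (chart_inv c y) * chart_div X c y + dph y .* V y)
  = ind (cimg c) y * (ph (chart_inv c y) * chart_div X c y) + w c y * D (inv0 c y)" for y
  using wV[of y] by (simp add: distrib_left)
 have cV: "continuous_on (cimg c) (%y. dph y .* V y)"
 proof -
  have "continuous_on (cimg c) (flux_density X c i)" for i
   using C1[OF c, of i] has_grad_continuous by blast
  thus ?thesis
   unfolding V_def by (intro continuous_on_inner continuous_on_vec_lambda has_grad_continuous_grad[OF dph])
 qed
 have dph0: "dph y = 0" if "y : cimg c" "y ~: K'" for y
  by (rule gradient_eq_0[OF has_gradD[OF dph that(1)], of "cimg c - K'"])
   (use that out' open_image[OF c] K'c compact_imp_closed in auto)
 have "bounded ((%y. dph y .* V y) ` K')"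
  by (intro compact_imp_bounded compact_continuous_image continuous_on_subset[OF cV] K's K'c)
 then obtain B where B: "!!y. y : K' ==> abs (dph y .* V y) <= B" unfolding bounded_iff real_norm_def by blast
 have iD: "integrable lborel (%y. w c y * D (inv0 c y))"
  unfolding wV[symmetric]
 proof (rule i_bsupp[OF _ _ compact_imp_bounded[OF K'c], where C = "max B 0"])
  have "(%y. if y : cimg c then dph y .* V y else 0) : bmeas borel"
   by (rule bmeas_cont_if[OF image_borel[OF c] cV]) simp
  moreover have "(%y. if y : cimg c then dph y .* V y else 0) = (%y. ind (cimg c) y * (dph y .* V y))"
   by (auto simp: fun_eq_iff indicator_def)
  ultimately show "(%y. ind (cimg c) y * (dph y .* V y)) : bmeas borel" by simp
  show "ind (cimg c) y * (dph y .* V y) = 0" if "y ~: K'" for y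
   using that dph0[of y] by (cases "y : cimg c") auto
  show "norm (ind (cimg c) y * (dph y .* V y)) <= max B 0" for y
   using B[of y] dph0[of y] by (cases "y : K'"; cases "y : cimg c") auto
 qed
 have "integrable lborel (%y. (ind (cimg c) y * (ph (chart_inv c y) * chart_div X c y) + w c y * D (inv0 c y)) - w c y * D (inv0 c y))"
  using ibp(1) iD unfolding split by (rule lint_i_diff)
 thus i: "integrable lborel (%y. ind (cimg c) y * (ph (chart_inv c y) * chart_div X c y))" by simp
 have "0 = (LINT y|lborel. ind (cimg c) y * (ph (chart_inv c y) * chart_div X c y)) + (LINT y|lborel. w c y * D (inv0 c y))"
  using ibp(2) i iD unfolding split by simp
 moreover have "(LINT p|mu. D p) = (LINT y|lborel. w c y * D (inv0 c y))"
  by (rule mu_integral_chart(1)[OF c Dm D_out])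
 ultimately show "(LINT y|lborel. ind (cimg c) y * (ph (chart_inv c y) * chart_div X c y))
  = - (LINT p|mu. (if p : fst c1 then dps (snd c1 p) .* X c1 p else 0))"
  by (simp add: D_def[abs_def])
qed

lemma gradient_inner_Basis: "b : Basis ==> gradient f z .* b = frechet_derivative f (at z) b"
 by (simp add: gradient_def inner_sum_left inner_Basis if_distrib cong: if_cong)

text \<open>In both charts the weak form has the same value, minus the integral of
  \<open>dph(X)\<close>. So the continuous difference integrates to 0 against every test function
  supported in the overlap, and vanishes. The Jacobian of the transition map never has to be
  differentiated.\<close>

lemma chart_div_eq:
 assumes X: "is_vector_field A X"
  and C1: "!!c i. c : A ==> EX d. has_grad (flux_density X c i) d (cimg c)"
  and c: "c1 : A" "c2 : A" and p: "p : fst c1" "p : fst c2"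
 shows "chart_div X c1 (snd c1 p) / vol_density G c1 p = chart_div X c2 (snd c2 p) / vol_density G c2 p"
proof -
 have cd: "continuous_on (cimg c) (chart_div X c)" if cA: "c : A" for c
 proof -
  have "continuous_on (cimg c) (gradient (flux_density X c i))" for i
   using C1[OF cA, of i] has_grad_gradient has_grad_continuous_grad by blast
  thus ?thesis unfolding chart_div_def[abs_def] by (intro continuous_intros)
 qed
 define S where "S = snd c1 ` (fst c1 Int fst c2)"
 have oS: "open S" unfolding S_def by (rule open_overlap[OF c])
 have SU: "S \<subseteq> cimg c1" using c by (auto simp: S_def)
 have Sinv: "chart_inv c1 y : fst c1" "chart_inv c1 y : fst c2" if "y : S" for y using that c by (auto simp: S_def)
 define q where "q p = chart_div X c2 (snd c2 p) / vol_density G c2 p" for p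
 have q_w: "q p = chart_div X c2 (snd c2 p) / w c2 (snd c2 p)" if "p : fst c2" for p
  using that c by (simp add: q_def w_def)
 have w2: "w c2 (snd c2 p) ~= 0" if "p : fst c2" for p
  using that c vol_density_pos[OF c(2) that] by (simp add: w_def)
 have qc: "continuous_on (fst c2) q"
 proof -
  have "continuous_on (fst c2) (%p. chart_div X c2 (snd c2 p) / w c2 (snd c2 p))"
   using w2 c(2) by (intro continuous_on_divide cont_comp2[OF cd[OF c(2)]] cont_comp2[OF w_continuous[OF c(2)]]
     cont_coord) auto
  thus ?thesis by (rule continuous_on_eq) (simp add: q_w)
 qed
 define u where "u y = chart_div X c1 y - w c1 y * q (chart_inv c1 y)" for y
 have uc: "continuous_on S u"
  unfolding u_def
  by (intro continuous_intros continuous_on_subset[OF cd[OF c(1)] SU] continuous_on_subset[OF w_continuous[OF c(1)] SU]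
    cont_comp2[OF qc continuous_on_subset[OF cont_inv[OF c(1)] SU]]) (use Sinv in auto)
 have "u (snd c1 p) = 0"
 proof (rule continuous_zero_of_weak_zero[OF oS uc])
  show "snd c1 p : S" using p by (auto simp: S_def)
  fix ps dps K assume ps: "has_grad ps dps UNIV" and K: "compact K" "K \<subseteq> S" and out: "!!y. y ~: K ==> ps y = 0"
  define ph where "ph p = (if p : fst c1 then ps (snd c1 p) else 0)" for p
  have Ks: "K \<subseteq> snd c1 ` (fst c1 Int fst c1)" "K \<subseteq> snd c1 ` (fst c1 Int fst c2)" using K(2) by (auto simp: S_def)
  note W1 = chart_div_weak[OF X C1 c(1) c(1) ps K(1) Ks(1) out, folded ph_def]
  note W2 = chart_div_weak[OF X C1 c(1) c(2) ps K(1) Ks(2) out, folded ph_def]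
  have ph0: "ph p = 0" if "p ~: fst c1 \<or> p ~: fst c2" for p
  proof (cases "p : fst c1")
   case True
   have "snd c1 p ~: K"
   proof
    assume "snd c1 p : K"
    hence "chart_inv c1 (snd c1 p) : fst c2" using K(2) Sinv by blast
    thus False using that True c by simp
   qed
   thus ?thesis using out by (simp add: ph_def)
  qed (simp add: ph_def)
  \<comment> \<open>\<open>ph\<close> times the divergence in \<open>c2\<close> is written as
    \<open>w c2\<close> times a function on the manifold, so that its integral can be carried over
    to the chart \<open>c1\<close>.\<close>
  define f where "f p = (if p : fst c1 Int fst c2 then ps (snd c1 p) * q p else 0)" for p
  have f_eq: "f p = (if p : fst c2 then ph p * q p else 0)" for p using ph0[of p] by (auto simp: f_def ph_def)
  have fm: "f : bmeas borel"
  proof -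
   have "continuous_on (fst c1 Int fst c2) (%p. ps (snd c1 p) * q p)"
    by (intro continuous_intros continuous_on_subset[OF qc] cont_comp2[OF has_grad_continuous[OF ps]]
      continuous_on_subset[OF cont_coord[OF c(1)]]) auto
   thus ?thesis unfolding f_def by (intro bmeas_cont_if sets.Int dom_borel c) auto
  qed
  have eqw: "ind (cimg c2) y * (ph (chart_inv c2 y) * chart_div X c2 y) = w c2 y * f (inv0 c2 y)" for y
  proof (cases "y : cimg c2")
   case True
   thus ?thesis using w2[of "chart_inv c2 y"] q_w[of "chart_inv c2 y"] c(2) by (simp add: inv0_def f_eq)
  qed (simp add: w_def)
  have "(LINT y|lborel. ind (cimg c2) y * (ph (chart_inv c2 y) * chart_div X c2 y)) = (LINT y|lborel. w c2 y * f (inv0 c2 y))"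
   unfolding eqw ..
  also have "... = (LINT p|mu. f p)" by (rule mu_integral_chart(1)[symmetric, OF c(2) fm]) (simp add: f_def)
  also have "... = (LINT y|lborel. w c1 y * f (inv0 c1 y))" by (rule mu_integral_chart(1)[OF c(1) fm]) (simp add: f_def)
  finally have e2: "(LINT y|lborel. ind (cimg c2) y * (ph (chart_inv c2 y) * chart_div X c2 y)) = (LINT y|lborel. w c1 y * f (inv0 c1 y))" .
  have if1: "integrable lborel (%y. w c1 y * f (inv0 c1 y))"
  proof -
   have "integrable lborel (%y. w c2 y * f (inv0 c2 y))"
    using W2(2) unfolding eqw .
   hence "integrable mu f" by (subst mu_integral_chart(2)[OF c(2) fm]) (simp_all add: f_def)
   thus ?thesis by (subst (asm) mu_integral_chart(2)[OF c(1) fm]) (simp_all add: f_def)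
  qed
  have eq: "ps y * u y = ind (cimg c1) y * (ph (chart_inv c1 y) * chart_div X c1 y) - w c1 y * f (inv0 c1 y)" for y
  proof (cases "y : S")
   case True
   hence yU: "y : cimg c1" using SU by auto
   hence "ph (chart_inv c1 y) = ps y" using c by (simp add: ph_def)
   thus ?thesis using yU Sinv[OF True] c by (simp add: u_def inv0_def f_eq algebra_simps)
  next
   case False
   hence "ps y = 0" using K(2) out by blast
   moreover have "f (inv0 c1 y) = 0" if "y : cimg c1"
    using that c \<open>ps y = 0\<close> by (simp add: f_def inv0_def)
   ultimately show ?thesis
    using c by (cases "y : cimg c1") (auto simp: ph_def w_def)
  qed
  have "(LINT y|lborel. ps y * u y) = (LINT y|lborel. ind (cimg c1) y * (ph (chart_inv c1 y) * chart_div X c1 y)) - (LINT y|lborel. w c1 y * f (inv0 c1 y))"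
   unfolding eq by (rule lint_diff[OF W1(2) if1])
  also have "... = 0" using W1(1) W2(1) e2 by simp
  finally show "(LINT y|lborel. ps y * u y) = 0" .
 qed
 thus ?thesis using p c vol_density_pos[OF c(1) p(1)] by (simp add: u_def q_def w_def field_simps)
qed

lemma riem_div_chart:
 assumes X: "is_vector_field A X"
  and C1: "!!c i. c : A ==> EX d. has_grad (flux_density X c i) d (cimg c)"
  and c: "c : A" "p : fst c"
 shows "riem_div A G X p = chart_div X c (snd c p) / vol_density G c p"
proof -
 have "riem_div A G X p = chart_div X (chart_at A p) (snd (chart_at A p) p) / vol_density G (chart_at A p) p"
  by (simp add: riem_div_def Let_def chart_div_def gradient_inner_Basis axis_in_Basis_iff flux_density_def[abs_def])
 thus ?thesis using chart_div_eq[OF X C1 chart_at(1) c(1) chart_at(2) c(2)] by simp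
qed

end

section \<open>Borel versions of Young measures\<close>

text \<open>\<open>f\<close> is not assumed measurable; agreement with a Borel function off a null
  set makes it measurable for the completion. The integrals of the theorem are of this kind.\<close>

lemma integral_completion_AE:
 fixes f f' :: "'a => real"
 assumes f'[measurable]: "f' : bmeas M" and ae: "AE x in M. f x = f' x"
 shows "(LINT x|completion M. f x) = (LINT x|M. f' x)"
proof -
 obtain Z where Z: "Z : null_sets M" "!!x. x : space M ==> x ~: Z ==> f x = f' x"
  using ae by (auto elim!: AE_E3)
 have "f : bmeas (completion M)"
 proof (rule measurableI)
  fix B :: "real set" assume B: "B : sets borel"
  have "f -` B Int space M = (f' -` B Int space M - Z) Un (f -` B Int space M Int Z)"
   using Z(2) by auto
  moreover have "f' -` B Int space M - Z : sets M" using Z(1) measurable_sets[OF f' B] by auto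
  ultimately show "f -` B Int space (completion M) : sets (completion M)"
   using Z(1) by (auto intro!: sets_completionI[of _ "f' -` B Int space M - Z" "f -` B Int space M Int Z" Z])
 qed auto
 hence "(LINT x|completion M. f x) = (LINT x|completion M. f' x)"
  using AE_completion[OF ae] by (intro integral_cong_AE) (auto intro: measurable_completion)
 thus ?thesis by (simp add: integral_completion)
qed

text \<open>When each level comes with its own null set, only countably many can be handled at once;
  right continuity of the tail recovers the others from the rational ones.\<close>

lemma emeasure_greaterThan_SUP_rat:
 assumes "sets M = sets (borel :: real measure)"
 shows "emeasure M {a<..} = (SUP r\<in>{r::rat. a < real_of_rat r}. emeasure M {real_of_rat r<..})"
proof (rule antisym)
 have "emeasure M {a<..} = emeasure M (\<Union>n. {a + inverse (real (Suc n))<..})"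
 proof (intro arg_cong[of _ _ "emeasure M"] set_eqI iffI)
  fix x assume "x : {a<..}"
  then obtain n where "inverse (real (Suc n)) < x - a" using reals_Archimedean[of "x - a"] by auto
  hence "x : {a + inverse (real (Suc n))<..}" by simp
  thus "x : (\<Union>n. {a + inverse (real (Suc n))<..})" by blast
 next
  fix x assume "x : (\<Union>n. {a + inverse (real (Suc n))<..})"
  then obtain n where n: "a + inverse (real (Suc n)) < x" by auto
  have "0 < inverse (real (Suc n))" by simp
  with n show "x : {a<..}" unfolding greaterThan_iff by linarith
 qed
 also have "... = (SUP n. emeasure M {a + inverse (real (Suc n))<..})"
 proof (rule SUP_emeasure_incseq[symmetric])
  show "range (%n. {a + inverse (real (Suc n))<..}) \<subseteq> sets M" unfolding assms by (rule image_subsetI) (rule borel_open[OF open_greaterThan])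
  show "incseq (%n. {a + inverse (real (Suc n))<..})"
  proof (rule incseq_SucI)
   fix n
   have "inverse (real (Suc (Suc n))) <= inverse (real (Suc n))" by (rule le_imp_inverse_le) auto
   hence "a + inverse (real (Suc (Suc n))) <= a + inverse (real (Suc n))" by (rule add_left_mono)
   thus "{a + inverse (real (Suc n))<..} \<subseteq> {a + inverse (real (Suc (Suc n)))<..}" by (simp only: greaterThan_subset_iff)
  qed
 qed
 also have "... <= (SUP r\<in>{r::rat. a < real_of_rat r}. emeasure M {real_of_rat r<..})"
 proof (rule SUP_least)
  fix n
  obtain r where r: "a < real_of_rat r" "real_of_rat r < a + inverse (real (Suc n))"
   using of_rat_dense[of a "a + inverse (real (Suc n))"] by auto
  have "emeasure M {a + inverse (real (Suc n))<..} <= emeasure M {real_of_rat r<..}"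
   using r assms by (intro emeasure_mono) auto
  also have "... <= (SUP r\<in>{r::rat. a < real_of_rat r}. emeasure M {real_of_rat r<..})"
   using r by (intro SUP_upper) auto
  finally show "emeasure M {a + inverse (real (Suc n))<..} <= (SUP r\<in>{r::rat. a < real_of_rat r}. emeasure M {real_of_rat r<..})" .
 qed
 finally show "emeasure M {a<..} <= (SUP r\<in>{r::rat. a < real_of_rat r}. emeasure M {real_of_rat r<..})" .
 show "(SUP r\<in>{r::rat. a < real_of_rat r}. emeasure M {real_of_rat r<..}) <= emeasure M {a<..}"
  using assms by (intro SUP_least emeasure_mono) auto
qed

text \<open>Each rational level has a Borel version of its tail function, off a null set. On the
  union \<open>N\<close> of these null sets the kernel is replaced by a point mass, and since
  half-lines generate the Borel sets, Borel tails make a Borel kernel.\<close>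

lemma borel_kernel_version:
 fixes K :: "'a => real measure"
 assumes K: "!!x. x : space M ==> prob_space (K x)" "!!x. x : space M ==> sets (K x) = sets borel"
  and meas: "!!r. (%x. measure (K x) {r<..}) : bmeas (completion M)"
 obtains N where "N : null_sets M" "(%x. if x : N then return borel 0 else K x) : M -M> prob_algebra borel"
proof -
 have "EX f:bmeas M. AE x in M. measure (K x) {r<..} = f x" for r
  using completion_ex_borel_measurable_real[OF meas[of r]] by auto
 then obtain f where f: "!!r. f r : bmeas M" "!!r. AE x in M. measure (K x) {r<..} = f r x"
  by metis
 have "EX N:null_sets M. ALL x:space M - N. measure (K x) {r<..} = f r x" for r
  using f(2)[of r] by (auto elim!: AE_E3)
 then obtain Nr where Nr: "!!r. Nr r : null_sets M" "!!r x. x : space M - Nr r ==> measure (K x) {r<..} = f r x"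
  by metis
 define N where "N = (\<Union>q::rat. Nr (real_of_rat q))"
 have N: "N : null_sets M" unfolding N_def by (rule null_sets_UN') (auto intro: Nr)
 hence Ns[measurable]: "N : sets M" by auto
 define K' where "K' x = (if x : N then return borel 0 else K x)" for x
 have pK': "prob_space (K' x)" "sets (K' x) = sets borel" if "x : space M" for x
  using K[OF that] by (auto simp: K'_def prob_space_return)
 have rat: "(%x. emeasure (K' x) {real_of_rat q<..}) : bmeas M" for q
 proof -
  have [measurable]: "f (real_of_rat q) : bmeas M" by (rule f)
  have "(%x. if x : N then ind {real_of_rat q<..} 0 else ennreal (f (real_of_rat q) x)) : bmeas M"
   by measurable
  thus ?thesis
  proof (rule measurable_cong[THEN iffD1, rotated])
   fix x assume x: "x : space M"
   interpret prob_space "K x" by (rule K(1)[OF x])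
   show "(if x : N then ind {real_of_rat q<..} 0 else ennreal (f (real_of_rat q) x)) = emeasure (K' x) {real_of_rat q<..}"
    using Nr(2)[of x "real_of_rat q"] x by (auto simp: K'_def emeasure_eq_measure N_def)
  qed
 qed
 have "K' : M -M> prob_algebra borel"
 proof (rule measurable_prob_algebra_generated[where \<Omega> = UNIV and G = "range (%a::real. {a<..})"])
  have "sets (borel::real measure) = sets (sigma UNIV (range (%a::real. {a<..})))"
   by (simp only: borel_Ioi[symmetric])
  thus "sets (borel::real measure) = sigma_sets UNIV (range (%a::real. {a<..}))" by simp
  show "Int_stable (range (%a::real. {a<..}))"
  proof (rule Int_stableI_image)
   show "EX c:UNIV. {a<..} Int {b<..} = {c<..}" for a b :: real
    by (intro bexI[of _ "max a b"]) auto
  qed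
  fix B assume "B : range (%a::real. {a<..})"
  then obtain a where a: "B = {a<..}" by auto
  have "(%x. SUP q\<in>{q::rat. a < real_of_rat q}. emeasure (K' x) {real_of_rat q<..}) : bmeas M"
   by (intro borel_measurable_SUP rat) auto
  thus "(%x. emeasure (K' x) B) : bmeas M"
   by (rule measurable_cong[THEN iffD1, rotated])
    (simp add: a emeasure_greaterThan_SUP_rat[OF pK'(2)])
 qed (use pK' in auto)
 thus ?thesis using that[OF N] by (simp add: K'_def[abs_def])
qed

section \<open>Completions of product measures\<close>

context
 fixes M1 :: "'a measure" and T :: real
 assumes fin: "finite_measure M1" and T: "T > 0"
begin

lemma restrict_lborel_sets:
 assumes "B : sets (lebesgue_on {0<..<T})"
 obtains S N N' where "B = S Un N" "S : sets (restrict_space lborel {0<..<T})" "N \<subseteq> N'" "N' : null_sets (restrict_space lborel {0<..<T})"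
proof -
 have B: "B : sets lebesgue" "B \<subseteq> {0<..<T}" using assms by (auto simp: sets_restrict_space)
 obtain S N N' where *: "B = S Un N" "N \<subseteq> N'" "N' : null_sets lborel" "S : sets lborel"
  using B(1) by (auto elim: sets_completionE)
 have S: "S : sets (restrict_space lborel {0<..<T})" using * B by (subst sets_restrict_space_iff) auto
 have N': "N' Int {0<..<T} : null_sets (restrict_space lborel {0<..<T})"
  using *(3) by (subst null_sets_restrict_space) (auto intro: null_set_Int2)
 have "N \<subseteq> N' Int {0<..<T}" using *(1,2) B(2) by auto
 thus ?thesis by (rule that[OF *(1) S _ N'])
qed

lemma finite_time: "finite_measure (restrict_space lborel {0<..<T})" "finite_measure (lebesgue_on {0<..<T})"
proof -
 have e: "emeasure lborel {0<..<T} = ennreal T" using emeasure_lborel_Ioo[of 0 T] T by simp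
 have "emeasure (restrict_space lborel {0<..<T}) {0<..<T} = emeasure lborel {0<..<T}"
  by (rule emeasure_restrict_space) auto
 thus "finite_measure (restrict_space lborel {0<..<T})"
  by (intro finite_measureI) (simp only: space_restrict_space space_lborel Int_UNIV_right e, simp)
 have "emeasure (lebesgue_on {0<..<T}) {0<..<T} = emeasure lebesgue {0<..<T}"
  by (rule emeasure_restrict_space) auto
 also have "emeasure lebesgue {0<..<T} = emeasure lborel {0<..<T}" by simp
 finally show "finite_measure (lebesgue_on {0<..<T})"
  by (intro finite_measureI) (simp only: space_restrict_space space_completion space_lborel Int_UNIV_right e, simp)
qed

text \<open>A rectangle with sides measurable for the completed factors is a Borel rectangle up to
  strips over null sets.\<close>

lemma pair_completion_sets:
 "sets (completion M1 <x> lebesgue_on {0<..<T}) \<subseteq> sets (completion (M1 <x> restrict_space lborel {0<..<T}))"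
proof -
 let ?M2 = "restrict_space lborel {0<..<T}"
 interpret F2: finite_measure ?M2 by (rule finite_time)
 have sp: "space (completion (M1 <x> ?M2)) = space (completion M1) \<times> space (lebesgue_on {0<..<T})"
  by (simp add: space_pair_measure space_restrict_space)
 show ?thesis
  unfolding sets_pair_measure sp[symmetric]
 proof (rule sets.sigma_sets_subset, safe)
  fix X Y assume X: "X : sets (completion M1)" and Y: "Y : sets (lebesgue_on {0<..<T})"
  obtain S N N' where X': "X = S Un N" "N \<subseteq> N'" "N' : null_sets M1" "S : sets M1"
   using X by (auto elim: sets_completionE)
  obtain S2 N2 N2' where Y': "Y = S2 Un N2" "S2 : sets ?M2" "N2 \<subseteq> N2'" "N2' : null_sets ?M2"
   using restrict_lborel_sets[OF Y] by metis
  have n1: "N' \<times> space ?M2 : null_sets (M1 <x> ?M2)"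
  proof (rule null_setsI)
   show "N' \<times> space ?M2 : sets (M1 <x> ?M2)" using X'(3) by (intro pair_measureI sets.top) auto
   show "emeasure (M1 <x> ?M2) (N' \<times> space ?M2) = 0"
    using X'(3) by (subst F2.emeasure_pair_measure_Times[OF _ sets.top]) auto
  qed
  have n2: "space M1 \<times> N2' : null_sets (M1 <x> ?M2)"
  proof (rule null_setsI)
   show "space M1 \<times> N2' : sets (M1 <x> ?M2)" using Y'(4) by (intro pair_measureI sets.top) auto
   show "emeasure (M1 <x> ?M2) (space M1 \<times> N2') = 0"
    using Y'(4) by (subst F2.emeasure_pair_measure_Times[OF sets.top]) auto
  qed
  have "X \<subseteq> space M1" "Y \<subseteq> space ?M2" using sets.sets_into_space[OF X] sets.sets_into_space[OF Y] by (auto simp: space_restrict_space)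
  hence "X \<times> Y = S \<times> S2 Un (X \<times> Y - S \<times> S2)" "X \<times> Y - S \<times> S2 \<subseteq> N' \<times> space ?M2 Un space M1 \<times> N2'"
   using X' Y' by auto
  thus "X \<times> Y : sets (completion (M1 <x> ?M2))"
   by (rule sets_completionI[OF _ _ null_sets.Un[OF n1 n2] pair_measureI[OF X'(4) Y'(2)]])
 qed
qed

text \<open>The sections of a Borel set are Borel, and on those completion changes no value.\<close>

lemma pair_completion_emeasure:
 assumes S: "S : sets (M1 <x> restrict_space lborel {0<..<T})"
 shows "S : sets (completion M1 <x> lebesgue_on {0<..<T})"
  and "emeasure (completion M1 <x> lebesgue_on {0<..<T}) S = emeasure (M1 <x> restrict_space lborel {0<..<T}) S"
proof -
 let ?M2 = "restrict_space lborel {0<..<T}"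
 interpret F2: finite_measure ?M2 by (rule finite_time)
 interpret G2: finite_measure "lebesgue_on {0<..<T}" by (rule finite_time)
 have sub2: "sets ?M2 \<subseteq> sets (lebesgue_on {0<..<T})" unfolding sets_restrict_space sets_lborel by (rule image_mono) auto
 have "sets (M1 <x> ?M2) \<subseteq> sets (completion M1 <x> lebesgue_on {0<..<T})"
 proof -
  have sp: "space (completion M1 <x> lebesgue_on {0<..<T}) = space M1 \<times> space ?M2"
   by (simp add: space_pair_measure space_restrict_space)
  show ?thesis
   unfolding sets_pair_measure[of M1] sp[symmetric]
  proof (rule sets.sigma_sets_subset, safe)
   fix X Y assume "X : sets M1" "Y : sets ?M2"
   thus "X \<times> Y : sets (completion M1 <x> lebesgue_on {0<..<T})"
    using sub2 by (intro pair_measureI) auto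
  qed
 qed
 thus S': "S : sets (completion M1 <x> lebesgue_on {0<..<T})" using S by auto
 have "emeasure (completion M1 <x> lebesgue_on {0<..<T}) S = (\<integral>\<^sup>+x. emeasure (lebesgue_on {0<..<T}) (Pair x -` S) \<partial>completion M1)"
  by (rule G2.emeasure_pair_measure_alt[OF S'])
 also have "... = (\<integral>\<^sup>+x. emeasure ?M2 (Pair x -` S) \<partial>completion M1)"
 proof (intro nn_integral_cong)
  fix x
  have "Pair x -` S : sets ?M2" using S by (rule sets_Pair1)
  hence "Pair x -` S : sets borel" "Pair x -` S \<subseteq> {0<..<T}" by (auto simp: sets_restrict_space)
  thus "emeasure (lebesgue_on {0<..<T}) (Pair x -` S) = emeasure ?M2 (Pair x -` S)"
   by (simp add: emeasure_restrict_space)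
 qed
 also have "... = (\<integral>\<^sup>+x. emeasure ?M2 (Pair x -` S) \<partial>M1)"
  by (rule nn_integral_completion)
 also have "... = emeasure (M1 <x> ?M2) S" by (rule F2.emeasure_pair_measure_alt[OF S, symmetric])
 finally show "emeasure (completion M1 <x> lebesgue_on {0<..<T}) S = emeasure (M1 <x> ?M2) S" .
qed

text \<open>A null set of the product of the completed factors is contained in a null set of the
  Borel product, so the second completion adds nothing new either. This brings weak-star
  measurability into the form that \<open>borel_kernel_version\<close> takes.\<close>

lemma spacetime_sets:
 "sets (completion (completion M1 <x> lebesgue_on {0<..<T})) \<subseteq> sets (completion (M1 <x> restrict_space lborel {0<..<T}))"
proof
 let ?P = "M1 <x> restrict_space lborel {0<..<T}" and ?Q = "completion M1 <x> lebesgue_on {0<..<T}"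
 fix X assume "X : sets (completion ?Q)"
 then obtain S N N' where X: "X = S Un N" "N \<subseteq> N'" "N' : null_sets ?Q" "S : sets ?Q"
  by (auto elim: sets_completionE)
 have "N' : sets (completion ?P)" using X(3) pair_completion_sets by auto
 then obtain S1 N1 N1' where N': "N' = S1 Un N1" "N1 \<subseteq> N1'" "N1' : null_sets ?P" "S1 : sets ?P"
  by (auto elim: sets_completionE)
 have "emeasure ?P S1 = emeasure ?Q S1" by (rule pair_completion_emeasure(2)[OF N'(4), symmetric])
 also have "... <= emeasure ?Q N'" using N'(1) X(3) by (intro emeasure_mono) auto
 also have "... = 0" using X(3) by auto
 finally have "S1 : null_sets ?P" using N'(4) by (auto simp: null_sets_def)
 hence "S1 Un N1' : null_sets ?P" using N'(3) by auto
 hence "N : sets (completion ?P)" using X(2) N'(1,2) by (intro sets_completionI[of N "{}" N "S1 Un N1'"]) auto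
 thus "X : sets (completion ?P)" using X(1,4) pair_completion_sets by auto
qed

lemma spacetime_measurable:
 fixes h :: "'a * real => real"
 assumes "h : bmeas (completion (completion M1 <x> lebesgue_on {0<..<T}))"
 shows "h : bmeas (completion (M1 <x> restrict_space lborel {0<..<T}))"
proof (rule measurableI)
 have sp: "space (completion (completion M1 <x> lebesgue_on {0<..<T})) = space (completion (M1 <x> restrict_space lborel {0<..<T}))"
  by (simp add: space_pair_measure space_restrict_space)
 fix B :: "real set" assume "B : sets borel"
 from measurable_sets[OF assms this] spacetime_sets
 show "h -` B Int space (completion (M1 <x> restrict_space lborel {0<..<T})) : sets (completion (M1 <x> restrict_space lborel {0<..<T}))"
  unfolding sp by blast
qed auto

text \<open>Finite total mass puts functions that are constant on spacetime into
  \<open>L1_C0\<close>.\<close>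

lemma spacetime_finite: "emeasure (completion (completion M1 <x> lebesgue_on {0<..<T})) (space (completion M1 <x> lebesgue_on {0<..<T})) < \<infinity>"
proof -
 interpret F1: finite_measure M1 by (rule fin)
 interpret G2: finite_measure "lebesgue_on {0<..<T}" by (rule finite_time)
 have "emeasure (completion M1) (space M1) < \<infinity>" "emeasure (lebesgue_on {0<..<T}) (space (lebesgue_on {0<..<T})) < \<infinity>"
  using F1.emeasure_finite[of "space M1"] G2.emeasure_finite[of "space (lebesgue_on {0<..<T})"]
  by (simp_all only: infinity_ennreal_def less_top[symmetric] emeasure_completion sets.top main_part_sets) auto
 hence "emeasure (completion M1) (space M1) * emeasure (lebesgue_on {0<..<T}) (space (lebesgue_on {0<..<T})) < \<infinity>"
  by (simp add: ennreal_mult_less_top)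
 moreover have "emeasure (completion M1 <x> lebesgue_on {0<..<T}) (space M1 \<times> space (lebesgue_on {0<..<T}))
   = emeasure (completion M1) (space M1) * emeasure (lebesgue_on {0<..<T}) (space (lebesgue_on {0<..<T}))"
  by (rule G2.emeasure_pair_measure_Times) auto
 moreover have "space (completion M1 <x> lebesgue_on {0<..<T}) = space M1 \<times> space (lebesgue_on {0<..<T})"
  by (simp add: space_pair_measure)
 ultimately have "emeasure (completion M1 <x> lebesgue_on {0<..<T}) (space (completion M1 <x> lebesgue_on {0<..<T})) < \<infinity>"
  by (simp only:)
 moreover have "emeasure (completion Q) (space Q) = emeasure Q (space Q)" for Q :: "('a * real) measure" by simp
 ultimately show ?thesis by (simp only:)
qed

end

text \<open>The complement of the support is a union of null open sets; a countable basis makes it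
  null.\<close>

lemma measure_support_AE:
 assumes S: "sets mu = sets (borel :: real measure)" and sup: "measure_support mu \<subseteq> {a..b}"
 shows "AE v in mu. v : {a..b}"
proof -
 obtain \<B> :: "real set set" where \<B>: "countable \<B>" "topological_basis \<B>" using ex_countable_basis by blast
 define Z where "Z = (UN U:{U : \<B>. emeasure mu U = 0}. U)"
 have "Z : null_sets mu"
  unfolding Z_def
 proof (rule null_sets_UN')
  show "countable {U : \<B>. emeasure mu U = 0}" using \<B>(1) by auto
  fix U assume "U : {U : \<B>. emeasure mu U = 0}"
  thus "U : null_sets mu" using S topological_basis_open[OF \<B>(2)] by (auto simp: null_sets_def)
 qed
 hence "AE v in mu. v ~: Z" by (rule AE_not_in)
 thus ?thesis
 proof eventually_elim
  fix v assume v: "v ~: Z"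
  show "v : {a..b}"
  proof (rule ccontr)
   assume "v ~: {a..b}"
   hence "v ~: measure_support mu" using sup by blast
   then obtain U where U: "open U" "v : U" "\<not> emeasure mu U > 0" unfolding measure_support_def by blast
   obtain W where W: "W : \<B>" "v : W" "W \<subseteq> U" using topological_basisE[OF \<B>(2) U(1,2)] by blast
   have "emeasure mu W <= emeasure mu U" using S U(1) W(3) by (intro emeasure_mono) auto
   hence "emeasure mu W = 0" using U(3) by auto
   thus False using v W unfolding Z_def by blast
  qed
 qed
qed

text \<open>A ramp of slope \<open>n\<close> starting at \<open>r\<close>, times a cutoff that ends
  at \<open>n\<close>. Taken constant in (x, t), these functions are admissible in the weak-star
  measurability, and their limits give the tails of the Young measures.\<close>

lemma bump_indicator_C0:
 fixes r :: real
 obtains h :: "nat => real \<Rightarrow>\<^sub>C real" where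
  "!!n. (apply_bcontfun (h n) \<longlongrightarrow> 0) at_infinity" "!!n v. abs (apply_bcontfun (h n) v) <= 1"
  "!!v. (%n. apply_bcontfun (h n) v) \<longlonglongrightarrow> ind {r<..} v"
proof -
 define q where "q n v = min 1 (max 0 (real n * (v - r))) * min 1 (max 0 (real n - v))" for n v
 have q01: "0 <= q n v" "q n v <= 1" for n v
  unfolding q_def using mult_mono[of "min 1 (max 0 (real n * (v - r)))" 1 "min 1 (max 0 (real n - v))" 1] by auto
 have q: "q n : bcontfun" for n
  unfolding bcontfun_def using q01
  by (auto simp: bounded_iff intro!: exI[of _ 1]) (auto simp: q_def intro!: continuous_intros)
 have out: "q n v = 0" if "abs v > abs r + real n" for n v
 proof (cases "v > real n")
  case False
  hence "v < r" using that by auto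
  hence "real n * (v - r) <= 0" by (intro mult_nonneg_nonpos) auto
  hence "max 0 (real n * (v - r)) = 0" by (rule max_absorb1)
  thus ?thesis by (simp add: q_def)
 qed (simp add: q_def)
 show ?thesis
 proof (rule that[of "%n. Bcontfun (q n)"])
  show "(apply_bcontfun (Bcontfun (q n)) \<longlongrightarrow> 0) at_infinity" for n
  proof (rule Lim_transform_eventually[OF tendsto_const])
   show "\<forall>\<^sub>F v in at_infinity. 0 = apply_bcontfun (Bcontfun (q n)) v"
    unfolding eventually_at_infinity Bcontfun_inverse[OF q]
    by (intro exI[of _ "abs r + real n + 1"]) (auto simp: out)
  qed
  show "abs (apply_bcontfun (Bcontfun (q n)) v) <= 1" for n v
   unfolding Bcontfun_inverse[OF q] using q01[of n v] by auto
  show "(%n. apply_bcontfun (Bcontfun (q n)) v) \<longlonglongrightarrow> ind {r<..} v" for v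
   unfolding Bcontfun_inverse[OF q]
  proof (cases "v > r")
   case True
   obtain n1 where n1: "1 < real n1 * (v - r)" using reals_Archimedean3[of "v - r"] True by auto
   obtain n2 where n2: "v + 1 < real n2" using reals_Archimedean2 by blast
   have "q n v = 1" if "n >= max n1 n2" for n
   proof -
    have "real n1 * (v - r) <= real n * (v - r)" using that True by (intro mult_right_mono) auto
    hence "1 <= real n * (v - r)" using n1 by linarith
    moreover have "1 <= real n - v" using that n2 by auto
    ultimately show ?thesis by (simp add: q_def)
   qed
   hence "\<forall>\<^sub>F n in sequentially. 1 = q n v" unfolding eventually_sequentially by metis
   thus "(%n. q n v) \<longlonglongrightarrow> ind {r<..} v" using True by (simp add: Lim_transform_eventually[OF tendsto_const])
  next
   case False
   have "q n v = 0" for n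
   proof -
    have "real n * (v - r) <= 0" using False by (intro mult_nonneg_nonpos) auto
    hence "max 0 (real n * (v - r)) = 0" by (rule max_absorb1)
    thus ?thesis by (simp add: q_def)
   qed
   thus "(%n. q n v) \<longlonglongrightarrow> ind {r<..} v" using False by simp
  qed
 qed
qed

text \<open>The density is positive, so being null can be read off in coordinates without reference
  to the metric; all volume measures of the family therefore share their null sets.\<close>

lemma (in riemannian_manifold) null_sets_chart:
 assumes N: "N : sets borel"
 shows "N : null_sets mu \<longleftrightarrow> (ALL c:A. AE y in lborel. y : cimg c --> chart_inv c y ~: N)"
proof -
 have chart: "emeasure mu (N Int fst c) = 0 \<longleftrightarrow> (AE y in lborel. y : cimg c --> chart_inv c y ~: N)"
  if c: "c : A" for c
 proof -
  note [measurable] = w_measurable[OF c]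
  let ?S = "snd c ` (N Int fst c)"
  have B: "N Int fst c : sets borel" using N dom_borel[OF c] by auto
  have S: "?S = {y : cimg c. chart_inv c y : N}" using coord_image[OF c, of "N Int fst c"] c by auto
  have [measurable]: "?S : sets borel" by (rule coord_image_borel[OF c B]) simp
  have "emeasure mu (N Int fst c) = emeasure (vol c) (N Int fst c)" using is_vol_mu c B by (auto simp: is_vol_def)
  also have "... = (\<integral>\<^sup>+y. ennreal (vol_density G c (chart_inv c y)) * ind ?S y \<partial>lborel)"
   by (simp add: emeasure_vol[OF c B] Int_assoc)
  also have "... = (\<integral>\<^sup>+y. ennreal (w c y) * ind ?S y \<partial>lborel)"
   by (intro nn_integral_cong) (auto simp: w_def S indicator_def)
  finally have "emeasure mu (N Int fst c) = 0 \<longleftrightarrow> (AE y in lborel. ennreal (w c y) * ind ?S y = 0)"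
   by (simp add: nn_integral_0_iff_AE)
  moreover have "ennreal (w c y) * ind ?S y = 0 \<longleftrightarrow> (y : cimg c --> chart_inv c y ~: N)" for y
  proof (cases "y : ?S")
   case True
   hence "w c y > 0" using vol_density_pos[OF c] c S by (simp add: w_def)
   thus ?thesis using True S by (simp add: ennreal_eq_0_iff)
  next
   case False
   thus ?thesis using S by simp
  qed
  ultimately show ?thesis by simp
 qed
 have iff: "N : null_sets mu \<longleftrightarrow> (ALL c:A. emeasure mu (N Int fst c) = 0)"
 proof
  assume "N : null_sets mu"
  hence "N Int fst c : null_sets mu" if "c : A" for c using dom_borel[OF that] by (intro null_set_Int2) auto
  thus "ALL c:A. emeasure mu (N Int fst c) = 0" by auto
 next
  assume *: "ALL c:A. emeasure mu (N Int fst c) = 0"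
  obtain C where C: "C \<subseteq> A" "finite C" "(UN c:C. fst c) = UNIV" by (rule finite_cover)
  have "N Int fst c : null_sets mu" if "c : C" for c
   using that C(1) * N dom_borel by (intro null_setsI) auto
  hence "(UN c:C. N Int fst c) : null_sets mu" using C(2) by (intro null_sets_UN' countable_finite)
  moreover have "(UN c:C. N Int fst c) = N" using C(3) by blast
  ultimately show "N : null_sets mu" by simp
 qed
 show ?thesis unfolding iff using chart by blast
qed

section \<open>The conservation law and Borel versions of its Young measures\<close>

locale conservation_law = closed_manifold A for A :: "('m::{t2_space,second_countable_topology}, 'd::finite) chart set" +
 fixes T :: real and g :: "real => ('m, 'd) mfield" and f :: "('m, 'd) flux"
 assumes T: "T > 0" and metric_family: "c11_metric_family A T g" and admissible: "admissible_flux A T g f"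
begin

lemma metric_chart_cont:
 assumes "c : A"
 shows "continuous_on (cimg c <*> {0..T}) (%(y, t). g t c (chart_inv c y))"
proof -
 have "c11_on (cimg c <*> {0..T}) (%(y, t). g t c (chart_inv c y))"
  using metric_family assms unfolding c11_metric_family_def by blast
 then obtain f' where "!!z. z : cimg c <*> {0..T} ==> ((%(y, t). g t c (chart_inv c y)) has_derivative blinfun_apply (f' z)) (at z within cimg c <*> {0..T})"
  unfolding c11_on_def by metis
 thus ?thesis by (rule has_derivative_continuous_on)
qed

lemma riem: "t : {0..T} ==> riemannian_manifold A (g t)"
proof
 assume t: "t : {0..T}"
 thus "is_riemannian_metric A (g t)" using metric_family unfolding c11_metric_family_def by blast
 fix c assume "c : A"
 have "continuous_on (cimg c) (%y. (%(y, t). g t c (chart_inv c y)) (y, t))"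
  by (rule cont_comp2[OF metric_chart_cont[OF \<open>c : A\<close>]]) (use t in \<open>auto intro!: continuous_intros\<close>)
 thus "continuous_on (cimg c) (%y. g t c (chart_inv c y))" by simp
qed

definition dV :: "real => 'm measure" where "dV t = riemannian_manifold.mu A (g t)"

lemma dV_sets: "t : {0..T} ==> sets (dV t) = sets borel" and dV_space: "t : {0..T} ==> space (dV t) = UNIV"
 and finite_dV: "t : {0..T} ==> finite_measure (dV t)"
 and riem_volume_dV: "t : {0..T} ==> riem_volume A (g t) = completion (dV t)"
 unfolding dV_def
 using riemannian_manifold.mu_sets[OF riem] riemannian_manifold.mu_space[OF riem]
  riemannian_manifold.finite_mu[OF riem] riemannian_manifold.riem_volume_eq[OF riem] by blast+

lemma null_sets_dV:
 assumes "s : {0..T}" "t : {0..T}" "N : null_sets (dV s)"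
 shows "N : null_sets (dV t)"
proof -
 have "N : sets borel" using assms(3) dV_sets[OF assms(1)] by auto
 from riemannian_manifold.null_sets_chart[OF riem[OF assms(1)] this] riemannian_manifold.null_sets_chart[OF riem[OF assms(2)] this]
 show ?thesis using assms(3) unfolding dV_def by blast
qed

text \<open>Off a null set of spacetime \<open>nv\<close> agrees with a Borel kernel; elsewhere a
  point mass at 0 keeps the support bound valid for every \<open>w\<close>. Fubini turns the null
  set into null sections at almost every time, at first for \<open>dV 0\<close> and then, null sets
  being common, for \<open>dV t\<close>.\<close>

lemma mv_kernel:
 assumes ws: "weak_star_measurable_prob A T g nv"
  and supp: "!!p t. t : {0<..<T} ==> measure_support (nv p t) \<subseteq> {a..b}"
  and R: "R > 0" "{a..b} \<subseteq> {- R<..<R}"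
 obtains nv' Z where "nv' : borel -M> prob_algebra borel" "!!w. AE v in nv' w. abs v < R"
  "Z : null_sets lborel" "!!t. t : {0<..<T} ==> t ~: Z ==> AE p in dV t. nv' (p, t) = nv p t"
proof -
 have T0: "0 : {0..T}" using T by simp
 define I where "I = restrict_space lborel {0<..<T}"
 define M where "M = dV 0 <x> I"
 define K where "K w = nv (fst w) (snd w)" for w
 interpret F1: finite_measure "dV 0" by (rule finite_dV[OF T0])
 interpret F2: finite_measure I unfolding I_def by (rule finite_time(1)[OF F1.finite_measure_axioms T])
 interpret P: pair_sigma_finite "dV 0" I by standard
 have st: "spacetime A T g = completion (completion (dV 0) <x> lebesgue_on {0<..<T})"
  by (simp add: spacetime_def riem_volume_dV[OF T0])
 have spM: "space M = UNIV <*> {0<..<T}" by (simp add: M_def I_def space_pair_measure dV_space[OF T0] space_restrict_space)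
 have sp: "space (spacetime A T g) = UNIV <*> {0<..<T}"
  by (simp add: st space_pair_measure dV_space[OF T0] space_restrict_space)
 have rd: "prob_space (K w)" "sets (K w) = sets borel" if "w : UNIV <*> {0<..<T}" for w
 proof -
  have "real_distribution (K w)" using ws that unfolding weak_star_measurable_prob_def K_def by auto
  thus "prob_space (K w)" "sets (K w) = sets borel"
   by (auto simp: real_distribution_def real_distribution_axioms_def)
 qed
 have meas: "(%w. measure (K w) {r<..}) : bmeas (completion M)" for r
 proof -
  obtain h :: "nat => real \<Rightarrow>\<^sub>C real" where h:
   "!!n. (apply_bcontfun (h n) \<longlongrightarrow> 0) at_infinity" "!!n v. abs (apply_bcontfun (h n) v) <= 1"
   "!!v. (%n. apply_bcontfun (h n) v) \<longlonglongrightarrow> ind {r<..} v" 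
  proof (rule bump_indicator_C0[of r])
   fix h :: "nat => real \<Rightarrow>\<^sub>C real"
   assume h: "!!n. (apply_bcontfun (h n) \<longlongrightarrow> 0) at_infinity" "!!n v. abs (apply_bcontfun (h n) v) <= 1"
    "!!v. (%n. apply_bcontfun (h n) v) \<longlonglongrightarrow> ind {r<..} v"
   show thesis by (rule that[OF h])
  qed
  have L1: "(%_. h n) : L1_C0 (spacetime A T g)" for n
  proof -
   have "ennreal (norm (h n)) * emeasure (spacetime A T g) (space (spacetime A T g)) < \<infinity>"
    using spacetime_finite[OF F1.finite_measure_axioms T] by (simp add: st ennreal_mult_less_top)
   thus ?thesis by (simp add: L1_C0_def h(1))
  qed
  have hm: "(%(p, t). LINT v|nv p t. apply_bcontfun (h n) v) : bmeas (spacetime A T g)" for n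
   using bspec[OF conjunct2[OF ws[unfolded weak_star_measurable_prob_def]] L1[of n]] .
  have "(%w. measure (K w) {r<..}) : bmeas (spacetime A T g)"
  proof (rule borel_measurable_LIMSEQ_real)
   show "(%w. LINT v|K w. apply_bcontfun (h n) v) : bmeas (spacetime A T g)" for n
    using hm[of n] by (simp add: K_def case_prod_beta')
   fix w assume "w : space (spacetime A T g)"
   hence w: "w : UNIV <*> {0<..<T}" by (simp only: sp)
   interpret prob_space "K w" by (rule rd[OF w])
   have [measurable_cong]: "sets (K w) = sets borel" by (rule rd[OF w])
   have "(%n. LINT v|K w. apply_bcontfun (h n) v) \<longlonglongrightarrow> (LINT v|K w. ind {r<..} v)"
   proof (rule integral_dominated_convergence[where w = "%_. 1"])
    show "(%v. apply_bcontfun (h n) v) : bmeas (K w)" for n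
    proof -
     have "apply_bcontfun (h n) : bmeas borel" by (intro bmeas_contI continuous_on_apply_bcontfun)
     thus ?thesis by measurable
    qed
   qed (use h in auto)
   thus "(%n. LINT v|K w. apply_bcontfun (h n) v) \<longlonglongrightarrow> measure (K w) {r<..}"
    by simp
  qed
  from spacetime_measurable[OF F1.finite_measure_axioms T this[unfolded st]] show ?thesis by (simp add: M_def I_def)
 qed
 obtain N where N: "N : null_sets M" "(%w. if w : N then return borel 0 else K w) : M -M> prob_algebra borel"
  by (rule borel_kernel_version[of M K, OF _ _ meas]) (use rd spM in auto)
 define nv' where "nv' w = (if w : UNIV <*> {0<..<T} then (if w : N then return borel 0 else K w) else return borel 0)" for w
 have S: "UNIV <*> {0<..<T} : sets (borel :: ('m * real) measure)" by (intro borel_open open_Times) auto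
 have 1: "nv' : borel -M> prob_algebra borel"
  unfolding nv'_def
 proof (subst measurable_If_restrict_space_iff)
  note cm = bmeas_contI
  let ?B = "restrict_space borel {w::'m * real. w : UNIV <*> {0<..<T}}"
  have "(%w. w) : ?B -M> M"
   unfolding M_def
  proof (rule measurable_pair)
   show "fst \<circ> (%w. w) : ?B -M> dV 0"
    unfolding o_def meas_cong_sets[OF refl dV_sets[OF T0]] by (intro measurable_restrict_space1 cm) (intro continuous_intros)
   show "snd \<circ> (%w. w) : ?B -M> I"
    unfolding I_def o_def
   proof (rule measurable_restrict_space2)
    have "(%w::'m * real. snd w) : bmeas borel" by (rule cm) (intro continuous_intros)
    thus "(%w. snd w) : ?B -M> lborel" by (intro measurable_restrict_space1) simp
   qed (auto simp: space_restrict_space)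
  qed
  from measurable_compose[OF this N(2)]
  show "(%w. if w : N then return borel 0 else K w) : restrict_space borel {w. w : UNIV <*> {0<..<T}} -M> prob_algebra borel &
   (%w. return borel 0) : restrict_space borel {w::'m * real. \<not> w : UNIV <*> {0<..<T}} -M> prob_algebra borel"
   by (auto simp: space_prob_algebra intro!: measurable_const prob_space_return)
 qed (use S in simp)
 have 2: "AE v in nv' w. abs v < R" for w
 proof (cases "w : UNIV <*> {0<..<T} - N")
  case True
  hence w: "w : UNIV <*> {0<..<T}" "snd w : {0<..<T}" by auto
  have "measure_support (K w) \<subseteq> {a..b}" unfolding K_def by (rule supp[OF w(2)])
  hence "AE v in K w. v : {a..b}" by (rule measure_support_AE[OF rd(2)[OF w(1)]])
  hence "AE v in K w. abs v < R"
  proof eventually_elim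
   case (elim v)
   hence "v : {- R<..<R}" using R(2) by blast
   thus ?case by auto
  qed
  moreover have "nv' w = K w" unfolding nv'_def using True w(1) by (simp only: if_True Diff_iff simp_thms if_False)
  ultimately show ?thesis by (subst \<open>nv' w = K w\<close>)
 next
  case False
  hence "nv' w = return borel 0" by (auto simp: nv'_def)
  thus ?thesis using R(1) by (subst \<open>nv' w = return borel 0\<close>, subst AE_return) auto
 qed
 have Nm: "N : sets (dV 0 <x> I)" using N(1) by (auto simp: M_def)
 have "AE w in dV 0 <x> I. w ~: N" using AE_not_in[OF N(1)] unfolding M_def .
 hence "AE p in dV 0. AE t in I. (p, t) ~: N" by (rule P.AE_pair)
 hence "AE t in I. AE p in dV 0. (p, t) ~: N"
  by (subst (asm) P.AE_commute) (use Nm in measurable)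
 hence "AE t in lborel. t : {0<..<T} --> (AE p in dV 0. (p, t) ~: N)"
  unfolding I_def by (subst (asm) AE_restrict_space_iff) auto
 then obtain Z where Z: "Z : null_sets lborel" "!!t. t : {0<..<T} ==> t ~: Z ==> AE p in dV 0. (p, t) ~: N"
 proof (rule AE_E3)
  fix Z assume h: "!!t. t : space lborel - Z ==> t : {0<..<T} --> (AE p in dV 0. (p, t) ~: N)" "Z : null_sets lborel"
  show thesis
  proof (rule that[OF h(2)])
   fix t assume t: "t : {0<..<T}" "t ~: Z"
   have "t : space lborel - Z" using t(2) by simp
   from mp[OF h(1)[OF this] t(1)] show "AE p in dV 0. (p, t) ~: N" .
  qed
 qed
 have 3: "AE p in dV t. nv' (p, t) = nv p t" if t: "t : {0<..<T}" "t ~: Z" for t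
 proof -
  have "(%p. (p, t)) -` N : sets (dV 0)" by (rule sets_Pair2[OF Nm])
  moreover have "AE p in dV 0. p ~: (%p. (p, t)) -` N" using Z(2)[OF t] by simp
  ultimately have n0: "(%p. (p, t)) -` N : null_sets (dV 0)" by (rule AE_iff_null_sets[THEN iffD2])
  have "t : {0..T}" using t(1) by simp
  from null_sets_dV[OF T0 this n0] have "(%p. (p, t)) -` N : null_sets (dV t)" .
  hence "AE p in dV t. p ~: (%p. (p, t)) -` N" by (rule AE_not_in)
  thus ?thesis
  proof eventually_elim
   fix p assume "p ~: (%p. (p, t)) -` N"
   thus "nv' (p, t) = nv p t" using t(1) by (simp add: nv'_def K_def)
  qed
 qed
 show ?thesis by (rule that[OF 1 2 Z(1) 3])
qed

end

section \<open>Localisation\<close>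

text \<open>The kinetic convention is \<open>v <= r < u\<close>; the missing endpoint is a null set,
  and for \<open>u < v\<close> both sides are 0.\<close>

lemma half_open_integral:
 fixes f :: "real => real"
 assumes f: "continuous_on UNIV f"
 shows "(LINT r|lborel. (if v <= r & r < u then f r else 0)) = integral {v..u} f"
proof -
 have [measurable]: "f : bmeas borel" using f by (rule bmeas_contI)
 have s: "set_integrable lborel {v..u} f"
  by (rule borel_integrable_atLeastAtMost') (rule continuous_on_subset[OF f subset_UNIV])
 have "(LINT r|lborel. (if v <= r & r < u then f r else 0)) = (LINT r|lborel. ind {v..u} r *. f r)"
  by (rule integral_cong_AE) (use AE_lborel_singleton[of u] in \<open>auto elim!: eventually_mono simp: indicator_def\<close>)
 also have "... = integral {v..u} f"
  using set_borel_integral_eq_integral(2)[OF s] by (simp add: set_lebesgue_integral_def)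
 finally show ?thesis .
qed

lemma continuous_on_extend_zero:
 fixes H :: "'e::euclidean_space => real => 'b::real_normed_vector"
 assumes H: "continuous_on (OM <*> UNIV) (%(z, u). H z u)" and OM: "open OM" and K: "closed K" "K \<subseteq> OM"
  and zero: "!!z u. z : OM ==> z ~: K ==> H z u = 0"
 shows "continuous_on UNIV (%(z, u). if z : K then H z u else 0)"
proof -
 let ?H = "%(z, u). if z : K then H z u else 0"
 have 1: "continuous_on (OM <*> UNIV) ?H"
  by (rule continuous_on_eq[OF H]) (use zero in auto)
 have 2: "continuous_on ((- K) \<times> (UNIV::real set)) ?H"
  by (rule continuous_on_eq[OF continuous_on_const[of _ 0]]) auto
 have "(OM <*> UNIV) Un ((- K) <*> UNIV) = (UNIV :: ('e * real) set)" using K by auto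
 moreover have "open (OM \<times> (UNIV::real set))" "open ((- K) \<times> (UNIV::real set))"
  using OM K(1) by (auto intro!: open_Times)
 ultimately show ?thesis using continuous_on_open_Un[OF _ _ 1 2] by metis
qed

lemma clip_bound:
 fixes H :: "'e::euclidean_space => real => 'b::real_normed_vector" and R :: real
 assumes "continuous_on (OM <*> UNIV) (%(z, u). H z u)" "compact K" "K \<subseteq> OM"
 obtains C where "C >= 0" "!!z r. z : K ==> abs r <= R ==> norm (H z r) <= C"
proof -
 have "bounded ((%(z, u). H z u) ` (K <*> {- R..R}))"
  by (intro compact_imp_bounded compact_continuous_image continuous_on_subset[OF assms(1)] compact_Times assms(2)) (use assms(3) in auto)
 then obtain C where C: "!!z r. z : K ==> r : {-R..R} ==> norm (H z r) <= C" unfolding bounded_iff by fast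
 show ?thesis
 proof (rule that[of "max C 0"])
  fix z r assume "z : K" "abs r <= R"
  hence "norm (H z r) <= C" by (intro C) auto
  thus "norm (H z r) <= max C 0" by simp
 qed simp
qed

lemma clip_measurable:
 fixes H :: "'e::euclidean_space => real => 'b::{real_normed_vector, second_countable_topology}" and R :: real
 assumes "continuous_on (OM <*> UNIV) (%(z, u). H z u)" "compact K" "K \<subseteq> OM"
 shows "(%(z, r). if z : K & abs r <= R then H z r else 0) : bmeas borel2"
proof -
 have "(%x. if x : K <*> {- R..R} then (%(z, u). H z u) x else 0) : bmeas borel"
  by (intro bmeas_cont_if borel_closed closed_Times compact_imp_closed assms(2)
    continuous_on_subset[OF assms(1)] continuous_on_const) (use assms(3) in auto)
 moreover have "(%x. if x : K <*> {- R..R} then (%(z, u). H z u) x else 0) = (%(z, r). if z : K & abs r <= R then H z r else 0)"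
  by (auto simp: fun_eq_iff)
 ultimately show ?thesis by (simp add: borel_prod)
qed

lemma section_cont:
 assumes "continuous_on (OM <*> UNIV) (%(z, u). H z u)" "z : OM"
 shows "continuous_on UNIV (H z)"
proof -
 have "continuous_on UNIV (%u. (%(z, u). H z u) (z, u))"
  by (rule cont_comp2[OF assms(1)]) (use assms(2) in \<open>auto intro!: continuous_intros\<close>)
 thus ?thesis by simp
qed

section \<open>Flux fields with a state parameter and their reduction to bounded data\<close>

locale parametrized_field =
 fixes A a :: "'e::euclidean_space => real => 'e" and dA da :: "'e => 'e => real => 'e" and OM :: "'e set"
 assumes open_dom: "open OM"
  and A_grad: "!!b u. b : Basis ==> has_grad (%z. A z u .* b) (%z. dA b z u) OM"
  and a_grad: "!!b u. b : Basis ==> has_grad (%z. a z u .* b) (%z. da b z u) OM"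
  and A_deriv: "!!z u. z : OM ==> (A z has_vector_derivative a z u) (at u)"
  and A_cont: "continuous_on (OM <*> UNIV) (%(z, u). A z u)"
  and a_cont: "continuous_on (OM <*> UNIV) (%(z, u). a z u)"
  and dA_cont: "!!b. b : Basis ==> continuous_on (OM <*> UNIV) (%(z, u). dA b z u)"
  and da_cont: "!!b. b : Basis ==> continuous_on (OM <*> UNIV) (%(z, u). da b z u)"
begin

definition divA :: "'e => real => real" where "divA z u = (SUM b:Basis. dA b z u .* b)"

definition diva :: "'e => real => real" where "diva z u = (SUM b:Basis. da b z u .* b)"

lemma divA_cont: "continuous_on (OM <*> UNIV) (%(z, u). divA z u)"
 and diva_cont: "continuous_on (OM <*> UNIV) (%(z, u). diva z u)"
 unfolding divA_def diva_def case_prod_beta'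
 using dA_cont da_cont by (auto simp: case_prod_beta' intro!: continuous_intros)

lemma A_diff:
 assumes z: "z : OM" and vu: "v <= u"
 shows "A z u .* e - A z v .* e = integral {v..u} (%r. a z r .* e)"
proof -
 have "((%r. a z r .* e) has_integral (A z u .* e - A z v .* e)) {v..u}"
 proof (rule fundamental_theorem_of_calculus[OF vu])
  fix r
  have "((%r. A z r .* e) has_vector_derivative a z r .* e) (at r)"
   by (rule bounded_linear.has_vector_derivative[OF bounded_linear_inner_left A_deriv[OF z]])
  thus "((%r. A z r .* e) has_vector_derivative a z r .* e) (at r within {v..u})"
   by (rule has_vector_derivative_at_within)
 qed
 thus ?thesis by (simp add: integral_unique)
qed

lemma line_derivative:
 assumes f: "has_grad f df OM" and z: "z + s *. b : OM"
 shows "((%s. f (z + s *. b)) has_real_derivative df (z + s *. b) .* b) (at s)"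
proof -
 have "((%s. z + s *. b) has_derivative (%h. h *. b)) (at s)" by (auto intro!: derivative_eq_intros)
 from diff_chain_at[OF this has_gradD[OF f z]]
 show ?thesis by (simp add: o_def has_field_derivative_def mult_commute_abs)
qed

text \<open>The derivatives in state and space are exchanged by differentiating the integral formula
  of \<open>A_diff\<close> along the line \<open>z + s *. b\<close> in two ways: through
  \<open>dA\<close>, and by the Leibniz rule.\<close>

lemma dA_diff:
 assumes b: "b : Basis" and z: "z : OM" and vu: "v <= u"
 shows "(dA b z u - dA b z v) .* b = integral {v..u} (%r. da b z r .* b)"
proof -
 obtain de where de: "de > 0" "ball z de \<subseteq> OM" using open_dom z open_contains_ball by blast
 let ?U = "{- de<..<de}"
 have inOM: "z + s *. b : OM" if "s : ?U" for s
  using that de(2) b by (intro subsetD[OF de(2)]) (auto simp: dist_norm)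
 have "((%s. integral (cbox v u) (%r. a (z + s *. b) r .* b)) has_real_derivative
   integral (cbox v u) (%r. da b (z + 0 *. b) r .* b)) (at 0 within ?U)"
 proof (rule leibniz_rule_field_derivative)
  show "((%s. a (z + s *. b) r .* b) has_real_derivative da b (z + s *. b) r .* b) (at s within ?U)"
   if "s : ?U" for s r
   by (rule has_field_derivative_at_within[OF line_derivative[OF a_grad[OF b] inOM[OF that]]])
  show "(%r. a (z + s *. b) r .* b) integrable_on cbox v u" if "s : ?U" for s
   by (intro integrable_continuous continuous_intros continuous_on_subset[OF section_cont[OF a_cont inOM[OF that]]]) auto
  have "continuous_on (?U \<times> cbox v u) (%x. (%(z, u). da b z u) (z + fst x *. b, snd x))"
   by (rule cont_comp2[OF da_cont[OF b]]) (use inOM in \<open>auto intro!: continuous_intros\<close>)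
  thus "continuous_on (?U \<times> cbox v u) (%(s, r). da b (z + s *. b) r .* b)"
   by (auto simp: case_prod_beta' intro!: continuous_intros)
 qed (use de(1) in auto)
 hence "((%s. integral (cbox v u) (%r. a (z + s *. b) r .* b)) has_real_derivative
   integral {v..u} (%r. da b z r .* b)) (at 0)"
  using de(1) by (simp add: at_within_open[of 0 ?U])
 moreover have "((%s. A (z + s *. b) u .* b - A (z + s *. b) v .* b) has_real_derivative
   dA b (z + 0 *. b) u .* b - dA b (z + 0 *. b) v .* b) (at 0)"
  by (intro DERIV_diff line_derivative[OF A_grad[OF b]] inOM) (use de(1) in auto)
 hence "((%s. integral (cbox v u) (%r. a (z + s *. b) r .* b)) has_real_derivative
   dA b (z + 0 *. b) u .* b - dA b (z + 0 *. b) v .* b) (at 0)"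
 proof (rule DERIV_cong_ev[OF refl _ refl, THEN iffD1, rotated])
  have "\<forall>\<^sub>F s in nhds 0. s : ?U" using de(1) by (intro eventually_nhds_in_open) auto
  thus "\<forall>\<^sub>F s in nhds 0. A (z + s *. b) u .* b - A (z + s *. b) v .* b = integral (cbox v u) (%r. a (z + s *. b) r .* b)"
   by eventually_elim (simp add: A_diff[OF inOM vu])
 qed
 ultimately have "dA b (z + 0 *. b) u .* b - dA b (z + 0 *. b) v .* b = integral {v..u} (%r. da b z r .* b)"
  by (rule DERIV_unique[rotated])
 thus ?thesis by (simp add: inner_diff_left)
qed

lemma divA_diff:
 assumes z: "z : OM" and vu: "v <= u"
 shows "divA z u - divA z v = integral {v..u} (diva z)"
proof -
 have c: "continuous_on UNIV (%r. da b z r .* b)" if "b : Basis" for b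
  by (intro continuous_intros section_cont[OF da_cont[OF that] z])
 have "divA z u - divA z v = (SUM b:Basis. (dA b z u - dA b z v) .* b)"
  by (simp add: divA_def sum_subtractf inner_diff_left)
 also have "... = (SUM b:Basis. integral {v..u} (%r. da b z r .* b))"
  by (intro sum.cong refl dA_diff[OF _ z vu])
 also have "... = integral {v..u} (%r. SUM b:Basis. da b z r .* b)"
  by (intro integral_sum[symmetric] integrable_continuous_real continuous_on_subset[OF c]) auto
 finally show ?thesis by (simp add: diva_def[abs_def])
qed

text \<open>
 Multiplying the field by a cutoff function and clamping the state variable reduces the local
 situation to the globally defined, bounded data of \<open>kinetic_pair\<close>.
\<close>

theorem kinetic_product_local:
 fixes nv sig :: "'e => real measure"
 assumes nu[measurable]: "nv : borel -M> prob_algebra borel" and sg[measurable]: "sig : borel -M> prob_algebra borel"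
  and nu_supp: "!!z. AE u in nv z. abs u < R" and sg_supp: "!!z. AE u in sig z. abs u < R"
  and nu_bal: "!!c ph dph K. has_grad ph dph UNIV ==> (!!z. 0 <= ph z) ==>
    compact K ==> K \<subseteq> OM ==> (!!z. z ~: K ==> ph z = 0) ==>
    0 <= (LINT z|lborel. LINT u|nv z. (if c < u then dph z .* (A z u - A z c) - ph z * divA z c else 0))"
  and sg_bal: "!!c ph dph K. has_grad ph dph UNIV ==> (!!z. 0 <= ph z) ==>
    compact K ==> K \<subseteq> OM ==> (!!z. z ~: K ==> ph z = 0) ==>
    0 <= (LINT z|lborel. LINT v|sig z. (if v <= c then dph z .* (A z c - A z v) + ph z * divA z c else 0))"
  and ps: "has_grad ps dps UNIV" "!!z. 0 <= ps z"
  and K: "compact K" "K \<subseteq> OM" "!!z. z ~: K ==> ps z = 0"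
 shows "0 <= (LINT w|lborel. measure (nv (fst w)) {snd w<..} * measure (sig (fst w)) {..snd w} *
   (if abs (snd w) <= R then a (fst w) (snd w) .* dps (fst w) else 0))"
proof -
 obtain th dth V K' where th: "has_grad th dth UNIV" "!!z. 0 <= th z" "!!z. th z <= 1"
  and V: "open V" "K \<subseteq> V" "!!z. z : V ==> th z = 1"
  and K': "compact K'" "K' \<subseteq> OM" "!!z. z ~: K' ==> th z = 0"
 proof (rule cutoff_exists[OF K(1,2) open_dom])
  fix th :: "'e => real" and dth V K'
  assume h: "has_grad th dth UNIV" "!!z. 0 <= th z" "!!z. th z <= 1"
   "open V" "K \<subseteq> V" "!!z. z : V ==> th z = 1" "compact K'" "K' \<subseteq> OM" "!!z. z ~: K' ==> th z = 0"
  show thesis by (rule that[OF h])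
 qed
 note K'cl = compact_imp_closed[OF K'(1)]
 have dth0: "dth z = 0" if "z ~: K'" for z by (rule has_grad_zero_outside[OF th(1) K'cl K'(3) that])
 have VK': "V \<subseteq> K'" using V(3) K'(3) by force
 have dthV: "dth z = 0" if "z : V" for z
 proof (rule gradient_eq_0[OF _ V(1) that])
  have "((%z. th z - 1) has_derivative (%h. dth z .* h - 0)) (at z)"
   by (intro has_derivative_diff has_gradD[OF th(1)] has_derivative_const) simp
  thus "((%z. th z - 1) has_derivative (%h. dth z .* h)) (at z)" by simp
 qed (use V(3) in auto)
 have cth: "continuous_on S th" "continuous_on S dth" for S
  using has_grad_continuous[OF th(1)] has_grad_continuous_grad[OF th(1)] continuous_on_subset by blast+
 have cth1: "continuous_on S (%x. th (fst x))" "continuous_on S (%x. dth (fst x))" for S :: "('e * real) set"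
  by (rule cont_comp2[OF cth(1)[of UNIV]] cont_comp2[OF cth(2)[of UNIV]]; auto intro!: continuous_intros)+
 \<comment> \<open>\<open>a'\<close>, \<open>be\<close> and \<open>Q\<close> come from the cut off
   field \<open>th *. A\<close>: its state derivative, the divergence of that, and its own
   divergence at fixed state. Clamping the state by \<open>cl\<close> keeps \<open>b\<close> bounded
   and makes its state derivative vanish beyond \<open>R\<close>.\<close>
 define a' where "a' z r = (if z : K' & abs r <= R then th z *. a z r else 0)" for z r
 define be where "be z r = (if z : K' & abs r <= R then th z * diva z r + dth z .* a z r else 0)" for z r
 define cl where "cl u = max (- R) (min R u)" for u
 define Q where "Q z u = (if z : K' then th z * divA z u + dth z .* A z u else 0)" for z u
 define b where "b z u = Q z (cl u)" for z u
 have R0: "0 <= R"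
 proof (rule ccontr)
  assume "\<not> 0 <= R"
  hence "AE u in nv 0. False" using nu_supp[of 0] by (auto elim!: eventually_mono)
  thus False using prob_space.AE_False[OF kernel_prob_space_borel(1)[OF nu, of 0]] by simp
 qed
 have cl: "abs (cl u) <= R" for u using R0 by (auto simp: cl_def)
 have c1: "continuous_on (OM <*> UNIV) (%(z, r). th z *. a z r)"
  and c2: "continuous_on (OM <*> UNIV) (%(z, r). th z * diva z r + dth z .* a z r)"
  and c3: "continuous_on (OM <*> UNIV) (%(z, r). th z * divA z r + dth z .* A z r)"
  using A_cont a_cont divA_cont diva_cont unfolding case_prod_beta' by - (intro continuous_intros cth1; assumption)+
 have Qc: "continuous_on UNIV (%(z, u). Q z u)"
  unfolding Q_def by (rule continuous_on_extend_zero[OF c3 open_dom K'cl K'(2)]) (simp add: K'(3) dth0)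
 obtain C1 where C1: "C1 >= 0" "!!z r. z : K' ==> abs r <= R ==> norm (th z *. a z r) <= C1"
  using clip_bound[OF c1 K'(1,2)] by metis
 obtain C2 where C2: "C2 >= 0" "!!z r. z : K' ==> abs r <= R ==> norm (th z * diva z r + dth z .* a z r) <= C2"
  using clip_bound[OF c2 K'(1,2)] by metis
 obtain C3 where C3: "C3 >= 0" "!!z r. z : K' ==> abs r <= R ==> norm (th z * divA z r + dth z .* A z r) <= C3"
  using clip_bound[OF c3 K'(1,2)] by metis
 define da' where "da' r e z = (if z : K' then (a z r .* e) *. dth z + th z *. da e z r else 0)" for r e z
 have a'_grad: "has_grad (%z. a' z r .* e) (da' r e) UNIV" if r: "abs r <= R" and e: "e : Basis" for r e
 proof -
  have "has_grad (%z. if z : OM then th z * (a z r .* e) else 0) (da' r e) UNIV"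
   unfolding da'_def
   by (rule has_grad_extend_zero[OF has_grad_mult[OF has_grad_subset[OF th(1) subset_UNIV] a_grad[OF e]]
      open_dom K'cl K'(2)]) (simp add: K'(3))
  moreover have "(%z. if z : OM then th z * (a z r .* e) else 0) = (%z. a' z r .* e)"
   using r K'(2,3) by (auto simp: a'_def fun_eq_iff)
  ultimately show ?thesis by simp
 qed
 have "EX C>=0. ALL z r. abs r <= R --> norm (da' r e z) <= C" if e: "e : Basis" for e
 proof -
  have "continuous_on (OM <*> UNIV) (%(z, r). (a z r .* e) *. dth z + th z *. da e z r)"
   using a_cont da_cont[OF e] unfolding case_prod_beta' by - (intro continuous_intros cth1; assumption)
  from clip_bound[OF this K'(1,2)] obtain C where "C >= 0" "!!z r. z : K' ==> abs r <= R ==> norm ((a z r .* e) *. dth z + th z *. da e z r) <= C"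
   by metis
  thus ?thesis by (intro exI[of _ C]) (simp add: da'_def)
 qed
 then obtain Cd where Cd: "!!e. e : Basis ==> 0 <= Cd e" "!!e z r. e : Basis ==> abs r <= R ==> norm (da' r e z) <= Cd e" by metis
 define C4 where "C4 = (SUM e:(Basis::'e set). Cd e)"
 have C4: "C4 >= 0" unfolding C4_def by (intro sum_nonneg Cd)
 define L where "L = C1 + C2 + C3 + C4"
 have L: "L >= 0" "C1 <= L" "C2 <= L" "C3 <= L" "C4 <= L" using C1(1) C2(1) C3(1) C4 by (auto simp: L_def)
 \<comment> \<open>The domain is \<open>V\<close>, where \<open>th = 1\<close>: test functions
   supported there do not see the cutoff, so the given inequalities for \<open>A\<close> yield the
   required ones.\<close>
 interpret kinetic_pair nv sig a' be b V R L
 proof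
  show "(%(z, r). a' z r) : bmeas borel2"
   unfolding a'_def by (rule clip_measurable[OF c1 K'(1,2)])
  show bem: "(%(z, r). be z r) : bmeas borel2"
   unfolding be_def by (rule clip_measurable[OF c2 K'(1,2)])
  have "continuous_on UNIV (%x::'e * real. (%(z, u). Q z u) (fst x, cl (snd x)))"
   unfolding cl_def by (rule cont_comp2[OF Qc]) (auto intro!: continuous_intros)
  hence "(%(z, r). b z r) : bmeas borel"
   unfolding b_def case_prod_beta' fst_conv snd_conv by (rule bmeas_contI)
  thus "(%(z, r). b z r) : bmeas borel2" by (simp add: borel_prod)
  show "norm (a' z r) <= L" for z r using C1(2)[of z r] L unfolding a'_def by auto
  show "abs (be z r) <= L" for z r using C2(2)[of z r] L unfolding be_def by auto
  show "abs (b z u) <= L" for z u using C3(2)[of z "cl u", OF _ cl] L unfolding b_def Q_def by auto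
  show "norm (a' z r - a' z' r) <= L * norm (z - z')" for z z' r
  proof (cases "abs r <= R")
   case True
   have "norm (a' z r - a' z' r) <= (SUM e:Basis. abs ((a' z r - a' z' r) .* e))" by (rule norm_le_l1)
   also have "... <= (SUM e:Basis. Cd e * norm (z - z'))"
    unfolding inner_diff_left
    by (intro sum_mono has_grad_lipschitz[OF a'_grad[OF True] convex_UNIV Cd(2)[OF _ True]]) auto
   also have "... = C4 * norm (z - z')" by (simp add: C4_def sum_distrib_right)
   also have "... <= L * norm (z - z')" using L by (intro mult_right_mono) auto
   finally show ?thesis .
  next
   case False
   thus ?thesis using L(1) by (simp add: a'_def)
  qed
  show "EX d>0. ALL z z' u. norm (z - z') < d --> abs (b z u - b z' u) < e" if e: "e > 0" for e
  proof -
   \<comment> \<open>If one of two points closer than 1 lies in \<open>K'\<close>, both lie in the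
     compact set \<open>K1\<close>, on which \<open>Q\<close> is uniformly continuous; if neither
     does, both values are 0.\<close>
   define K1 where "K1 = {x + y |x y. x : K' & y : cball (0::'e) 1}"
   have "compact K1" unfolding K1_def by (intro compact_sums K'(1)) auto
   hence "uniformly_continuous_on (K1 <*> {- R..R}) (%(z, u). Q z u)"
    by (intro compact_uniformly_continuous continuous_on_subset[OF Qc] compact_Times) auto
   then obtain d where d: "d > 0" "!!x x'. x : K1 <*> {- R..R} ==> x' : K1 <*> {- R..R} ==> dist x' x < d ==>
     dist ((%(z, u). Q z u) x') ((%(z, u). Q z u) x) < e"
    using e unfolding uniformly_continuous_on_def by metis
   have near: "z : K1" if "x : K'" "norm (z - x) < 1" for z x
    unfolding K1_def using that by (intro CollectI exI[of _ x] exI[of _ "z - x"]) auto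
   have "abs (b z u - b z' u) < e" if zz: "norm (z - z') < min d 1" for z z' u
   proof (cases "z : K' \<or> z' : K'")
    case True
    have "norm (z' - z) < 1" using zz by (simp add: norm_minus_commute)
    hence "z : K1" "z' : K1" using True near[of z z'] near[of z' z] near[of z z] near[of z' z'] zz by auto
    moreover have "cl u : {- R..R}" using cl[of u] by auto
    moreover have "dist (z, cl u) (z', cl u) < d" using zz by (simp add: dist_Pair_Pair dist_norm)
    ultimately have "dist ((%(z, u). Q z u) (z, cl u)) ((%(z, u). Q z u) (z', cl u)) < e" by (intro d(2)) auto
    thus ?thesis by (simp add: b_def dist_real_def)
   next
    case False
    thus ?thesis using e by (simp add: b_def Q_def)
   qed
   thus ?thesis using d(1) by (intro exI[of _ "min d 1"]) auto
  qed
  show "b z u - b z v = (LINT r|lborel. (if v <= r & r < u then be z r else 0))" if vu: "v <= u" for z u v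
  proof (cases "z : K'")
   case True
   hence z: "z : OM" using K'(2) by auto
   have clvu: "cl v <= cl u" using vu by (auto simp: cl_def)
   note ca = section_cont[OF a_cont z] and cd = section_cont[OF diva_cont z]
   let ?f = "%r. th z * diva z r + a z r .* dth z"
   have cf: "continuous_on UNIV ?f" by (intro continuous_intros ca cd)
   hence [measurable]: "?f : bmeas borel" by (rule bmeas_contI)
   have "b z u - b z v = th z * (divA z (cl u) - divA z (cl v)) + (A z (cl u) .* dth z - A z (cl v) .* dth z)"
    using True by (simp add: b_def Q_def algebra_simps inner_commute)
   also have "... = th z * integral {cl v..cl u} (diva z) + integral {cl v..cl u} (%r. a z r .* dth z)"
    by (simp only: divA_diff[OF z clvu] A_diff[OF z clvu])
   also have "... = integral {cl v..cl u} ?f"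
   proof (subst integral_add)
    show "(%r. th z * diva z r) integrable_on {cl v..cl u}" "(%r. a z r .* dth z) integrable_on {cl v..cl u}"
     by (intro integrable_continuous_real continuous_intros continuous_on_subset[OF ca] continuous_on_subset[OF cd]; simp)+
   qed simp
   also have "... = (LINT r|lborel. (if cl v <= r & r < cl u then ?f r else 0))" by (rule half_open_integral[OF cf, symmetric])
   also have "... = (LINT r|lborel. (if v <= r & r < u then be z r else 0))"
   proof (rule integral_cong_AE)
    have [measurable]: "be z : bmeas borel" using measurable_compose[OF _ bem, of "%r. (z, r)" borel] by simp
    show "(%r. if v <= r & r < u then be z r else 0) : bmeas lborel" by measurable
    \<comment> \<open>Clamping \<open>v\<close> and \<open>u\<close> amounts to restricting
      \<open>r\<close> to \<open>abs r <= R\<close>, except at the single point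
      \<open>r = R\<close>.\<close>
    show "AE r in lborel. (if cl v <= r & r < cl u then ?f r else 0) = (if v <= r & r < u then be z r else 0)"
     using AE_lborel_singleton[of R]
    proof eventually_elim
     case (elim r)
     have "(cl v <= r & r < cl u) \<longleftrightarrow> (v <= r & r < u & abs r <= R)" using elim R0 unfolding cl_def by auto
     thus ?case using True by (simp add: be_def inner_commute)
    qed
   qed measurable
   finally show ?thesis .
  qed (simp add: b_def Q_def be_def cong: if_cong)
  show "(LINT z|lborel. ph z * be z r + a' z r .* dph z) = 0"
   if ph: "has_grad ph dph UNIV" and K1: "compact K1" and out: "!!z. z ~: K1 ==> ph z = 0" for ph dph K1 r
  proof (cases "abs r <= R")
   case True
   have "be z r = (SUM e:Basis. da' r e z .* e)" for z
   proof (cases "z : K'")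
    case z: True
    have "(SUM e:Basis. (a z r .* e) * (dth z .* e)) = dth z .* a z r"
     by (subst euclidean_inner) (simp add: mult.commute)
    thus ?thesis using z True
     by (simp add: be_def da'_def inner_add_left sum.distrib sum_distrib_left diva_def)
   qed (simp add: be_def da'_def)
   thus ?thesis
    using integration_by_parts(2)[OF open_UNIV a'_grad[OF True] ph K1 subset_UNIV out] by (simp add: inner_commute)
  qed (simp add: be_def a'_def)
  fix c ph dph K1
  assume c: "abs c <= R" and ph: "has_grad ph dph UNIV" "!!z::'e. 0 <= ph z"
   and K1: "compact K1" "K1 \<subseteq> V" and out: "!!z. z ~: K1 ==> ph z = 0"
  have K1OM: "K1 \<subseteq> OM" using K1(2) VK' K'(2) by auto
  have dph0: "dph z = 0" if "z ~: K1" for z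
   by (rule has_grad_zero_outside[OF ph(1) compact_imp_closed[OF K1(1)] out that])
  have clc: "cl c = c" using c by (auto simp: cl_def)
  \<comment> \<open>On \<open>V\<close> and for states in range, cutoff and clamping are invisible,
    and the kinetic integral is again a difference of values of \<open>A\<close>.\<close>
  have inV: "b z c = divA z c" "(LINT r|lborel. (if v <= r & r < u then a' z r .* dph z else 0)) = (if v < u then dph z .* (A z u - A z v) else 0)"
   if z: "z : K1" and uv: "abs u <= R" "abs v <= R" for z u v
  proof -
   have zV: "z : V" "z : K'" "z : OM" using z K1(2) VK' K'(2) by auto
   show "b z c = divA z c" using zV V(3) dthV by (simp add: b_def Q_def clc)
   have "(LINT r|lborel. (if v <= r & r < u then a' z r .* dph z else 0)) = (LINT r|lborel. (if v <= r & r < u then a z r .* dph z else 0))"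
    using zV V(3) uv by (intro lint_cong refl) (auto simp: a'_def)
   also have "... = integral {v..u} (%r. a z r .* dph z)"
    by (rule half_open_integral) (intro continuous_intros section_cont[OF a_cont zV(3)])
   also have "... = (if v < u then dph z .* (A z u - A z v) else 0)"
   proof (cases "v <= u")
    case True
    thus ?thesis using A_diff[OF zV(3) True, of "dph z"] by (cases "v = u") (simp_all add: inner_diff_right inner_commute)
   qed simp
   finally show "(LINT r|lborel. (if v <= r & r < u then a' z r .* dph z else 0)) = (if v < u then dph z .* (A z u - A z v) else 0)" .
  qed
  have am: "(%(z, r). a' z r) : bmeas borel2"
   unfolding a'_def by (rule clip_measurable[OF c1 K'(1,2)])
  have a's[measurable]: "a' z : bmeas borel" for z
   using measurable_compose[OF _ am, of "%r. (z, r)" borel] by simp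
  have Am: "A z : bmeas borel" if "z : K1" for z
   by (rule bmeas_contI) (use that K1OM section_cont[OF A_cont] in auto)
  have "(LINT z|lborel. LINT u|nv z. (LINT r|lborel. (if c <= r & r < u then a' z r .* dph z else 0)) - (if c < u then ph z * b z c else 0))
    = (LINT z|lborel. LINT u|nv z. (if c < u then dph z .* (A z u - A z c) - ph z * divA z c else 0))"
  proof (rule lint_cong[OF refl])
   fix z
   note [measurable_cong] = kernel_prob_space_borel(2)[OF nu, of z]
   show "(LINT u|nv z. (LINT r|lborel. (if c <= r & r < u then a' z r .* dph z else 0)) - (if c < u then ph z * b z c else 0))
    = (LINT u|nv z. (if c < u then dph z .* (A z u - A z c) - ph z * divA z c else 0))"
   proof (cases "z : K1")
    case True
    note [measurable] = Am[OF True]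
    show ?thesis
    proof (rule integral_cong_AE)
     show "AE u in nv z. (LINT r|lborel. (if c <= r & r < u then a' z r .* dph z else 0)) - (if c < u then ph z * b z c else 0)
       = (if c < u then dph z .* (A z u - A z c) - ph z * divA z c else 0)"
      using nu_supp[of z] by eventually_elim (use c in \<open>simp add: inV[OF True]\<close>)
    qed measurable
   qed (simp add: out dph0 cong: if_cong)
  qed
  thus "0 <= (LINT z|lborel. LINT u|nv z. (LINT r|lborel. (if c <= r & r < u then a' z r .* dph z else 0)) - (if c < u then ph z * b z c else 0))"
   using nu_bal[OF ph K1(1) K1OM out] by simp
  have "(LINT z|lborel. LINT v|sig z. (LINT r|lborel. (if v <= r & r < c then a' z r .* dph z else 0)) + (if v <= c then ph z * b z c else 0))
    = (LINT z|lborel. LINT v|sig z. (if v <= c then dph z .* (A z c - A z v) + ph z * divA z c else 0))"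
  proof (rule lint_cong[OF refl])
   fix z
   note [measurable_cong] = kernel_prob_space_borel(2)[OF sg, of z]
   show "(LINT v|sig z. (LINT r|lborel. (if v <= r & r < c then a' z r .* dph z else 0)) + (if v <= c then ph z * b z c else 0))
    = (LINT v|sig z. (if v <= c then dph z .* (A z c - A z v) + ph z * divA z c else 0))"
   proof (cases "z : K1")
    case True
    note [measurable] = Am[OF True]
    show ?thesis
    proof (rule integral_cong_AE)
     show "AE v in sig z. (LINT r|lborel. (if v <= r & r < c then a' z r .* dph z else 0)) + (if v <= c then ph z * b z c else 0)
       = (if v <= c then dph z .* (A z c - A z v) + ph z * divA z c else 0)"
      using sg_supp[of z]
     proof eventually_elim
      case (elim v)
      hence v: "abs v <= R" by simp
      show ?case using inV[OF True c v] by (cases "v = c") auto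
     qed
    qed measurable
   qed (simp add: out dph0 cong: if_cong)
  qed
  thus "0 <= (LINT z|lborel. LINT v|sig z. (LINT r|lborel. (if v <= r & r < c then a' z r .* dph z else 0)) + (if v <= c then ph z * b z c else 0))"
   using sg_bal[OF ph K1(1) K1OM out] by simp
 qed (use nu sg nu_supp sg_supp L(1) V(1) in \<open>auto simp: a'_def be_def\<close>)
 have dps0: "dps z = 0" if "z ~: K" for z
  by (rule has_grad_zero_outside[OF ps(1) compact_imp_closed[OF K(1)] K(3) that])
 have "a' z r .* dps z = (if abs r <= R then a z r .* dps z else 0)" for z r
 proof (cases "z : K")
  case True
  hence "z : V" "z : K'" using V(2) VK' by auto
  thus ?thesis using V(3) by (simp add: a'_def)
 qed (simp add: dps0)
 thus ?thesis using kinetic_product_inequality[OF ps K(1) V(2) K(3)] by (simp add: g_def h_def)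
qed

end

lemma linear_functional_inner:
 fixes m :: "'a::euclidean_space => real"
 assumes "linear m"
 shows "(SUM b:Basis. m b *. b) .* h = m h"
proof -
 have "m h = m (SUM b:Basis. (h .* b) *. b)" by (simp add: euclidean_representation)
 also have "... = (SUM b:Basis. (h .* b) * m b)"
  by (simp add: linear_sum[OF assms] linear_scale[OF assms])
 finally show ?thesis by (simp add: inner_sum_left inner_commute[of h] mult.commute)
qed

lemma linear_functional_inner_fun: "linear m ==> (.*) (SUM b:Basis. m b *. b) = m"
 for m :: "'a::euclidean_space => real"
 by (rule ext) (rule linear_functional_inner)

text \<open>On an open subset of \<open>S'\<close> the derivative within \<open>S'\<close> is the
  ordinary one; this is how the regularity classes on closed time intervals enter
  \<open>has_grad\<close>.\<close>

lemma has_grad_blinfun: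
 fixes F :: "'a::euclidean_space => 'b::real_normed_vector" and l :: "'b => real"
 assumes F: "!!z. z : S' ==> (F has_derivative blinfun_apply (F' z)) (at z within S')" and F': "continuous_on S' F'"
  and S: "open S" "S \<subseteq> S'" and l: "bounded_linear l"
 shows "has_grad (%z. l (F z)) (%z. SUM b:Basis. l (blinfun_apply (F' z) b) *. b) S"
 unfolding has_grad_def
proof (intro conjI ballI)
 fix z assume z: "z : S"
 have "at z within S' = at z" by (rule at_within_open_subset[OF z S])
 hence "(F has_derivative blinfun_apply (F' z)) (at z)" using F[of z] z S(2) by auto
 from bounded_linear.has_derivative[OF l this]
 have "((%z. l (F z)) has_derivative (%h. l (blinfun_apply (F' z) h))) (at z)" .
 moreover have "linear (%h. l (blinfun_apply (F' z) h))"
  by (intro bounded_linear.linear bounded_linear_compose[OF l blinfun.bounded_linear_right])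
 note linear_functional_inner_fun[OF this]
 ultimately show "((%z. l (F z)) has_derivative (.*) (SUM b:Basis. l (blinfun_apply (F' z) b) *. b)) (at z)"
  by (simp only:)
next
 show "continuous_on S (%z. SUM b:Basis. l (blinfun_apply (F' z) b) *. b)"
  by (intro continuous_on_sum continuous_on_scaleR continuous_on_const bounded_linear.continuous_on[OF l]
    bounded_bilinear.continuous_on[OF bounded_bilinear_blinfun_apply] continuous_on_subset[OF F' S(2)])
qed

context
 fixes F :: "'y::euclidean_space * real * real => real^'n::finite" and U :: "'y set" and T :: real
 assumes F: "c1_on (U <*> {0..T} <*> UNIV) F" and U: "open U"
begin

lemma parametrized_derivative:
 obtains F' where "!!z (u::real). z : U <*> {0<..<T} ==> (F has_derivative blinfun_apply (F' (fst z, snd z, u))) (at (fst z, snd z, u))"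
  "continuous_on (U <*> {0..T} <*> UNIV) F'" "continuous_on (U <*> {0..T} <*> UNIV) F"
proof -
 obtain F' where F': "!!z. z : U <*> {0..T} <*> UNIV ==> (F has_derivative blinfun_apply (F' z)) (at z within U <*> {0..T} <*> UNIV)"
  "continuous_on (U <*> {0..T} <*> UNIV) F'" using F unfolding c1_on_def by metis
 show ?thesis
 proof (rule that[OF _ F'(2) has_derivative_continuous_on[OF F'(1)]])
  fix z :: "'y * real" and u :: real assume z: "z : U <*> {0<..<T}"
  have "at (fst z, snd z, u) within U <*> {0..T} <*> UNIV = at (fst z, snd z, u)"
   by (rule at_within_open_subset[of _ "U <*> {0<..<T} <*> UNIV"]) (use z U in \<open>auto intro!: open_Times\<close>)
  moreover have "(fst z, snd z, u) : U <*> {0..T} <*> UNIV" using z by auto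
  ultimately show "(F has_derivative blinfun_apply (F' (fst z, snd z, u))) (at (fst z, snd z, u))" using F'(1) by metis
 qed
qed

lemma parametrized_gradient:
 shows "has_grad (%z. F (fst z, snd z, u) $ i) (gradient (%z. F (fst z, snd z, u) $ i)) (U <*> {0<..<T})"
  and "continuous_on ((U <*> {0<..<T}) <*> UNIV) (%(z, u). gradient (%z. F (fst z, snd z, u) $ i) z)"
  and "continuous_on ((U <*> {0<..<T}) <*> UNIV) (%(z, u). F (fst z, snd z, u))"
  and "z : U <*> {0<..<T} ==> (%u. F (fst z, snd z, u)) differentiable (at u)"
proof -
 obtain F' where F': "!!z u. z : U <*> {0<..<T} ==> (F has_derivative blinfun_apply (F' (fst z, snd z, u))) (at (fst z, snd z, u))"
  "continuous_on (U <*> {0..T} <*> UNIV) F'" "continuous_on (U <*> {0..T} <*> UNIV) F" by (rule parametrized_derivative) blast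
 have cc: "continuous_on ((U <*> {0<..<T}) <*> UNIV) (%x. q (fst (fst x), snd (fst x), snd x))"
  if "continuous_on (U <*> {0..T} <*> UNIV) q" for q :: "'y * real * real => 'c::real_normed_vector"
  by (rule cont_comp2[OF that]) (auto intro!: continuous_intros)
 show "continuous_on ((U <*> {0<..<T}) <*> UNIV) (%(z, u). F (fst z, snd z, u))"
  using cc[OF F'(3)] by (simp add: case_prod_beta')
 define G where "G z u = (SUM b:Basis. (blinfun_apply (F' (fst z, snd z, u)) (fst b, snd b, 0) $ i) *. b)" for z u
 have G: "((%z. F (fst z, snd z, u) $ i) has_derivative (.*) (G z u)) (at z)" if z: "z : U <*> {0<..<T}" for z u
 proof -
  have "((%z. (fst z, snd z, u)) has_derivative (%h. (fst h, snd h, 0))) (at z)"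
   by (auto intro!: derivative_eq_intros)
  from diff_chain_at[OF this F'(1)[OF z]]
  have "((%z. F (fst z, snd z, u)) has_derivative (%h. blinfun_apply (F' (fst z, snd z, u)) (fst h, snd h, 0))) (at z)"
   by (simp add: o_def)
  from bounded_linear.has_derivative[OF bounded_linear_vec_nth[of i] this]
  have D: "((%z. F (fst z, snd z, u) $ i) has_derivative (%h. blinfun_apply (F' (fst z, snd z, u)) (fst h, snd h, 0) $ i)) (at z)" .
  show ?thesis using D unfolding G_def linear_functional_inner_fun[OF has_derivative_linear[OF D]] .
 qed
 have Gc: "continuous_on ((U <*> {0<..<T}) <*> UNIV) (%x. G (fst x) (snd x))"
  unfolding G_def
  by (intro continuous_on_sum continuous_on_scaleR continuous_on_const bounded_linear.continuous_on[OF bounded_linear_vec_nth]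
    bounded_bilinear.continuous_on[OF bounded_bilinear_blinfun_apply] cc[OF F'(2)])
 have gr: "gradient (%z. F (fst z, snd z, u) $ i) z = G z u" if "z : U <*> {0<..<T}" for z u
  by (rule gradient_eqI) (use G[OF that] in simp)
 show "continuous_on ((U <*> {0<..<T}) <*> UNIV) (%(z, u). gradient (%z. F (fst z, snd z, u) $ i) z)"
  by (rule continuous_on_eq[OF Gc]) (auto simp: gr)
 show "has_grad (%z. F (fst z, snd z, u) $ i) (gradient (%z. F (fst z, snd z, u) $ i)) (U <*> {0<..<T})"
  unfolding has_grad_def
 proof (intro conjI ballI)
  show "((%z. F (fst z, snd z, u) $ i) has_derivative (.*) (gradient (%z. F (fst z, snd z, u) $ i) z)) (at z)"
   if "z : U <*> {0<..<T}" for z using G[OF that] gr[OF that] by simp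
  have "continuous_on (U <*> {0<..<T}) (%z. (%x. G (fst x) (snd x)) (z, u))"
   by (rule cont_comp2[OF Gc]) (auto intro!: continuous_intros)
  thus "continuous_on (U <*> {0<..<T}) (gradient (%z. F (fst z, snd z, u) $ i))"
   by (rule continuous_on_eq) (auto simp: gr)
 qed
 show "(%u. F (fst z, snd z, u)) differentiable (at u)" if z: "z : U <*> {0<..<T}"
 proof -
  have "((%u. (fst z, snd z, u)) has_derivative (%h. (0, 0, h))) (at u)"
   by (auto intro!: derivative_eq_intros)
  from diff_chain_at[OF this F'(1)[OF z]] show ?thesis by (auto simp: o_def differentiable_def)
 qed
qed

end

section \<open>The two half entropies and their fluxes\<close>

lemma left_deriv_eqI:
 assumes "(et has_real_derivative D) (at_left v)"
 shows "left_deriv et v = D"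
 unfolding left_deriv_def
 by (rule the_equality) (rule assms, rule has_field_derivative_unique[OF _ assms trivial_limit_at_left_real])

lemma has_derivative_at_left:
 assumes "(h has_real_derivative D) (at v)" "!!x. x <= v ==> et x = h x"
 shows "(et has_real_derivative D) (at_left v)"
proof -
 have "(h has_real_derivative D) (at v within {..v})" by (rule has_field_derivative_at_within[OF assms(1)])
 hence "(et has_real_derivative D) (at v within {..v})"
  unfolding has_field_derivative_def by (rule has_derivative_transform[rotated 2]) (use assms(2) in auto)
 thus ?thesis by (rule has_field_derivative_subset) auto
qed

text \<open>At the kink the left derivative is 0 here and -1 for the reflected entropy below; hence
  the thresholds \<open>c < v\<close> and \<open>v <= c\<close>, strict for one solution and closed
  for the other.\<close>

lemma left_deriv_positive_part: "left_deriv (%v. max (v - c) 0) v = (if c < v then 1 else 0)"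
proof (cases "c < v")
 case True
 have "((%v. v - c) has_real_derivative 1) (at v)" by (auto intro!: derivative_eq_intros)
 hence "((%v. max (v - c) 0) has_real_derivative 1) (at v)"
  by (rule has_field_derivative_transform_within_open[of _ _ _ "{c<..}"]) (use True in auto)
 thus ?thesis using True by (simp add: left_deriv_eqI[OF has_field_derivative_at_within])
next
 case False
 have "((%v. max (v - c) 0) has_real_derivative 0) (at_left v)"
  by (rule has_derivative_at_left[of "%_. 0"]) (use False in auto)
 thus ?thesis using False by (simp add: left_deriv_eqI)
qed

lemma left_deriv_negative_part: "left_deriv (%v. max (c - v) 0) v = (if v <= c then - 1 else 0)"
proof (cases "v <= c")
 case True
 have "((%v. c - v) has_real_derivative - 1) (at v)" by (auto intro!: derivative_eq_intros)
 hence "((%v. max (c - v) 0) has_real_derivative - 1) (at_left v)"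
  by (rule has_derivative_at_left) (use True in auto)
 thus ?thesis using True by (simp add: left_deriv_eqI)
next
 case False
 have "((%_. 0) has_real_derivative 0) (at v)" by simp
 hence "((%v. max (c - v) 0) has_real_derivative 0) (at v)"
  by (rule has_field_derivative_transform_within_open[of _ _ _ "{c<..}"]) (use False in auto)
 thus ?thesis using False by (simp add: left_deriv_eqI[OF has_field_derivative_at_within])
qed

lemma convex_on_positive_part: "convex_on UNIV (%v::real. max (a * v + b) 0)"
proof (rule convex_onI)
 fix t x y :: real assume t: "t > 0" "t < 1"
 have "a * ((1 - t) * x + t * y) + b = (1 - t) * (a * x + b) + t * (a * y + b)" by (simp add: algebra_simps)
 also have "... <= (1 - t) * max (a * x + b) 0 + t * max (a * y + b) 0"
  using t by (intro add_mono mult_left_mono) auto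
 finally show "max (a * ((1 - t) *. x + t *. y) + b) 0 <= (1 - t) * max (a * x + b) 0 + t * max (a * y + b) 0"
  using t by simp
qed simp

text \<open>The kink truncates the interval to the one from \<open>max k c\<close> to
  \<open>max u c\<close>, also when \<open>u < k\<close> and the integral is oriented
  backwards.\<close>

lemma interval_integral_above:
 fixes ph :: "real => 'b::euclidean_space" and k u c :: real
 shows "(LBINT v=ereal k..ereal u. (if c < v then 1 else 0::real) *. ph v) = (LBINT v=ereal (max k c)..ereal (max u c). ph v)"
proof -
 have *: "(LINT v|lborel. ind {a<..<b} v *. ((if c < v then 1 else 0::real) *. ph v))
   = (LINT v|lborel. ind {max a c<..<max b c} v *. ph v)" for a b :: real
  by (rule lint_cong[OF refl]) (auto simp: indicator_def)
 show ?thesis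
 proof (cases "k <= u")
  case True
  hence "max k c <= max u c" by auto
  thus ?thesis using True *[of k u]
   by (simp add: interval_lebesgue_integral_def set_lebesgue_integral_def del: ereal_max)
 next
  case False
  show ?thesis
  proof (cases "max k c <= max u c")
   case le: True
   hence "{max k c<..<max u c} = {}" "{max u c<..<max k c} = {}" using False by auto
   thus ?thesis using False le *[of u k]
    by (simp add: interval_lebesgue_integral_def set_lebesgue_integral_def del: ereal_max)
  next
   case nle: False
   thus ?thesis using False *[of u k]
    by (simp add: interval_lebesgue_integral_def set_lebesgue_integral_def del: ereal_max)
  qed
 qed
qed

lemma interval_integral_below:
 fixes ph :: "real => 'b::euclidean_space" and k u c :: real
 assumes [measurable]: "ph : bmeas borel"
 shows "(LBINT v=ereal k..ereal u. (if v <= c then - 1 else 0::real) *. ph v) = - (LBINT v=ereal (min k c)..ereal (min u c). ph v)"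
proof -
 have *: "(LINT v|lborel. ind {a<..<b} v *. ((if v <= c then - 1 else 0::real) *. ph v))
   = - (LINT v|lborel. ind {min a c<..<min b c} v *. ph v)" for a b :: real
 proof -
  have "(LINT v|lborel. ind {a<..<b} v *. ((if v <= c then - 1 else 0::real) *. ph v))
    = (LINT v|lborel. - (ind {min a c<..<min b c} v *. ph v))"
  proof (rule integral_cong_AE)
   show "AE v in lborel. ind {a<..<b} v *. ((if v <= c then - 1 else 0::real) *. ph v)
     = - (ind {min a c<..<min b c} v *. ph v)"
    using AE_lborel_singleton[of c] by eventually_elim (auto simp: indicator_def)
  qed measurable
  thus ?thesis by simp
 qed
 show ?thesis
 proof (cases "k <= u")
  case True
  hence "min k c <= min u c" by auto
  thus ?thesis using True *[of k u]
   by (simp add: interval_lebesgue_integral_def set_lebesgue_integral_def del: ereal_min)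
 next
  case False
  show ?thesis
  proof (cases "min k c <= min u c")
   case le: True
   hence "{min k c<..<min u c} = {}" "{min u c<..<min k c} = {}" using False by auto
   thus ?thesis using False le *[of u k]
    by (simp add: interval_lebesgue_integral_def set_lebesgue_integral_def del: ereal_min)
  next
   case nle: False
   thus ?thesis using False *[of u k]
    by (simp add: interval_lebesgue_integral_def set_lebesgue_integral_def del: ereal_min)
  qed
 qed
qed

lemma interval_integral_derivative:
 fixes F ph :: "real => 'b::euclidean_space"
 assumes "!!v. (F has_vector_derivative ph v) (at v)" "continuous_on UNIV ph"
 shows "(LBINT v=ereal a..ereal b. ph v) = F b - F a"
 by (rule interval_integral_FTC_finite) (use assms in \<open>auto intro: has_vector_derivative_at_within continuous_on_subset\<close>)

lemma sum_Basis_prod: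
 fixes h :: "'a::euclidean_space * 'b::euclidean_space => real"
 shows "(SUM b:Basis. h b) = (SUM b:Basis. h (b, 0)) + (SUM b:Basis. h (0, b))"
proof -
 have "inj_on (%u. (u::'a, 0::'b)) Basis" "inj_on (%u. (0::'a, u::'b)) Basis" by (auto intro!: inj_onI)
 moreover have "(%u. (u::'a, 0::'b)) ` Basis Int (%u. (0, u)) ` Basis = {}" by (auto dest: nonzero_Basis)
 ultimately show ?thesis
  unfolding Basis_prod_def by (subst sum.union_disjoint) (auto simp: sum.reindex)
qed

section \<open>Coordinate expressions of density, flux and divergence\<close>

context conservation_law
begin

definition W :: "('m, 'd) chart => (real^'d)*real => real" where
 "W c z = vol_density (g (snd z)) c (chart_inv c (fst z))"

definition H :: "('m, 'd) chart => (real^'d)*real => real => real^'d" where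
 "H c z u = f (snd z) u c (chart_inv c (fst z))"

definition Hu :: "('m, 'd) chart => (real^'d)*real => real => real^'d" where
 "Hu c z u = flux_du f (snd z) u c (chart_inv c (fst z))"

definition Om :: "('m, 'd) chart => ((real^'d)*real) set" where
 "Om c = cimg c <*> {0<..<T}"

abbreviation "gW c \<equiv> gradient (W c)"
abbreviation "gH c i u \<equiv> gradient (%z. H c z u $ i)"
abbreviation "gHu c i u \<equiv> gradient (%z. Hu c z u $ i)"

lemma open_Om: "c : A ==> open (Om c)"
 unfolding Om_def by (intro open_Times open_image) auto

lemma W_pos: "c : A ==> z : Om c ==> W c z > 0"
 unfolding W_def by (rule riemannian_manifold.vol_density_pos[OF riem]) (auto simp: Om_def)

text \<open>By its permutation expansion the determinant is a polynomial in the C^1 entries of the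
  metric, and it is positive, so its square root is C^1 too.\<close>

lemma W_gradient:
 assumes c: "c : A"
 shows "has_grad (W c) (gW c) (Om c)"
proof -
 have "c11_on (cimg c <*> {0..T}) (%(y, t). g t c (chart_inv c y))"
  using metric_family c unfolding c11_metric_family_def by blast
 then obtain F' where F': "!!z. z : cimg c <*> {0..T} ==> ((%(y, t). g t c (chart_inv c y)) has_derivative blinfun_apply (F' z)) (at z within cimg c <*> {0..T})"
  "continuous_on (cimg c <*> {0..T}) F'" unfolding c11_on_def by metis
 have sub: "Om c \<subseteq> cimg c <*> {0..T}" by (auto simp: Om_def)
 have ent: "EX d. has_grad (%z. g (snd z) c (chart_inv c (fst z)) $ i $ j) d (Om c)" for i j
  using has_grad_blinfun[OF F' open_Om[OF c] sub
    bounded_linear_compose[OF bounded_linear_vec_nth[of j] bounded_linear_vec_nth[of i]]]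
  by (auto simp: case_prod_beta')
 define D where "D z = det (g (snd z) c (chart_inv c (fst z)))" for z
 define q where "q p z = of_int (sign p) * (PROD i:UNIV. g (snd z) c (chart_inv c (fst z)) $ i $ p i)" for p z
 have q: "has_grad (q p) (gradient (q p)) (Om c)" for p
 proof -
  obtain d where "has_grad (%z. PROD i:UNIV. g (snd z) c (chart_inv c (fst z)) $ i $ p i) d (Om c)"
   using has_grad_prod[of UNIV "%i z. g (snd z) c (chart_inv c (fst z)) $ i $ p i", OF finite ent] by blast
  from has_grad_gradient[OF has_grad_cmult[OF this, of "of_int (sign p)"]]
  show ?thesis by (simp add: q_def[abs_def])
 qed
 have "D = (%z. \<Sum>p | p permutes UNIV. q p z)" by (simp add: fun_eq_iff D_def det_def q_def)
 hence D: "has_grad D (%z. \<Sum>p | p permutes UNIV. gradient (q p) z) (Om c)"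
  using has_grad_sum[OF finite_permutations[OF finite] q] by simp
 have pos: "D z > 0" if "z : Om c" for z
  unfolding D_def by (rule riemannian_manifold.det_metric_pos[OF riem c]) (use that c in \<open>auto simp: Om_def\<close>)
 have "has_grad (%z. sqrt (D z)) (%z. (inverse (sqrt (D z)) / 2) *. (\<Sum>p | p permutes UNIV. gradient (q p) z)) (Om c)"
 proof (rule has_grad_real_comp[OF D, of sqrt "%x. inverse (sqrt x) / 2"])
  show "continuous_on (D ` Om c) (%x. inverse (sqrt x) / 2)"
   using pos by (intro continuous_intros) force+
 qed (use pos DERIV_real_sqrt in blast)
 hence "EX d. has_grad (W c) d (Om c)" by (auto simp: W_def[abs_def] vol_density_def D_def)
 thus ?thesis using has_grad_gradient by blast
qed

lemma H_props:
 assumes c: "c : A"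
 shows H_gradient: "has_grad (%z. H c z u $ i) (gH c i u) (Om c)"
  and gH_cont: "continuous_on (Om c <*> UNIV) (%(z, u). gH c i u z)"
  and H_cont: "continuous_on (Om c <*> UNIV) (%(z, u). H c z u)"
  and H_differentiable: "z : Om c ==> H c z differentiable (at u)"
proof -
 have "c1_on (cimg c <*> {0..T} <*> UNIV) (%(y, t, u). f t u c (chart_inv c y))"
  using admissible c unfolding admissible_flux_def c1_flux_def by blast
 from parametrized_gradient[OF this open_image[OF c]]
 show "has_grad (%z. H c z u $ i) (gH c i u) (Om c)" "continuous_on (Om c <*> UNIV) (%(z, u). gH c i u z)"
  "continuous_on (Om c <*> UNIV) (%(z, u). H c z u)" "z : Om c ==> H c z differentiable (at u)"
  by (simp_all add: H_def[abs_def] Om_def)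
qed

lemma Hu_props:
 assumes c: "c : A"
 shows Hu_gradient: "has_grad (%z. Hu c z u $ i) (gHu c i u) (Om c)"
  and gHu_cont: "continuous_on (Om c <*> UNIV) (%(z, u). gHu c i u z)"
  and Hu_cont: "continuous_on (Om c <*> UNIV) (%(z, u). Hu c z u)"
proof -
 have "c1_on (cimg c <*> {0..T} <*> UNIV) (%(y, t, u). flux_du f t u c (chart_inv c y))"
  using admissible c unfolding admissible_flux_def c1_flux_def by blast
 from parametrized_gradient(1-3)[OF this open_image[OF c]]
 show "has_grad (%z. Hu c z u $ i) (gHu c i u) (Om c)" "continuous_on (Om c <*> UNIV) (%(z, u). gHu c i u z)"
  "continuous_on (Om c <*> UNIV) (%(z, u). Hu c z u)"
  by (simp_all add: Hu_def[abs_def] Om_def)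
qed

lemma H_deriv: "c : A ==> z : Om c ==> (H c z has_vector_derivative Hu c z u) (at u)"
 using vector_derivative_works[THEN iffD1, OF H_differentiable] by (simp add: Hu_def flux_du_def H_def[abs_def])

text \<open>\<open>chart_at\<close> and \<open>c\<close> give densities that differ by a Jacobian
  determinant independent of time, which cancels in the quotient.\<close>

lemma vol_rate_chart:
 assumes t: "t : {0<..<T}" and c: "c : A" "p : fst c"
 shows "vol_rate A g p t = gW c (snd c p, t) .* (0, 1) / W c (snd c p, t)"
proof -
 define c' where "c' = chart_at A p"
 have c': "c' : A" "p : fst c'" using chart_at by (auto simp: c'_def)
 define J where "J = det (jac c' c p)"
 have J: "J > 0" unfolding J_def by (rule det_jac_pos) (use c c' in auto)
 have tr: "vol_density (g s) c' p = J * W c (snd c p, s)" if "s : {0..T}" for s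
  using riemannian_manifold.vol_density_transform[OF riem[OF that] c'(1) c(1), of p] c c' by (simp add: W_def J_def)
 have z: "(snd c p, t) : Om c" using t c by (auto simp: Om_def)
 have "((%s. (snd c p, s)) has_derivative (%h. (0, h))) (at t)" by (auto intro!: derivative_eq_intros)
 from diff_chain_at[OF this has_gradD[OF W_gradient[OF c(1)] z]]
 have "((%s. W c (snd c p, s)) has_derivative (%h. gW c (snd c p, t) .* (0, h))) (at t)" by (simp add: o_def)
 hence "((%s. W c (snd c p, s)) has_real_derivative gW c (snd c p, t) .* (0, 1)) (at t)"
  by (simp add: has_field_derivative_def inner_prod_def mult_commute_abs)
 from DERIV_cmult[OF this, of J]
 have "((%s. vol_density (g s) c' p) has_real_derivative J * (gW c (snd c p, t) .* (0, 1))) (at t)"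
  by (rule has_field_derivative_transform_within_open[of _ _ _ "{0<..<T}"]) (use t tr in auto)
 thus ?thesis using J tr[of t] t by (simp add: vol_rate_def Let_def c'_def[symmetric] DERIV_imp_deriv)
qed

text \<open>\<open>W\<close> times the Riemannian divergence of the flux at fixed state: the spatial
  divergence of \<open>W c z *. H c z u\<close>, expanded by the product rule.\<close>

definition Dx :: "('m, 'd) chart => (real^'d)*real => real => real" where
 "Dx c z u = (SUM i:UNIV. H c z u $ i * (gW c z .* (axis i 1, 0)) + W c z * (gH c i u z .* (axis i 1, 0)))"

lemma WH_gradient:
 "c : A ==> has_grad (%z. W c z * H c z u $ i) (%z. H c z u $ i *. gW c z + W c z *. gH c i u z) (Om c)"
 by (rule has_grad_mult[OF W_gradient H_gradient])

text \<open>Stated for combinations of two states because the entropy flux of a half entropy is a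
  difference of \<open>f\<close> at two states. Equality with \<open>X\<close> is asked for only
  inside charts of the atlas, where components have a meaning.\<close>

lemma flux_combination:
 assumes t: "t : {0<..<T}" and X: "!!c p. c : A ==> p : fst c ==> X c p = r *. f t a c p - s *. f t b c p"
 shows "is_vector_field A X"
  and "c : A ==> p : fst c ==> riem_div A (g t) X p = (r * Dx c (snd c p, t) a - s * Dx c (snd c p, t) b) / W c (snd c p, t)"
proof -
 have t': "t : {0..T}" using t by auto
 have vf: "is_vector_field A (f t u)" for u using admissible t' unfolding admissible_flux_def by blast
 show X_vf: "is_vector_field A X"
  unfolding is_vector_field_def
 proof (intro ballI)
  fix c1 c2 p assume c: "c1 : A" "c2 : A" "p : fst c1 Int fst c2"
  have f2: "f t u c2 p = jac c1 c2 p *v f t u c1 p" for u using vf[of u] c unfolding is_vector_field_def by blast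
  have "X c2 p = r *. (jac c1 c2 p *v f t a c1 p) - s *. (jac c1 c2 p *v f t b c1 p)"
   using X[of c2 p] c f2 by simp
  also have "... = jac c1 c2 p *v (r *. f t a c1 p - s *. f t b c1 p)"
   by (simp only: linear_diff[OF matrix_vector_mul_linear] linear_scale[OF matrix_vector_mul_linear])
  finally show "X c2 p = jac c1 c2 p *v X c1 p" using X[of c1 p] c by simp
 qed
 interpret R: riemannian_manifold A "g t" by (rule riem[OF t'])
 define dq where "dq c i z = r *. (H c z a $ i *. gW c z + W c z *. gH c i a z) - s *. (H c z b $ i *. gW c z + W c z *. gH c i b z)" for c i z
 have q: "has_grad (%z. r * (W c z * H c z a $ i) - s * (W c z * H c z b $ i)) (dq c i) (Om c)" if "c : A" for c i
  unfolding dq_def by (intro has_grad_diff has_grad_cmult WH_gradient that)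
 have fd: "has_grad (R.flux_density X c i) (%y. SUM e:Basis. (dq c i (y, t) .* (e, 0)) *. e) (cimg c)" if c: "c : A" for c i
 proof -
  have "has_grad (%y. r * (W c (y, t) * H c (y, t) a $ i) - s * (W c (y, t) * H c (y, t) b $ i))
    (%y. SUM e:Basis. (dq c i (y, t) .* (e, 0)) *. e) (cimg c)"
   by (rule has_grad_compose[OF q[OF c], where ta = "%y. (y, t)" and ta' = "%_ h. (h, 0)"])
    (use t in \<open>auto simp: Om_def intro!: derivative_eq_intros continuous_intros\<close>)
  thus ?thesis
  proof (rule has_grad_transform[OF _ open_image[OF c]])
   fix y assume y: "y : cimg c"
   show "r * (W c (y, t) * H c (y, t) a $ i) - s * (W c (y, t) * H c (y, t) b $ i) = R.flux_density X c i y"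
    by (simp add: R.flux_density_def W_def H_def X[OF c inv_in[OF c y]] algebra_simps)
  qed
 qed
 show "riem_div A (g t) X p = (r * Dx c (snd c p, t) a - s * Dx c (snd c p, t) b) / W c (snd c p, t)"
  if c: "c : A" "p : fst c"
 proof -
  have gr: "gradient (R.flux_density X c i) (snd c p) .* axis i 1 = dq c i (snd c p, t) .* (axis i 1, 0)" for i
  proof -
   have gr: "gradient (R.flux_density X c i) (snd c p) = (SUM e:Basis. (dq c i (snd c p, t) .* (e, 0)) *. e)"
    by (rule gradient_eqI) (use has_gradD[OF fd[OF c(1)] coord_in[OF c]] in simp)
   have lin: "linear (%h. dq c i (snd c p, t) .* (h, 0))" by (rule linearI) (simp_all add: inner_prod_def inner_add_right)
   show ?thesis unfolding gr by (rule linear_functional_inner[OF lin])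
  qed
  have "riem_div A (g t) X p = R.chart_div X c (snd c p) / vol_density (g t) c p"
   by (rule R.riem_div_chart[OF X_vf _ c]) (use fd in blast)
  also have "R.chart_div X c (snd c p) = r * Dx c (snd c p, t) a - s * Dx c (snd c p, t) b"
   unfolding R.chart_div_def gr dq_def Dx_def
   by (simp add: inner_diff_left inner_add_left sum_subtractf sum.distrib sum_distrib_left algebra_simps)
  finally show ?thesis using c by (simp add: W_def)
 qed
qed

lemma riem_div_flux:
 assumes "t : {0<..<T}" "c : A" "p : fst c"
 shows "riem_div A (g t) (f t a) p = Dx c (snd c p, t) a / W c (snd c p, t)"
 using flux_combination(2)[OF assms(1) _ assms(2,3), of "f t a" 1 a 0 a] by simp

lemma flux_section:
 assumes t: "t : {0<..<T}" and c: "c : A" "p : fst c"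
 shows "((%v. f t v c p) has_vector_derivative flux_du f t u c p) (at u)"
  and "continuous_on UNIV (%v. flux_du f t v c p)" "continuous_on UNIV (%v. f t v c p)"
proof -
 have z: "(snd c p, t) : Om c" using t c by (auto simp: Om_def)
 show "((%v. f t v c p) has_vector_derivative flux_du f t u c p) (at u)"
  using H_deriv[OF c(1) z, of u] c by (simp add: H_def[abs_def] Hu_def)
 show "continuous_on UNIV (%v. flux_du f t v c p)"
  using section_cont[OF Hu_cont[OF c(1)] z] c by (simp add: Hu_def[abs_def])
 show "continuous_on UNIV (%v. f t v c p)"
  using section_cont[OF H_cont[OF c(1)] z] c by (simp add: H_def[abs_def])
qed

lemma entropy_flux_positive_part:
 assumes t: "t : {0<..<T}" and c: "c : A" "p : fst c"
 shows "entropy_flux f k (%v. max (v - c0) 0) t u c p = f t (max u c0) c p - f t (max k c0) c p"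
 unfolding entropy_flux_def left_deriv_positive_part interval_integral_above
 by (rule interval_integral_derivative[OF flux_section(1,2)[OF t c]])

lemma entropy_flux_negative_part:
 assumes t: "t : {0<..<T}" and c: "c : A" "p : fst c"
 shows "entropy_flux f k (%v. max (c0 - v) 0) t u c p = f t (min k c0) c p - f t (min u c0) c p"
 unfolding entropy_flux_def left_deriv_negative_part
  interval_integral_below[OF bmeas_contI[OF flux_section(2)[OF t c]]]
  interval_integral_derivative[OF flux_section(1,2)[OF t c]] by simp

end

section \<open>The entropy inequality in a chart\<close>

lemma integrable_prob_bounded:
 fixes q :: "real => real"
 assumes N: "prob_space N" "sets N = sets borel" "AE v in N. abs v < R" and q: "q : bmeas borel"
  and b: "!!v. abs v <= R ==> abs (q v) <= C"
 shows "integrable N q"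
proof -
 interpret prob_space N by (rule N)
 show ?thesis
 proof (rule integrable_const_bound[where B = C])
  show "AE v in N. norm (q v) <= C" using N(3) by eventually_elim (use b in auto)
  show "q : bmeas N" using q by (simp cong: meas_cong_sets add: meas_cong_sets[OF N(2) refl])
 qed
qed

lemma integrable_prob_continuous:
 fixes q :: "real => real"
 assumes N: "prob_space N" "sets N = sets borel" "AE v in N. abs v < R" and q: "continuous_on UNIV q"
 shows "integrable N q"
proof -
 have "bounded (q ` {- R..R})"
  by (intro compact_imp_bounded compact_continuous_image continuous_on_subset[OF q]) auto
 then obtain C where C: "!!v. v : {- R..R} ==> abs (q v) <= C" unfolding bounded_iff real_norm_def by blast
 show ?thesis
  by (rule integrable_prob_bounded[OF N bmeas_contI[OF q], of C]) (rule C, auto)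
qed

context conservation_law
begin

text \<open>The spatial integrand of the entropy inequality, with the Young measure at (p, t) as a
  separate argument \<open>N\<close>, so that it can be exchanged for its Borel version.\<close>

definition entropy_integrand where
 "entropy_integrand k et Ph N p t = deriv (%s. Ph p s) t * (LINT v|N. et v)
     + Ph p t * (LINT v|N.
        vol_rate A g p t * (et v - left_deriv et v * v)
       + riem_div A (g t) (entropy_flux f k et t v) p
       - left_deriv et v * riem_div A (g t) (f t v) p)
     + (LINT v|N. diff_along A (%x. Ph x t) (entropy_flux f k et t v) p)"

context
 fixes c :: "('m, 'd) chart" and ph :: "(real^'d)*real => real" and dph K
 assumes c: "c : A" and ph: "has_grad ph dph UNIV"
  and K: "compact K" "K \<subseteq> Om c" "!!z. z ~: K ==> ph z = 0"
begin

lemma space_support: "compact (fst ` K)" "fst ` K \<subseteq> cimg c" "!!y t. y ~: fst ` K ==> ph (y, t) = 0"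
proof -
 show "compact (fst ` K)" by (intro compact_continuous_image K(1) continuous_on_fst continuous_on_id)
 show "fst ` K \<subseteq> cimg c" using K(2) by (auto simp: Om_def)
 show "ph (y, t) = 0" if "y ~: fst ` K" for y t using that K(3)[of "(y, t)"] by force
qed

lemma time_support:
 obtains al be where "0 < al" "be < T" "!!y t. t ~: {al..be} ==> ph (y, t) = 0"
proof (cases "K = {}")
 case True
 thus ?thesis using that[of "T / 2" "T / 2"] T K(3) by auto
next
 case False
 have co: "compact (snd ` K)" by (intro compact_continuous_image K(1) continuous_on_snd continuous_on_id)
 have ne: "snd ` K ~= {}" using False by simp
 obtain al where al: "al : snd ` K" "ALL t:snd ` K. al <= t" using compact_attains_inf[OF co ne] by blast
 obtain be where be: "be : snd ` K" "ALL t:snd ` K. t <= be" using compact_attains_sup[OF co ne] by blast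
 show ?thesis
 proof (rule that[of al be])
  show "0 < al" "be < T" using al(1) be(1) K(2) by (auto simp: Om_def)
  fix y t assume t: "t ~: {al..be}"
  have "(y, t) ~: K"
  proof
   assume "(y, t) : K"
   hence "t : snd ` K" by force
   thus False using al(2) be(2) t by auto
  qed
  thus "ph (y, t) = 0" by (rule K(3))
 qed
qed

lemma gradient_outside: "z ~: K ==> dph z = 0"
 by (rule has_grad_zero_outside[OF ph compact_imp_closed[OF K(1)] K(3)])

text \<open>Written for an abstract entropy so that both half entropies are instances:
  \<open>B\<close> is the set where its left derivative is nonzero, \<open>G\<close> the
  contribution of the states in \<open>B\<close>, and \<open>S\<close> a remainder independent of
  the state.\<close>

context
 fixes et :: "real => real" and k R :: real and B :: "real set" and al be S :: "(real^'d)*real => real"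
  and G :: "(real^'d)*real => real => real"
 assumes B: "B : sets borel" and et: "continuous_on UNIV et"
  and vf: "!!t v. t : {0<..<T} ==> is_vector_field A (entropy_flux f k et t v)"
  and q3: "!!p t. t : {0<..<T} ==> p : fst c ==> continuous_on UNIV (%v. entropy_flux f k et t v c p)"
  and q2: "!!p t v. t : {0<..<T} ==> p : fst c ==>
    vol_rate A g p t * (et v - left_deriv et v * v) + riem_div A (g t) (entropy_flux f k et t v) p
     - left_deriv et v * riem_div A (g t) (f t v) p = al (snd c p, t) + (if v : B then be (snd c p, t) else 0)"
  and tot: "!!z v. z : Om c ==> W c z * (snd (dph z) * et v + ph z * (al z + (if v : B then be z else 0))
     + fst (dph z) .* entropy_flux f k et (snd z) v c (chart_inv c (fst z))) = (if v : B then G z v else 0) + S z"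
  and G: "continuous_on (Om c <*> UNIV) (%(z, v). G z v)" and S: "continuous_on (Om c) S"
begin

text \<open>The right-hand side of \<open>tot\<close> cut down to \<open>K\<close> and
  \<open>abs v <= R\<close>, which makes it bounded. Nothing is lost: the measures in question do
  not charge larger states, and the test function vanishes off \<open>K\<close>.\<close>

definition e :: "(real^'d)*real => real => real" where
 "e z v = (if v : B then (if z : K & abs v <= R then G z v else 0) else 0) + (if z : K & abs v <= R then S z else 0)"

lemma S_cont: "continuous_on (Om c <*> UNIV) (%(z, v::real). S z)"
 unfolding case_prod_beta' by (rule cont_comp2[OF S]) (auto intro!: continuous_intros)

lemma e_measurable: "(%(z, v). e z v) : bmeas borel2"
proof -
 note [measurable] = B clip_measurable[OF G K(1,2), of R] clip_measurable[OF S_cont K(1,2), of R]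
 have "(%x. (if snd x : B then (%(z, v). if z : K & abs v <= R then G z v else 0) x else 0)
   + (%(z, v). if z : K & abs v <= R then S z else 0) x) : bmeas borel2"
  by measurable
 thus ?thesis by (simp add: e_def case_prod_beta')
qed

lemma e_section: "e z : bmeas borel"
 using measurable_compose[OF _ e_measurable, of "%v. (z, v)" borel] by simp

lemma e_bound: obtains C where "C >= 0" "!!z v. abs (e z v) <= C"
proof -
 obtain C1 where C1: "C1 >= 0" "!!z v. z : K ==> abs v <= R ==> norm (G z v) <= C1" using clip_bound[OF G K(1,2)] by metis
 obtain C2 where C2: "C2 >= 0" "!!z v. z : K ==> abs (v::real) <= R ==> norm (S z) <= C2" using clip_bound[OF S_cont K(1,2)] by metis
 show ?thesis
 proof (rule that[of "C1 + C2"])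
  fix z v
  have "\<bar>if v : B then (if z : K & \<bar>v\<bar> <= R then G z v else 0) else 0\<bar> <= C1" using C1(1) C1(2)[of z v] by auto
  moreover have "\<bar>if z : K & \<bar>v\<bar> <= R then S z else 0\<bar> <= C2" using C2(1) C2(2)[of z v] by auto
  ultimately show "abs (e z v) <= C1 + C2" unfolding e_def by linarith
 qed (use C1(1) C2(1) in simp)
qed

lemma pointwise_integrand:
 assumes t: "t : {0<..<T}" and N: "prob_space N" "sets N = sets borel" "AE v in N. abs v < R"
 shows "entropy_integrand k et (lift c ph) N p t = (if p : fst c then (LINT v|N. e (snd c p, t) v) / W c (snd c p, t) else 0)"
proof -
 note d1 = deriv_lift[OF c ph space_support]
 note d2 = diff_along_lift[OF c ph space_support vf[OF t]]
 show ?thesis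
 proof (cases "p : fst c")
  case False
  moreover from this have "lift c ph p t = 0" by (simp add: lift_def)
  ultimately show ?thesis by (simp add: entropy_integrand_def d1 d2)
 next
  case True
  let ?z = "(snd c p, t)"
  have z: "?z : Om c" using t True c by (auto simp: Om_def)
  have lift: "lift c ph p t = ph ?z" using True by (simp add: lift_def)
  let ?Q3 = "%v. fst (dph ?z) .* entropy_flux f k et t v c p"
  let ?Q2 = "%v. al ?z + (if v : B then be ?z else 0)"
  have i1: "integrable N et" by (rule integrable_prob_continuous[OF N et])
  have i2: "integrable N ?Q2"
  proof (rule integrable_prob_bounded[OF N, where C = "abs (al ?z) + abs (be ?z)"])
   note [measurable] = B
   show "?Q2 : bmeas borel" by measurable
  qed auto
  have i3: "integrable N ?Q3"
   by (rule integrable_prob_continuous[OF N]) (intro continuous_intros q3[OF t True])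
  have "entropy_integrand k et (lift c ph) N p t = snd (dph ?z) * (LINT v|N. et v) + ph ?z * (LINT v|N. ?Q2 v) + (LINT v|N. ?Q3 v)"
   using True lift by (simp add: entropy_integrand_def d1 d2 q2[OF t True])
  also have "... = (LINT v|N. snd (dph ?z) * et v + ph ?z * ?Q2 v + ?Q3 v)"
   using i1 i2 i3 by (simp only: lint_add lint_i_add integrable_mult_right integral_mult_right_zero)
  finally have eq: "entropy_integrand k et (lift c ph) N p t = (LINT v|N. snd (dph ?z) * et v + ph ?z * ?Q2 v + ?Q3 v)" .
  have i: "integrable N (%v. snd (dph ?z) * et v + ph ?z * ?Q2 v + ?Q3 v)"
   by (intro lint_i_add integrable_mult_right i1 i2 i3)
  have "W c ?z * (LINT v|N. snd (dph ?z) * et v + ph ?z * ?Q2 v + ?Q3 v) = (LINT v|N. W c ?z * (snd (dph ?z) * et v + ph ?z * ?Q2 v + ?Q3 v))"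
   by (rule integral_mult_right_zero[symmetric])
  also have "... = (LINT v|N. e ?z v)"
  proof (rule integral_cong_AE)
   show "(%v. W c ?z * (snd (dph ?z) * et v + ph ?z * ?Q2 v + ?Q3 v)) : bmeas N"
    by (rule borel_measurable_integrable) (intro integrable_mult_right i)
   show "e ?z : bmeas N" using e_section meas_cong_sets[OF N(2) refl] by blast
   show "AE v in N. W c ?z * (snd (dph ?z) * et v + ph ?z * ?Q2 v + ?Q3 v) = e ?z v"
    using N(3)
   proof eventually_elim
    case (elim v)
    show ?case
    proof (cases "?z : K")
     case True
     thus ?thesis using tot[OF z, of v] elim \<open>p : fst c\<close> c by (simp add: e_def)
    next
     case False
     thus ?thesis using K(3)[OF False] gradient_outside[OF False] by (simp add: e_def)
    qed
   qed
  qed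
  finally show ?thesis using eq True W_pos[OF c z] by (simp add: field_simps)
 qed
qed

context
 fixes nv :: "'m => real => real measure" and nv' :: "'m * real => real measure" and Z u0
 assumes nu[measurable]: "nv' : borel -M> prob_algebra borel" and supp: "!!w. AE v in nv' w. abs v < R"
  and Z: "Z : null_sets lborel" "!!t. t : {0<..<T} ==> t ~: Z ==> AE p in dV t. nv' (p, t) = nv p t"
  and ineq: "!!Ph. test_function A T Ph ==>
   (LINT t:{0<..<T}|lebesgue. LINT p|riem_volume A (g t). entropy_integrand k et Ph (nv p t) p t)
    + (LINT p|riem_volume A (g 0). Ph p 0 * et (u0 p)) >= 0"
  and ph_nonneg: "!!z. 0 <= ph z" and S0: "(LINT z|lborel. (if z : K then S z else 0)) = 0"
begin

definition ka :: "(real^'d)*real => real measure" where "ka z = nv' (inv0 c (fst z), snd z)"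

lemma ka_kernel: "ka : borel -M> prob_algebra borel"
proof -
 have f: "fst : borel -M> (borel :: (real^'d) measure)" and s: "snd : (borel :: ((real^'d)*real) measure) -M> borel"
  by (auto intro!: bmeas_contI continuous_intros)
 have "(%z. (inv0 c (fst z), snd z)) : (borel :: ((real^'d)*real) measure) -M> borel <x> borel"
  by (intro measurable_Pair measurable_compose[OF f inv0_measurable[OF c]] s)
 hence "(%z. (inv0 c (fst z), snd z)) : (borel :: ((real^'d)*real) measure) -M> borel" by (simp only: borel_prod)
 from measurable_compose[OF this nu] show ?thesis by (simp add: ka_def[abs_def])
qed

lemmas ka_prob = kernel_prob_space_borel[OF ka_kernel]

definition E :: "(real^'d)*real => real" where "E z = (LINT v|ka z. e z v)"

lemma E_measurable: "E : bmeas borel"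
 unfolding E_def[abs_def] by (rule kernel_integral_measurable[OF e_measurable ka_kernel])

lemma E_bound: obtains C where "C >= 0" "!!z. abs (E z) <= C"
proof -
 obtain C where C: "C >= 0" "!!z v. abs (e z v) <= C" by (rule e_bound) blast
 show ?thesis
 proof (rule that[OF C(1)])
  fix z
  interpret prob_space "ka z" by (rule ka_prob)
  have "abs (E z) <= (LINT v|ka z. C)" unfolding E_def by (rule integral_abs_le) (use C in auto)
  thus "abs (E z) <= C" by (simp add: prob_space)
 qed
qed

lemma E_outside: "z ~: K ==> E z = 0"
 by (simp add: E_def e_def cong: if_cong)

lemma space_integral:
 assumes t: "t : {0<..<T}" "t ~: Z"
 shows "(LINT p|riem_volume A (g t). entropy_integrand k et (lift c ph) (nv p t) p t) = (LINT y|lborel. E (y, t))"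
proof -
 have t': "t : {0..T}" using t by auto
 interpret Rt: riemannian_manifold A "g t" by (rule riem[OF t'])
 define F where "F p = (if p : fst c then E (snd c p, t) / W c (snd c p, t) else 0)" for p
 define sig where "sig p = (if p : fst c then snd c p else 0)" for p
 have w: "Rt.w c y = W c (y, t)" if "y : cimg c" for y using that by (simp add: Rt.w_def W_def)
 have [measurable]: "sig : borel -M> borel"
  unfolding sig_def by (intro bmeas_cont_if dom_borel c cont_coord continuous_on_const)
 have "(%y::real^'d. (y, t)) : borel -M> borel" by (intro bmeas_contI continuous_intros)
 from measurable_compose[OF this E_measurable] have [measurable]: "(%y. E (y, t)) : bmeas borel" .
 note [measurable] = Rt.w_measurable[OF c] dom_borel[OF c]
 have "(%p. if p : fst c then E (sig p, t) / Rt.w c (sig p) else 0) : bmeas borel" by measurable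
 moreover have "(%p. if p : fst c then E (sig p, t) / Rt.w c (sig p) else 0) = F"
  using c by (auto simp: fun_eq_iff F_def sig_def w)
 ultimately have Fm: "F : bmeas borel" by simp
 have ae: "AE p in Rt.mu. entropy_integrand k et (lift c ph) (nv p t) p t = F p"
  using Z(2)[OF t] unfolding dV_def
 proof eventually_elim
  case (elim p)
  have "entropy_integrand k et (lift c ph) (nv' (p, t)) p t = F p"
   using c kernel_prob_space_borel[OF nu, of "(p, t)"] supp
   by (subst pointwise_integrand[OF t(1)]) (auto simp: F_def E_def ka_def inv0_def)
  thus ?case by (simp add: elim)
 qed
 have "(LINT p|riem_volume A (g t). entropy_integrand k et (lift c ph) (nv p t) p t) = (LINT p|Rt.mu. F p)"
  unfolding Rt.riem_volume_eq by (rule integral_completion_AE[OF _ ae]) (use Fm in simp)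
 also have "... = (LINT y|lborel. Rt.w c y * F (inv0 c y))"
  by (rule Rt.mu_integral_chart(1)[OF c Fm]) (simp add: F_def)
 also have "... = (LINT y|lborel. E (y, t))"
 proof (rule lint_cong[OF refl])
  fix y
  show "Rt.w c y * F (inv0 c y) = E (y, t)"
  proof (cases "y : cimg c")
   case True
   hence "(y, t) : Om c" using t by (simp add: Om_def)
   from W_pos[OF c this] show ?thesis using True c by (simp add: w inv0_def F_def)
  next
   case False
   hence "(y, t) ~: K" using K(2) by (auto simp: Om_def)
   thus ?thesis using False by (simp add: E_outside Rt.w_def)
  qed
 qed
 finally show ?thesis .
qed

text \<open>The initial term of the entropy inequality is 0 because \<open>K\<close> lies over the
  open time interval, and \<open>S\<close> integrates to 0 by \<open>S0\<close>; what remains is the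
  contribution of \<open>G\<close>.\<close>

lemma chart_balance: "0 <= (LINT z|lborel. LINT v|nv' (inv0 c (fst z), snd z). (if v : B & z : K then G z v else 0))"
proof -
 obtain C where C: "C >= 0" "!!z. abs (E z) <= C" by (rule E_bound) blast
 have bK: "bounded K" by (rule compact_imp_bounded[OF K(1)])
 have Em: "E : bmeas borel2" using E_measurable by (simp add: borel_prod)
 note Fub = lborel_Fubini_bounded[OF Em C(2) bK E_outside]
 have m1: "(%t. LINT y|lborel. E (y, t)) : bmeas lborel"
 proof -
  have "(%(t, y). E (y, t)) : bmeas (lborel <x> lborel)"
   using measurable_compose[OF measurable_pair_swap' Em] by (simp add: case_prod_beta' cong: meas_cong_sets sets_pair_measure_cong)
  thus ?thesis by (intro lborel.borel_measurable_lebesgue_integral)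
 qed
 obtain al' be' where tm: "0 < al'" "be' < T" "!!y t. t ~: {al'..be'} ==> ph (y, t) = 0" by (rule time_support) blast
 have tf: "test_function A T (lift c ph)"
  by (rule lift_test_function[OF c ph space_support ph_nonneg tm])
 have init: "lift c ph p 0 = 0" for p
 proof -
  have "(snd c p, 0) ~: K" using K(2) by (auto simp: Om_def)
  thus ?thesis using K(3) by (simp add: lift_def)
 qed
 have "(LINT t:{0<..<T}|lebesgue. LINT p|riem_volume A (g t). entropy_integrand k et (lift c ph) (nv p t) p t) = (LINT t|lborel. LINT y|lborel. E (y, t))"
  unfolding set_lebesgue_integral_def
 proof (rule integral_completion_AE[OF m1])
  show "AE t in lborel. ind {0<..<T} t *. (LINT p|riem_volume A (g t). entropy_integrand k et (lift c ph) (nv p t) p t) = (LINT y|lborel. E (y, t))"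
   using AE_not_in[OF Z(1)]
  proof eventually_elim
   case (elim t)
   show ?case
   proof (cases "t : {0<..<T}")
    case True
    thus ?thesis using space_integral[OF True elim] by simp
   next
    case False
    hence "(y, t) ~: K" for y using K(2) by (auto simp: Om_def)
    thus ?thesis using False by (simp add: E_outside)
   qed
  qed
 qed
 also have "... = (LINT z|lborel. E z)" by (rule Fub(3))
 finally have E_nonneg: "0 <= (LINT z|lborel. E z)" using ineq[OF tf] by (simp add: init)
 define S1 where "S1 z = (if z : K then S z else 0)" for z
 have E_eq: "E z = (LINT v|ka z. (if v : B & z : K then G z v else 0)) + S1 z" for z
 proof (cases "z : K")
  case True
  note [measurable] = B
  have "AE v in ka z. abs v < R" unfolding ka_def by (rule supp)
  note N = ka_prob[of z] this
  interpret prob_space "ka z" by (rule N)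
  have "continuous_on UNIV (G z)" by (rule section_cont[OF G]) (use True K(2) in auto)
  hence [measurable]: "G z : bmeas borel" by (rule bmeas_contI)
  have Gm: "(%v. if v : B then G z v else 0) : bmeas borel" by measurable
  obtain C1 where C1: "C1 >= 0" "!!z v. z : K ==> abs v <= R ==> norm (G z v) <= C1" using clip_bound[OF G K(1,2)] by metis
  have i: "integrable (ka z) (%v. if v : B then G z v else 0)"
   by (rule integrable_prob_bounded[OF N Gm, of C1]) (use C1 True in auto)
  have "E z = (LINT v|ka z. (if v : B then G z v else 0) + S z)"
   unfolding E_def
  proof (rule integral_cong_AE)
   show "e z : bmeas (ka z)" using e_section meas_cong_sets[OF N(2) refl] by blast
   show "(%v. (if v : B then G z v else 0) + S z) : bmeas (ka z)" using i by simp
   show "AE v in ka z. e z v = (if v : B then G z v else 0) + S z"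
    using N(3) by eventually_elim (use True in \<open>simp add: e_def\<close>)
  qed
  also have "... = (LINT v|ka z. (if v : B then G z v else 0)) + S z" using i by (simp add: prob_space)
  finally show ?thesis using True by (simp add: S1_def)
 next
  case False
  thus ?thesis by (simp add: E_outside S1_def)
 qed
 have iS: "integrable lborel S1"
 proof -
  obtain C2 where C2: "C2 >= 0" "!!z v. z : K ==> abs (v::real) <= 1 ==> norm (S z) <= C2" using clip_bound[OF S_cont K(1,2)] by metis
  have "S1 : bmeas borel"
   unfolding S1_def by (intro bmeas_cont_if borel_closed compact_imp_closed K(1) continuous_on_subset[OF S K(2)] continuous_on_const)
  thus ?thesis
   by (rule i_bsupp[OF _ _ bK, of _ C2]) (use C2(1) C2(2)[of _ 0] in \<open>auto simp: S1_def\<close>)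
 qed
 have "(LINT z|lborel. LINT v|ka z. (if v : B & z : K then G z v else 0)) = (LINT z|lborel. E z - S1 z)"
  by (simp add: E_eq)
 also have "... = (LINT z|lborel. E z) - (LINT z|lborel. S1 z)" by (rule lint_diff[OF Fub(1) iS])
 also have "(LINT z|lborel. S1 z) = 0" using S0 by (simp add: S1_def[abs_def])
 finally show ?thesis using E_nonneg by (simp add: ka_def)
qed

end
end
end
end

lemma sum_axis:
 fixes y :: "'n::finite => 'b::real_vector"
 shows "(SUM i:UNIV. (axis j 1 :: real^'n) $ i *. y i) = y j"
proof -
 have "(SUM i:UNIV. (axis j 1 :: real^'n) $ i *. y i) = (SUM i:UNIV. if i = j then y i else 0)"
  by (rule sum.cong) (auto simp: axis_def)
 thus ?thesis by simp
qed

lemma component_gradient: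
 fixes q :: "'z::euclidean_space => real^'n::finite"
 assumes w: "has_grad w dw S" and q: "!!i. has_grad (%z. q z $ i) (dq i) S"
 shows "has_grad (%z. w z * (e .* q z)) (%z. (e .* q z) *. dw z + w z *. (SUM i:UNIV. e $ i *. dq i z)) S"
proof -
 have "has_grad (%z. SUM i:UNIV. e $ i * q z $ i) (%z. SUM i:UNIV. e $ i *. dq i z) S"
  by (intro has_grad_sum has_grad_cmult q) auto
 hence "has_grad (%z. e .* q z) (%z. SUM i:UNIV. e $ i *. dq i z) S" by (simp add: inner_vec_def)
 from has_grad_mult[OF w this] show ?thesis .
qed

text \<open>This is the spacetime divergence of the field \<open>w *. (q, r)\<close> at constant
  \<open>r\<close>: the time direction contributes \<open>r\<close> times the time derivative of
  \<open>w\<close>, the space directions the product rule.\<close>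

lemma component_divergence:
 fixes q :: "real^'n::finite" and dq :: "'n => (real^'n) * real"
 shows "(SUM b:Basis. ((fst b .* q + r * snd b) *. dw + w *. (SUM i:UNIV. fst b $ i *. dq i)) .* b)
  = r * (dw .* (0, 1)) + (SUM i:UNIV. q $ i * (dw .* (axis i 1, 0)) + w * (dq i .* (axis i 1, 0)))"
proof -
 have "axis j 1 .* q = q $ j" for j by (simp add: inner_axis')
 thus ?thesis
  by (simp add: sum_Basis_prod sum_Basis_cart sum_axis inner_add_left)
qed

section \<open>The spacetime field of the equation and its kinetic inequalities\<close>

context conservation_law
begin

text \<open>Multiplied by the density \<open>W\<close>, the equation says formally that
  \<open>field c z (u z)\<close> has spacetime divergence 0: the time derivative of
  \<open>W * u\<close> contains the term with lambda.\<close>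

definition field :: "('m, 'd) chart => (real^'d)*real => real => (real^'d)*real" where
 "field c z u = (W c z *. H c z u, W c z * u)"

definition field_du :: "('m, 'd) chart => (real^'d)*real => real => (real^'d)*real" where
 "field_du c z u = (W c z *. Hu c z u, W c z)"

definition dfield where
 "dfield c b z u = (fst b .* H c z u + u * snd b) *. gW c z + W c z *. (SUM i:UNIV. fst b $ i *. gH c i u z)"

definition dfield_du where
 "dfield_du c b z u = (fst b .* Hu c z u + 1 * snd b) *. gW c z + W c z *. (SUM i:UNIV. fst b $ i *. gHu c i u z)"

lemma parametrized:
 assumes c: "c : A"
 shows "parametrized_field (field c) (field_du c) (dfield c) (dfield_du c) (Om c)"
proof
 have Wc: "continuous_on (Om c <*> UNIV) (%x. W c (fst x))" "continuous_on (Om c <*> UNIV) (%x. gW c (fst x))"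
  by (rule cont_comp2[OF has_grad_continuous[OF W_gradient[OF c]]]
     cont_comp2[OF has_grad_continuous_grad[OF W_gradient[OF c]]]; auto intro!: continuous_intros)+
 note cont = Wc H_cont[OF c, unfolded case_prod_beta'] gH_cont[OF c, unfolded case_prod_beta']
  Hu_cont[OF c, unfolded case_prod_beta'] gHu_cont[OF c, unfolded case_prod_beta']
 show "open (Om c)" by (rule open_Om[OF c])
 show "continuous_on (Om c <*> UNIV) (%(z, u). field c z u)" "continuous_on (Om c <*> UNIV) (%(z, u). field_du c z u)"
  unfolding field_def field_du_def case_prod_beta' by (intro continuous_intros cont)+
 show "continuous_on (Om c <*> UNIV) (%(z, u). dfield c b z u)" "continuous_on (Om c <*> UNIV) (%(z, u). dfield_du c b z u)" for b
  unfolding dfield_def dfield_du_def case_prod_beta' by (intro continuous_intros cont)+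
 show "has_grad (%z. field c z u .* b) (%z. dfield c b z u) (Om c)" for b u
 proof -
  have "has_grad (%z. W c z * (fst b .* H c z u) + (u * snd b) * W c z) (%z. (fst b .* H c z u) *. gW c z + W c z *. (SUM i:UNIV. fst b $ i *. gH c i u z) + (u * snd b) *. gW c z) (Om c)"
   by (intro has_grad_add has_grad_cmult component_gradient W_gradient H_gradient c)
  thus ?thesis by (simp add: field_def dfield_def inner_prod_def inner_commute algebra_simps)
 qed
 show "has_grad (%z. field_du c z u .* b) (%z. dfield_du c b z u) (Om c)" for b u
 proof -
  have "has_grad (%z. W c z * (fst b .* Hu c z u) + snd b * W c z) (%z. (fst b .* Hu c z u) *. gW c z + W c z *. (SUM i:UNIV. fst b $ i *. gHu c i u z) + snd b *. gW c z) (Om c)"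
   by (intro has_grad_add has_grad_cmult component_gradient W_gradient Hu_gradient c)
  thus ?thesis by (simp add: field_du_def dfield_du_def inner_prod_def inner_commute algebra_simps)
 qed
 show "(field c z has_vector_derivative field_du c z u) (at u)" if "z : Om c" for z u
 proof -
  have 1: "((%u. W c z *. H c z u) has_vector_derivative W c z *. Hu c z u) (at u)"
   by (rule bounded_linear.has_vector_derivative[OF bounded_linear_scaleR_right H_deriv[OF c that]])
  have 2: "((%u. W c z * u) has_vector_derivative W c z) (at u)"
   unfolding has_real_derivative_iff_has_vector_derivative[symmetric] by (auto intro!: derivative_eq_intros)
  have "((%u. (W c z *. H c z u, W c z * u)) has_derivative (%h. (h *. (W c z *. Hu c z u), h *. W c z))) (at u)"
   by (intro has_derivative_Pair 1[unfolded has_vector_derivative_def] 2[unfolded has_vector_derivative_def])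
  thus ?thesis by (simp add: has_vector_derivative_def field_def[abs_def] field_du_def)
 qed
qed

definition divf where "divf c z u = u * (gW c z .* (0, 1)) + Dx c z u"

lemma divA_field:
 assumes c: "c : A"
 shows "parametrized_field.divA (dfield c) = divf c"
 by (intro ext, subst parametrized_field.divA_def[OF parametrized[OF c]])
  (simp only: dfield_def component_divergence divf_def Dx_def)

lemma divf_cont: "c : A ==> continuous_on (Om c <*> UNIV) (%(z, u). divf c z u)"
 using parametrized_field.divA_cont[OF parametrized] by (simp add: divA_field)

lemma Dx_cont: "c : A ==> continuous_on (Om c) (%z. Dx c z u)"
proof -
 assume c: "c : A"
 have "continuous_on (Om c) (%z. (%(z, u). divf c z u) (z, u))"
  by (rule cont_comp2[OF divf_cont[OF c]]) (auto intro!: continuous_intros)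
 hence "continuous_on (Om c) (%z. divf c z u - u * (gW c z .* (0, 1)))"
  by (intro continuous_intros has_grad_continuous_grad[OF W_gradient[OF c]]) simp
 thus ?thesis by (simp add: divf_def)
qed

definition flux_error :: "('m, 'd) chart => ((real^'d)*real => real) => ((real^'d)*real => (real^'d)*real) => real => real => (real^'d)*real => real" where
 "flux_error c ph dph a b z = ph z * (Dx c z a - Dx c z b) + W c z * (fst (dph z) .* (H c z a - H c z b))"

text \<open>
 The entropy fluxes are normalised at \<open>k\<close> instead of the kink of the entropy; the difference
 is a vector field independent of the solution and does not contribute.
\<close>

lemma flux_error:
 assumes c: "c : A" and ph: "has_grad ph dph UNIV"
  and K: "compact K" "K \<subseteq> Om c" "!!z. z ~: K ==> ph z = 0"
 shows "(LINT z|lborel. (if z : K then flux_error c ph dph a b z else 0)) = 0"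
  and "continuous_on (Om c) (flux_error c ph dph a b)"
proof -
 \<comment> \<open>The state-independent field to be integrated by parts; its time component is 0,
   so only spatial derivatives of \<open>ph\<close> appear.\<close>
 define V where "V z = (W c z *. (H c z a - H c z b), 0::real)" for z
 define dH where "dH u e z = (fst e .* H c z u + 0 * snd e) *. gW c z + W c z *. (SUM i:UNIV. fst e $ i *. gH c i u z)" for u z and e :: "(real^'d)*real"
 have V: "has_grad (%z. V z .* e) (%z. dH a e z - dH b e z) (Om c)" for e
 proof -
  have "has_grad (%z. W c z * (fst e .* H c z a) - W c z * (fst e .* H c z b)) (%z. dH a e z - dH b e z) (Om c)"
   unfolding dH_def mult_zero_left add_0_right
   by (intro has_grad_diff component_gradient W_gradient H_gradient c)
  thus ?thesis by (simp add: V_def inner_prod_def inner_diff_right inner_commute algebra_simps)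
 qed
 have dv: "(SUM e:Basis. (dH a e z - dH b e z) .* e) = Dx c z a - Dx c z b" for z
  unfolding inner_diff_left sum_subtractf dH_def component_divergence by (simp add: Dx_def)
 have d0: "dph z = 0" if "z ~: K" for z
  by (rule has_grad_zero_outside[OF ph compact_imp_closed[OF K(1)] K(3) that])
 have eq: "ind (Om c) z * (ph z * (Dx c z a - Dx c z b) + dph z .* V z) = (if z : K then flux_error c ph dph a b z else 0)" for z
  using K(2) K(3)[of z] d0[of z] by (cases "z : K") (auto simp: flux_error_def V_def inner_prod_def)
 show "(LINT z|lborel. (if z : K then flux_error c ph dph a b z else 0)) = 0"
  using integration_by_parts(2)[OF open_Om[OF c] V has_grad_subset[OF ph subset_UNIV] K(1,2,3)] unfolding dv eq by simp
 have hc: "continuous_on (Om c) (%z. H c z u)" for u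
 proof -
  have "continuous_on (Om c) (%z. (%(z, u). H c z u) (z, u))"
   by (rule cont_comp2[OF H_cont[OF c]]) (auto intro!: continuous_intros)
  thus ?thesis by simp
 qed
 show "continuous_on (Om c) (flux_error c ph dph a b)"
  unfolding flux_error_def[abs_def]
  by (intro continuous_intros Dx_cont[OF c] hc has_grad_continuous[OF W_gradient[OF c]]
    continuous_on_subset[OF has_grad_continuous[OF ph]] continuous_on_subset[OF has_grad_continuous_grad[OF ph]]) auto
qed

text \<open>Agreement is asked for at almost every time and then almost everywhere for the volume of
  that time, which is the order of integration in the entropy inequality.\<close>

definition represents :: "real => ('m => real => real measure) => ('m * real => real measure) => bool" where
 "represents R nv nv' \<longleftrightarrow> nv' : borel -M> prob_algebra borel & (ALL w. AE v in nv' w. abs v < R) &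
  (EX Z:null_sets lborel. ALL t:{0<..<T}. t ~: Z --> (AE p in dV t. nv' (p, t) = nv p t))"

context
 fixes c :: "('m, 'd) chart" and ph :: "(real^'d)*real => real" and dph K and nv nv' u0 and k R c0 :: real
 assumes c: "c : A" and ph: "has_grad ph dph UNIV" and ph_nonneg: "!!z. 0 <= ph z"
  and K: "compact K" "K \<subseteq> Om c" "!!z. z ~: K ==> ph z = 0"
  and rep: "represents R nv nv'" and sol: "mv_entropy_solution A T g f k u0 nv"
begin

lemma entropy_inequality:
 "convex_on UNIV et ==> test_function A T Ph ==>
  (LINT t:{0<..<T}|lebesgue. LINT p|riem_volume A (g t). entropy_integrand k et Ph (nv p t) p t)
   + (LINT p|riem_volume A (g 0). Ph p 0 * et (u0 p)) >= 0"
 using sol unfolding mv_entropy_solution_def entropy_integrand_def by blast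

lemma om: "t : {0<..<T} ==> p : fst c ==> (snd c p, t) : Om c"
 using c by (auto simp: Om_def)

lemma dph_outside: "z ~: K ==> dph z = 0"
 by (rule has_grad_zero_outside[OF ph compact_imp_closed[OF K(1)] K(3)])

lemma field_balance_cont:
 "continuous_on (Om c <*> UNIV) (%(z, v). s * (dph z .* (field c z v - field c z c0) - ph z * divf c z c0))"
proof -
 have 1: "continuous_on (Om c <*> UNIV) (%x. field c (fst x) (snd x))"
  using parametrized_field.A_cont[OF parametrized[OF c]] by (simp add: case_prod_beta')
 have 2: "continuous_on (Om c <*> UNIV) (%x::((real^'d)*real) * real. (%(z, u). field c z u) (fst x, c0))"
  by (rule cont_comp2[OF parametrized_field.A_cont[OF parametrized[OF c]]]) (auto intro!: continuous_intros)
 have 3: "continuous_on (Om c <*> UNIV) (%x::((real^'d)*real) * real. (%(z, u). divf c z u) (fst x, c0))"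
  by (rule cont_comp2[OF divf_cont[OF c]]) (auto intro!: continuous_intros)
 have 4: "continuous_on (Om c <*> UNIV) (%x::((real^'d)*real) * real. ph (fst x))" "continuous_on (Om c <*> UNIV) (%x::((real^'d)*real) * real. dph (fst x))"
  by (rule cont_comp2[OF has_grad_continuous[OF ph]] cont_comp2[OF has_grad_continuous_grad[OF ph]]; auto intro!: continuous_intros)+
 show ?thesis unfolding case_prod_beta' using 1 2 3 4 by (auto intro!: continuous_intros)
qed

lemma inner_field: "dph z .* (field c z v - field c z w) = W c z * (fst (dph z) .* (H c z v - H c z w)) + W c z * (snd (dph z) * (v - w))"
 by (simp add: field_def inner_prod_def inner_diff_right right_diff_distrib mult.left_commute)

text \<open>For states above \<open>c0\<close> the divergence of \<open>f\<close> at the state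
  cancels between the two divergence terms of the inequality, leaving \<open>divf\<close> at
  \<open>c0\<close>. The entropy flux is \<open>f\<close> at the state minus \<open>f\<close> at
  \<open>c0\<close>, plus the difference of \<open>f\<close> at \<open>c0\<close> and at
  \<open>max k c0\<close>, which becomes the \<open>flux_error\<close>.\<close>

lemma positive_part_balance:
 "0 <= (LINT z|lborel. LINT v|nv' (inv0 c (fst z), snd z). (if c0 < v then dph z .* (field c z v - field c z c0) - ph z * divf c z c0 else 0))"
proof -
 obtain Z where Z: "Z : null_sets lborel" "!!t. t : {0<..<T} ==> t ~: Z ==> AE p in dV t. nv' (p, t) = nv p t"
  using rep unfolding represents_def by blast
 let ?et = "%v. max (v - c0) 0"
 have ef: "entropy_flux f k ?et t v c' p = 1 *. f t (max v c0) c' p - 1 *. f t (max k c0) c' p" if "t : {0<..<T}" "c' : A" "p : fst c'" for t v c' p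
  using entropy_flux_positive_part[OF that] by simp
 have "0 <= (LINT z|lborel. LINT v|nv' (inv0 c (fst z), snd z). (if v : {c0<..} & z : K then 1 * (dph z .* (field c z v - field c z c0) - ph z * divf c z c0) else 0))"
 proof (rule chart_balance[OF c ph K, where et = ?et and k = k and R = R and nv = nv and Z = Z and ?u0.0 = u0 and B = "{c0<..}"
    and al = "%z. (Dx c z c0 - Dx c z (max k c0)) / W c z" and be = "%z. - divf c z c0 / W c z" and S = "flux_error c ph dph c0 (max k c0)"])
  show "{c0<..} : sets borel" by simp
  show "continuous_on UNIV ?et" by (intro continuous_intros)
  show "is_vector_field A (entropy_flux f k ?et t v)" if "t : {0<..<T}" for t v
   by (rule flux_combination(1)[OF that ef[OF that]])
  show "continuous_on UNIV (%v. entropy_flux f k ?et t v c p)" if "t : {0<..<T}" "p : fst c" for t p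
   unfolding ef[OF that(1) c that(2)]
   by (intro continuous_intros cont_comp2[OF flux_section(3)[OF that(1) c that(2)]]) auto
  show "vol_rate A g p t * (?et v - left_deriv ?et v * v) + riem_div A (g t) (entropy_flux f k ?et t v) p - left_deriv ?et v * riem_div A (g t) (f t v) p
    = (Dx c (snd c p, t) c0 - Dx c (snd c p, t) (max k c0)) / W c (snd c p, t) + (if v : {c0<..} then - divf c (snd c p, t) c0 / W c (snd c p, t) else 0)"
   if t: "t : {0<..<T}" "p : fst c" for p t v
  proof -
   have w: "W c (snd c p, t) > 0" by (rule W_pos[OF c om[OF t]])
   have rd: "riem_div A (g t) (entropy_flux f k ?et t v) p = (1 * Dx c (snd c p, t) (max v c0) - 1 * Dx c (snd c p, t) (max k c0)) / W c (snd c p, t)"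
    by (rule flux_combination(2)[OF t(1) _ c t(2)]) (rule ef[OF t(1)])
   show ?thesis
    unfolding left_deriv_positive_part vol_rate_chart[OF t(1) c t(2)] riem_div_flux[OF t(1) c t(2)] rd
    using w by (cases "c0 < v") (simp_all add: divf_def field_simps max_def)
  qed
  show "W c z * (snd (dph z) * ?et v + ph z * ((Dx c z c0 - Dx c z (max k c0)) / W c z + (if v : {c0<..} then - divf c z c0 / W c z else 0))
     + fst (dph z) .* entropy_flux f k ?et (snd z) v c (chart_inv c (fst z)))
    = (if v : {c0<..} then 1 * (dph z .* (field c z v - field c z c0) - ph z * divf c z c0) else 0) + flux_error c ph dph c0 (max k c0) z"
   if z: "z : Om c" for z v
  proof -
   have w: "W c z > 0" by (rule W_pos[OF c z])
   have z': "snd z : {0<..<T}" "chart_inv c (fst z) : fst c" using z c by (auto simp: Om_def)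
   have ef': "entropy_flux f k ?et (snd z) v c (chart_inv c (fst z)) = H c z (max v c0) - H c z (max k c0)"
    using ef[OF z'(1) c z'(2), of v] by (simp add: H_def)
   show ?thesis
    unfolding ef' inner_field flux_error_def
    using w by (cases "c0 < v") (simp_all add: inner_diff_right field_simps max_def)
  qed
  show "continuous_on (Om c <*> UNIV) (%(z, v). 1 * (dph z .* (field c z v - field c z c0) - ph z * divf c z c0))"
   by (rule field_balance_cont)
  show "continuous_on (Om c) (flux_error c ph dph c0 (max k c0))" by (rule flux_error(2)[OF c ph K])
  show "(LINT z|lborel. (if z : K then flux_error c ph dph c0 (max k c0) z else 0)) = 0" by (rule flux_error(1)[OF c ph K])
  show "nv' : borel -M> prob_algebra borel" "!!w. AE v in nv' w. abs v < R" using rep unfolding represents_def by blast+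
  show "Z : null_sets lborel" by (rule Z(1))
  show "AE p in dV t. nv' (p, t) = nv p t" if "t : {0<..<T}" "t ~: Z" for t by (rule Z(2)[OF that])
  show "0 <= ph z" for z by (rule ph_nonneg)
  have "convex_on UNIV ?et" using convex_on_positive_part[of 1 "- c0"] by simp
  from entropy_inequality[OF this]
  show "(LINT t:{0<..<T}|lebesgue. LINT p|riem_volume A (g t). entropy_integrand k ?et Ph (nv p t) p t)
   + (LINT p|riem_volume A (g 0). Ph p 0 * ?et (u0 p)) >= 0" if "test_function A T Ph" for Ph using that by blast
 qed
 moreover have "(if v : {c0<..} & z : K then 1 * (dph z .* (field c z v - field c z c0) - ph z * divf c z c0) else 0)
   = (if c0 < v then dph z .* (field c z v - field c z c0) - ph z * divf c z c0 else 0)" for z v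
  using K(3)[of z] dph_outside[of z] by (cases "z : K") auto
 ultimately show ?thesis by (simp only:)
qed

text \<open>The mirror image: the active states form the closed half-line \<open>{..c0}\<close>, the
  left derivative there is -1, and this sign turns the flux difference around.\<close>

lemma negative_part_balance:
 "0 <= (LINT z|lborel. LINT v|nv' (inv0 c (fst z), snd z). (if v <= c0 then dph z .* (field c z c0 - field c z v) + ph z * divf c z c0 else 0))"
proof -
 obtain Z where Z: "Z : null_sets lborel" "!!t. t : {0<..<T} ==> t ~: Z ==> AE p in dV t. nv' (p, t) = nv p t"
  using rep unfolding represents_def by blast
 let ?et = "%v. max (c0 - v) 0"
 have ef: "entropy_flux f k ?et t v c' p = 1 *. f t (min k c0) c' p - 1 *. f t (min v c0) c' p" if "t : {0<..<T}" "c' : A" "p : fst c'" for t v c' p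
  using entropy_flux_negative_part[OF that] by simp
 have "0 <= (LINT z|lborel. LINT v|nv' (inv0 c (fst z), snd z). (if v : {..c0} & z : K then - 1 * (dph z .* (field c z v - field c z c0) - ph z * divf c z c0) else 0))"
 proof (rule chart_balance[OF c ph K, where et = ?et and k = k and R = R and nv = nv and Z = Z and ?u0.0 = u0 and B = "{..c0}"
    and al = "%z. (Dx c z (min k c0) - Dx c z c0) / W c z" and be = "%z. divf c z c0 / W c z" and S = "flux_error c ph dph (min k c0) c0"])
  show "{..c0} : sets borel" by simp
  show "continuous_on UNIV ?et" by (intro continuous_intros)
  show "is_vector_field A (entropy_flux f k ?et t v)" if "t : {0<..<T}" for t v
   by (rule flux_combination(1)[OF that ef[OF that]])
  show "continuous_on UNIV (%v. entropy_flux f k ?et t v c p)" if "t : {0<..<T}" "p : fst c" for t p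
   unfolding ef[OF that(1) c that(2)]
   by (intro continuous_intros cont_comp2[OF flux_section(3)[OF that(1) c that(2)]]) auto
  show "vol_rate A g p t * (?et v - left_deriv ?et v * v) + riem_div A (g t) (entropy_flux f k ?et t v) p - left_deriv ?et v * riem_div A (g t) (f t v) p
    = (Dx c (snd c p, t) (min k c0) - Dx c (snd c p, t) c0) / W c (snd c p, t) + (if v : {..c0} then divf c (snd c p, t) c0 / W c (snd c p, t) else 0)"
   if t: "t : {0<..<T}" "p : fst c" for p t v
  proof -
   have w: "W c (snd c p, t) > 0" by (rule W_pos[OF c om[OF t]])
   have rd: "riem_div A (g t) (entropy_flux f k ?et t v) p = (1 * Dx c (snd c p, t) (min k c0) - 1 * Dx c (snd c p, t) (min v c0)) / W c (snd c p, t)"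
    by (rule flux_combination(2)[OF t(1) _ c t(2)]) (rule ef[OF t(1)])
   show ?thesis
    unfolding left_deriv_negative_part vol_rate_chart[OF t(1) c t(2)] riem_div_flux[OF t(1) c t(2)] rd
    using w by (cases "v <= c0") (simp_all add: divf_def field_simps min_def)
  qed
  show "W c z * (snd (dph z) * ?et v + ph z * ((Dx c z (min k c0) - Dx c z c0) / W c z + (if v : {..c0} then divf c z c0 / W c z else 0))
     + fst (dph z) .* entropy_flux f k ?et (snd z) v c (chart_inv c (fst z)))
    = (if v : {..c0} then - 1 * (dph z .* (field c z v - field c z c0) - ph z * divf c z c0) else 0) + flux_error c ph dph (min k c0) c0 z"
   if z: "z : Om c" for z v
  proof -
   have w: "W c z > 0" by (rule W_pos[OF c z])
   have z': "snd z : {0<..<T}" "chart_inv c (fst z) : fst c" using z c by (auto simp: Om_def)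
   have ef': "entropy_flux f k ?et (snd z) v c (chart_inv c (fst z)) = H c z (min k c0) - H c z (min v c0)"
    using ef[OF z'(1) c z'(2), of v] by (simp add: H_def)
   show ?thesis
    unfolding ef' inner_field flux_error_def
    using w by (cases "v <= c0") (simp_all add: inner_diff_right field_simps min_def)
  qed
  show "continuous_on (Om c <*> UNIV) (%(z, v). - 1 * (dph z .* (field c z v - field c z c0) - ph z * divf c z c0))"
   by (rule field_balance_cont)
  show "continuous_on (Om c) (flux_error c ph dph (min k c0) c0)" by (rule flux_error(2)[OF c ph K])
  show "(LINT z|lborel. (if z : K then flux_error c ph dph (min k c0) c0 z else 0)) = 0" by (rule flux_error(1)[OF c ph K])
  show "nv' : borel -M> prob_algebra borel" "!!w. AE v in nv' w. abs v < R" using rep unfolding represents_def by blast+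
  show "Z : null_sets lborel" by (rule Z(1))
  show "AE p in dV t. nv' (p, t) = nv p t" if "t : {0<..<T}" "t ~: Z" for t by (rule Z(2)[OF that])
  show "0 <= ph z" for z by (rule ph_nonneg)
  have "convex_on UNIV ?et" using convex_on_positive_part[of "- 1" c0] by simp
  from entropy_inequality[OF this]
  show "(LINT t:{0<..<T}|lebesgue. LINT p|riem_volume A (g t). entropy_integrand k ?et Ph (nv p t) p t)
   + (LINT p|riem_volume A (g 0). Ph p 0 * ?et (u0 p)) >= 0" if "test_function A T Ph" for Ph using that by blast
 qed
 moreover have "(if v : {..c0} & z : K then - 1 * (dph z .* (field c z v - field c z c0) - ph z * divf c z c0) else 0)
   = (if v <= c0 then dph z .* (field c z c0 - field c z v) + ph z * divf c z c0 else 0)" for z v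
  using K(3)[of z] dph_outside[of z] by (cases "z : K") (auto simp: inner_diff_right)
 ultimately show ?thesis by (simp only:)
qed

end

lemma represents_chart_kernel:
 assumes c: "c : A" and rep: "represents R nv nv'"
 shows "(%z. nv' (inv0 c (fst z), snd z)) : borel -M> prob_algebra borel"
  and "AE v in nv' w. abs v < R"
proof -
 have nu: "nv' : borel -M> prob_algebra borel" using rep unfolding represents_def by blast
 have fs: "fst : borel -M> (borel :: (real^'d) measure)" and s: "snd : (borel :: ((real^'d)*real) measure) -M> borel"
  by (auto intro!: bmeas_contI continuous_intros)
 have "(%z. (inv0 c (fst z), snd z)) : (borel :: ((real^'d)*real) measure) -M> borel <x> borel"
  by (intro measurable_Pair measurable_compose[OF fs inv0_measurable[OF c]] s)
 hence "(%z. (inv0 c (fst z), snd z)) : (borel :: ((real^'d)*real) measure) -M> borel" by (simp only: borel_prod)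
 from measurable_compose[OF this nu] show "(%z. nv' (inv0 c (fst z), snd z)) : borel -M> prob_algebra borel" .
 show "AE v in nv' w. abs v < R" using rep unfolding represents_def by blast
qed

lemma chart_kinetic:
 assumes c: "c : A" and nv: "represents R nv nv'" "mv_entropy_solution A T g f k u0 nv"
  and sig: "represents R sig sig'" "mv_entropy_solution A T g f k w0 sig"
  and ps: "has_grad ps dps UNIV" "!!z. 0 <= ps z"
  and K: "compact K" "K \<subseteq> Om c" "!!z. z ~: K ==> ps z = 0"
 shows "0 <= (LINT w|lborel. measure (nv' (inv0 c (fst (fst w)), snd (fst w))) {snd w<..} * measure (sig' (inv0 c (fst (fst w)), snd (fst w))) {..snd w} *
   (if abs (snd w) <= R then field_du c (fst w) (snd w) .* dps (fst w) else 0))"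
proof (rule parametrized_field.kinetic_product_local[OF parametrized[OF c] represents_chart_kernel(1)[OF c nv(1)] represents_chart_kernel(1)[OF c sig(1)]
   represents_chart_kernel(2)[OF c nv(1)] represents_chart_kernel(2)[OF c sig(1)] _ _ ps K])
 fix c0 and ph :: "(real^'d)*real => real" and dph K
 assume ph: "has_grad ph dph UNIV" "!!z. 0 <= ph z" and K: "compact K" "K \<subseteq> Om c" "!!z. z ~: K ==> ph z = 0"
 show "0 <= (LINT z|lborel. LINT u|nv' (inv0 c (fst z), snd z). (if c0 < u then dph z .* (field c z u - field c z c0) - ph z * parametrized_field.divA (dfield c) z c0 else 0))"
  unfolding divA_field[OF c] by (rule positive_part_balance[OF c ph K nv])
 show "0 <= (LINT z|lborel. LINT v|sig' (inv0 c (fst z), snd z). (if v <= c0 then dph z .* (field c z c0 - field c z v) + ph z * parametrized_field.divA (dfield c) z c0 else 0))"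
  unfolding divA_field[OF c] by (rule negative_part_balance[OF c ph K sig])
qed

end

section \<open>Globalisation\<close>

lemma prob_lborel_Fubini:
 fixes q :: "real => real => real" and N :: "real measure"
 assumes N: "prob_space N" "sets N = sets borel" and q: "(%(u, r). q u r) : bmeas borel2"
  and b: "!!u r. abs (q u r) <= 1" "!!u r. abs r > R ==> q u r = 0"
 shows "(LINT u|N. LINT r|lborel. q u r) = (LINT r|lborel. LINT u|N. q u r)"
proof -
 interpret prob_space N by (rule N)
 interpret P: pair_sigma_finite N "lborel :: real measure" by standard
 have "sets (N <x> (lborel :: real measure)) = sets borel2" by (intro sets_pair_measure_cong) (simp_all add: N(2))
 hence qm: "(%(u, r). q u r) : bmeas (N <x> (lborel :: real measure))" using q meas_cong_sets by blast
 have S: "space N <*> {- R..R} : sets (N <x> (lborel :: real measure))" by (intro pair_measureI sets.top) simp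
 have "emeasure (N <x> (lborel :: real measure)) (space N <*> {- R..R}) = emeasure N (space N) * emeasure lborel {- R..R}"
  by (rule lborel.emeasure_pair_measure_Times) auto
 also have "... < \<infinity>" by (simp add: emeasure_space_1 emeasure_lborel_Icc_eq)
 finally have i: "integrable (N <x> (lborel :: real measure)) (ind (space N <*> {- R..R}) :: _ => real)"
  using S by (intro integrable_real_indicator)
 have "integrable (N <x> (lborel :: real measure)) (%(u, r). q u r)"
 proof (rule lint_i_bound[OF i qm])
  show "AE x in N <x> (lborel :: real measure). norm (case x of (u, r) => q u r) <= norm (ind (space N <*> {- R..R}) x :: real)"
  proof (rule AE_I2)
   fix x assume x: "x : space (N <x> (lborel :: real measure))"
   obtain u r where [simp]: "x = (u, r)" by (cases x)
   have "u : space N" using x by (simp add: space_pair_measure)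
   thus "norm (case x of (u, r) => q u r) <= norm (ind (space N <*> {- R..R}) x :: real)"
    using b(1)[of u r] b(2)[of r u] by (cases "abs r > R") (auto simp: indicator_def)
  qed
 qed
 from P.Fubini_integral[OF this] show ?thesis by simp
qed

context
 fixes N N' :: "real measure" and R :: real
 assumes N: "prob_space N" "sets N = sets borel" "AE v in N. abs v < R"
  and N': "prob_space N'" "sets N' = sets borel" "AE v in N'. abs v < R"
begin

lemma integral_step:
 assumes "a <= b" "- R <= a" "b <= R"
 shows "(LINT r|lborel. (if a <= r & r < b & abs r <= R then 1 else 0 :: real)) = b - a"
proof -
 have "(LINT r|lborel. (if a <= r & r < b & abs r <= R then 1 else 0 :: real)) = (LINT r|lborel. ind {a..<b} r)"
  by (rule lint_cong[OF refl]) (use assms in \<open>auto simp: indicator_def\<close>)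
 thus ?thesis using assms(1) by simp
qed

lemma measure_integral:
 assumes "B : sets borel"
 shows "(LINT u|N. (if u : B then x else 0)) = x * measure N B"
proof -
 interpret prob_space N by (rule N)
 have "(LINT u|N. (if u : B then x else 0)) = (LINT u|N. x * ind B u)"
  by (rule lint_cong[OF refl]) (auto simp: indicator_def)
 moreover have "space N = UNIV" using sets_eq_imp_space_eq[OF N(2)] by simp
 ultimately show ?thesis using assms N(2) by simp
qed

text \<open>Layer cake: for states within \<open>R\<close>, the positive part of
  \<open>u - v\<close> is the length of the set of \<open>r\<close> with
  \<open>v <= r < u\<close>.\<close>

lemma positive_part_integral:
 assumes v: "abs v < R"
 shows "(LINT u|N. max (u - v) 0) = (LINT r|lborel. (if v <= r & abs r <= R then measure N {r<..} else 0))"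
proof -
 let ?q = "%u r. if v <= r & r < u & abs r <= R then 1 else 0 :: real"
 have qm: "(%(u, r). ?q u r) : bmeas borel2" by measurable
 have "(LINT u|N. max (u - v) 0) = (LINT u|N. LINT r|lborel. ?q u r)"
 proof (rule integral_cong_AE)
  show "(%u. max (u - v) 0) : bmeas N" unfolding meas_cong_sets[OF N(2) refl] by measurable
  show "(%u. LINT r|lborel. ?q u r) : bmeas N"
   unfolding meas_cong_sets[OF N(2) refl] by measurable
  show "AE u in N. max (u - v) 0 = (LINT r|lborel. ?q u r)"
   using N(3)
  proof eventually_elim
   case (elim u)
   show ?case
   proof (cases "v <= u")
    case True
    thus ?thesis using integral_step[of v u] elim v by auto
   next
    case False
    hence "?q u r = 0" for r by auto
    thus ?thesis using False by (simp cong: if_cong)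
   qed
  qed
 qed
 also have "... = (LINT r|lborel. LINT u|N. ?q u r)"
  by (rule prob_lborel_Fubini[OF N(1,2) qm, of R]) auto
 also have "... = (LINT r|lborel. (if v <= r & abs r <= R then measure N {r<..} else 0))"
 proof (rule lint_cong[OF refl])
  fix r
  have "?q u r = (if u : {r<..} then (if v <= r & abs r <= R then 1 else 0) else 0)" for u by auto
  thus "(LINT u|N. ?q u r) = (if v <= r & abs r <= R then measure N {r<..} else 0)"
   by (simp only: measure_integral borel_open[OF open_greaterThan]) simp
 qed
 finally show ?thesis .
qed

lemma negative_part_integral:
 assumes v: "abs v < R"
 shows "(LINT u|N. max (v - u) 0) = (LINT r|lborel. (if r < v & abs r <= R then measure N {..r} else 0))"
proof -
 let ?q = "%u r. if u <= r & r < v & abs r <= R then 1 else 0 :: real"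
 have qm: "(%(u, r). ?q u r) : bmeas borel2" by measurable
 have "(LINT u|N. max (v - u) 0) = (LINT u|N. LINT r|lborel. ?q u r)"
 proof (rule integral_cong_AE)
  show "(%u. max (v - u) 0) : bmeas N" unfolding meas_cong_sets[OF N(2) refl] by measurable
  show "(%u. LINT r|lborel. ?q u r) : bmeas N"
   unfolding meas_cong_sets[OF N(2) refl] by measurable
  show "AE u in N. max (v - u) 0 = (LINT r|lborel. ?q u r)"
   using N(3)
  proof eventually_elim
   case (elim u)
   show ?case
   proof (cases "u <= v")
    case True
    thus ?thesis using integral_step[of u v] elim v by auto
   next
    case False
    hence "?q u r = 0" for r by auto
    thus ?thesis using False by (simp cong: if_cong)
   qed
  qed
 qed
 also have "... = (LINT r|lborel. LINT u|N. ?q u r)"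
  by (rule prob_lborel_Fubini[OF N(1,2) qm, of R]) auto
 also have "... = (LINT r|lborel. (if r < v & abs r <= R then measure N {..r} else 0))"
 proof (rule lint_cong[OF refl])
  fix r
  have "?q u r = (if u : {..r} then (if r < v & abs r <= R then 1 else 0) else 0)" for u by auto
  thus "(LINT u|N. ?q u r) = (if r < v & abs r <= R then measure N {..r} else 0)"
   by (simp only: measure_integral borel_closed[OF closed_atMost]) simp
 qed
 finally show ?thesis .
qed

lemma tail_measurable: "(%r. measure N {r<..}) : bmeas borel" "(%r. measure N {..r}) : bmeas borel"
proof -
 interpret prob_space N by (rule N)
 have s: "{r<..} : events" "{..r} : events" for r using N(2) by auto
 show "(%r. measure N {..r}) : bmeas borel"
  by (intro borel_measurable_mono monoI finite_measure_mono s) auto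
 have "mono (%r. - measure N {r<..})"
  by (intro monoI le_imp_neg_le finite_measure_mono s) auto
 hence "(%r. - (- measure N {r<..})) : bmeas borel"
  by (intro borel_measurable_uminus borel_measurable_mono)
 thus "(%r. measure N {r<..}) : bmeas borel" by simp
qed

end

context
 fixes N N' :: "real measure" and R :: real
 assumes N: "prob_space N" "sets N = sets borel" "AE v in N. abs v < R"
  and N': "prob_space N'" "sets N' = sets borel" "AE v in N'. abs v < R"
begin

lemma measure_le_1: "abs (measure N B) <= 1"
 using prob_space.prob_le_1[OF N(1), of B] by simp

lemma positive_part_pairing:
 "(LINT v|N'. LINT u|N. max (u - v) 0) = (LINT r|lborel. (if abs r <= R then measure N {r<..} * measure N' {..r} else 0))"
proof -
 let ?q = "%v r. if v <= r & abs r <= R then measure N {r<..} else 0 :: real"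
 note [measurable] = tail_measurable[OF N N']
 have qm: "(%(v, r). ?q v r) : bmeas borel2" by measurable
 have "(LINT v|N'. LINT u|N. max (u - v) 0) = (LINT v|N'. LINT r|lborel. ?q v r)"
 proof (rule integral_cong_AE)
  interpret prob_space N by (rule N)
  show "(%v. LINT u|N. max (u - v) 0) : bmeas N'"
   unfolding meas_cong_sets[OF N'(2) refl]
  proof (rule borel_measurable_lebesgue_integral)
   have "sets (borel <x> N) = sets borel2" by (intro sets_pair_measure_cong) (simp_all add: N(2))
   moreover have "(%(v, u). max (u - v) 0) : bmeas (borel <x> (borel :: real measure))" by measurable
   ultimately show "(%(v, u). max (u - v) 0) : bmeas (borel <x> N)" using meas_cong_sets by blast
  qed
  show "(%v. LINT r|lborel. ?q v r) : bmeas N'"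
   unfolding meas_cong_sets[OF N'(2) refl] by measurable
  show "AE v in N'. (LINT u|N. max (u - v) 0) = (LINT r|lborel. ?q v r)"
   using N'(3) by eventually_elim (rule positive_part_integral[OF N N'])
 qed
 also have "... = (LINT r|lborel. LINT v|N'. ?q v r)"
  by (rule prob_lborel_Fubini[OF N'(1,2) qm, of R]) (use measure_le_1 in auto)
 also have "... = (LINT r|lborel. (if abs r <= R then measure N {r<..} * measure N' {..r} else 0))"
 proof (rule lint_cong[OF refl])
  fix r
  have "?q v r = (if v : {..r} then (if abs r <= R then measure N {r<..} else 0) else 0)" for v by auto
  thus "(LINT v|N'. ?q v r) = (if abs r <= R then measure N {r<..} * measure N' {..r} else 0)"
   by (simp only: measure_integral[OF N' N] borel_closed[OF closed_atMost]) simp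
 qed
 finally show ?thesis .
qed

lemma negative_part_pairing:
 "(LINT v|N'. LINT u|N. max (v - u) 0) = (LINT r|lborel. (if abs r <= R then measure N' {r<..} * measure N {..r} else 0))"
proof -
 let ?q = "%v r. if r < v & abs r <= R then measure N {..r} else 0 :: real"
 note [measurable] = tail_measurable[OF N N']
 have qm: "(%(v, r). ?q v r) : bmeas borel2" by measurable
 have "(LINT v|N'. LINT u|N. max (v - u) 0) = (LINT v|N'. LINT r|lborel. ?q v r)"
 proof (rule integral_cong_AE)
  interpret prob_space N by (rule N)
  show "(%v. LINT u|N. max (v - u) 0) : bmeas N'"
   unfolding meas_cong_sets[OF N'(2) refl]
  proof (rule borel_measurable_lebesgue_integral)
   have "sets (borel <x> N) = sets borel2" by (intro sets_pair_measure_cong) (simp_all add: N(2))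
   moreover have "(%(v, u). max (v - u) 0) : bmeas (borel <x> (borel :: real measure))" by measurable
   ultimately show "(%(v, u). max (v - u) 0) : bmeas (borel <x> N)" using meas_cong_sets by blast
  qed
  show "(%v. LINT r|lborel. ?q v r) : bmeas N'"
   unfolding meas_cong_sets[OF N'(2) refl] by measurable
  show "AE v in N'. (LINT u|N. max (v - u) 0) = (LINT r|lborel. ?q v r)"
   using N'(3) by eventually_elim (rule negative_part_integral[OF N N'])
 qed
 also have "... = (LINT r|lborel. LINT v|N'. ?q v r)"
  by (rule prob_lborel_Fubini[OF N'(1,2) qm, of R]) (use measure_le_1 in auto)
 also have "... = (LINT r|lborel. (if abs r <= R then measure N' {r<..} * measure N {..r} else 0))"
 proof (rule lint_cong[OF refl])
  fix r
  have "?q v r = (if v : {r<..} then (if abs r <= R then measure N {..r} else 0) else 0)" for v by auto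
  thus "(LINT v|N'. ?q v r) = (if abs r <= R then measure N' {r<..} * measure N {..r} else 0)"
   by (simp only: measure_integral[OF N' N] borel_open[OF open_greaterThan]) simp
 qed
 finally show ?thesis .
qed

end

lemma absolute_value_pairing:
 fixes N N' :: "real measure"
 assumes N: "prob_space N" "sets N = sets borel" "AE v in N. abs v < R"
  and N': "prob_space N'" "sets N' = sets borel" "AE v in N'. abs v < R"
 shows "(LINT v|N'. LINT u|N. abs (u - v)) = (LINT v|N'. LINT u|N. max (u - v) 0) + (LINT v|N'. LINT u|N. max (v - u) 0)"
proof -
 interpret N: prob_space N by (rule N)
 interpret N': prob_space N' by (rule N')
 have i1: "integrable N (%u. max (u - v) 0)" and i2: "integrable N (%u. max (v - u) 0)" for v
  by (rule integrable_prob_continuous[OF N]; intro continuous_intros)+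
 have int: "integrable N' (%v. LINT u|N. q v u)"
  if q: "(%(v, u). q v u) : bmeas borel2" "!!v. integrable N (q v)" "!!u v. abs (q v u) <= abs u + abs v" for q
 proof (rule integrable_prob_bounded[OF N', where C = "2 * R"])
  show "(%v. LINT u|N. q v u) : bmeas borel"
  proof (rule N.borel_measurable_lebesgue_integral)
   have "sets (borel <x> N) = sets borel2" by (intro sets_pair_measure_cong) (simp_all add: N(2))
   thus "(%(v, u). q v u) : bmeas (borel <x> N)" using meas_cong_sets q(1) by blast
  qed
  fix v :: real assume v: "abs v <= R"
  have "abs (LINT u|N. q v u) <= (LINT u|N. abs (q v u))" by (rule integral_abs_bound)
  also have "... <= (LINT u|N. 2 * R)"
  proof (rule integral_mono_AE)
   show "integrable N (%u. abs (q v u))" using q(2) by (rule integrable_abs)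
   show "AE u in N. abs (q v u) <= 2 * R"
    using N(3)
   proof eventually_elim
    case (elim u)
    thus ?case using q(3)[of v u] v by linarith
   qed
  qed simp
  finally show "abs (LINT u|N. q v u) <= 2 * R" by (simp add: N.prob_space)
 qed
 have j1: "integrable N' (%v. LINT u|N. max (u - v) 0)" by (rule int[OF _ i1]) auto
 have j2: "integrable N' (%v. LINT u|N. max (v - u) 0)" by (rule int[OF _ i2]) auto
 have eq: "abs (u - v) = max (u - v) 0 + max (v - u) 0" for u v :: real by auto
 show ?thesis
  unfolding eq lint_add[OF i1 i2] by (rule lint_add[OF j1 j2])
qed

text \<open>Mollifying \<open>m\<close> gives functions \<open>M n\<close> that are nonincreasing at
  all times away from the ends, because a primitive of the difference of two shifted mollifiers is
  an admissible test function. A subsequence converges to \<open>m\<close> almost everywhere, so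
  monotonicity holds off a null set of times, and countably many intervals exhaust (0, T).\<close>

lemma nonincreasing_of_weak:
 fixes m :: "real => real" and T :: real
 assumes int: "!!al be. 0 < al ==> al < be ==> be < T ==> integrable lborel (%t. ind {al..be} t * m t)"
  and weak: "!!th dth al be. has_grad th dth UNIV ==> (!!t. 0 <= th t) ==> 0 < al ==> be < T ==>
    (!!t. t ~: {al..be} ==> th t = 0) ==> 0 <= (LINT t|lborel. dth t * m t)"
  and T: "0 < T"
 shows "EX N:null_sets lborel. ALL s t. s ~: N --> t ~: N --> 0 < s --> s <= t --> t < T --> m t <= m s"
proof -
 define h where "h n = inverse (real (Suc n))" for n
 have h0: "h n > 0" for n by (simp add: h_def)
 have hlim: "h \<longlonglongrightarrow> 0" unfolding h_def by (rule LIMSEQ_inverse_real_of_nat)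
 define good where "good n rh \<longleftrightarrow> continuous_on UNIV rh & (ALL r. 0 <= rh r) & (ALL r. abs r >= h n --> rh r = 0)
   & (LINT r|lborel. rh r) = 1 & (EX C. ALL r. rh r <= C)" for n and rh :: "real => real"
 obtain C0 where C0: "C0 >= 0" "!!ep. ep > 0 ==> EX rh drh. has_grad rh drh (UNIV::real set)
   & (ALL z. 0 <= rh z) & (ALL z. rh z <= C0 / ep ^ DIM(real)) & (ALL z. norm (drh z) <= C0 / ep ^ Suc DIM(real))
   & (ALL z. z ~: ball 0 ep --> rh z = 0) & (LINT z|lborel. rh z) = 1"
 proof (rule mollifier_exists)
  fix C :: real
  assume h: "C >= 0" "!!ep. ep > 0 ==> EX rh drh. has_grad rh drh (UNIV::real set)
   & (ALL z. 0 <= rh z) & (ALL z. rh z <= C / ep ^ DIM(real)) & (ALL z. norm (drh z) <= C / ep ^ Suc DIM(real))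
   & (ALL z. z ~: ball 0 ep --> rh z = 0) & (LINT z|lborel. rh z) = 1"
  show thesis by (rule that[OF h])
 qed
 have "EX rh. good n rh" for n
 proof -
  obtain rh drh where r: "has_grad rh drh (UNIV::real set)" "ALL z. 0 <= rh z" "ALL z. rh z <= C0 / h n ^ DIM(real)"
   "ALL z. z ~: ball 0 (h n) --> rh z = 0" "(LINT z|lborel. rh z) = 1"
   using C0(2)[OF h0[of n]] by (elim exE conjE)
  have "good n rh"
   unfolding good_def
  proof (intro conjI)
   show "continuous_on UNIV rh" by (rule has_grad_continuous[OF r(1)])
   show "ALL r. h n <= abs r --> rh r = 0" using r(4) by (simp add: dist_norm)
   show "EX C. ALL r. rh r <= C" using r(3) by blast
  qed (rule r(2), rule r(5))
  thus ?thesis by blast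
 qed
 hence "ALL n. EX rh. good n rh" by (rule allI)
 from choice[OF this] obtain rh where good: "ALL n. good n (rh n)" by (rule exE)
 have rhc: "continuous_on UNIV (rh n)" and rh0: "0 <= rh n r" and rhout: "h n <= abs r ==> rh n r = 0"
  and rh1: "(LINT r|lborel. rh n r) = 1" and rhb: "EX C. ALL r. rh n r <= C" for n r
  using good unfolding good_def by simp_all
 have [measurable]: "rh n : bmeas borel" for n by (rule bmeas_contI[OF rhc])
 have rhint: "integrable lborel (rh n)" for n
  using rh1[of n] not_integrable_integral_eq[of lborel "rh n"] by fastforce
 have weight: "integrable lborel (%r. rh n (r - a) * q r)" if q: "integrable lborel q" for n a q
 proof -
  obtain C where C: "!!r. rh n r <= C" using rhb by blast
  have [measurable]: "q : bmeas borel" using q by simp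
  show ?thesis
  proof (rule lint_i_bound[OF integrable_mult_right[OF q, of C]])
   show "(%r. rh n (r - a) * q r) : bmeas lborel" by measurable
   show "AE r in lborel. norm (rh n (r - a) * q r) <= norm (C * q r)"
   proof (rule AE_I2)
    fix r
    have "rh n (r - a) * abs (q r) <= abs C * abs (q r)" using C[of "r - a"] by (intro mult_right_mono) auto
    thus "norm (rh n (r - a) * q r) <= norm (C * q r)" using rh0[of n "r - a"] by (simp add: abs_mult)
   qed
  qed
 qed
 define M where "M n s = (LINT ta|lborel. rh n (ta - s) * m ta)" for n s
 \<comment> \<open>\<open>m\<close> is integrable only on compact subintervals of (0, T), but the
   mollifier sees no more than such a part.\<close>
 have localise: "rh n (ta - s) * m ta = rh n (ta - s) * (ind {al..be} ta * m ta)"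
  if "al + h n <= s" "s <= be - h n" for n s al be ta
  using rhout[of n "ta - s"] that by (cases "ta : {al..be}") auto
 have mono: "M n t <= M n s" if st: "al + h n <= s" "s < t" "t <= be - h n" and ab: "0 < al" "al < be" "be < T" for n s t al be
 proof -
  have "EX F. ALL x::real. - \<infinity> < ereal x --> ereal x < \<infinity> --> (F has_vector_derivative rh n x) (at x)"
   by (rule einterval_antiderivative) (use rhc in \<open>auto simp: continuous_on_eq_continuous_at\<close>)
  then obtain Q where "!!x. (Q has_vector_derivative rh n x) (at x)" by auto
  hence Q: "(Q has_real_derivative rh n x) (at x)" for x
   by (simp add: has_real_derivative_iff_has_vector_derivative)
  have Qshift: "((%x. Q (x - a)) has_real_derivative rh n (x - a)) (at x)" for a x
   using DERIV_shift[of Q "rh n (x - a)" x "- a"] Q[of "x - a"] by simp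
  have Qmono: "Q a <= Q b" if "a <= b" for a b
   by (rule DERIV_nonneg_imp_nondecreasing[OF that]) (use Q rh0 in blast)
  have Qconst: "Q a = Q b" if "a <= b" "b <= - h n \<or> h n <= a" for a b
  proof (rule antisym[OF Qmono[OF that(1)]])
   show "Q b <= Q a"
   proof (rule DERIV_nonpos_imp_nonincreasing[OF that(1)])
    fix x assume "a <= x" "x <= b"
    hence "rh n x = 0" using that(2) by (intro rhout) auto
    thus "EX y. (Q has_real_derivative y) (at x) & y <= 0" using Q[of x] by auto
   qed
  qed
  \<comment> \<open>A smoothed indicator of \<open>{s..t}\<close>: it rises around \<open>s\<close>,
    falls around \<open>t\<close>, and its derivative is the difference of the mollifiers that
    define \<open>M n s\<close> and \<open>M n t\<close>.\<close>
  define th where "th x = Q (x - s) - Q (x - t)" for x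
  have gr: "has_grad th (%x. rh n (x - s) - rh n (x - t)) UNIV"
   unfolding has_grad_def
  proof (intro conjI ballI)
   fix x
   have "(th has_real_derivative (rh n (x - s) - rh n (x - t))) (at x)"
    unfolding th_def by (intro DERIV_diff Qshift)
   thus "(th has_derivative (.*) (rh n (x - s) - rh n (x - t))) (at x)"
    by (simp add: has_field_derivative_def inner_real_def[abs_def])
  next
   show "continuous_on UNIV (%x. rh n (x - s) - rh n (x - t))"
    by (intro continuous_intros cont_comp2[OF rhc]) auto
  qed
  have i: "integrable lborel (%ta. rh n (ta - a) * m ta)" if "al + h n <= a" "a <= be - h n" for a
   unfolding localise[OF that] by (rule weight[OF int[OF ab]])
  have "0 <= (LINT x|lborel. (rh n (x - s) - rh n (x - t)) * m x)"
  proof (rule weak[OF gr _ ab(1,3)])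
   show "0 <= th x" for x using Qmono[of "x - t" "x - s"] st(2) by (simp add: th_def)
   show "th x = 0" if "x ~: {al..be}" for x
    using Qconst[of "x - t" "x - s"] that st by (auto simp: th_def)
  qed
  also have "... = M n s - M n t"
   unfolding M_def left_diff_distrib by (rule lint_diff) (use i st h0[of n] in auto)
  finally show ?thesis by simp
 qed
 have "EX N:null_sets lborel. ALL s t. s ~: N --> t ~: N --> al < s --> s < t --> t < be --> m t <= m s"
  if ab: "0 < al" "al < be" "be < T" for al be
 proof -
  define q where "q t = ind {al..be} t * m t" for t
  have q: "integrable lborel q" using int[OF ab] by (simp add: q_def[abs_def])
  hence [measurable]: "q : bmeas borel" by simp
  \<comment> \<open>Well inside the interval \<open>u n s\<close> is the mollification error
    \<open>M n s - m s\<close>, written with the integrable truncation \<open>q\<close>. Its L1 norm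
    is controlled by the translation errors of \<open>q\<close> for shifts below
    \<open>h n\<close>.\<close>
  define u where "u n s = (LINT r|lborel. rh n r * (q (s + r) - q s))" for n s
  have qs: "integrable lborel (%r. q (s + r))" for s
   using lborel_integrable_real_affine[OF q, of 1 s] by simp
  have iu: "integrable lborel (%r. rh n r * (q (s + r) - q s))" for n s
   using weight[OF qs, of n 0 s] integrable_mult_left[OF rhint[of n], of "q s"] by (simp add: right_diff_distrib)
  have um[measurable]: "u n : bmeas borel" for n
   unfolding u_def[abs_def] by measurable
  have bound: "(\<integral>\<^sup>+s. ennreal (norm (u n s)) \<partial>lborel) <= ennreal e"
   if d: "!!xi. norm xi < d ==> (LINT z|lborel. abs (q (z + xi) - q z)) < e" and hn: "h n < d" for n e and d :: real
  proof -
   have "(\<integral>\<^sup>+s. ennreal (norm (u n s)) \<partial>lborel) <= (\<integral>\<^sup>+s. \<integral>\<^sup>+r. ennreal (norm (rh n r * (q (s + r) - q s))) \<partial>lborel \<partial>lborel)"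
    unfolding u_def by (intro nn_integral_mono integral_norm_bound_ennreal iu)
   also have "... = (\<integral>\<^sup>+r. \<integral>\<^sup>+s. ennreal (norm (rh n r * (q (s + r) - q s))) \<partial>lborel \<partial>lborel)"
    by (rule lborel_pair.Fubini') measurable
   also have "... <= (\<integral>\<^sup>+r. ennreal (rh n r) * ennreal e \<partial>lborel)"
   proof (rule nn_integral_mono)
    fix r
    show "(\<integral>\<^sup>+s. ennreal (norm (rh n r * (q (s + r) - q s))) \<partial>lborel) <= ennreal (rh n r) * ennreal e"
    proof (cases "abs r < h n")
     case True
     have iq: "integrable lborel (%s. abs (q (s + r) - q s))"
      using lborel_integrable_real_affine[OF q, of 1 r] q by (auto simp: add.commute)
     have "(\<integral>\<^sup>+s. ennreal (norm (rh n r * (q (s + r) - q s))) \<partial>lborel) = (\<integral>\<^sup>+s. ennreal (rh n r) * ennreal \<bar>q (s + r) - q s\<bar> \<partial>lborel)"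
      using rh0[of n r] by (intro nn_integral_cong) (simp add: abs_mult ennreal_mult)
     also have "... = ennreal (rh n r) * (\<integral>\<^sup>+s. ennreal \<bar>q (s + r) - q s\<bar> \<partial>lborel)"
      by (rule nn_integral_cmult) measurable
     also have "(\<integral>\<^sup>+s. ennreal \<bar>q (s + r) - q s\<bar> \<partial>lborel) = ennreal (LINT s|lborel. \<bar>q (s + r) - q s\<bar>)"
      by (rule nn_integral_eq_integral[OF iq]) simp
     also have "ennreal (rh n r) * ennreal (LINT s|lborel. abs (q (s + r) - q s)) <= ennreal (rh n r) * ennreal e"
      using d[of r] True hn by (intro mult_left_mono ennreal_leI) auto
     finally show ?thesis .
    next
     case False
     thus ?thesis using rhout[of n r] by simp
    qed
   qed
   also have "... = (\<integral>\<^sup>+r. ennreal (rh n r) \<partial>lborel) * ennreal e"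
    by (rule nn_integral_multc) measurable
   also have "(\<integral>\<^sup>+r. ennreal (rh n r) \<partial>lborel) = 1"
    using nn_integral_eq_integral[OF rhint[of n]] rh0 rh1 by simp
   finally show ?thesis by simp
  qed
  note small = translation_continuous_L1[OF q]
  have ev: "\<forall>\<^sub>F n in sequentially. (\<integral>\<^sup>+s. ennreal (norm (u n s)) \<partial>lborel) <= ennreal e" if e: "e > 0" for e
  proof -
   obtain d where d: "d > 0" "!!xi. norm xi < d ==> (LINT z|lborel. abs (q (z + xi) - q z)) < e" using small e by blast
   have "\<forall>\<^sub>F n in sequentially. h n < d" using hlim d(1) by (rule order_tendstoD(2))
   thus ?thesis by eventually_elim (rule bound[OF d(2)])
  qed
  obtain n0 where n0: "!!n. n >= n0 ==> (\<integral>\<^sup>+s. ennreal (norm (u n s)) \<partial>lborel) <= ennreal 1"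
   using ev[of 1] unfolding eventually_sequentially by auto
  have ui: "integrable lborel (u (n + n0))" for n
   by (rule integrableI_bounded) (use n0[of "n + n0"] in \<open>auto intro: le_less_trans\<close>)
  have "(%n. LINT s|lborel. norm (u (n + n0) s)) \<longlonglongrightarrow> 0"
  proof (rule tendstoI)
   fix e :: real assume e: "e > 0"
   have "\<forall>\<^sub>F n in sequentially. (\<integral>\<^sup>+s. ennreal (norm (u (n + n0) s)) \<partial>lborel) <= ennreal (e / 2)"
    using ev[of "e / 2"] e by (subst eventually_sequentially_seg[where P = "%n. (\<integral>\<^sup>+s. ennreal (norm (u n s)) \<partial>lborel) <= ennreal (e / 2)"]) simp
   thus "\<forall>\<^sub>F n in sequentially. dist (LINT s|lborel. norm (u (n + n0) s)) 0 < e"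
   proof eventually_elim
    case (elim n)
    have "ennreal (LINT s|lborel. norm (u (n + n0) s)) <= ennreal (e / 2)"
     using elim nn_integral_eq_integral[OF integrable_norm[OF ui[of n]]] by simp
    hence "(LINT s|lborel. norm (u (n + n0) s)) <= e / 2" using e by (simp add: ennreal_le_iff)
    moreover have "0 <= (LINT s|lborel. norm (u (n + n0) s))" by simp
    ultimately show ?case using e by (simp add: dist_real_def)
   qed
  qed
  from tendsto_L1_AE_subseq[OF ui this]
  obtain \<pi> where \<pi>: "strict_mono \<pi>" "AE s in lborel. (%n. u (\<pi> n + n0) s) \<longlonglongrightarrow> 0" by (elim exE conjE)
  obtain N where N: "N : null_sets lborel" "{s. \<not> (%n. u (\<pi> n + n0) s) \<longlonglongrightarrow> 0} \<subseteq> N"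
   using \<pi>(2) unfolding eventually_ae_filter by auto
  have conv: "(%n. M (\<pi> n + n0) s) \<longlonglongrightarrow> m s" if s: "s ~: N" "al < s" "s < be" for s
  proof -
   have "(%n. u (\<pi> n + n0) s) \<longlonglongrightarrow> 0" using N(2) s(1) by blast
   hence lim: "(%n. u (\<pi> n + n0) s + q s) \<longlonglongrightarrow> 0 + q s" by (intro tendsto_add tendsto_const)
   have hl: "(%n. h (\<pi> n + n0)) \<longlonglongrightarrow> 0"
    using LIMSEQ_subseq_LIMSEQ[OF LIMSEQ_ignore_initial_segment[OF hlim, of n0] \<pi>(1)] by (simp add: o_def)
   have "\<forall>\<^sub>F n in sequentially. h (\<pi> n + n0) < min (s - al) (be - s)"
    using hl by (rule order_tendstoD(2)) (use s in auto)
   hence "\<forall>\<^sub>F n in sequentially. u (\<pi> n + n0) s + q s = M (\<pi> n + n0) s"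
   proof eventually_elim
    case (elim n)
    let ?n = "\<pi> n + n0"
    have "u ?n s + q s = (LINT r|lborel. rh ?n r * q (s + r)) - (LINT r|lborel. rh ?n r * q s) + q s"
     unfolding u_def right_diff_distrib
     by (subst lint_diff) (use weight[OF qs, of ?n 0 s] integrable_mult_left[OF rhint[of ?n], of "q s"] in simp_all)
    also have "... = (LINT r|lborel. rh ?n r * q (s + r))" using rh1[of ?n] by simp
    also have "... = (LINT ta|lborel. rh ?n (ta - s) * q ta)"
     using lborel_integral_real_affine[of 1 "%ta. rh ?n (ta - s) * q ta" s] by simp
    also have "... = M ?n s"
    proof -
     have "rh ?n (ta - s) * m ta = rh ?n (ta - s) * (ind {al..be} ta * m ta)" for ta
      by (rule localise) (use elim in auto)
     thus ?thesis unfolding M_def q_def by (simp only:)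
    qed
    finally show ?case .
   qed
   from Lim_transform_eventually[OF lim this] show ?thesis using s by (simp add: q_def)
  qed
  show ?thesis
  proof (intro bexI[OF _ N(1)] allI impI)
   fix s t assume st: "s ~: N" "t ~: N" "al < s" "s < t" "t < be"
   have hl: "(%n. h (\<pi> n + n0)) \<longlonglongrightarrow> 0"
    using LIMSEQ_subseq_LIMSEQ[OF LIMSEQ_ignore_initial_segment[OF hlim, of n0] \<pi>(1)] by (simp add: o_def)
   have "\<forall>\<^sub>F n in sequentially. h (\<pi> n + n0) < min (s - al) (be - t)"
    using hl by (rule order_tendstoD(2)) (use st in auto)
   hence ev: "\<forall>\<^sub>F n in sequentially. M (\<pi> n + n0) t <= M (\<pi> n + n0) s"
    by eventually_elim (rule mono[OF _ st(4) _ ab]; simp)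
   have "s < be" "al < t" using st by auto
   thus "m t <= m s"
    by (intro tendsto_le[OF sequentially_bot conv[OF st(1,3)] conv[OF st(2) _ st(5)] ev])
  qed
 qed
 note interval = this
 \<comment> \<open>The 3 keeps \<open>a k\<close> at most \<open>T / 3\<close>, so that the interval
   from \<open>a k\<close> to \<open>T - a k\<close> is never empty.\<close>
 define a where "a k = T / (real k + 3)" for k
 have ak: "0 < a k" "a k < T - a k" "T - a k < T" for k :: nat
 proof -
  have "a k <= T / 3" unfolding a_def using T by (intro divide_left_mono) auto
  moreover have "0 < a k" using T by (simp add: a_def)
  ultimately show "0 < a k" "a k < T - a k" "T - a k < T" using T by linarith+
 qed
 have "EX N. N : null_sets lborel & (ALL s t. s ~: N --> t ~: N --> a k < s --> s < t --> t < T - a k --> m t <= m s)" for k :: nat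
  using interval[OF ak] by blast
 hence "ALL k. EX N. N : null_sets lborel & (ALL s t. s ~: N --> t ~: N --> a k < s --> s < t --> t < T - a k --> m t <= m s)" by blast
 from choice[OF this] obtain N where N: "!!k. N k : null_sets lborel"
  "!!k s t. s ~: N k ==> t ~: N k ==> a k < s ==> s < t ==> t < T - a k ==> m t <= m s" by blast
 show ?thesis
 proof (intro bexI[of _ "\<Union>k. N k"] allI impI)
  show "(\<Union>k. N k) : null_sets lborel" using N(1) by (intro null_sets_UN') auto
  fix s t assume st: "s ~: (\<Union>k. N k)" "t ~: (\<Union>k. N k)" "0 < s" "s <= t" "t < T"
  obtain k where k: "T / min s (T - t) < real k" using reals_Archimedean2 by blast
  have mn: "0 < min s (T - t)" using st by auto
  have "T < real k * min s (T - t)" using k mn by (simp add: divide_less_eq)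
  also have "... <= (real k + 3) * min s (T - t)" using mn by (intro mult_right_mono) auto
  finally have "T < min s (T - t) * (real k + 3)" by (simp only: mult.commute)
  moreover have "0 < real k + 3" by simp
  ultimately have "a k < min s (T - t)" unfolding a_def by (intro pos_divide_less_eq[THEN iffD2])
  thus "m t <= m s" using N(2)[of s k t] st by (cases "s = t") auto
 qed
qed

section \<open>A partition of unity subordinate to charts\<close>

context closed_manifold
begin

definition bump :: "('m, 'd) chart => (real^'d => real) => 'm => real" where
 "bump c b p = (if p : fst c then b (snd c p) else 0)"

lemma bump_lift: "bump c b p = lift c (%z. b (fst z)) p t"
 by (simp add: bump_def lift_def)

lemma gradient_fst:
 fixes b :: "'a::euclidean_space => real"
 assumes "has_grad b db UNIV"
 shows "has_grad (%z::'a * real. b (fst z)) (%z. (db (fst z), 0)) UNIV"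
 unfolding has_grad_def
proof (intro conjI ballI)
 fix z :: "'a * real"
 have "(fst has_derivative fst) (at z)" by (auto intro!: derivative_eq_intros)
 from diff_chain_at[OF this has_gradD[OF assms UNIV_I]]
 show "((%z. b (fst z)) has_derivative (.*) (db (fst z), 0)) (at z)" by (simp add: o_def inner_prod_def[abs_def])
qed (intro continuous_intros cont_comp2[OF has_grad_continuous_grad[OF assms]]; auto)

lemma bump_chart:
 assumes c: "c : A" and b: "has_grad b db UNIV" and K: "compact K" "K \<subseteq> cimg c" "!!y. y ~: K ==> b y = 0"
  and c': "c' : A"
 shows "EX d. has_grad (%y. bump c b (chart_inv c' y)) d (cimg c')"
proof -
 have out: "!!y t. y ~: K ==> b (fst (y, t::real)) = 0" using K(3) by simp
 obtain d where "has_grad (%z. lift c (%z. b (fst z)) (chart_inv c' (fst z)) (snd z)) d (cimg c' <*> UNIV)"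
  using lift_chart[OF c gradient_fst[OF b] K(1,2) out c'] by blast
 note comp = has_grad_compose[OF this, where ta = "%y. (y, 0)" and ta' = "%_ h. (h, 0)" and S = "cimg c'"]
 have "has_grad (%y. lift c (%z. b (fst z)) (chart_inv c' y) 0)
   (%y. SUM e:Basis. (d (y, 0) .* (e, 0)) *. e) (cimg c')"
  by (rule comp[simplified]) (auto intro!: derivative_eq_intros continuous_intros)
 thus ?thesis unfolding bump_lift[of c b _ 0, symmetric] by blast
qed

text \<open>Each member is kept as a function of the coordinates of its own chart, the form in which
  it enters chart test functions; \<open>D\<close> is a finite set of centres, and
  \<open>chart_at A p\<close> is the chart of the centre \<open>p\<close>. Bumps are divided by
  their positive sum \<open>S\<close>, which is C^1 in every chart, so the quotients stay
  C^1.\<close>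

lemma partition_of_unity:
 obtains D :: "'m set" and K and b :: "'m => real^'d => real" and db where "finite D"
  "!!p. p : D ==> has_grad (b p) (db p) UNIV" "!!p y. p : D ==> 0 <= b p y"
  "!!p. p : D ==> compact (K p)" "!!p. p : D ==> K p \<subseteq> cimg (chart_at A p)"
  "!!p y. p : D ==> y ~: K p ==> b p y = 0" "!!q. (SUM p:D. bump (chart_at A p) (b p) q) = 1"
proof -
 define c where "c p = chart_at A p" for p
 have c: "c p : A" "p : fst (c p)" for p using chart_at by (auto simp: c_def)
 define ok where "ok p x \<longleftrightarrow> fst x > (0::real) & cball (snd (c p) p) (fst x) \<subseteq> cimg (c p)
  & has_grad (fst (snd x)) (snd (snd x)) UNIV & (ALL z. 0 <= fst (snd x) z)
  & (ALL z:ball (snd (c p) p) (fst x). 0 < fst (snd x) z) & (ALL z. z ~: ball (snd (c p) p) (fst x) --> fst (snd x) z = 0)"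
  for p and x :: "real \<times> (real^'d => real) \<times> (real^'d => real^'d)"
 have "ALL p. EX x. ok p x"
 proof
  fix p
  have "snd (c p) p : cimg (c p)" using c by simp
  then obtain r where r: "r > 0" "cball (snd (c p) p) r \<subseteq> cimg (c p)"
   using open_image[OF c(1)] open_contains_cball by blast
  from bump_exists[OF r(1), of "snd (c p) p"]
  obtain f df where "has_grad f df UNIV" "ALL z. 0 <= f z" "ALL z:ball (snd (c p) p) r. 0 < f z" "ALL z. z ~: ball (snd (c p) p) r --> f z = 0"
   by (elim exE conjE)
  hence "ok p (r, f, df)" using r unfolding ok_def fst_conv snd_conv by (intro conjI)
  thus "EX x. ok p x" by blast
 qed
 from choice[OF this] obtain X where X: "ALL p. ok p (X p)" by (rule exE)
 define r b0 db0 where "r p = fst (X p)" and "b0 p = fst (snd (X p))" and "db0 p = snd (snd (X p))" for p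
 have r: "r p > 0" and rK: "cball (snd (c p) p) (r p) \<subseteq> cimg (c p)" and b0: "has_grad (b0 p) (db0 p) UNIV"
  and b0n: "0 <= b0 p z" and b0p: "z : ball (snd (c p) p) (r p) ==> 0 < b0 p z" and b0o: "z ~: ball (snd (c p) p) (r p) ==> b0 p z = 0" for p z
  using X unfolding ok_def r_def b0_def db0_def by blast+
 define K where "K p = cball (snd (c p) p) (r p)" for p
 have K: "compact (K p)" "K p \<subseteq> cimg (c p)" for p using rK by (auto simp: K_def)
 have b0K: "b0 p z = 0" if "z ~: K p" for p z by (rule b0o) (use that in \<open>auto simp: K_def\<close>)
 define U where "U p = chart_inv (c p) ` ball (snd (c p) p) (r p)" for p
 have bU: "ball (snd (c p) p) (r p) \<subseteq> cimg (c p)" for p by (rule subset_trans[OF ball_subset_cball rK])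
 have oU: "open (U p)" for p unfolding U_def by (rule open_inv_image[OF c(1) open_ball bU])
 have pU: "p : U p" for p
  unfolding U_def by (rule image_eqI[of _ _ "snd (c p) p"]) (use c r in auto)
 have "(UNIV :: 'm set) \<subseteq> (UN p:UNIV. U p)" using pU by blast
 from compactE_image[OF compact_UNIV oU this] obtain D where D: "finite D" "UNIV \<subseteq> (UN p:D. U p)" by metis
 define S where "S q = (SUM p:D. bump (c p) (b0 p) q)" for q
 have S: "S q > 0" for q
 proof -
  obtain p where p: "p : D" "q : U p" using D(2) by blast
  then obtain y where y: "y : ball (snd (c p) p) (r p)" "q = chart_inv (c p) y" unfolding U_def by blast
  have yU: "y : cimg (c p)" using y(1) bU by blast
  have "bump (c p) (b0 p) q = b0 p y" using c(1)[of p] yU by (simp add: bump_def y(2))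
  hence "bump (c p) (b0 p) q > 0" using b0p[OF y(1)] by simp
  from this show ?thesis unfolding S_def by (intro sum_pos2[OF D(1) p(1)]) (auto simp: bump_def b0n)
 qed
 define b where "b p y = (if y : cimg (c p) then b0 p y * inverse (S (chart_inv (c p) y)) else 0)" for p y
 have "EX d. has_grad (b p) d UNIV" for p
 proof -
  have "EX d. has_grad (%y. bump (c p') (b0 p') (chart_inv (c p) y)) d (cimg (c p))" for p'
   by (rule bump_chart[OF c(1) b0 K b0K c(1)])
  hence "has_grad (%y. bump (c p') (b0 p') (chart_inv (c p) y)) (gradient (%y. bump (c p') (b0 p') (chart_inv (c p) y))) (cimg (c p))" for p'
   using has_grad_gradient by blast
  from has_grad_sum[OF D(1) this]
  have Sg: "has_grad (%y. S (chart_inv (c p) y)) (%y. SUM p':D. gradient (%y. bump (c p') (b0 p') (chart_inv (c p) y)) y) (cimg (c p))"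
   by (simp add: S_def)
  have ig: "has_grad (%y. inverse (S (chart_inv (c p) y)))
    (%y. (- (inverse (S (chart_inv (c p) y)) ^ Suc (Suc 0))) *. (SUM p':D. gradient (%y. bump (c p') (b0 p') (chart_inv (c p) y)) y)) (cimg (c p))"
  proof (rule has_grad_real_comp[OF Sg, of inverse "%x. - (inverse x ^ Suc (Suc 0))"])
   show "(inverse has_real_derivative - (inverse (S (chart_inv (c p) z)) ^ Suc (Suc 0))) (at (S (chart_inv (c p) z)))" for z
    by (rule DERIV_inverse) (use S[of "chart_inv (c p) z"] in simp)
   show "continuous_on ((%y. S (chart_inv (c p) y)) ` cimg (c p)) (%x. - (inverse x ^ Suc (Suc 0)))"
    using S by (intro continuous_intros) (metis imageE less_numeral_extra(3))
  qed
  note ext = has_grad_extend_zero[OF has_grad_mult[OF has_grad_subset[OF b0 subset_UNIV] ig] open_image[OF c(1)] compact_imp_closed[OF K(1)] K(2)]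
  have "EX d. has_grad (%y. if y : cimg (c p) then b0 p y * inverse (S (chart_inv (c p) y)) else 0) d UNIV"
   by (rule exI, rule ext) (simp add: b0K)
  thus ?thesis unfolding b_def .
 qed
 hence bg: "has_grad (b p) (gradient (b p)) UNIV" for p using has_grad_gradient by blast
 have sum1: "(SUM p:D. bump (c p) (b p) q) = 1" for q
 proof -
  have eq: "bump (c p) (b p) q = bump (c p) (b0 p) q / S q" for p
   using c(1) by (simp add: bump_def b_def divide_inverse)
  have "(SUM p:D. bump (c p) (b p) q) = (SUM p:D. bump (c p) (b0 p) q / S q)" by (simp only: eq)
  also have "... = (SUM p:D. bump (c p) (b0 p) q) / S q" by (rule sum_divide_distrib[symmetric])
  also have "... = S q / S q" by (simp only: S_def)
  also have "... = 1" using S[of q] by simp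
  finally show ?thesis .
 qed
 show ?thesis
 proof (rule that[OF D(1) bg])
  show "0 <= b p y" for p y using b0n S[of "chart_inv (c p) y"] by (simp add: b_def)
  show "compact (K p)" "K p \<subseteq> cimg (chart_at A p)" for p using K by (auto simp: c_def)
  show "b p y = 0" if "y ~: K p" for p y using b0K[OF that] by (simp add: b_def)
  show "(SUM p:D. bump (chart_at A p) (b p) q) = 1" for q using sum1 by (simp add: c_def)
 qed
qed

end

lemma kernel_tail_measurable:
 fixes ka :: "'z => real measure"
 assumes ka: "ka : M -M> prob_algebra borel"
 shows "(%w. measure (ka (fst w)) {snd w<..}) : bmeas (M <x> borel)"
  and "(%w. measure (ka (fst w)) {..snd w}) : bmeas (M <x> borel)"
proof -
 have f1: "(%x :: ('z * real) * real. snd (fst x)) : bmeas ((M <x> borel) <x> borel)"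
  by (rule measurable_compose[OF measurable_fst measurable_snd])
 have f2: "(%x :: ('z * real) * real. snd x) : bmeas ((M <x> borel) <x> borel)"
  by (rule measurable_snd)
 have k: "(%w. ka (fst w)) : M <x> (borel :: real measure) -M> prob_algebra borel"
  by (rule measurable_compose[OF measurable_fst ka])
 have eq: "(LINT u|ka (fst w). (ind B u :: real)) = measure (ka (fst w)) B" if "w : space (M <x> (borel :: real measure))" for w and B :: "real set"
 proof -
  have "space (ka (fst w)) = UNIV"
   using kernel_prob_space(2)[OF k that] by (simp add: sets_eq_imp_space_eq[of _ borel])
  thus ?thesis by simp
 qed
 have "(%w. LINT u|ka (fst w). (ind {snd w<..} u :: real)) : bmeas (M <x> borel)"
 proof (rule kernel_integral_measurable[where f = "%w. ind {snd w<..}" and K = "%w. ka (fst w)", OF _ k])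
  have "(%x :: ('z * real) * real. if snd (fst x) < snd x then 1 else 0 :: real) : bmeas ((M <x> borel) <x> borel)"
   by (intro measurable_If borel_measurable_less[OF f1 f2]) auto
  moreover have "(%x :: ('z * real) * real. if snd (fst x) < snd x then 1 else 0 :: real) = (%(w :: 'z * real, u :: real). ind {snd w<..} u)"
   by (auto simp: fun_eq_iff indicator_def)
  ultimately show "(%(w :: 'z * real, u :: real). ind {snd w<..} u :: real) : bmeas ((M <x> borel) <x> borel)"
   by (simp only:)
 qed
 thus "(%w. measure (ka (fst w)) {snd w<..}) : bmeas (M <x> borel)"
  by (rule measurable_cong[THEN iffD1, rotated]) (rule eq)
 have "(%w. LINT u|ka (fst w). (ind {..snd w} u :: real)) : bmeas (M <x> borel)"
 proof (rule kernel_integral_measurable[where f = "%w. ind {..snd w}" and K = "%w. ka (fst w)", OF _ k])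
  have "(%x :: ('z * real) * real. if snd x <= snd (fst x) then 1 else 0 :: real) : bmeas ((M <x> borel) <x> borel)"
   by (intro measurable_If borel_measurable_le[OF f2 f1]) auto
  moreover have "(%x :: ('z * real) * real. if snd x <= snd (fst x) then 1 else 0 :: real) = (%(w :: 'z * real, u :: real). ind {..snd w} u)"
   by (auto simp: fun_eq_iff indicator_def)
  ultimately show "(%(w :: 'z * real, u :: real). ind {..snd w} u :: real) : bmeas ((M <x> borel) <x> borel)"
   by (simp only:)
 qed
 thus "(%w. measure (ka (fst w)) {..snd w}) : bmeas (M <x> borel)"
  by (rule measurable_cong[THEN iffD1, rotated]) (rule eq)
qed

context conservation_law
begin

lemma chart_space_integral:
 fixes L :: "(real^'d)*real => real"
 assumes c: "c : A" and L: "L : bmeas borel" "!!z. abs (L z) <= C"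
  and K: "compact K" "K \<subseteq> Om c" "!!z. z ~: K ==> L z = 0" and t: "t : {0<..<T}"
 shows "integrable (dV t) (%q. if q : fst c then L (snd c q, t) / W c (snd c q, t) else 0)"
  and "(LINT y|lborel. L (y, t)) = (LINT q|dV t. (if q : fst c then L (snd c q, t) / W c (snd c q, t) else 0))"
proof -
 have t': "t : {0..T}" using t by auto
 interpret Rt: riemannian_manifold A "g t" by (rule riem[OF t'])
 define F where "F p = (if p : fst c then L (snd c p, t) / W c (snd c p, t) else 0)" for p
 define ta where "ta p = (if p : fst c then snd c p else 0)" for p
 have w: "Rt.w c y = W c (y, t)" if "y : cimg c" for y using that by (simp add: Rt.w_def W_def)
 have [measurable]: "ta : borel -M> borel"
  unfolding ta_def by (intro bmeas_cont_if dom_borel c cont_coord continuous_on_const)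
 have "(%y::real^'d. (y, t)) : borel -M> borel" by (intro bmeas_contI continuous_intros)
 from measurable_compose[OF this L(1)] have Lm[measurable]: "(%y. L (y, t)) : bmeas borel" .
 note [measurable] = Rt.w_measurable[OF c] dom_borel[OF c]
 have "(%p. if p : fst c then L (ta p, t) / Rt.w c (ta p) else 0) : bmeas borel" by measurable
 moreover have "(%p. if p : fst c then L (ta p, t) / Rt.w c (ta p) else 0) = F"
  using c by (auto simp: fun_eq_iff F_def ta_def w)
 ultimately have Fm: "F : bmeas borel" by simp
 have eq: "Rt.w c y * F (inv0 c y) = L (y, t)" for y
 proof (cases "y : cimg c")
  case True
  hence "(y, t) : Om c" using t by (simp add: Om_def)
  from W_pos[OF c this] show ?thesis using True c by (simp add: w inv0_def F_def)
 next
  case False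
  hence "(y, t) ~: K" using K(2) by (auto simp: Om_def)
  thus ?thesis using False by (simp add: K(3) Rt.w_def)
 qed
 have "bounded (fst ` K)" by (intro compact_imp_bounded compact_continuous_image K(1) continuous_on_fst continuous_on_id)
 hence i: "integrable lborel (%y. L (y, t))"
  by (rule i_bsupp[OF Lm, where C = C, rotated]) (use L(2) K(3) in \<open>force+\<close>)
 have Fo: "F p = 0" if "p ~: fst c" for p using that by (simp add: F_def)
 show "integrable (dV t) (%q. if q : fst c then L (snd c q, t) / W c (snd c q, t) else 0)"
  using Rt.mu_integral_chart(2)[OF c Fm Fo] i unfolding eq by (simp add: dV_def F_def[abs_def])
 show "(LINT y|lborel. L (y, t)) = (LINT q|dV t. (if q : fst c then L (snd c q, t) / W c (snd c q, t) else 0))"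
  using Rt.mu_integral_chart(1)[OF c Fm Fo] unfolding eq by (simp add: dV_def F_def[abs_def])
qed

text \<open>The transformation law is linear in the components and its matrix does not depend on the
  state, so it may be differentiated in the state.\<close>

lemma flux_du_vector_field:
 assumes t: "t : {0<..<T}"
 shows "is_vector_field A (flux_du f t r)"
 unfolding is_vector_field_def
proof (intro ballI)
 fix c1 c2 p assume c: "c1 : A" "c2 : A" "p : fst c1 Int fst c2"
 have "t : {0..T}" using t by auto
 hence "is_vector_field A (f t u)" for u using admissible unfolding admissible_flux_def by blast
 hence eq: "f t u c2 p = jac c1 c2 p *v f t u c1 p" for u using c unfolding is_vector_field_def by blast
 have p: "p : fst c1" "p : fst c2" using c(3) by auto
 have "bounded_linear (%x. jac c1 c2 p *v x)" by (rule matrix_vector_mul_bounded_linear)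
 from bounded_linear.has_vector_derivative[OF this flux_section(1)[OF t c(1) p(1), of r]]
 have "((%u. f t u c2 p) has_vector_derivative jac c1 c2 p *v flux_du f t r c1 p) (at r)" by (simp add: eq)
 from vector_derivative_unique_at[OF flux_section(1)[OF t c(2) p(2), of r] this]
 show "flux_du f t r c2 p = jac c1 c2 p *v flux_du f t r c1 p" .
qed

text \<open>The sum is the derivative of the constant 1 along \<open>X\<close>, computed in one
  chart around \<open>q\<close>. This is where the spatial fluxes of the local inequalities
  disappear.\<close>

lemma partition_flux_zero:
 assumes D: "finite D" "!!p. p : D ==> has_grad (b p) (db p) UNIV"
  "!!p. p : D ==> compact (K p)" "!!p. p : D ==> K p \<subseteq> cimg (chart_at A p)"
  "!!p y. p : D ==> y ~: K p ==> b p y = 0" "!!q. (SUM p:D. bump (chart_at A p) (b p) q) = 1"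
  and X: "is_vector_field A X"
 shows "(SUM p:D. (if q : fst (chart_at A p) then db p (snd (chart_at A p) q) .* X (chart_at A p) q else 0)) = 0"
proof -
 define c' where "c' = chart_at A q"
 have c': "c' : A" "q : fst c'" using chart_at by (auto simp: c'_def)
 define y where "y = snd c' q"
 have y: "y : cimg c'" using c' by (simp add: y_def)
 define d where "d p = gradient (%y. bump (chart_at A p) (b p) (chart_inv c' y)) y" for p
 have D': "((%y. bump (chart_at A p) (b p) (chart_inv c' y)) has_derivative (.*) (d p)) (at y)" if p: "p : D" for p
 proof -
  obtain e where "has_grad (%y. bump (chart_at A p) (b p) (chart_inv c' y)) e (cimg c')"
   using bump_chart[OF chart_at(1) D(2)[OF p] D(3)[OF p] D(4)[OF p] D(5)[OF p] c'(1)] by blast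
  from has_gradD[OF has_grad_gradient[OF this] y] show ?thesis by (simp add: d_def)
 qed
 have summand: "(if q : fst (chart_at A p) then db p (snd (chart_at A p) q) .* X (chart_at A p) q else 0) = d p .* X c' q" if p: "p : D" for p
 proof -
  have out: "!!y t. y ~: K p ==> b p (fst (y, t::real)) = 0" using D(5)[OF p] by simp
  have "diff_along A (%x. lift (chart_at A p) (%z. b p (fst z)) x 0) X q
    = (if q : fst (chart_at A p) then fst (db p (fst (snd (chart_at A p) q, 0::real)), 0::real) .* X (chart_at A p) q else 0)"
   by (rule diff_along_lift[OF chart_at(1) gradient_fst[OF D(2)[OF p]] D(3)[OF p] D(4)[OF p] out X])
  moreover have "diff_along A (bump (chart_at A p) (b p)) X q = d p .* X c' q"
   using frechet_derivative_at[OF D'[OF p], symmetric] by (simp add: diff_along_def c'_def[symmetric] y_def[symmetric] Let_def)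
  moreover have "(%x. lift (chart_at A p) (%z. b p (fst z)) x 0) = bump (chart_at A p) (b p)"
   by (simp add: fun_eq_iff lift_def bump_def)
  ultimately show ?thesis by simp
 qed
 have "((%y. SUM p:D. bump (chart_at A p) (b p) (chart_inv c' y)) has_derivative (%h. SUM p:D. d p .* h)) (at y)"
  by (rule has_derivative_sum) (rule D')
 hence "((%y. 1::real) has_derivative (%h. SUM p:D. d p .* h)) (at y)" by (simp add: D(6))
 from has_derivative_unique[OF this has_derivative_const]
 have "(SUM p:D. d p .* X c' q) = 0" by (rule fun_cong)
 thus ?thesis by (simp add: summand)
qed

section \<open>Summing the local inequalities\<close>

context
 fixes nv sig :: "'m => real => real measure" and nv' sig' :: "'m * real => real measure" and R :: real
 assumes nv: "represents R nv nv'" and sig: "represents R sig sig'"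
begin

definition tails :: "'m => real => real => real" where
 "tails q t r = measure (nv' (q, t)) {r<..} * measure (sig' (q, t)) {..r}"

lemma kernels: "nv' : borel -M> prob_algebra borel" "sig' : borel -M> prob_algebra borel"
 "AE v in nv' w. abs v < R" "AE v in sig' w. abs v < R"
 using nv sig unfolding represents_def by blast+

lemmas probs = kernel_prob_space_borel[OF kernels(1)] kernels(3) kernel_prob_space_borel[OF kernels(2)] kernels(4)

lemma tails_bounds: "0 <= tails q t r" "tails q t r <= 1"
 unfolding tails_def
 using prob_space.prob_le_1[OF probs(1), of "(q, t)" "{r<..}"] prob_space.prob_le_1[OF probs(4), of "(q, t)" "{..r}"]
 by (auto intro!: mult_le_one)

lemma tails_measurable: "tails q t : bmeas borel"
proof -
 note m = tail_measurable[OF probs(1-3)[of "(q, t)"] probs(4-6)[of "(q, t)"]] tail_measurable[OF probs(4-6)[of "(q, t)"] probs(1-3)[of "(q, t)"]]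
 show ?thesis unfolding tails_def[abs_def] by (rule borel_measurable_times[OF m(1) m(4)])
qed

lemma tails_integrable:
 assumes "continuous_on UNIV G"
 shows "integrable lborel (%r. tails q t r * (if abs r <= R then G r else 0))"
proof -
 have "bounded (G ` {- R..R})" by (intro compact_imp_bounded compact_continuous_image continuous_on_subset[OF assms]) auto
 then obtain C where C: "!!r. r : {- R..R} ==> abs (G r) <= C" unfolding bounded_iff real_norm_def by blast
 note [measurable] = tails_measurable bmeas_contI[OF assms]
 show ?thesis
 proof (rule i_bsupp[where K = "{- R..R}" and C = "max C 0"])
  show "norm (tails q t r * (if abs r <= R then G r else 0)) <= max C 0" for r
  proof (cases "abs r <= R")
   case True
   have "tails q t r * abs (G r) <= 1 * abs (G r)" using tails_bounds by (intro mult_right_mono) auto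
   also have "1 * abs (G r) <= C"
   proof -
    have "r : {- R..R}" using True unfolding atLeastAtMost_iff by arith
    from C[OF this] show ?thesis by simp
   qed
   finally show ?thesis using True tails_bounds by (simp add: abs_mult)
  qed simp
  show "(%r. tails q t r * (if abs r <= R then G r else 0)) : bmeas borel" by measurable
 qed auto
qed

text \<open>By \<open>Th_pairing\<close> below this is the pairing with the positive part of the
  difference. The restriction to \<open>abs r <= R\<close> loses nothing, as both kernels live in
  that range.\<close>

definition Th :: "'m => real => real" where
 "Th q t = (LINT r|lborel. tails q t r * (if abs r <= R then 1 else 0))"

context
 fixes c :: "('m, 'd) chart" and G :: "(real^'d)*real => real => real" and K
 assumes c: "c : A" and G: "continuous_on (Om c <*> UNIV) (%(z, r). G z r)" and K: "compact K" "K \<subseteq> Om c"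
begin

text \<open>The integrand of \<open>chart_kinetic\<close> with a general factor \<open>G\<close>,
  cut down to \<open>K\<close>. Two choices of \<open>G\<close> occur: \<open>W\<close> times a
  member of the partition of unity, and the kinetic field paired with a test gradient.\<close>

definition Ph :: "((real^'d)*real) * real => real" where
 "Ph w = tails (inv0 c (fst (fst w))) (snd (fst w)) (snd w) * (if fst w : K & abs (snd w) <= R then G (fst w) (snd w) else 0)"

definition L :: "(real^'d)*real => real" where "L z = (LINT r|lborel. Ph (z, r))"

lemma Ph_measurable: "Ph : bmeas borel2"
proof -
 note [measurable] = kernel_tail_measurable(1)[OF represents_chart_kernel(1)[OF c nv]]
  kernel_tail_measurable(2)[OF represents_chart_kernel(1)[OF c sig]] clip_measurable[OF G K, of R, unfolded case_prod_beta']
 show ?thesis unfolding Ph_def[abs_def] tails_def by measurable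
qed

lemma Ph_bound: obtains C where "C >= 0" "!!w. abs (Ph w) <= C" "!!w. abs (Ph w) <= C * ind {- R..R} (snd w)"
proof -
 obtain C where C: "C >= 0" "!!z r. z : K ==> abs r <= R ==> norm (G z r) <= C" using clip_bound[OF G K] by metis
 have b: "abs (Ph w) <= C * ind {- R..R} (snd w)" for w
 proof (cases "fst w : K & abs (snd w) <= R")
  case True
  let ?t = "tails (inv0 c (fst (fst w))) (snd (fst w)) (snd w)"
  have "abs (Ph w) = ?t * abs (G (fst w) (snd w))" using True tails_bounds by (simp add: Ph_def abs_mult)
  also have "... <= 1 * C" using C(1) C(2)[of "fst w" "snd w"] True tails_bounds by (intro mult_mono) auto
  also have "... = C * ind {- R..R} (snd w)" using True by (auto simp: indicator_def)
  finally show ?thesis .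
 next
  case False
  hence "Ph w = 0" unfolding Ph_def by (simp only: if_False mult_zero_right)
  thus ?thesis using C(1) by simp
 qed
 have "abs (Ph w) <= C" for w
 proof -
  have "C * ind {- R..R} (snd w) <= C * 1" by (intro mult_left_mono C(1) indicator_le_1)
  thus ?thesis using b[of w] by linarith
 qed
 from that[OF C(1) this b] show thesis .
qed

lemma Ph_support: "bounded (K <*> {- R..R})" "w ~: K <*> {- R..R} ==> Ph w = 0"
proof -
 show "bounded (K <*> {- R..R})" by (intro bounded_Times compact_imp_bounded K(1)) auto
 assume "w ~: K <*> {- R..R}"
 hence "\<not> (fst w : K & abs (snd w) <= R)" by (cases w) auto
 thus "Ph w = 0" unfolding Ph_def by (simp only: if_False mult_zero_right)
qed

lemma L_measurable: "L : bmeas borel"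
proof -
 have "(%(z, r). Ph (z, r)) : bmeas (borel <x> lborel)"
  using Ph_measurable by (simp cong: meas_cong_sets sets_pair_measure_cong)
 thus ?thesis unfolding L_def[abs_def] by (rule lborel.borel_measurable_lebesgue_integral)
qed

lemma L_bound: obtains C where "!!z. abs (L z) <= C"
proof -
 obtain C where C: "C >= 0" "!!w. abs (Ph w) <= C" "!!w. abs (Ph w) <= C * ind {- R..R} (snd w)" using Ph_bound by metis
 have "abs (L z) <= (LINT r|lborel. C * ind {- R..R} r)" for z
  unfolding L_def
 proof (rule integral_abs_le)
  have "emeasure lborel {- R..R} < \<infinity>" by (simp add: emeasure_lborel_Icc_eq)
  thus "integrable lborel (%r. C * ind {- R..R} r)" by (intro integrable_mult_right integrable_real_indicator) auto
  show "abs (Ph (z, r)) <= C * ind {- R..R} r" for r using C(3)[of "(z, r)"] by simp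
 qed
 thus thesis by (rule that)
qed

lemma L_outside: "z ~: K ==> L z = 0"
 by (simp add: L_def Ph_def)

lemma L_integral:
 "(LINT w|lborel. Ph w) = (LINT t|lborel. LINT y|lborel. L (y, t))" "integrable lborel (%t. LINT y|lborel. L (y, t))"
proof -
 obtain C where C: "C >= 0" "!!w. abs (Ph w) <= C" "!!w. abs (Ph w) <= C * ind {- R..R} (snd w)" using Ph_bound by metis
 obtain CL where CL: "!!z. abs (L z) <= CL" using L_bound by metis
 have Lm: "L : bmeas borel2" using L_measurable by (simp add: borel_prod)
 have "(LINT w|lborel. Ph w) = (LINT z|lborel. L z)"
  using lborel_Fubini_bounded(2)[OF Ph_measurable C(2) Ph_support] by (simp add: L_def)
 also have "... = (LINT t|lborel. LINT y|lborel. L (y, t))"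
  by (rule lborel_Fubini_bounded(3)[OF Lm CL compact_imp_bounded[OF K(1)] L_outside, symmetric])
 finally show "(LINT w|lborel. Ph w) = (LINT t|lborel. LINT y|lborel. L (y, t))" .
 define L' where "L' p = L (snd p, fst p)" for p
 have Lm': "L' : bmeas borel2"
  using measurable_compose[OF measurable_pair_swap' Lm] by (simp add: L'_def[abs_def] case_prod_beta')
 define K2 where "K2 = (%z. (snd z, fst z)) ` K"
 have "compact K2" unfolding K2_def by (intro compact_continuous_image K(1) continuous_intros)
 hence bK: "bounded K2" by (rule compact_imp_bounded)
 have L0: "L' p = 0" if "p ~: K2" for p
 proof -
  have "(snd p, fst p) ~: K"
  proof
   assume "(snd p, fst p) : K"
   hence "(%z. (snd z, fst z)) (snd p, fst p) : K2" unfolding K2_def by (rule imageI)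
   thus False using that by simp
  qed
  thus ?thesis by (simp add: L'_def L_outside)
 qed
 have bL: "abs (L' p) <= CL" for p by (simp add: L'_def CL)
 show "integrable lborel (%t. LINT y|lborel. L (y, t))"
  using lborel_Fubini_bounded(4)[OF Lm' bL bK L0] by (simp add: L'_def)
qed

lemma L_chart:
 assumes q: "q : fst c" and t: "t : {0<..<T}"
 shows "L (snd c q, t) / W c (snd c q, t)
  = (LINT r|lborel. tails q t r * (if abs r <= R then (if (snd c q, t) : K then G (snd c q, t) r else 0) / W c (snd c q, t) else 0))"
proof -
 have i: "inv0 c (snd c q) = q" using c q by (simp add: inv0_def)
 have "L (snd c q, t) / W c (snd c q, t) = (LINT r|lborel. Ph ((snd c q, t), r) / W c (snd c q, t))"
  unfolding L_def by (rule integral_divide_zero[symmetric])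
 also have "... = (LINT r|lborel. tails q t r * (if abs r <= R then (if (snd c q, t) : K then G (snd c q, t) r else 0) / W c (snd c q, t) else 0))"
  by (rule lint_cong[OF refl]) (simp add: Ph_def i)
 finally show ?thesis .
qed

end

text \<open>Used twice: with \<gamma> equal to 1 it shows that the spatial integral of
  \<open>Th\<close> is integrable in time, and with \<gamma> equal to \<open>dth t\<close> it
  evaluates the sum of the local inequalities. \<Gamma> is \<open>G\<close> divided by
  \<open>W\<close> because the chart integrals are taken against Lebesgue measure and not against
  the Riemannian one.\<close>

lemma partition_sum:
 fixes D :: "'m set" and G :: "'m => (real^'d)*real => real => real"
 assumes D: "finite D" and G: "!!p. p : D ==> continuous_on (Om (chart_at A p) <*> UNIV) (%(z, r). G p z r)"
  and K: "!!p. p : D ==> compact (K p)" "!!p. p : D ==> K p \<subseteq> Om (chart_at A p)" and t: "t : {0<..<T}"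
  and \<Gamma>: "!!p q r. p : D ==> q : fst (chart_at A p) ==>
    (if (snd (chart_at A p) q, t) : K p then G p (snd (chart_at A p) q, t) r else 0) / W (chart_at A p) (snd (chart_at A p) q, t) = \<Gamma> p q r"
  and \<Gamma>0: "!!p q r. p : D ==> q ~: fst (chart_at A p) ==> \<Gamma> p q r = 0"
  and \<Gamma>c: "!!p q. p : D ==> continuous_on UNIV (\<Gamma> p q)" and \<gamma>: "!!q r. (SUM p:D. \<Gamma> p q r) = \<gamma>"
 shows "(SUM p:D. LINT y|lborel. L (chart_at A p) (G p) (K p) (y, t)) = \<gamma> * (LINT q|dV t. Th q t)"
proof -
 let ?c = "chart_at A"
 define F where "F p q = (if q : fst (?c p) then L (?c p) (G p) (K p) (snd (?c p) q, t) / W (?c p) (snd (?c p) q, t) else 0)" for p q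
 have F: "F p q = (LINT r|lborel. tails q t r * (if abs r <= R then \<Gamma> p q r else 0))" if p: "p : D" for p q
 proof (cases "q : fst (?c p)")
  case True
  thus ?thesis
   using L_chart[OF chart_at(1) G[OF p] K(1)[OF p] K(2)[OF p] True t] unfolding \<Gamma>[OF p True] by (simp add: F_def)
 next
  case False
  thus ?thesis by (simp add: F_def \<Gamma>0[OF p False] cong: if_cong)
 qed
 have *: "integrable (dV t) (F p) & (LINT y|lborel. L (?c p) (G p) (K p) (y, t)) = (LINT q|dV t. F p q)" if p: "p : D" for p
 proof -
  note ctx = chart_at(1) G[OF p] K(1)[OF p] K(2)[OF p]
  obtain C where C: "!!z. abs (L (?c p) (G p) (K p) z) <= C" using L_bound[OF ctx] by metis
  show ?thesis
   using chart_space_integral[OF chart_at(1) L_measurable[OF ctx] C K(1)[OF p] K(2)[OF p] L_outside[OF ctx] t] by (simp add: F_def[abs_def])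
 qed
 have "(SUM p:D. LINT y|lborel. L (?c p) (G p) (K p) (y, t)) = (SUM p:D. LINT q|dV t. F p q)"
  by (rule sum.cong) (use * in auto)
 also have "... = (LINT q|dV t. (SUM p:D. F p q))"
  by (rule lint_sum[symmetric]) (use * in blast)
 also have "... = (LINT q|dV t. \<gamma> * Th q t)"
 proof (rule lint_cong[OF refl])
  fix q
  have "(SUM p:D. F p q) = (SUM p:D. LINT r|lborel. tails q t r * (if abs r <= R then \<Gamma> p q r else 0))"
   by (rule sum.cong) (use F in auto)
  also have "... = (LINT r|lborel. (SUM p:D. tails q t r * (if abs r <= R then \<Gamma> p q r else 0)))"
   by (rule lint_sum[symmetric]) (rule tails_integrable[OF \<Gamma>c])
  also have "... = (LINT r|lborel. \<gamma> * (tails q t r * (if abs r <= R then 1 else 0)))"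
  proof (rule lint_cong[OF refl])
   fix r
   show "(SUM p:D. tails q t r * (if abs r <= R then \<Gamma> p q r else 0)) = \<gamma> * (tails q t r * (if abs r <= R then 1 else 0))"
    using \<gamma>[of q r] by (simp add: sum_distrib_left[symmetric])
  qed
  also have "... = \<gamma> * Th q t" unfolding Th_def by (rule integral_mult_right_zero)
  finally show "(SUM p:D. F p q) = \<gamma> * Th q t" .
 qed
 also have "... = \<gamma> * (LINT q|dV t. Th q t)" by (rule integral_mult_right_zero)
 finally show ?thesis .
qed

lemma Th_measurable:
 assumes t: "t : {0..T}"
 shows "(%q. Th q t) : bmeas (dV t)" "abs (Th q t) <= measure lborel {- R..R}"
proof -
 have m: "(%q::'m. (q, t)) : borel -M> borel" by (intro bmeas_contI continuous_intros)
 note [measurable] = kernel_tail_measurable(1)[OF measurable_compose[OF m kernels(1)]] kernel_tail_measurable(2)[OF measurable_compose[OF m kernels(2)]]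
 have "(%w::'m * real. tails (fst w) t (snd w) * (if abs (snd w) <= R then 1 else 0)) : bmeas borel2"
  unfolding tails_def by measurable
 hence "(%(q, r). tails q t r * (if abs r <= R then 1 else 0)) : bmeas (borel <x> lborel)"
  by (simp add: case_prod_beta' cong: meas_cong_sets sets_pair_measure_cong)
 hence "(%q. Th q t) : bmeas borel" unfolding Th_def by (rule lborel.borel_measurable_lebesgue_integral)
 thus "(%q. Th q t) : bmeas (dV t)" using meas_cong_sets[OF dV_sets[OF t] refl] by blast
 have fin: "emeasure lborel {- R..R} < \<infinity>" by (simp add: emeasure_lborel_Icc_eq)
 have "abs (Th q t) <= (LINT r|lborel. ind {- R..R} r)"
  unfolding Th_def
 proof (rule integral_abs_le)
  show "integrable lborel (ind {- R..R} :: real => real)" using fin by (intro integrable_real_indicator) auto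
  show "\<bar>tails q t r * (if \<bar>r\<bar> <= R then 1 else 0)\<bar> <= ind {- R..R} r" for r
   using tails_bounds[of q t r] by (auto simp: indicator_def)
 qed
 thus "abs (Th q t) <= measure lborel {- R..R}" by simp
qed

lemma Th_integrable: "t : {0..T} ==> integrable (dV t) (%q. Th q t)"
 by (rule finite_measure.integrable_const_bound[OF finite_dV _ Th_measurable(1), where B = "measure lborel {- R..R}"])
  (use Th_measurable(2) in auto)

lemma Th_pairing: "(LINT v|sig' (q, t). LINT u|nv' (q, t). max (u - v) 0) = Th q t"
proof -
 have "(LINT v|sig' (q, t). LINT u|nv' (q, t). max (u - v) 0) = (LINT r|lborel. (if abs r <= R then measure (nv' (q, t)) {r<..} * measure (sig' (q, t)) {..r} else 0))"
  by (rule positive_part_pairing[OF probs(1-3)[of "(q, t)"] probs(4-6)[of "(q, t)"]])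
 also have "... = Th q t" unfolding Th_def tails_def by (rule lint_cong[OF refl]) simp
 finally show ?thesis .
qed

text \<open>The same quantity with the integrations exchanged. Applied with the two solutions
  swapped, it supplies the second half of the absolute value.\<close>

lemma Th_negative_pairing: "(LINT v|nv' (q, t). LINT u|sig' (q, t). max (v - u) 0) = Th q t"
proof -
 have "(LINT v|nv' (q, t). LINT u|sig' (q, t). max (v - u) 0) = (LINT r|lborel. (if abs r <= R then measure (nv' (q, t)) {r<..} * measure (sig' (q, t)) {..r} else 0))"
  by (rule negative_part_pairing[OF probs(4-6)[of "(q, t)"] probs(1-3)[of "(q, t)"]])
 also have "... = Th q t" unfolding Th_def tails_def by (rule lint_cong[OF refl]) simp
 finally show ?thesis .
qed

text \<open>Each chart inequality is tested with a member of the partition times a function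
  \<open>th\<close> of time. In the sum the spatial derivatives of the partition cancel and its
  values add up to 1, leaving the weak inequality that \<open>nonincreasing_of_weak\<close> asks
  for.\<close>

lemma kinetic_nonincreasing:
 assumes sol: "mv_entropy_solution A T g f k u0 nv" "mv_entropy_solution A T g f k w0 sig"
 shows "EX N:null_sets lborel. ALL s t. s ~: N --> t ~: N --> 0 < s --> s <= t --> t < T -->
  (LINT q|dV t. Th q t) <= (LINT q|dV s. Th q s)"
proof -
 obtain D K b db where D: "finite D"
  "!!p. p : D ==> has_grad (b p) (db p) UNIV" "!!p y. p : D ==> 0 <= b p y"
  "!!p. p : D ==> compact (K p)" "!!p. p : D ==> K p \<subseteq> cimg (chart_at A p)"
  "!!p y. p : D ==> y ~: K p ==> b p y = 0" "!!q. (SUM p:D. bump (chart_at A p) (b p) q) = 1"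
 proof (rule partition_of_unity)
  fix D :: "'m set" and b :: "'m => real^'d => real" and K db
  assume h: "finite D"
   "!!p. p : D ==> has_grad (b p) (db p) UNIV" "!!p y. p : D ==> 0 <= b p y"
   "!!p. p : D ==> compact (K p)" "!!p. p : D ==> K p \<subseteq> cimg (chart_at A p)"
   "!!p y. p : D ==> y ~: K p ==> b p y = 0" "!!q. (SUM p:D. bump (chart_at A p) (b p) q) = 1"
  show thesis by (rule that[OF h])
 qed
 let ?c = "chart_at A"
 have db0: "db p y = 0" if "p : D" "y ~: K p" for p y
  by (rule has_grad_zero_outside[OF D(2)[OF that(1)] compact_imp_closed[OF D(4)[OF that(1)]] D(6)[OF that(1)] that(2)])
 have Kc: "compact (K p <*> {al..be})" "K p <*> {al..be} \<subseteq> Om (?c p)" if "p : D" "0 < al" "be < T" for p and al be :: real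
  using D(4)[OF that(1)] D(5)[OF that(1)] that(2,3) by (auto simp: Om_def intro!: compact_Times)
 have om: "(snd (?c p) q, t) : Om (?c p)" if "q : fst (?c p)" "t : {0<..<T}" for p q t
  using that chart_at(1)[of p] by (auto simp: Om_def)
 define m where "m t = (LINT q|dV t. Th q t)" for t
 have "EX N:null_sets lborel. ALL s t. s ~: N --> t ~: N --> 0 < s --> s <= t --> t < T --> m t <= m s"
 proof (rule nonincreasing_of_weak[OF _ _ T])
  fix al be :: real assume ab: "0 < al" "al < be" "be < T"
  \<comment> \<open>With this factor the chart integrals add up to \<open>m t\<close> on
    \<open>{al..be}\<close>; integrability of \<open>m\<close> in time is inherited from
    theirs.\<close>
  define G where "G p z r = W (?c p) z * b p (fst z)" for p z and r :: real
  have G: "continuous_on (Om (?c p) <*> UNIV) (%(z, r). G p z r)" if p: "p : D" for p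
   unfolding G_def case_prod_beta'
   by (intro continuous_intros cont_comp2[OF has_grad_continuous[OF W_gradient[OF chart_at(1)[of p]]]]
     cont_comp2[OF has_grad_continuous[OF D(2)[OF p]]]) auto
  note ctx = chart_at(1) G Kc(1)[OF _ ab(1,3)] Kc(2)[OF _ ab(1,3)]
  have eq: "(SUM p:D. LINT y|lborel. L (?c p) (G p) (K p <*> {al..be}) (y, t)) = ind {al..be} t * m t" for t
  proof (cases "t : {al..be}")
   case True
   hence t: "t : {0<..<T}" using ab by auto
   have "(SUM p:D. LINT y|lborel. L (?c p) (G p) (K p <*> {al..be}) (y, t)) = 1 * (LINT q|dV t. Th q t)"
   proof (rule partition_sum[where \<Gamma> = "%p q r. bump (?c p) (b p) q", OF D(1) ctx(2-4) t])
    fix p q and r :: real assume p: "p : D" and q: "q : fst (?c p)"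
    show "(if (snd (?c p) q, t) : K p <*> {al..be} then G p (snd (?c p) q, t) r else 0) / W (?c p) (snd (?c p) q, t) = bump (?c p) (b p) q"
     using W_pos[OF chart_at(1) om[OF q t]] D(6)[OF p, of "snd (?c p) q"] q True by (auto simp: G_def bump_def)
   qed (use D(7) in \<open>auto simp: bump_def\<close>)
   thus ?thesis using True by (simp add: m_def)
  next
   case False
   have "L (?c p) (G p) (K p <*> {al..be}) (y, t) = 0" if "p : D" for p y
    by (rule L_outside[OF ctx(1) G[OF that] Kc(1)[OF that ab(1,3)] Kc(2)[OF that ab(1,3)]]) (use False in auto)
   thus ?thesis using False by simp
  qed
  have "integrable lborel (%t. SUM p:D. LINT y|lborel. L (?c p) (G p) (K p <*> {al..be}) (y, t))"
   by (rule lint_i_sum) (rule L_integral(2)[OF ctx])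
  thus "integrable lborel (%t. ind {al..be} t * m t)" by (simp only: eq)
 next
  fix th dth and al be :: real
  assume th: "has_grad th dth UNIV" "!!t. 0 <= th t" and ab: "0 < al" "be < T" and out: "!!t. t ~: {al..be} ==> th t = 0"
  have dth0: "dth t = 0" if "t ~: {al..be}" for t
   by (rule has_grad_zero_outside[OF th(1) closed_atLeastAtMost out that])
  define ps where "ps p z = b p (fst z) * th (snd z)" for p and z :: "(real^'d)*real"
  define dps where "dps p z = (th (snd z) *. db p (fst z), b p (fst z) * dth (snd z))" for p and z :: "(real^'d)*real"
  have ps: "has_grad (ps p) (dps p) UNIV" if p: "p : D" for p
   unfolding has_grad_def
  proof (intro conjI ballI)
   fix z :: "(real^'d)*real"
   have "(snd has_derivative snd) (at z)" by (auto intro!: derivative_eq_intros)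
   from diff_chain_at[OF this has_gradD[OF th(1) UNIV_I]]
   have 1: "((%z. th (snd z)) has_derivative (%h. dth (snd z) * snd h)) (at z)" by (simp add: o_def)
   have "(fst has_derivative fst) (at z)" by (auto intro!: derivative_eq_intros)
   from diff_chain_at[OF this has_gradD[OF D(2)[OF p] UNIV_I]]
   have 2: "((%z. b p (fst z)) has_derivative (%h. db p (fst z) .* fst h)) (at z)" by (simp add: o_def)
   have "(%h. b p (fst z) * (dth (snd z) * snd h) + (db p (fst z) .* fst h) * th (snd z)) = (.*) (dps p z)"
    by (simp add: fun_eq_iff dps_def inner_prod_def mult_ac)
   with has_derivative_mult[OF 2 1] show "(ps p has_derivative (.*) (dps p z)) (at z)" by (simp add: ps_def[abs_def])
  next
   show "continuous_on UNIV (dps p)"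
    unfolding dps_def
    by (intro continuous_intros cont_comp2[OF has_grad_continuous[OF th(1)]] cont_comp2[OF has_grad_continuous_grad[OF th(1)]]
      cont_comp2[OF has_grad_continuous[OF D(2)[OF p]]] cont_comp2[OF has_grad_continuous_grad[OF D(2)[OF p]]]) auto
  qed
  define G where "G p z r = field_du (?c p) z r .* dps p z" for p z r
  have G: "continuous_on (Om (?c p) <*> UNIV) (%(z, r). G p z r)" if p: "p : D" for p
  proof -
   have 1: "continuous_on (Om (?c p) <*> UNIV) (%x. field_du (?c p) (fst x) (snd x))"
    using parametrized_field.a_cont[OF parametrized[OF chart_at(1)[of p]]] by (simp add: case_prod_beta')
   have 2: "continuous_on (Om (?c p) <*> UNIV) (%x::((real^'d)*real) * real. dps p (fst x))"
    by (rule cont_comp2[OF has_grad_continuous_grad[OF ps[OF p]]]) (auto intro!: continuous_intros)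
   show ?thesis unfolding G_def case_prod_beta' by (rule continuous_on_inner[OF 1 2])
  qed
  note ctx = chart_at(1) G Kc(1)[OF _ ab] Kc(2)[OF _ ab]
  have ps0: "ps p z = 0" "dps p z = 0" if "p : D" "z ~: K p <*> {al..be}" for p z
   using that D(6)[OF that(1), of "fst z"] db0[OF that(1), of "fst z"] out[of "snd z"] dth0[of "snd z"]
   by (cases z; auto simp: ps_def dps_def zero_prod_def)+
  have eq: "(SUM p:D. LINT y|lborel. L (?c p) (G p) (K p <*> {al..be}) (y, t)) = dth t * m t" for t
  proof (cases "t : {0<..<T}")
   case t: True
   \<comment> \<open>The two parts of the kinetic field after division by \<open>W\<close>: the
     spatial one carries the derivative of the partition, the temporal one its value.\<close>
   let ?\<Gamma> = "%p q r. th t * (if q : fst (?c p) then db p (snd (?c p) q) .* flux_du f t r (?c p) q else 0) + dth t * bump (?c p) (b p) q"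
   have "(SUM p:D. LINT y|lborel. L (?c p) (G p) (K p <*> {al..be}) (y, t)) = dth t * (LINT q|dV t. Th q t)"
   proof (rule partition_sum[where \<Gamma> = ?\<Gamma>, OF D(1) ctx(2-4) t])
    fix p q and r :: real assume p: "p : D"
    show "?\<Gamma> p q r = 0" if "q ~: fst (?c p)" using that by (simp add: bump_def)
    show "continuous_on UNIV (?\<Gamma> p q)"
    proof (cases "q : fst (?c p)")
     case True
     thus ?thesis using flux_section(2)[OF t chart_at(1) True] by (auto intro!: continuous_intros)
    qed simp
    show "(if (snd (?c p) q, t) : K p <*> {al..be} then G p (snd (?c p) q, t) r else 0) / W (?c p) (snd (?c p) q, t) = ?\<Gamma> p q r"
     if q: "q : fst (?c p)"
    proof -
     have w: "W (?c p) (snd (?c p) q, t) > 0" by (rule W_pos[OF chart_at(1) om[OF q t]])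
     have "(if (snd (?c p) q, t) : K p <*> {al..be} then G p (snd (?c p) q, t) r else 0) = G p (snd (?c p) q, t) r"
      using ps0(2)[OF p, of "(snd (?c p) q, t)"] by (auto simp: G_def)
     also have "... = W (?c p) (snd (?c p) q, t) * ?\<Gamma> p q r"
      using q chart_at(1)[of p] by (simp add: G_def field_du_def dps_def inner_prod_def Hu_def bump_def inner_commute algebra_simps)
     finally show ?thesis using w by simp
    qed
   next
    fix q and r :: real
    have pz: "(SUM p:D. (if q : fst (?c p) then db p (snd (?c p) q) .* flux_du f t r (?c p) q else 0)) = 0"
     by (rule partition_flux_zero[where b = b and db = db and K = K and X = "flux_du f t r" and q = q, OF D(1,2,4,5,6,7) flux_du_vector_field[OF t]])
    show "(SUM p:D. ?\<Gamma> p q r) = dth t"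
     unfolding sum.distrib sum_distrib_left[symmetric] D(7) pz by simp
   qed
   thus ?thesis by (simp add: m_def)
  next
   case False
   hence t: "t ~: {al..be}" using ab by auto
   have "L (?c p) (G p) (K p <*> {al..be}) (y, t) = 0" if "p : D" for p y
    by (rule L_outside[OF ctx(1) G[OF that] Kc(1)[OF that ab] Kc(2)[OF that ab]]) (use t in auto)
   thus ?thesis using dth0[OF t] by simp
  qed
  have nn: "0 <= (LINT t|lborel. LINT y|lborel. L (?c p) (G p) (K p <*> {al..be}) (y, t))" if p: "p : D" for p
  proof -
   have "0 <= (LINT w|lborel. measure (nv' (inv0 (?c p) (fst (fst w)), snd (fst w))) {snd w<..} * measure (sig' (inv0 (?c p) (fst (fst w)), snd (fst w))) {..snd w} *
     (if abs (snd w) <= R then field_du (?c p) (fst w) (snd w) .* dps p (fst w) else 0))"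
    by (rule chart_kinetic[OF chart_at(1) nv sol(1) sig sol(2) ps[OF p] _ Kc(1)[OF p ab] Kc(2)[OF p ab] ps0(1)[OF p]])
     (use D(3)[OF p] th(2) in \<open>auto simp: ps_def\<close>)
   also have "... = (LINT w|lborel. Ph (?c p) (G p) (K p <*> {al..be}) w)"
   proof (rule lint_cong[OF refl])
    fix w :: "((real^'d)*real) * real"
    show "measure (nv' (inv0 (?c p) (fst (fst w)), snd (fst w))) {snd w<..} * measure (sig' (inv0 (?c p) (fst (fst w)), snd (fst w))) {..snd w} *
     (if abs (snd w) <= R then field_du (?c p) (fst w) (snd w) .* dps p (fst w) else 0) = Ph (?c p) (G p) (K p <*> {al..be}) w"
     using ps0(2)[OF p, of "fst w"]
     by (cases "fst w : K p <*> {al..be}") (simp_all add: Ph_def[OF ctx(1) G[OF p] Kc(1)[OF p ab] Kc(2)[OF p ab]] tails_def G_def)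
   qed
   also have "... = (LINT t|lborel. LINT y|lborel. L (?c p) (G p) (K p <*> {al..be}) (y, t))"
    by (rule L_integral(1)[OF ctx(1) G[OF p] Kc(1)[OF p ab] Kc(2)[OF p ab]])
   finally show ?thesis .
  qed
  have "0 <= (SUM p:D. LINT t|lborel. LINT y|lborel. L (?c p) (G p) (K p <*> {al..be}) (y, t))" by (rule sum_nonneg) (rule nn)
  also have "... = (LINT t|lborel. (SUM p:D. LINT y|lborel. L (?c p) (G p) (K p <*> {al..be}) (y, t)))"
   by (rule lint_sum[symmetric]) (rule L_integral(2)[OF ctx])
  finally show "0 <= (LINT t|lborel. dth t * m t)" by (simp only: eq)
 qed
 thus ?thesis by (simp only: m_def)
qed

end

text \<open>Every bound beyond \<open>R0\<close> works, so that two solutions can be given a common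
  \<open>R\<close>.\<close>

lemma representative:
 assumes sol: "mv_entropy_solution A T g f k u0 nv"
 obtains R0 where "!!R. R0 < R ==> EX nv'. represents R nv nv'"
proof -
 have ws: "weak_star_measurable_prob A T g nv" using sol unfolding mv_entropy_solution_def by blast
 obtain a b where ab: "ALL p. ALL t:{0<..<T}. measure_support (nv p t) \<subseteq> {a..b}" using sol unfolding mv_entropy_solution_def by blast
 show ?thesis
 proof (rule that[of "max \<bar>a\<bar> \<bar>b\<bar>"])
  fix R assume R: "max \<bar>a\<bar> \<bar>b\<bar> < R"
  have R': "R > 0" "{a..b} \<subseteq> {- R<..<R}" using R by auto
  show "EX nv'. represents R nv nv'"
  proof (rule mv_kernel[OF ws _ R'])
   fix nv' Z assume h: "nv' : borel -M> prob_algebra borel" "!!w. AE v in nv' w. abs v < R"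
    "Z : null_sets lborel" "!!t. t : {0<..<T} ==> t ~: Z ==> AE p in dV t. nv' (p, t) = nv p t"
   show "EX nv'. represents R nv nv'"
    unfolding represents_def by (intro exI[of _ nv'] conjI allI bexI[OF _ h(3)] ballI impI h)
  qed (use ab in blast)
 qed
qed

end

theorem proposition4p2:
  fixes A :: "('m::{t2_space,second_countable_topology}, 'd::finite) chart set"
    and T k :: real
    and g :: "real \<Rightarrow> ('m, 'd) mfield"
    and f :: "('m, 'd) flux"
    and u0 w0 :: "'m \<Rightarrow> real"
    and \<nu> \<sigma> :: "'m \<Rightarrow> real \<Rightarrow> real measure"
  assumes "closed_oriented_manifold A"
    and "T > 0"
    and "c11_metric_family A T g"
    and "admissible_flux A T g f"
    and "u0 \<in> L_infty (riem_volume A (g 0))"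
    and "w0 \<in> L_infty (riem_volume A (g 0))"
    and "mv_entropy_solution A T g f k u0 \<nu>"
    and "mv_entropy_solution A T g f k w0 \<sigma>"
  shows "(\<exists>N\<in>null_sets lebesgue. \<forall>s t. s \<notin> N \<longrightarrow> t \<notin> N \<longrightarrow> 0 < s \<longrightarrow> s \<le> t \<longrightarrow> t < T \<longrightarrow>
            (LINT p|riem_volume A (g t). tensor_pairing \<nu> \<sigma> t (\<lambda>u v. max (u - v) 0) p)
              \<le> (LINT p|riem_volume A (g s). tensor_pairing \<nu> \<sigma> s (\<lambda>u v. max (u - v) 0) p))
       \<and> (\<exists>N\<in>null_sets lebesgue. \<forall>s t. s \<notin> N \<longrightarrow> t \<notin> N \<longrightarrow> 0 < s \<longrightarrow> s \<le> t \<longrightarrow> t < T \<longrightarrow>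
            (LINT p|riem_volume A (g t). tensor_pairing \<nu> \<sigma> t (\<lambda>u v. \<bar>u - v\<bar>) p)
              \<le> (LINT p|riem_volume A (g s). tensor_pairing \<nu> \<sigma> s (\<lambda>u v. \<bar>u - v\<bar>) p))"
proof -
 interpret conservation_law A T g f
  by unfold_locales (rule assms(1-4))+
 obtain R1 where R1: "!!R. R1 < R ==> EX \<nu>'. represents R \<nu> \<nu>'" using representative[OF assms(7)] by blast
 obtain R2 where R2: "!!R. R2 < R ==> EX \<sigma>'. represents R \<sigma> \<sigma>'" using representative[OF assms(8)] by blast
 define R where "R = max R1 R2 + 1"
 have R: "R1 < R" "R2 < R" using max.cobounded1[of R1 R2] max.cobounded2[of R2 R1] unfolding R_def by linarith+
 obtain \<nu>' where \<nu>: "represents R \<nu> \<nu>'" using R1[OF R(1)] by blast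
 obtain \<sigma>' where \<sigma>: "represents R \<sigma> \<sigma>'" using R2[OF R(2)] by blast
 obtain Z1 where Z1: "Z1 : null_sets lborel" "!!t. t : {0<..<T} ==> t ~: Z1 ==> AE p in dV t. \<nu>' (p, t) = \<nu> p t"
  using \<nu> unfolding represents_def by blast
 obtain Z2 where Z2: "Z2 : null_sets lborel" "!!t. t : {0<..<T} ==> t ~: Z2 ==> AE p in dV t. \<sigma>' (p, t) = \<sigma> p t"
  using \<sigma> unfolding represents_def by blast
 \<comment> \<open>\<open>?P\<close> belongs to the positive part of \<open>u - v\<close>;
   \<open>?Q\<close>, with the solutions exchanged, to that of \<open>v - u\<close>. Their sum gives
   the absolute value.\<close>
 let ?P = "Th \<nu>' \<sigma>' R" and ?Q = "Th \<sigma>' \<nu>' R"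
 have pos: "(LINT p|riem_volume A (g t). tensor_pairing \<nu> \<sigma> t (%u v. max (u - v) 0) p) = (LINT q|dV t. ?P q t)"
  if t: "t : {0<..<T}" "t ~: Z1" "t ~: Z2" for t
 proof -
  have t': "t : {0..T}" using t by auto
  show ?thesis
   unfolding riem_volume_dV[OF t']
  proof (rule integral_completion_AE[OF Th_measurable(1)[OF \<nu> \<sigma> t']])
   show "AE p in dV t. tensor_pairing \<nu> \<sigma> t (%u v. max (u - v) 0) p = ?P p t"
    using Z1(2)[OF t(1,2)] Z2(2)[OF t(1,3)]
   proof eventually_elim
    case (elim p)
    thus ?case using Th_pairing[OF \<nu> \<sigma>, of p t] by (simp add: tensor_pairing_def)
   qed
  qed
 qed
 have abs: "(LINT p|riem_volume A (g t). tensor_pairing \<nu> \<sigma> t (%u v. abs (u - v)) p) = (LINT q|dV t. ?P q t) + (LINT q|dV t. ?Q q t)"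
  if t: "t : {0<..<T}" "t ~: Z1" "t ~: Z2" for t
 proof -
  have t': "t : {0..T}" using t by auto
  have "(LINT p|riem_volume A (g t). tensor_pairing \<nu> \<sigma> t (%u v. abs (u - v)) p) = (LINT q|dV t. ?P q t + ?Q q t)"
   unfolding riem_volume_dV[OF t']
  proof (rule integral_completion_AE)
   show "(%q. ?P q t + ?Q q t) : bmeas (dV t)"
    by (rule borel_measurable_add[OF Th_measurable(1)[OF \<nu> \<sigma> t'] Th_measurable(1)[OF \<sigma> \<nu> t']])
   show "AE p in dV t. tensor_pairing \<nu> \<sigma> t (%u v. abs (u - v)) p = ?P p t + ?Q p t"
    using Z1(2)[OF t(1,2)] Z2(2)[OF t(1,3)]
   proof eventually_elim
    case (elim p)
    have "(LINT v|\<sigma>' (p, t). LINT u|\<nu>' (p, t). abs (u - v)) = ?P p t + ?Q p t"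
     using absolute_value_pairing[OF probs(1-3)[OF \<nu> \<sigma>, of "(p, t)"] probs(4-6)[OF \<nu> \<sigma>, of "(p, t)"]]
      Th_pairing[OF \<nu> \<sigma>, of p t] Th_negative_pairing[OF \<sigma> \<nu>, of p t] by simp
    thus ?case using elim by (simp add: tensor_pairing_def)
   qed
  qed
  also have "... = (LINT q|dV t. ?P q t) + (LINT q|dV t. ?Q q t)"
   by (rule lint_add[OF Th_integrable[OF \<nu> \<sigma> t'] Th_integrable[OF \<sigma> \<nu> t']])
  finally show ?thesis .
 qed
 obtain N1 where N1: "N1 : null_sets lborel" "!!s t. s ~: N1 ==> t ~: N1 ==> 0 < s ==> s <= t ==> t < T ==>
   (LINT q|dV t. ?P q t) <= (LINT q|dV s. ?P q s)" using kinetic_nonincreasing[OF \<nu> \<sigma> assms(7,8)] by blast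
 obtain N2 where N2: "N2 : null_sets lborel" "!!s t. s ~: N2 ==> t ~: N2 ==> 0 < s ==> s <= t ==> t < T ==>
   (LINT q|dV t. ?Q q t) <= (LINT q|dV s. ?Q q s)" using kinetic_nonincreasing[OF \<sigma> \<nu> assms(8,7)] by blast
 \<comment> \<open>The excluded times are those at which a Borel version may differ from the given
   Young measure or one of the two monotonicity statements may fail.\<close>
 define N where "N = Z1 Un Z2 Un N1 Un N2"
 have "N : null_sets lborel" unfolding N_def by (intro null_sets.Un Z1(1) Z2(1) N1(1) N2(1))
 hence N: "N : null_sets lebesgue" by (rule null_sets_completionI)
 show ?thesis
 proof (intro conjI bexI[OF _ N] allI impI)
  fix s t assume st: "s ~: N" "t ~: N" "0 < s" "s <= t" "t < T"
  have s': "s : {0<..<T}" "s ~: Z1" "s ~: Z2" "s ~: N1" "s ~: N2" and t': "t : {0<..<T}" "t ~: Z1" "t ~: Z2" "t ~: N1" "t ~: N2"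
   using st by (auto simp: N_def)
  note le = N1(2)[OF s'(4) t'(4) st(3-5)] N2(2)[OF s'(5) t'(5) st(3-5)]
  show "(LINT p|riem_volume A (g t). tensor_pairing \<nu> \<sigma> t (%u v. max (u - v) 0) p)
    <= (LINT p|riem_volume A (g s). tensor_pairing \<nu> \<sigma> s (%u v. max (u - v) 0) p)"
   unfolding pos[OF s'(1-3)] pos[OF t'(1-3)] by (rule le(1))
  show "(LINT p|riem_volume A (g t). tensor_pairing \<nu> \<sigma> t (%u v. abs (u - v)) p)
    <= (LINT p|riem_volume A (g s). tensor_pairing \<nu> \<sigma> s (%u v. abs (u - v)) p)"
   unfolding abs[OF s'(1-3)] abs[OF t'(1-3)] by (rule add_mono[OF le])
 qed
qed

end
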